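(* Let $N\ge1$ and $g\ge1$ be integers, with $g\ge2$ if $N\ge2$. Let $u\in V$ be quasiprimary of weight $N$, inserted at $x$, and let $v_{\gamma_k}\in\mathcal W_{\gamma_k}$ be inserted at $y_k$ for $k=1,\ldots,n$, with intermediate module labels $\boldsymbol\delta=\delta_1,\ldots,\delta_{n-1}$. Then for all admissible module labels $\boldsymbol\alpha,\boldsymbol\beta$, $$\mathcal F_{\boldsymbol{\alpha\beta}}(u,x;\boldsymbol{v_\gamma},\boldsymbol y\,|\,0,\boldsymbol\gamma;0,\boldsymbol\delta)=\sum_{a=1}^g\sum_{\ell=0}^{2N-2}\Theta_{N,a}^\ell(x)\,\mathrm{Res}_a^\ell\mathcal F_{\boldsymbol{\alpha\beta}}(u;\boldsymbol{v_\gamma},\boldsymbol y\,|\,0,\boldsymbol\gamma;0,\boldsymbol\delta)+\sum_{k=1}^n\sum_{j\ge0}\Psi_N^{(0,j)}(x,y_k)\,\mathcal F_{\boldsymbol{\alpha\beta}}(\ldots;u(j)v_{\gamma_k},y_k;\ldots\,|\,\boldsymbol\gamma;\boldsymbol\delta)\,dy_k^{\,j}.$$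
   Context: **VOA.** $V=(V,Y,\mathbf{1},\omega)$ is a simple vertex operator algebra over $\mathbb{C}$ of strong CFT type ($V=\bigoplus_{n\ge0}V_n$, $\dim V_n<\infty$, $V_0=\mathbb{C}\mathbf{1}$, $L(1)V_1=0$), isomorphic to its contragredient module $V'$; $Y(u,z)=\sum_nu(n)z^{-n-1}$, $Y(\omega,z)=\sum_nL(n)z^{-n-2}$. $u$ is quasiprimary of weight $N$ if $u\in V_N$, $L(1)u=0$. $\langle\cdot,\cdot\rangle$ is the unique non-degenerate invariant bilinear form on $V$ with $\langle\mathbf 1,\mathbf 1\rangle=1$: $\langle Y(u,z)v,w\rangle=\langle v,Y(e^{zL(1)}(-z^{-2})^{L(0)}u,z^{-1})w\rangle$. **Modules and intertwiners.** $\{(Y_\alpha,\mathcal W_\alpha)\}_{\alpha\in\mathcal A}$ are the inequivalent irreducible ordinary $V$-modules, $\mathcal W_0=V$, $\mathcal W_\alpha=\bigoplus_{n\ge0}\mathcal W_{\alpha,n+h_\alpha}$ with finite-dimensional $L(0)$-eigenspaces of eigenvalue (weight) $n+h_\alpha$, $h_\alpha\in\mathbb C$. $\alpha'$ labels the contragredient module $\mathcal W_{\alpha'}=\mathcal W_\alpha'$, and $\langle\cdot,\cdot\rangle$ also denotes the canonical pairing. $\mathcal Y^\gamma_{\alpha\beta}$ is an intertwining operator of type $\binom{\gamma}{\alpha\ \beta}$ (in the standard Frenkel–Huang–Lepowsky sense), and $N^\gamma_{\alpha\beta}$ the dimension of the space of these. It is assumed that $N^\gamma_{\alpha0}=\delta_{\alpha\gamma}$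 and $N^0_{\alpha\beta}=\delta_{\alpha\beta'}$. Normalizations: $\mathcal Y^\beta_{0\beta}=Y_\beta$; $\mathcal Y^\alpha_{\alpha0}(v_\alpha,z)u=e^{zL(-1)}Y_\alpha(u,-z)v_\alpha$; $\langle u,\mathcal Y^0_{\alpha\alpha'}(v_\alpha,z)v_{\alpha'}\rangle=\langle\mathcal Y^\alpha_{\alpha0}(e^{zL(1)}(-z^{-2})^{L(0)}v_\alpha,z^{-1})u,v_{\alpha'}\rangle$; for other types an intertwining operator is fixed. **Correlation functions.** For $v_{\gamma_k}\in\mathcal W_{\gamma_k}$, $k=1,\ldots,n$, and intermediate labels $\boldsymbol\delta=\delta_1,\ldots,\delta_{n-1}$ (with $\delta_1=\gamma_1'$, $\delta_{n-1}=\gamma_n$), $$\mathcal Y^{\boldsymbol\delta}_{\boldsymbol\gamma}(\boldsymbol{v_\gamma},\boldsymbol y)=\mathcal Y^0_{\gamma_1\delta_1}(v_{\gamma_1},y_1)\cdots\mathcal Y^{\delta_{k-1}}_{\gamma_k\delta_k}(v_{\gamma_k},y_k)\cdots\mathcal Y^{\delta_{n-1}}_{\gamma_n0}(v_{\gamma_n},y_n).$$ Let $\mathcal I=\{\pm1,\ldots,\pm g\}$, with formal variables $w_a$ ($a\in\mathcal I$), $\rho_a=\rho_{-a}$. For labels $\boldsymbol\alpha=\alpha_1,\ldots,\alpha_g$ let $\{b_a\}$ be a homogeneous basis of $\mathcal W_{\alpha_a}$, $\{b_a'\}$ the dual basis of $\mathcal W_{\alpha_a'}$, $b_{-a}:=\rho_a^{\mathrm{wt}(b_a)}b_a'$.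 For labels $\boldsymbol\beta=\beta_1,\ldots,\beta_{2g-1}$ with $\beta_1=\alpha_1'$, $\beta_{2g-1}=\alpha_g'$, $$\mathcal Y^{\boldsymbol\beta}_{\boldsymbol{\alpha\alpha'}}(\boldsymbol b,\boldsymbol w)=\mathcal Y^0_{\alpha_1\beta_1}(b_1,w_1)\mathcal Y^{\beta_1}_{\alpha_1'\beta_2}(b_{-1},w_{-1})\cdots\mathcal Y^{\beta_{2g-2}}_{\alpha_g\beta_{2g-1}}(b_g,w_g)\mathcal Y^{\beta_{2g-1}}_{\alpha_g'0}(b_{-g},w_{-g}).$$ The genus $g$ intertwiner correlation form is $$\mathcal F_{\boldsymbol{\alpha\beta}}(\boldsymbol{v_\gamma},\boldsymbol y|\boldsymbol\gamma;\boldsymbol\delta)=\sum_{b_1,\ldots,b_g}\langle\mathbf 1,\mathcal Y^{\boldsymbol\delta}_{\boldsymbol\gamma}(\boldsymbol{v_\gamma},\boldsymbol y)\,\mathcal Y^{\boldsymbol\beta}_{\boldsymbol{\alpha\alpha'}}(\boldsymbol b,\boldsymbol w)\mathbf 1\rangle\prod_kdy_k^{\mathrm{wt}(v_{\gamma_k})},$$ extended linearly to inhomogeneous vectors, and $\mathcal F_{\boldsymbol{\alpha\beta}}(u,x;\boldsymbol{v_\gamma},\boldsymbol y|0,\boldsymbol\gamma;0,\boldsymbol\delta)$ is obtained by inserting $Y(u,x)$ immediately to the right of $\langle\mathbf 1,$ and multiplying by $dx^N$. All are formal expressions; rational coefficients in $x$ are expanded in non-negative powers of the variables to the right of $x$.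 Further, $\mathrm{Res}_a^\ell\mathcal F_{\boldsymbol{\alpha\beta}}(u;\ldots):=\mathrm{Res}_{x-w_a}(x-w_a)^\ell\mathcal F_{\boldsymbol{\alpha\beta}}(u,x;\ldots)$, i.e. the expression for $\mathcal F_{\boldsymbol{\alpha\beta}}(\boldsymbol{v_\gamma},\boldsymbol y|\boldsymbol\gamma;\boldsymbol\delta)$ with $b_a$ replaced by $u(\ell)b_a$ in the intertwiner at $w_a$. **Schottky group and $\Psi_N,\Theta_{N,a}^\ell$.** For Schottky parameters satisfying $|w_a-w_b|>|\rho_a|^{1/2}+|\rho_b|^{1/2}$ for all $a\ne b$ in $\mathcal I$, $\Gamma$ is the free (Schottky) group generated by the Möbius maps $\gamma_az=w_{-a}+\rho_a/(z-w_a)$, $a=1,\ldots,g$, with limit set $\Lambda(\Gamma)$ and $\Omega_0=\widehat{\mathbb C}\setminus\Lambda(\Gamma)$. With $\mathcal L=\{0,\ldots,2N-2\}$, $\Psi_N(x,y)=\sum_{\gamma\in\Gamma}\Pi_N(\gamma x,y)$, $$\Pi_N(x,y)=\pi_N(x,y)dx^Ndy^{1-N},\qquad\pi_N(x,y)=\frac1{x-y}\prod_{\ell\in\mathcal L}\frac{y-A_\ell}{x-A_\ell},$$ where for $N\ge2$ the $A_\ell$ are distinct points of $\Lambda(\Gamma)$ and for $N=1$, $A_0\in\Omega_0$. The holomorphic $N$-forms $\Theta_{N,a}^\ell(x)$ are defined by $\Psi_N(x,\gamma_ay)-\Psi_N(x,y)=-\sum_{\ell\in\mathcal L}\Theta_{N,a}^\ell(x)(y-w_a)^\ell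 dy^{1-N}$. For functions, $f^{(i)}=\frac1{i!}\partial^if$, $h^{(i,j)}=\frac1{i!j!}\partial_x^i\partial_y^jh$; on $\Psi_N$ these act on the coefficient of $dx^Ndy^{1-N}$. **Expansions in $\rho$.** The identity is formal, $\Psi_N$ and $\Theta_{N,a}^\ell$ being represented by the following expansions in the $\rho_a$. Write $\pi_N(x,y)=\frac1{x-y}+\sum_{\ell\in\mathcal L}f_\ell(x)y^\ell$, $f_\ell(x)=-\sum_{i\in\mathcal L}\frac1{x-A_i}Q_i^{(\ell)}(0)$, $Q_i(y)=\prod_{j\ne i}\frac{y-A_j}{A_i-A_j}$. For $a,b\in\mathcal I$, $m,n\ge0$ let $L_b^n(x)=\rho_b^{n/2}\pi_N^{(0,n)}(x,w_b)dx^N$, $R_a^m(y)=(-1)^N\rho_a^{(m+1)/2}\pi_N^{(m,0)}(w_{-a},y)dy^{1-N}$, $A_{ab}^{mn}=(-1)^N\rho_a^{(m+1)/2}\rho_b^{n/2}\pi_N^{(m,n)}(w_{-a},w_b)$ if $a\ne-b$, $A_{a,-a}^{mn}=(-1)^N\rho_a^{(m+n+1)/2}\sum_{\ell\in\mathcal L}\binom{\ell}{n}f_\ell^{(m)}(w_{-a})w_{-a}^{\ell-n}$, $\Delta_{ab}^{mn}=\delta_{m,n+2N-1}\delta_{ab}$, $\widetilde L=L\Delta$, $\widetilde A=A\Delta$, $(I-\widetilde A)^{-1}=\sum_{k\ge0}\widetilde A^k$. Then $\Psi_N(x,y)=\Pi_N(x,y)+\widetilde L(x)(I-\widetilde A)^{-1}R(y)$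 and $\Theta_{N,a}^\ell(x)=T_a^\ell(x)+(-1)^N\rho_a^{N-1-\ell}T_{-a}^{2N-2-\ell}(x)$ with $T_a^\ell(x)=\rho_a^{-\ell/2}\big(L(x)+\widetilde L(x)(I-\widetilde A)^{-1}A\big)_a^\ell$. *)

theory Defs
  imports
    "HOL-Analysis.Analysis"
    "HOL-Computational_Algebra.Polynomial"
    "HOL-Library.Function_Algebras"
    "HOL-Library.Groups_Big_Fun"
begin

section \<open>Vertex operator algebras and their modules\<close>

text \<open>
  Every space that occurs is a complex subspace of one ambient complex vector space with scalar
  multiplication \<open>scl\<close> (take, e.g., the direct sum of all the spaces involved). Operations are
  only constrained on the subspaces concerned. \<open>mode U u n v\<close> is \<open>u(n)v\<close>, where
  \<open>Y(u,z) = \<Sum>n. u(n) z^(-n-1)\<close>.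
\<close>

record 'v voa =
  scl  :: "complex \<Rightarrow> 'v \<Rightarrow> 'v"
  car  :: "'v set"
  mode :: "'v \<Rightarrow> int \<Rightarrow> 'v \<Rightarrow> 'v"
  vac  :: 'v
  conf :: 'v

type_synonym 'v modes = "'v \<Rightarrow> int \<Rightarrow> 'v \<Rightarrow> 'v"
type_synonym 'v cmodes = "'v \<Rightarrow> complex \<Rightarrow> 'v \<Rightarrow> 'v"

text \<open>\<open>L(n) = \<omega>(n+1)\<close>, acting through the vertex operators \<open>Yw\<close>.\<close>

definition Lop :: "'v voa \<Rightarrow> 'v modes \<Rightarrow> int \<Rightarrow> 'v \<Rightarrow> 'v" where
  "Lop U Yw n w = Yw (conf U) (n + 1) w"

definition wtsp :: "'v voa \<Rightarrow> 'v set \<Rightarrow> 'v modes \<Rightarrow> complex \<Rightarrow> 'v set" where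
  "wtsp U W Yw c = {w \<in> W. Lop U Yw 0 w = scl U c w}"

definition findim :: "('v::ab_group_add) voa \<Rightarrow> 'v set \<Rightarrow> bool" where
  "findim U S \<longleftrightarrow> (\<exists>B. finite B \<and> module.span (scl U) B = S)"

definition bilinear_on ::
  "(complex \<Rightarrow> 'v \<Rightarrow> 'v::ab_group_add) \<Rightarrow> (complex \<Rightarrow> 'w \<Rightarrow> 'w::ab_group_add) \<Rightarrow>
   'v set \<Rightarrow> 'v set \<Rightarrow> 'w set \<Rightarrow> ('v \<Rightarrow> 'v \<Rightarrow> 'w) \<Rightarrow> bool" where
  "bilinear_on s t A B C f \<longleftrightarrow>
     (\<forall>a\<in>A. \<forall>b\<in>B. f a b \<in> C) \<and>
     (\<forall>a\<in>A. \<forall>a'\<in>A. \<forall>b\<in>B. f (a + a') b = f a b + f a' b) \<and>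
     (\<forall>a\<in>A. \<forall>b\<in>B. \<forall>b'\<in>B. f a (b + b') = f a b + f a b') \<and>
     (\<forall>c. \<forall>a\<in>A. \<forall>b\<in>B. f (s c a) b = t c (f a b) \<and> f a (s c b) = t c (f a b))"

text \<open>Integral modes viewed as a family of modes indexed by complex numbers.\<close>

definition cmodes :: "'v modes \<Rightarrow> ('v::zero) cmodes" where
  "cmodes Yw v c w = (if c \<in> \<int> then Yw v \<lfloor>Re c\<rfloor> w else 0)"

text \<open>
  The Jacobi identity for an operator of type \<open>(C; A B)\<close>, in components (the Borcherds identity).
  All sums have finite support by lower truncation.
\<close>

definition jacobi ::
  "('v::ab_group_add) voa \<Rightarrow> 'v set \<times> 'v modes \<Rightarrow> 'v set \<times> 'v modes \<Rightarrow> 'v set \<times> 'v modes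
   \<Rightarrow> 'v cmodes \<Rightarrow> bool" where
  "jacobi U A B C I \<longleftrightarrow>
     (\<forall>u\<in>car U. \<forall>v\<in>fst A. \<forall>w\<in>fst B. \<forall>(l::int) (m::int) (n::complex).
        Sum_any (\<lambda>i::nat. scl U (of_int m gchoose i)
           (I (snd A u (l + int i) v) (of_int m + n - of_nat i) w))
      = Sum_any (\<lambda>i::nat. scl U ((- 1) ^ i * (of_int l gchoose i))
           (snd C u (m + l - int i) (I v (n + of_nat i) w)
            - scl U ((- 1) powi l) (I v (n + of_int l - of_nat i) (snd B u (m + int i) w)))))"

definition is_voa :: "('v::ab_group_add) voa \<Rightarrow> bool" where
  "is_voa U \<longleftrightarrow>
     vector_space (scl U) \<and> module.subspace (scl U) (car U) \<and>
     (\<forall>n. bilinear_on (scl U) (scl U) (car U) (car U) (car U) (\<lambda>u v. mode U u n v)) \<and>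
     (\<forall>u\<in>car U. \<forall>v\<in>car U. \<exists>K. \<forall>n\<ge>K. mode U u n v = 0) \<and>
     vac U \<in> car U \<and> conf U \<in> car U \<and>
     (\<forall>v\<in>car U. \<forall>n. mode U (vac U) n v = (if n = - 1 then v else 0)) \<and>
     (\<forall>v\<in>car U. mode U v (- 1) (vac U) = v \<and> (\<forall>n\<ge>0. mode U v n (vac U) = 0)) \<and>
     jacobi U (car U, mode U) (car U, mode U) (car U, mode U) (cmodes (mode U)) \<and>
     (\<exists>c::complex. \<forall>m n. \<forall>v\<in>car U.
        Lop U (mode U) m (Lop U (mode U) n v) - Lop U (mode U) n (Lop U (mode U) m v)
        = scl U (of_int (m - n)) (Lop U (mode U) (m + n) v)
          + (if m + n = 0 then scl U (of_int (m ^ 3 - m) / 12 * c) v else 0)) \<and>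
     (\<forall>u\<in>car U. \<forall>v\<in>car U. \<forall>n.
        mode U (Lop U (mode U) (- 1) u) n v = scl U (- of_int n) (mode U u (n - 1) v)) \<and>
     car U = module.span (scl U) (\<Union>n::int. wtsp U (car U) (mode U) (of_int n)) \<and>
     (\<forall>n::int. findim U (wtsp U (car U) (mode U) (of_int n))) \<and>
     (\<exists>K::int. \<forall>n<K. wtsp U (car U) (mode U) (of_int n) = {0})"

definition strong_cft_type :: "('v::ab_group_add) voa \<Rightarrow> bool" where
  "strong_cft_type U \<longleftrightarrow>
     (\<forall>n<0::int. wtsp U (car U) (mode U) (of_int n) = {0}) \<and>
     vac U \<noteq> 0 \<and> wtsp U (car U) (mode U) 0 = range (\<lambda>c. scl U c (vac U)) \<and>
     (\<forall>v\<in>wtsp U (car U) (mode U) 1. Lop U (mode U) 1 v = 0)"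

definition irreducible_action ::
  "('v::ab_group_add) voa \<Rightarrow> 'v set \<times> 'v modes \<Rightarrow> bool" where
  "irreducible_action U W \<longleftrightarrow> fst W \<noteq> {0} \<and>
     (\<forall>S \<subseteq> fst W. module.subspace (scl U) S \<and> (\<forall>u\<in>car U. \<forall>n. \<forall>s\<in>S. snd W u n s \<in> S)
        \<longrightarrow> S = {0} \<or> S = fst W)"

definition simple_voa :: "('v::ab_group_add) voa \<Rightarrow> bool" where
  "simple_voa U \<longleftrightarrow> irreducible_action U (car U, mode U)"

definition ordinary_module :: "('v::ab_group_add) voa \<Rightarrow> 'v set \<times> 'v modes \<Rightarrow> bool" where
  "ordinary_module U W \<longleftrightarrow>
     module.subspace (scl U) (fst W) \<and>
     (\<forall>n. bilinear_on (scl U) (scl U) (car U) (fst W) (fst W) (\<lambda>u w. snd W u n w)) \<and>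
     (\<forall>u\<in>car U. \<forall>w\<in>fst W. \<exists>K. \<forall>n\<ge>K. snd W u n w = 0) \<and>
     (\<forall>w\<in>fst W. \<forall>n. snd W (vac U) n w = (if n = - 1 then w else 0)) \<and>
     jacobi U (car U, mode U) W W (cmodes (snd W)) \<and>
     (\<forall>u\<in>car U. \<forall>w\<in>fst W. \<forall>n.
        snd W (Lop U (mode U) (- 1) u) n w = scl U (- of_int n) (snd W u (n - 1) w)) \<and>
     fst W = module.span (scl U) (\<Union>c. wtsp U (fst W) (snd W) c) \<and>
     (\<forall>c. findim U (wtsp U (fst W) (snd W) c)) \<and>
     (\<forall>c. \<exists>K::nat. \<forall>n\<ge>K. wtsp U (fst W) (snd W) (c - of_nat n) = {0})"

definition module_iso ::
  "('v::ab_group_add) voa \<Rightarrow> 'v set \<times> 'v modes \<Rightarrow> 'v set \<times> 'v modes \<Rightarrow> bool" where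
  "module_iso U A B \<longleftrightarrow>
     (\<exists>f. bij_betw f (fst A) (fst B) \<and>
        (\<forall>x\<in>fst A. \<forall>y\<in>fst A. f (x + y) = f x + f y) \<and>
        (\<forall>c. \<forall>x\<in>fst A. f (scl U c x) = scl U c (f x)) \<and>
        (\<forall>u\<in>car U. \<forall>n. \<forall>x\<in>fst A. f (snd A u n x) = snd B u n (f x)))"

text \<open>
  The mode of \<open>Yw(e^(z L(1)) (-z^(-2))^(L(0)) u, z^(-1))\<close> that is the coefficient of \<open>z^(-n-1)\<close>,
  for \<open>u\<close> of integral weight \<open>m\<close>: there \<open>(-z^(-2))^(L(0)) u = (-1)^m z^(-2m) u\<close>.
\<close>

definition adjoint_mode ::
  "('v::ab_group_add) voa \<Rightarrow> 'v modes \<Rightarrow> int \<Rightarrow> 'v \<Rightarrow> int \<Rightarrow> 'v \<Rightarrow> 'v" where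
  "adjoint_mode U Yw m u n w =
     Sum_any (\<lambda>i::nat. scl U ((- 1) powi m / fact i)
       (Yw ((Lop U (mode U) 1 ^^ i) u) (2 * m - n - 2 - int i) w))"

text \<open>The underlying space of the contragredient module, with functionals extended by 0.\<close>

definition graded_dual ::
  "('v::ab_group_add) voa \<Rightarrow> 'v set \<times> 'v modes \<Rightarrow> ('v \<Rightarrow> complex) set" where
  "graded_dual U A = {\<phi>.
     (\<forall>x\<in>fst A. \<forall>y\<in>fst A. \<phi> (x + y) = \<phi> x + \<phi> y) \<and>
     (\<forall>c. \<forall>x\<in>fst A. \<phi> (scl U c x) = c * \<phi> x) \<and>
     finite {c. \<exists>x\<in>wtsp U (fst A) (snd A) c. \<phi> x \<noteq> 0} \<and>
     (\<forall>x. x \<notin> fst A \<longrightarrow> \<phi> x = 0)}"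

text \<open>
  The pairing \<open>P\<close> identifies the module \<open>B\<close> with the contragredient of \<open>A\<close>: \<open>b \<mapsto> P(_, b)\<close> is a
  linear bijection onto the graded dual, intertwining the actions of \<open>V\<close>.
\<close>

definition contragredient ::
  "('v::ab_group_add) voa \<Rightarrow> 'v set \<times> 'v modes \<Rightarrow> 'v set \<times> 'v modes
   \<Rightarrow> ('v \<Rightarrow> 'v \<Rightarrow> complex) \<Rightarrow> bool" where
  "contragredient U A B P \<longleftrightarrow>
     bilinear_on (scl U) (*) (fst A) (fst B) UNIV P \<and>
     bij_betw (\<lambda>b a. if a \<in> fst A then P a b else 0) (fst B) (graded_dual U A) \<and>
     (\<forall>m. \<forall>u\<in>wtsp U (car U) (mode U) (of_int m). \<forall>n. \<forall>a\<in>fst A. \<forall>b\<in>fst B.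
        P a (snd B u n b) = P (adjoint_mode U (snd A) m u n a) b)"

definition invariant_form :: "('v::ab_group_add) voa \<Rightarrow> ('v \<Rightarrow> 'v \<Rightarrow> complex) \<Rightarrow> bool" where
  "invariant_form U P \<longleftrightarrow>
     bilinear_on (scl U) (*) (car U) (car U) UNIV P \<and>
     (\<forall>v\<in>car U. (\<forall>w\<in>car U. P v w = 0) \<longrightarrow> v = 0) \<and>
     (\<forall>w\<in>car U. (\<forall>v\<in>car U. P v w = 0) \<longrightarrow> w = 0) \<and>
     (\<forall>m. \<forall>u\<in>wtsp U (car U) (mode U) (of_int m). \<forall>n. \<forall>v\<in>car U. \<forall>w\<in>car U.
        P (mode U u n v) w = P v (adjoint_mode U (mode U) m u n w)) \<and>
     P (vac U) (vac U) = 1"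

text \<open>The component of weight \<open>c\<close> of a vector.\<close>

definition wcomp ::
  "('v::ab_group_add) voa \<Rightarrow> 'v set \<times> 'v modes \<Rightarrow> complex \<Rightarrow> 'v \<Rightarrow> 'v" where
  "wcomp U W c v =
     (THE h. (\<forall>d. h d \<in> wtsp U (fst W) (snd W) d) \<and> finite {d. h d \<noteq> 0} \<and> Sum_any h = v) c"


section \<open>Intertwining operators\<close>

text \<open>\<open>I v n w\<close> is the coefficient of \<open>z^(-n-1)\<close>, \<open>n\<close> complex, in \<open>I(v,z)w\<close>.\<close>

definition intertwiner ::
  "('v::ab_group_add) voa \<Rightarrow> 'v set \<times> 'v modes \<Rightarrow> 'v set \<times> 'v modes \<Rightarrow> 'v set \<times> 'v modes
   \<Rightarrow> 'v cmodes \<Rightarrow> bool" where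
  "intertwiner U A B C I \<longleftrightarrow>
     (\<forall>n. bilinear_on (scl U) (scl U) (fst A) (fst B) (fst C) (\<lambda>v w. I v n w)) \<and>
     (\<forall>v\<in>fst A. \<forall>w\<in>fst B. \<exists>K::real. \<forall>n. Re n \<ge> K \<longrightarrow> I v n w = 0) \<and>
     jacobi U A B C I \<and>
     (\<forall>v\<in>fst A. \<forall>w\<in>fst B. \<forall>n. I (Lop U (snd A) (- 1) v) n w = scl U (- n) (I v (n - 1) w))"

text \<open>
  \<open>fusion_rule U A B C k\<close>: the space of intertwining operators of type \<open>(C; A B)\<close> has dimension
  \<open>k\<close>. Operators are made extensional, so that they are determined by their values on \<open>A \<times> B\<close>.
\<close>

definition fusion_rule ::
  "('v::ab_group_add) voa \<Rightarrow> 'v set \<times> 'v modes \<Rightarrow> 'v set \<times> 'v modes \<Rightarrow> 'v set \<times> 'v modes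
   \<Rightarrow> nat \<Rightarrow> bool" where
  "fusion_rule U A B C k \<longleftrightarrow>
     (let s = (\<lambda>c I v n w. scl U c (I v n w)) in
      \<exists>S. finite S \<and> card S = k \<and> \<not> module.dependent s S \<and>
        module.span s S = {I. intertwiner U A B C I \<and>
                              (\<forall>v n w. v \<notin> fst A \<or> w \<notin> fst B \<longrightarrow> I v n w = 0)})"

text \<open>
  The irreducible modules \<open>W\<^sub>\<alpha>\<close> (labelled by all of \<open>'l\<close>), the label \<open>0\<close> of \<open>V\<close>, the
  contragredient labels, the pairings of \<open>W\<^sub>\<alpha>\<close> with its contragredient, and the chosen intertwining operators:
  \<open>iop M \<alpha> \<beta> \<gamma>\<close> is the one of type \<open>(\<gamma>; \<alpha> \<beta>)\<close>.
\<close>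

record ('l, 'v) voa_modules =
  lab0    :: 'l
  mcar    :: "'l \<Rightarrow> 'v set"
  mmode   :: "'l \<Rightarrow> 'v modes"
  dual    :: "'l \<Rightarrow> 'l"
  pairing :: "'l \<Rightarrow> 'v \<Rightarrow> 'v \<Rightarrow> complex"
  iop     :: "'l \<Rightarrow> 'l \<Rightarrow> 'l \<Rightarrow> 'v cmodes"

abbreviation md :: "('l, 'v) voa_modules \<Rightarrow> 'l \<Rightarrow> 'v set \<times> 'v modes" where
  "md M \<alpha> \<equiv> (mcar M \<alpha>, mmode M \<alpha>)"

text \<open>
  In the completeness clause, restricting to modules carried by subspaces of the ambient space
  loses nothing: an irreducible module has countable dimension and is finite dimensional if \<open>V\<close>
  is, hence is isomorphic to one on a subspace of the ambient space.
\<close>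

definition irreducible_modules ::
  "('v::ab_group_add) voa \<Rightarrow> ('l, 'v) voa_modules \<Rightarrow> bool" where
  "irreducible_modules U M \<longleftrightarrow>
     (\<forall>\<alpha>. ordinary_module U (md M \<alpha>) \<and> irreducible_action U (md M \<alpha>)) \<and>
     (\<forall>\<alpha>. \<exists>h. mcar M \<alpha> = module.span (scl U)
        (\<Union>n::nat. wtsp U (mcar M \<alpha>) (mmode M \<alpha>) (of_nat n + h))) \<and>
     (\<forall>\<alpha> \<beta>. module_iso U (md M \<alpha>) (md M \<beta>) \<longrightarrow> \<alpha> = \<beta>) \<and>
     (\<forall>W. ordinary_module U W \<and> irreducible_action U W \<longrightarrow> (\<exists>\<alpha>. module_iso U W (md M \<alpha>))) \<and>
     mcar M (lab0 M) = car U \<and>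
     (\<forall>u\<in>car U. \<forall>n. \<forall>v\<in>car U. mmode M (lab0 M) u n v = mode U u n v) \<and>
     dual M (lab0 M) = lab0 M \<and>
     invariant_form U (pairing M (lab0 M)) \<and>
     (\<forall>\<alpha>. contragredient U (md M \<alpha>) (md M (dual M \<alpha>)) (pairing M \<alpha>))"

definition fusion_assumption ::
  "('v::ab_group_add) voa \<Rightarrow> ('l, 'v) voa_modules \<Rightarrow> bool" where
  "fusion_assumption U M \<longleftrightarrow>
     (\<forall>\<alpha> \<gamma>. fusion_rule U (md M \<alpha>) (md M (lab0 M)) (md M \<gamma>) (if \<alpha> = \<gamma> then 1 else 0)) \<and>
     (\<forall>\<alpha> \<beta>. fusion_rule U (md M \<alpha>) (md M \<beta>) (md M (lab0 M)) (if \<alpha> = dual M \<beta> then 1 else 0))"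

text \<open>
  The normalizations, mode by mode. In the last one \<open>(-z^(-2))^(L(0))\<close> acts on a vector of weight
  \<open>c\<close> as \<open>e^(i\<pi>c) z^(-2c)\<close>, i.e.\ the principal value of \<open>(-1)^c\<close> is used.
\<close>

definition normalized_intertwiners ::
  "('v::ab_group_add) voa \<Rightarrow> ('l, 'v) voa_modules \<Rightarrow> bool" where
  "normalized_intertwiners U M \<longleftrightarrow>
     (\<forall>\<alpha> \<beta> \<gamma>. intertwiner U (md M \<alpha>) (md M \<beta>) (md M \<gamma>) (iop M \<alpha> \<beta> \<gamma>)) \<and>
     (\<forall>\<beta>. \<forall>u\<in>car U. \<forall>c. \<forall>w\<in>mcar M \<beta>. iop M (lab0 M) \<beta> \<beta> u c w = cmodes (mmode M \<beta>) u c w) \<and>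
     (\<forall>\<alpha>. \<forall>v\<in>mcar M \<alpha>. \<forall>u\<in>car U.
        (\<forall>n::int. iop M \<alpha> (lab0 M) \<alpha> v (of_int n) u =
           Sum_any (\<lambda>i::nat. scl U ((- 1) powi (n + int i + 1) / fact i)
             ((Lop U (mmode M \<alpha>) (- 1) ^^ i) (mmode M \<alpha> u (n + int i) v)))) \<and>
        (\<forall>c. c \<notin> \<int> \<longrightarrow> iop M \<alpha> (lab0 M) \<alpha> v c u = 0)) \<and>
     (\<forall>\<alpha> c. \<forall>v\<in>wtsp U (mcar M \<alpha>) (mmode M \<alpha>) c. \<forall>v'\<in>mcar M (dual M \<alpha>). \<forall>u\<in>car U. \<forall>n.
        pairing M (lab0 M) u (iop M \<alpha> (dual M \<alpha>) (lab0 M) v n v') =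
          Sum_any (\<lambda>i::nat. (- 1) powr c / fact i *
            pairing M \<alpha> (iop M \<alpha> (lab0 M) \<alpha> ((Lop U (mmode M \<alpha>) 1 ^^ i) v)
                           (2 * c - n - 2 - of_nat i) u) v'))"


section \<open>Formal series\<close>

text \<open>
  The formal variables are \<open>x\<close>, \<open>y\<^sub>k\<close>, \<open>w\<^sub>a\<close>, \<open>\<rho>\<^sub>a\<close> (\<open>a > 0\<close>, since \<open>\<rho>\<^sub>-\<^sub>a = \<rho>\<^sub>a\<close>), and the differentials
  \<open>dx\<close>, \<open>dy\<^sub>k\<close>, which are treated as further formal variables. A formal series assigns a
  coefficient to each family of complex exponents.
\<close>

datatype fvar = Vx | Vdx | Vy nat | Vdy nat | Vw int | Vrho nat

type_synonym fexp = "fvar \<Rightarrow> complex"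
type_synonym fser = "fexp \<Rightarrow> complex"

definition mon :: "fvar \<Rightarrow> complex \<Rightarrow> fser" where
  "mon p c = (\<lambda>e. if e = (\<lambda>_. 0)(p := c) then 1 else 0)"

definition fone :: fser where
  "fone = (\<lambda>e. if e = (\<lambda>_. 0) then 1 else 0)"

definition cmul :: "complex \<Rightarrow> fser \<Rightarrow> fser" where
  "cmul c f = (\<lambda>e. c * f e)"

definition fmul :: "fser \<Rightarrow> fser \<Rightarrow> fser"  (infixl \<open>\<circledast>\<close> 70) where
  "f \<circledast> h = (\<lambda>e. Sum_any (\<lambda>d. f d * h (\<lambda>p. e p - d p)))"

text \<open>Infinite sum of formal series, coefficientwise finite.\<close>

definition fsum :: "('i \<Rightarrow> fser) \<Rightarrow> fser" where
  "fsum F = (\<lambda>e. Sum_any (\<lambda>i. F i e))"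

text \<open>\<open>dd p i f\<close> is \<open>\<partial>^i f / i!\<close> with respect to the variable \<open>p\<close>.\<close>

definition dd :: "fvar \<Rightarrow> nat \<Rightarrow> fser \<Rightarrow> fser" where
  "dd p i f = (\<lambda>e. ((e p + of_nat i) gchoose i) * f (e(p := e p + of_nat i)))"

text \<open>
  The left-to-right order \<open>x, y\<^sub>1, \<dots>, y\<^sub>n, w\<^sub>1, w\<^sub>-\<^sub>1, \<dots>, w\<^sub>g, w\<^sub>-\<^sub>g\<close> of the insertions. Rational
  functions are expanded in non-negative powers of the variables further to the right.
\<close>

fun fpos :: "fvar \<Rightarrow> nat \<times> nat" where
  "fpos (Vy k) = (1, k)"
| "fpos (Vw a) = (2, if a > 0 then 2 * nat a - 1 else 2 * nat (- a))"
| "fpos _ = (0, 0)"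

definition left_of :: "fvar \<Rightarrow> fvar \<Rightarrow> bool" where
  "left_of p q \<longleftrightarrow> fst (fpos p) < fst (fpos q) \<or> fst (fpos p) = fst (fpos q) \<and> snd (fpos p) < snd (fpos q)"

text \<open>The expansion of \<open>1/(p - q)\<close>.\<close>

definition inv_diff :: "fvar \<Rightarrow> fvar \<Rightarrow> fser" where
  "inv_diff p q =
     (if left_of p q then fsum (\<lambda>i::nat. mon p (- of_nat i - 1) \<circledast> mon q (of_nat i))
      else fsum (\<lambda>i::nat. cmul (- 1) (mon p (of_nat i) \<circledast> mon q (- of_nat i - 1))))"

text \<open>
  The expansion of \<open>1/(p - A)\<close>. The points \<open>A\<^sub>\<ell>\<close> count as standing to the right of all variables:
  this is the expansion at infinity, as is forced for \<open>p = x\<close>, the leftmost variable.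
\<close>

definition inv_diff_const :: "fvar \<Rightarrow> complex \<Rightarrow> fser" where
  "inv_diff_const p A = fsum (\<lambda>i::nat. cmul (A ^ i) (mon p (- of_nat i - 1)))"


section \<open>The Schottky group\<close>

definition Iset :: "nat \<Rightarrow> int set" where
  "Iset g = {a. a \<noteq> 0 \<and> \<bar>a\<bar> \<le> int g}"

abbreviation Lset :: "nat \<Rightarrow> nat set" where
  "Lset N \<equiv> {0..2 * N - 2}"

definition schottky_parameters :: "nat \<Rightarrow> (int \<Rightarrow> complex) \<Rightarrow> (int \<Rightarrow> complex) \<Rightarrow> bool" where
  "schottky_parameters g w r \<longleftrightarrow>
     (\<forall>a\<in>Iset g. r a \<noteq> 0 \<and> r (- a) = r a) \<and>
     (\<forall>a\<in>Iset g. \<forall>b\<in>Iset g. a \<noteq> b \<longrightarrow> cmod (w a - w b) > sqrt (cmod (r a)) + sqrt (cmod (r b)))"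

text \<open>The Riemann sphere is the one-point compactification, with \<open>None\<close> for infinity.\<close>

definition schottky_gen ::
  "(int \<Rightarrow> complex) \<Rightarrow> (int \<Rightarrow> complex) \<Rightarrow> int \<Rightarrow> complex option \<Rightarrow> complex option" where
  "schottky_gen w r a p =
     (case p of None \<Rightarrow> Some (w (- a))
      | Some z \<Rightarrow> if z = w a then None else Some (w (- a) + r a / (z - w a)))"

text \<open>Closing under the \<open>\<gamma>\<^sub>a\<close> with negative \<open>a\<close> gives inverses, as \<open>\<gamma>\<^sub>-\<^sub>a\<close> is the inverse of \<open>\<gamma>\<^sub>a\<close>.\<close>

inductive_set schottky_group ::
  "nat \<Rightarrow> (int \<Rightarrow> complex) \<Rightarrow> (int \<Rightarrow> complex) \<Rightarrow> (complex option \<Rightarrow> complex option) set"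
  for g w r where
  one: "id \<in> schottky_group g w r"
| gen: "h \<in> schottky_group g w r \<Longrightarrow> a \<in> Iset g \<Longrightarrow> schottky_gen w r a \<circ> h \<in> schottky_group g w r"

definition limit_set :: "(complex option \<Rightarrow> complex option) set \<Rightarrow> complex option set" where
  "limit_set \<Gamma> = {p. \<exists>z h. inj h \<and> range h \<subseteq> \<Gamma> \<and>
     limitin (Alexandroff_compactification euclidean) (\<lambda>n::nat. h n z) p sequentially}"

text \<open>
  The points \<open>A\<^sub>\<ell>\<close> are limit points (for \<open>N = 1\<close>, an ordinary point) of an actual Schottky group.
  In the formal expansions in the variables \<open>w\<^sub>a\<close>, \<open>\<rho>\<^sub>a\<close> below they are held fixed as constants.
\<close>

definition admissible_points ::
  "nat \<Rightarrow> nat \<Rightarrow> (int \<Rightarrow> complex) \<Rightarrow> (int \<Rightarrow> complex) \<Rightarrow> (nat \<Rightarrow> complex) \<Rightarrow> bool" where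
  "admissible_points g N w r A \<longleftrightarrow>
     (if N = 1 then Some (A 0) \<notin> limit_set (schottky_group g w r)
      else inj_on A (Lset N) \<and> (\<forall>l\<in>Lset N. Some (A l) \<in> limit_set (schottky_group g w r)))"


section \<open>The forms \<open>\<Psi>\<^sub>N\<close> and \<open>\<Theta>\<^sub>N\<close>\<close>

definition lagr :: "(nat \<Rightarrow> complex) \<Rightarrow> nat \<Rightarrow> nat \<Rightarrow> complex poly" where
  "lagr A N i = (\<Prod>j\<in>Lset N - {i}. smult (1 / (A i - A j)) [:- A j, 1:])"

text \<open>
  The rational function \<open>\<pi>\<^sub>N\<close> and its partial fraction decomposition, on which the formal version
  below is based; \<open>coeff (lagr A N i) l\<close> is \<open>Q\<^sub>i\<^sup>(\<^sup>l\<^sup>)(0)\<close>.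
\<close>

definition pi_fun :: "(nat \<Rightarrow> complex) \<Rightarrow> nat \<Rightarrow> complex \<Rightarrow> complex \<Rightarrow> complex" where
  "pi_fun A N x y = 1 / (x - y) * (\<Prod>l\<in>Lset N. (y - A l) / (x - A l))"

lemma pi_fun_partial_fractions:
  assumes N: "N \<ge> 1" and inj: "inj_on A (Lset N)"
    and x: "x \<notin> A ` Lset N" and xy: "x \<noteq> y"
  shows "pi_fun A N x y =
    1 / (x - y) + (\<Sum>l\<in>Lset N. (- (\<Sum>i\<in>Lset N. 1 / (x - A i) * coeff (lagr A N i) l)) * y ^ l)"
proof -
  define P where "P = (\<Prod>l\<in>Lset N. [:- A l, 1:])"
  define H where "H = (\<Sum>i\<in>Lset N. smult (poly P x / (x - A i)) (lagr A N i))"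
  have pP: "poly P z = (\<Prod>l\<in>Lset N. z - A l)" for z
    by (simp add: P_def poly_prod)
  have Px: "poly P x \<noteq> 0" using x by (auto simp: pP)
  have cL: "card (Lset N) = 2 * N - 1" using N by simp
  have deglagr: "degree (lagr A N i) \<le> 2 * N - 2" if "i \<in> Lset N" for i
  proof -
    have "degree (lagr A N i) \<le> (\<Sum>j\<in>Lset N - {i}. 1)"
      unfolding lagr_def
      by (rule order_trans[OF degree_prod_sum_le], simp, rule sum_mono)
        (auto intro: order_trans[OF degree_smult_le])
    also have "\<dots> = 2 * N - 2" using that cL by (simp add: card_Diff_singleton)
    finally show ?thesis .
  qed
  have degH: "degree H \<le> 2 * N - 2"
    unfolding H_def
    by (rule degree_sum_le) (auto simp del: degree_smult_eq intro!: order_trans[OF degree_smult_le deglagr])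
  have degP: "degree P = 2 * N - 1"
    unfolding P_def by (subst degree_prod_eq_sum_degree) (use cL in auto)
  have lagr_at: "poly (lagr A N i) (A j) = (if i = j then 1 else 0)"
    if "i \<in> Lset N" "j \<in> Lset N" for i j
  proof (cases "i = j")
    case True
    have "A i - A k \<noteq> 0" if "k \<in> Lset N - {i}" for k
      using inj_onD[OF inj, of i k] that \<open>i \<in> Lset N\<close> by auto
    then have "poly (smult (1 / (A i - A k)) [:- A k, 1:]) (A i) = 1" if "k \<in> Lset N - {i}" for k
      using that by (simp add: diff_divide_distrib[symmetric])
    then show ?thesis using True unfolding lagr_def poly_prod by (auto intro!: prod.neutral)
  next
    case False
    then show ?thesis using that by (auto simp: lagr_def poly_prod intro!: bexI[of _ j])
  qed
  have HA: "poly H (A j) = poly P x / (x - A j)" if "j \<in> Lset N" for j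
  proof -
    have "poly H (A j) = (\<Sum>i\<in>Lset N. poly P x / (x - A i) * (if i = j then 1 else 0))"
      unfolding H_def poly_sum poly_smult by (intro sum.cong refl) (simp only: lagr_at that)
    also have "\<dots> = poly P x / (x - A j)"
      by (subst sum.remove[OF _ that]) auto
    finally show ?thesis .
  qed
  have eq: "[:x, -1:] * H = [:poly P x:] - P"
  proof (rule poly_eqI_degree[where A = "insert x (A ` Lset N)"])
    fix z assume z: "z \<in> insert x (A ` Lset N)"
    show "poly ([:x, -1:] * H) z = poly ([:poly P x:] - P) z"
    proof (cases "z = x")
      case True then show ?thesis by simp
    next
      case False
      then obtain j where j: "j \<in> Lset N" "z = A j" using z by auto
      have "poly P z = 0" using j by (auto simp: pP)
      then show ?thesis using HA[OF j(1)] False j by (simp add: field_simps)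
    qed
  next
    have c: "card (insert x (A ` Lset N)) = 2 * N"
      using x N cL by (simp add: card_image[OF inj])
    have "degree ([:x, -1:] * H) \<le> degree [:x, -1:] + degree H" by (rule degree_mult_le)
    also have "\<dots> \<le> 1 + (2 * N - 2)" using degH by simp
    finally show "degree ([:x, -1:] * H) < card (insert x (A ` Lset N))" using c N by simp
    have "degree ([:poly P x:] - P) \<le> 2 * N - 1"
      using degP by (intro degree_diff_le) auto
    then show "degree ([:poly P x:] - P) < card (insert x (A ` Lset N))" using c N by simp
  qed
  have "(x - y) * poly H y = poly P x - poly P y"
    using arg_cong[OF eq, of "\<lambda>p. poly p y"] by (simp add: algebra_simps)
  then have quot: "poly P y / poly P x = 1 - (x - y) * (poly H y / poly P x)"
    using Px by (simp add: field_simps)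
  have pi: "pi_fun A N x y = 1 / (x - y) * (poly P y / poly P x)"
    by (simp add: pi_fun_def pP prod_dividef)
  have "poly (lagr A N i) y = (\<Sum>l\<in>Lset N. coeff (lagr A N i) l * y ^ l)" if "i \<in> Lset N" for i
    unfolding poly_altdef
    by (rule sum.mono_neutral_left) (use deglagr[OF that] in \<open>auto simp: coeff_eq_0\<close>)
  then have Hy: "poly H y / poly P x
      = (\<Sum>i\<in>Lset N. \<Sum>l\<in>Lset N. 1 / (x - A i) * coeff (lagr A N i) l * y ^ l)"
    using Px by (simp add: H_def poly_sum sum_divide_distrib sum_distrib_left mult.assoc)
  have "(\<Sum>l\<in>Lset N. (- (\<Sum>i\<in>Lset N. 1 / (x - A i) * coeff (lagr A N i) l)) * y ^ l)
      = - (poly H y / poly P x)"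
    unfolding Hy by (subst sum.swap) (simp add: sum_negf sum_distrib_right)
  moreover have "pi_fun A N x y = 1 / (x - y) - poly H y / poly P x"
    unfolding pi quot using xy by (simp add: field_simps)
  ultimately show ?thesis by simp
qed

definition fl :: "(nat \<Rightarrow> complex) \<Rightarrow> nat \<Rightarrow> nat \<Rightarrow> fvar \<Rightarrow> fser" where
  "fl A N l p = (\<Sum>i\<in>Lset N. cmul (- coeff (lagr A N i) l) (inv_diff_const p (A i)))"

definition pi_ser :: "(nat \<Rightarrow> complex) \<Rightarrow> nat \<Rightarrow> fvar \<Rightarrow> fvar \<Rightarrow> fser" where
  "pi_ser A N p q = inv_diff p q + (\<Sum>l\<in>Lset N. fl A N l p \<circledast> mon q (of_nat l))"

abbreviation rho :: "int \<Rightarrow> complex \<Rightarrow> fser" where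
  "rho a c \<equiv> mon (Vrho (nat \<bar>a\<bar>)) c"

text \<open>The infinite matrices and vectors are indexed by pairs \<open>(a, m)\<close>, \<open>a \<in> I\<close>, \<open>m \<ge> 0\<close>.\<close>

type_synonym idx = "int \<times> nat"

definition contr :: "nat \<Rightarrow> (idx \<Rightarrow> fser) \<Rightarrow> (idx \<Rightarrow> fser) \<Rightarrow> fser" where
  "contr g P Q = (\<Sum>c\<in>Iset g. fsum (\<lambda>k. P (c, k) \<circledast> Q (c, k)))"

definition mat_mult :: "nat \<Rightarrow> ('i \<Rightarrow> idx \<Rightarrow> fser) \<Rightarrow> (idx \<Rightarrow> 'j \<Rightarrow> fser) \<Rightarrow> 'i \<Rightarrow> 'j \<Rightarrow> fser" where
  "mat_mult g P Q = (\<lambda>i j. contr g (P i) (\<lambda>k. Q k j))"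

fun Lvec :: "(nat \<Rightarrow> complex) \<Rightarrow> nat \<Rightarrow> idx \<Rightarrow> fser" where
  "Lvec A N (b, n) =
     rho b (of_nat n / 2) \<circledast> dd (Vw b) n (pi_ser A N Vx (Vw b)) \<circledast> mon Vdx (of_nat N)"

fun Rvec :: "(nat \<Rightarrow> complex) \<Rightarrow> nat \<Rightarrow> nat \<Rightarrow> idx \<Rightarrow> fser" where
  "Rvec A N k (a, m) =
     cmul ((- 1) ^ N) (rho a ((of_nat m + 1) / 2) \<circledast> dd (Vw (- a)) m (pi_ser A N (Vw (- a)) (Vy k))
       \<circledast> mon (Vdy k) (1 - of_nat N))"

fun Amat :: "(nat \<Rightarrow> complex) \<Rightarrow> nat \<Rightarrow> idx \<Rightarrow> idx \<Rightarrow> fser" where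
  "Amat A N (a, m) (b, n) =
     (if a \<noteq> - b then
        cmul ((- 1) ^ N) (rho a ((of_nat m + 1) / 2) \<circledast> rho b (of_nat n / 2) \<circledast>
          dd (Vw (- a)) m (dd (Vw b) n (pi_ser A N (Vw (- a)) (Vw b))))
      else
        cmul ((- 1) ^ N) (rho a ((of_nat m + of_nat n + 1) / 2) \<circledast>
          (\<Sum>l\<in>Lset N. cmul (of_nat (l choose n))
             (dd (Vw (- a)) m (fl A N l (Vw (- a))) \<circledast> mon (Vw (- a)) (of_nat l - of_nat n)))))"

fun Delta :: "nat \<Rightarrow> idx \<Rightarrow> idx \<Rightarrow> fser" where
  "Delta N (a, m) (b, n) = (if a = b \<and> m = n + 2 * N - 1 then fone else 0)"

definition Ltil :: "nat \<Rightarrow> (nat \<Rightarrow> complex) \<Rightarrow> nat \<Rightarrow> idx \<Rightarrow> fser" where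
  "Ltil g A N = (\<lambda>j. contr g (Lvec A N) (\<lambda>k. Delta N k j))"

definition Atil :: "nat \<Rightarrow> (nat \<Rightarrow> complex) \<Rightarrow> nat \<Rightarrow> idx \<Rightarrow> idx \<Rightarrow> fser" where
  "Atil g A N = mat_mult g (Amat A N) (Delta N)"

primrec mat_pow :: "nat \<Rightarrow> (idx \<Rightarrow> idx \<Rightarrow> fser) \<Rightarrow> nat \<Rightarrow> idx \<Rightarrow> idx \<Rightarrow> fser" where
  "mat_pow g P 0 = (\<lambda>i j. if i = j then fone else 0)"
| "mat_pow g P (Suc k) = mat_mult g (mat_pow g P k) P"

text \<open>\<open>(I - P)\<close> inverted as a Neumann series.\<close>

definition neumann :: "nat \<Rightarrow> (idx \<Rightarrow> idx \<Rightarrow> fser) \<Rightarrow> idx \<Rightarrow> idx \<Rightarrow> fser" where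
  "neumann g P = (\<lambda>i j. fsum (\<lambda>k. mat_pow g P k i j))"

definition Psi :: "nat \<Rightarrow> (nat \<Rightarrow> complex) \<Rightarrow> nat \<Rightarrow> nat \<Rightarrow> fser" where
  "Psi g A N k =
     pi_ser A N Vx (Vy k) \<circledast> mon Vdx (of_nat N) \<circledast> mon (Vdy k) (1 - of_nat N)
     + contr g (Ltil g A N) (\<lambda>i. contr g (neumann g (Atil g A N) i) (Rvec A N k))"

definition Tform :: "nat \<Rightarrow> (nat \<Rightarrow> complex) \<Rightarrow> nat \<Rightarrow> int \<Rightarrow> nat \<Rightarrow> fser" where
  "Tform g A N a l = rho a (- of_nat l / 2) \<circledast>
     (Lvec A N (a, l)
      + contr g (Ltil g A N) (\<lambda>i. mat_mult g (neumann g (Atil g A N)) (Amat A N) i (a, l)))"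

definition Theta :: "nat \<Rightarrow> (nat \<Rightarrow> complex) \<Rightarrow> nat \<Rightarrow> int \<Rightarrow> nat \<Rightarrow> fser" where
  "Theta g A N a l = Tform g A N a l
     + cmul ((- 1) ^ N) (rho a (of_nat N - 1 - of_nat l) \<circledast> Tform g A N (- a) (2 * N - 2 - l))"


section \<open>Genus \<open>g\<close> intertwiner correlation forms\<close>

text \<open>
  An entry \<open>(\<alpha>, \<beta>, \<gamma>, v, p)\<close> is the coefficient of \<open>z^p\<close> in the operator of type \<open>(\<gamma>; \<alpha> \<beta>)\<close>
  for \<open>v\<close> at \<open>z\<close>.
\<close>

primrec chain ::
  "('l, 'v) voa_modules \<Rightarrow> ('l \<times> 'l \<times> 'l \<times> 'v \<times> complex) list \<Rightarrow> 'v \<Rightarrow> 'v" where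
  "chain M [] s = s"
| "chain M (t # ts) s =
     (case t of (\<alpha>, \<beta>, \<gamma>, v, p) \<Rightarrow> iop M \<alpha> \<beta> \<gamma> v (- p - 1) (chain M ts s))"

text \<open>
  \<open>v\<^sub>k\<close> enters through its component of weight the exponent of \<open>dy\<^sub>k\<close>; this is the linear
  extension to inhomogeneous vectors.
\<close>

definition y_part ::
  "('v::ab_group_add) voa \<Rightarrow> ('l, 'v) voa_modules \<Rightarrow> nat \<Rightarrow> (nat \<Rightarrow> 'l) \<Rightarrow> (nat \<Rightarrow> 'l) \<Rightarrow> (nat \<Rightarrow> 'v)
   \<Rightarrow> fexp \<Rightarrow> ('l \<times> 'l \<times> 'l \<times> 'v \<times> complex) list" where
  "y_part U M n \<gamma> \<delta> v e =
     map (\<lambda>k. (\<gamma> k, \<delta> k, \<delta> (k - 1), wcomp U (md M (\<gamma> k)) (e (Vdy k)) (v k), e (Vy k))) [1..<n + 1]"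

text \<open>
  The labels \<open>\<alpha>\<close> and \<open>\<beta>\<close>, homogeneous bases \<open>bas a\<close> of \<open>W\<close> with label \<open>\<alpha>\<^sub>a\<close>, and the dual bases:
  \<open>dbas a b\<close> is the element dual to \<open>b\<close>.
\<close>

record ('l, 'v) genus_data =
  genus :: nat
  al    :: "nat \<Rightarrow> 'l"
  be    :: "nat \<Rightarrow> 'l"
  bas   :: "nat \<Rightarrow> 'v set"
  dbas  :: "nat \<Rightarrow> 'v \<Rightarrow> 'v"

definition wlab :: "('l, 'v) voa_modules \<Rightarrow> ('l, 'v) genus_data \<Rightarrow> int \<Rightarrow> 'l" where
  "wlab M G a = (if a > 0 then al G (nat a) else dual M (al G (nat (- a))))"

text \<open>The vectors \<open>b\<^sub>a\<close> and, without the power of \<open>\<rho>\<^sub>a\<close>, \<open>b\<^sub>-\<^sub>a\<close>.\<close>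

definition wvec :: "('l, 'v) genus_data \<Rightarrow> (nat \<Rightarrow> 'v) \<Rightarrow> int \<Rightarrow> 'v" where
  "wvec G b a = (if a > 0 then b (nat a) else dbas G (nat (- a)) (b (nat (- a))))"

definition w_part ::
  "('l, 'v) voa_modules \<Rightarrow> ('l, 'v) genus_data \<Rightarrow> (int \<Rightarrow> 'v) \<Rightarrow> fexp
   \<Rightarrow> ('l \<times> 'l \<times> 'l \<times> 'v \<times> complex) list" where
  "w_part M G bv e =
     concat (map (\<lambda>a.
       [(wlab M G (int a), be G (2 * a - 1), be G (2 * a - 2), bv (int a), e (Vw (int a))),
        (wlab M G (- int a), be G (2 * a), be G (2 * a - 1), bv (- int a), e (Vw (- int a)))])
       [1..<genus G + 1])"

text \<open>
  Because of the factors \<open>\<rho>\<^sub>a^(wt b\<^sub>a)\<close>, the coefficient of a given monomial only involves those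
  finitely many \<open>b\<^sub>a\<close> whose weight is the exponent of \<open>\<rho>\<^sub>a\<close>. The argument \<open>F\<close> allows operators to be
  inserted on the left, and \<open>T\<close> allows the vectors at the \<open>w\<^sub>a\<close> to be modified.
\<close>

definition corr ::
  "('v::ab_group_add) voa \<Rightarrow> ('l, 'v) voa_modules \<Rightarrow> ('l, 'v) genus_data
   \<Rightarrow> nat \<Rightarrow> (nat \<Rightarrow> 'l) \<Rightarrow> (nat \<Rightarrow> 'l) \<Rightarrow> (nat \<Rightarrow> 'v)
   \<Rightarrow> ('v \<Rightarrow> 'v) \<Rightarrow> ((int \<Rightarrow> 'v) \<Rightarrow> int \<Rightarrow> 'v) \<Rightarrow> fser" where
  "corr U M G n \<gamma> \<delta> v F T e =
     (\<Sum>b \<in> (\<Pi>\<^sub>E a\<in>{1..genus G}. bas G a \<inter>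
               wtsp U (mcar M (al G a)) (mmode M (al G a)) (e (Vrho a))).
        pairing M (lab0 M) (vac U)
          (F (chain M (y_part U M n \<gamma> \<delta> v e @ w_part M G (T (wvec G b)) e) (vac U))))"

definition supported :: "fvar set \<Rightarrow> fexp \<Rightarrow> bool" where
  "supported S e \<longleftrightarrow> (\<forall>p. p \<notin> S \<longrightarrow> e p = 0)"

definition corr_vars :: "nat \<Rightarrow> nat \<Rightarrow> fvar set" where
  "corr_vars g n = Vy ` {1..n} \<union> Vdy ` {1..n} \<union> Vw ` Iset g \<union> Vrho ` {1..g}"

text \<open>The genus \<open>g\<close> correlation form of the \<open>v\<^sub>k\<close> at \<open>y\<^sub>k\<close>.\<close>

definition Fcorr ::
  "('v::ab_group_add) voa \<Rightarrow> ('l, 'v) voa_modules \<Rightarrow> ('l, 'v) genus_data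
   \<Rightarrow> nat \<Rightarrow> (nat \<Rightarrow> 'l) \<Rightarrow> (nat \<Rightarrow> 'l) \<Rightarrow> (nat \<Rightarrow> 'v) \<Rightarrow> fser" where
  "Fcorr U M G n \<gamma> \<delta> v = (\<lambda>e.
     if supported (corr_vars (genus G) n) e then corr U M G n \<gamma> \<delta> v id id e else 0)"

text \<open>The form with \<open>Y(u,x)dx^N\<close> inserted on the left.\<close>

definition Fcorr_u ::
  "('v::ab_group_add) voa \<Rightarrow> ('l, 'v) voa_modules \<Rightarrow> ('l, 'v) genus_data
   \<Rightarrow> nat \<Rightarrow> (nat \<Rightarrow> 'l) \<Rightarrow> (nat \<Rightarrow> 'l) \<Rightarrow> nat \<Rightarrow> 'v \<Rightarrow> (nat \<Rightarrow> 'v) \<Rightarrow> fser" where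
  "Fcorr_u U M G n \<gamma> \<delta> N u v = (\<lambda>e.
     if supported ({Vx, Vdx} \<union> corr_vars (genus G) n) e \<and> e Vdx = of_nat N
     then corr U M G n \<gamma> \<delta> v (cmodes (mode U) u (- e Vx - 1)) id e else 0)"

text \<open>\<open>Res\<^sub>a\<^sup>l\<close>: the form in which \<open>b\<^sub>a\<close> is replaced by \<open>u(l) b\<^sub>a\<close>.\<close>

definition Fcorr_res ::
  "('v::ab_group_add) voa \<Rightarrow> ('l, 'v) voa_modules \<Rightarrow> ('l, 'v) genus_data
   \<Rightarrow> nat \<Rightarrow> (nat \<Rightarrow> 'l) \<Rightarrow> (nat \<Rightarrow> 'l) \<Rightarrow> int \<Rightarrow> nat \<Rightarrow> 'v \<Rightarrow> (nat \<Rightarrow> 'v) \<Rightarrow> fser" where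
  "Fcorr_res U M G n \<gamma> \<delta> a l u v = (\<lambda>e.
     if supported (corr_vars (genus G) n) e
     then corr U M G n \<gamma> \<delta> v id (\<lambda>bv. bv(a := mmode M (wlab M G a) u (int l) (bv a))) e else 0)"

definition homogeneous_dual_bases ::
  "('v::ab_group_add) voa \<Rightarrow> ('l, 'v) voa_modules \<Rightarrow> ('l, 'v) genus_data \<Rightarrow> bool" where
  "homogeneous_dual_bases U M G \<longleftrightarrow>
     (\<forall>a\<in>{1..genus G}.
        bas G a \<subseteq> (\<Union>c. wtsp U (mcar M (al G a)) (mmode M (al G a)) c) \<and>
        \<not> module.dependent (scl U) (bas G a) \<and>
        module.span (scl U) (bas G a) = mcar M (al G a) \<and>
        (\<forall>b\<in>bas G a. dbas G a b \<in> mcar M (dual M (al G a)) \<and>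
           (\<forall>b'\<in>bas G a. pairing M (al G a) b' (dbas G a b) = (if b' = b then 1 else 0))))"

text \<open>
  Admissible intermediate labels. The outermost labels, which the notation leaves implicit, are
  those of \<open>V\<close>. For a single insertion (\<open>n = 1\<close>) the conditions on \<open>\<delta>\<close> force \<open>\<gamma> 1 = 0\<close>.
\<close>

definition admissible_delta ::
  "('l, 'v) voa_modules \<Rightarrow> nat \<Rightarrow> (nat \<Rightarrow> 'l) \<Rightarrow> (nat \<Rightarrow> 'l) \<Rightarrow> bool" where
  "admissible_delta M n \<gamma> \<delta> \<longleftrightarrow> \<delta> 0 = lab0 M \<and> \<delta> n = lab0 M \<and>
     (n \<ge> 1 \<longrightarrow> \<delta> 1 = dual M (\<gamma> 1) \<and> \<delta> (n - 1) = \<gamma> n)"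

definition admissible_beta :: "('l, 'v) voa_modules \<Rightarrow> ('l, 'v) genus_data \<Rightarrow> bool" where
  "admissible_beta M G \<longleftrightarrow>
     be G 0 = lab0 M \<and> be G (2 * genus G) = lab0 M \<and>
     be G 1 = dual M (al G 1) \<and> be G (2 * genus G - 1) = dual M (al G (genus G))"

end

theory Submission
  imports Defs
begin

text \<open>
  The theorem is a genus \<open>g\<close> version of Zhu reduction. Let \<open>u\<close> be quasiprimary of weight \<open>N\<close>, and let
  \<open>q\<^sub>i\<close> run over the points \<open>y\<^sub>1, \<dots>, y\<^sub>n, w\<^sub>1, w\<^sub>-\<^sub>1, \<dots>, w\<^sub>g, w\<^sub>-\<^sub>g\<close> at which operators are inserted, from
  left to right. Write \<open>Ins i j\<close> for the correlation form in which \<open>u(j)\<close> acts on the vector at \<open>q\<^sub>i\<close>.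

  \<^emph>\<open>Genus 0.\<close> A mode \<open>u(m)\<close> with \<open>m \<ge> 0\<close> annihilates the vacuum on the right. The adjoint of \<open>u(m)\<close> is
  \<open>\<plusminus>u(2N - 2 - m)\<close>, so modes with \<open>m \<le> 2N - 2\<close> annihilate the vacuum on the left (\<open>P_vac_mode\<close>).
  Commuting modes through the chain of intertwining operators thus expresses the form with \<open>Y(u, x)\<close>
  inserted by the \<open>Ins i j\<close>, \<open>j \<ge> 0\<close>, with coefficients \<open>\<partial>\<^sup>j (x - q\<^sub>i)^(-1) / j!\<close>
  (\<open>Fcorr_u_kern\<close>), and likewise the modes \<open>u(- m - 1)\<close> at a point \<open>q\<^sub>i\<close> by the non-negative modes at
  the others (\<open>Ins_negative\<close>). For \<open>0 \<le> m \<le> 2N - 2\<close> the same computation gives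
  linear relations (\<open>moments_zero\<close>), owing to which a polynomial of degree at most \<open>2N - 2\<close> in \<open>q\<^sub>i\<close> may be added
  to the kernel. Hence \<open>(x - q)^(-1)\<close> may be replaced by \<open>\<pi>\<^sub>N(x, q)\<close> (\<open>Fcorr_u_pi\<close>, \<open>Ins_negative_pi\<close>).

  \<^emph>\<open>Sewing.\<close> The sum over dual bases at \<open>w\<^sub>a\<close> and \<open>w\<^sub>-\<^sub>a\<close> identifies \<open>u(j)\<close> at \<open>w\<^sub>a\<close> with a
  multiple of \<open>u(2N - 2 - j)\<close> at \<open>w\<^sub>-\<^sub>a\<close> (\<open>Ins_sewing\<close>). For \<open>j = m + 2N - 1\<close> the latter is
  \<open>u(- m - 1)\<close>, which the genus 0 formula expresses by non-negative modes again. The vector \<open>Y\<close> of all modes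
  of index at least \<open>2N - 1\<close> at the \<open>w\<^sub>a\<close> therefore satisfies \<open>Y = Z + A \<Delta> Y\<close>, where \<open>Z\<close> collects the modes at the
  \<open>y\<^sub>k\<close> and the modes \<open>0, \<dots>, 2N - 2\<close> at the \<open>w\<^sub>a\<close> (\<open>Y_expansion\<close>). Substituting the solution
  \<open>(I - A \<Delta>)^(-1) Z\<close> into the formula for the form with \<open>Y(u, x)\<close> turns the coefficient of \<open>u(j)\<close> at \<open>y\<^sub>k\<close> into a
  derivative of \<open>\<Psi>\<^sub>N(x, y\<^sub>k)\<close>, and that of \<open>u(l)\<close> at \<open>w\<^sub>a\<close> into \<open>T\<^sub>a\<^sup>l\<close>. As \<open>u(l)\<close> at \<open>w\<^sub>a\<close> and \<open>u(2N - 2 - l)\<close> at \<open>w\<^sub>-\<^sub>a\<close> are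
  proportional, their coefficients combine to \<open>\<Theta>\<^sub>a\<^sup>l\<close> (\<open>Theta_Ins\<close>).

  \<^emph>\<open>Formal sums.\<close> All series are functions on exponents, and products of such functions are neither
  defined nor associative in general. What saves the computation is that weights are bounded below in every
  module and that the total weight is 0: this bounds the sum of the exponents of any initial
  segment of the \<open>q\<^sub>i\<close> from above, and the exponents of the \<open>\<rho>\<^sub>a\<close> from below (\<open>Ins_bounds\<close>).
  The expansions of the kernels respect the same bounds. So all supports lie in translates of
  one cone, in which a given exponent has only finitely many decompositions with a half-integral
  summand (\<open>finite_cone_split\<close>); and since \<open>A \<Delta>\<close> has positive degree in the \<open>\<rho>\<^sub>a\<close>, the
  Neumann series converges to the solution (\<open>neumann_solution\<close>).
\<close>

section \<open>Sums with finite support\<close>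

lemma Sum_any_nonzeroE:
  assumes "Sum_any f \<noteq> 0" obtains a where "f a \<noteq> 0"
  using assms by (rule Sum_any.not_neutral_obtains_not_neutral)

lemma Sum_any_reindex_inj:
  assumes "inj l" and "\<And>a. g a \<noteq> 0 \<Longrightarrow> a \<in> range l"
  shows "Sum_any g = Sum_any (\<lambda>t. g (l t))"
proof -
  have *: "{a. g a \<noteq> 0} = l ` {t. g (l t) \<noteq> 0}" using assms(2) by auto
  show ?thesis
    unfolding Sum_any.expand_set * using assms(1)
    by (subst sum.reindex) (auto intro: inj_on_subset)
qed

lemma finite_slices:
  assumes "finite {(x, y). R x y}"
  shows "finite {x. R x y}" and "finite {y. R x y}"
proof -
  have "{x. R x y} \<subseteq> fst ` {(x, y). R x y}" "{y. R x y} \<subseteq> snd ` {(x, y). R x y}" by force+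
  then show "finite {x. R x y}" "finite {y. R x y}"
    using finite_imageI[OF assms] finite_subset by blast+
qed

lemma Sum_any_pair:
  assumes "finite {(a, b). g a b \<noteq> 0}"
  shows "Sum_any (\<lambda>a. Sum_any (g a)) = Sum_any (\<lambda>(a, b). g a b)"
proof -
  have "{a. \<exists>b. g a b \<noteq> 0} = fst ` {(a, b). g a b \<noteq> 0}"
       "{b. \<exists>a. g a b \<noteq> 0} = snd ` {(a, b). g a b \<noteq> 0}" by force+
  then have "finite ({a. \<exists>b. g a b \<noteq> 0} \<times> {b. \<exists>a. g a b \<noteq> 0})" using assms by simp
  then show ?thesis by (rule Sum_any.cartesian_product) simp
qed

lemma Sum_any_swap_pair:
  assumes "finite {(a, b). g a b \<noteq> 0}"
  shows "Sum_any (\<lambda>a. Sum_any (g a)) = Sum_any (\<lambda>b. Sum_any (\<lambda>a. g a b))"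
proof -
  have "{a. \<exists>b. g a b \<noteq> 0} = fst ` {(a, b). g a b \<noteq> 0}"
       "{b. \<exists>a. g a b \<noteq> 0} = snd ` {(a, b). g a b \<noteq> 0}" by force+
  then have "finite ({a. \<exists>b. g a b \<noteq> 0} \<times> {b. \<exists>a. g a b \<noteq> 0})" using assms by simp
  then show ?thesis by (rule Sum_any.swap) simp
qed

lemma Sum_any_sum:
  fixes F :: "'s \<Rightarrow> 'a \<Rightarrow> 'b::comm_monoid_add"
  assumes "finite A" and "\<And>s. s \<in> A \<Longrightarrow> finite {a. F s a \<noteq> 0}"
  shows "Sum_any (\<lambda>a. \<Sum>s\<in>A. F s a) = (\<Sum>s\<in>A. Sum_any (F s))"
proof -
  define B where "B = (\<Union>s\<in>A. {a. F s a \<noteq> 0})"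
  have fin: "finite B" using assms by (auto simp: B_def)
  have "Sum_any (\<lambda>a. \<Sum>s\<in>A. F s a) = (\<Sum>a\<in>B. \<Sum>s\<in>A. F s a)"
    by (rule Sum_any.expand_superset[OF fin]) (auto simp: B_def elim: sum.not_neutral_contains_not_neutral)
  also have "\<dots> = (\<Sum>s\<in>A. \<Sum>a\<in>B. F s a)" by (rule sum.swap)
  also have "\<dots> = (\<Sum>s\<in>A. Sum_any (F s))"
    by (intro sum.cong refl Sum_any.expand_superset[OF fin, symmetric]) (auto simp: B_def)
  finally show ?thesis .
qed

section \<open>Convolutions and contractions of formal series\<close>

text \<open>
  Contraction over an index set together with the convolution of exponents, as one sum over pairs.
  A product of two series (one index), a contraction of vectors and an infinite sum of series (one
  factor constantly 1) are all of this form, so that a single associativity law, \<open>conv_assoc\<close>,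
  yields every interchange of infinite sums that is needed.
\<close>

definition conv :: "'i set \<Rightarrow> ('i \<Rightarrow> fser) \<Rightarrow> ('i \<Rightarrow> fser) \<Rightarrow> fser" where
  "conv S P Q = (\<lambda>e. Sum_any (\<lambda>(i, d). if i \<in> S then P i d * Q i (e - d) else 0))"

lemma fmul_apply: "(f \<circledast> h) e = Sum_any (\<lambda>d. f d * h (e - d))"
  by (simp add: fmul_def fun_diff_def)

lemma conv_nonzeroE:
  assumes "conv S P Q e \<noteq> 0"
  obtains i d where "i \<in> S" "P i d \<noteq> 0" "Q i (e - d) \<noteq> 0"
  using assms unfolding conv_def by (rule Sum_any_nonzeroE) (auto split: if_splits)

lemma fmul_nonzeroE:
  assumes "(f \<circledast> h) e \<noteq> 0"
  obtains d where "f d \<noteq> 0" "h (e - d) \<noteq> 0"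
  using assms unfolding fmul_apply by (rule Sum_any_nonzeroE) auto

lemma conv_unit: "conv (UNIV :: unit set) (\<lambda>_. f) (\<lambda>_. h) = f \<circledast> h"
proof
  fix e
  have "inj (\<lambda>d::fexp. ((), d))" by (auto intro: injI)
  then show "conv (UNIV :: unit set) (\<lambda>_. f) (\<lambda>_. h) e = (f \<circledast> h) e"
    unfolding conv_def fmul_apply by (subst Sum_any_reindex_inj) (auto simp: image_iff)
qed

lemma fone_apply: "fone e = (if e = 0 then 1 else 0)"
  by (simp add: fone_def zero_fun_def)

lemma conv_fone_left: "conv UNIV (\<lambda>_. fone) F = fsum F"
proof
  fix e
  have "inj (\<lambda>k. (k, 0 :: fexp))" by (auto intro: injI)
  then show "conv UNIV (\<lambda>_. fone) F e = fsum F e"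
    unfolding conv_def fsum_def
    by (subst Sum_any_reindex_inj[where l = "\<lambda>k. (k, 0)"])
      (auto simp: fone_apply image_iff split: if_splits)
qed

lemma fmul_commute: "f \<circledast> h = h \<circledast> f"
proof
  fix e
  have b: "bij (\<lambda>d::fexp. e - d)"
    by (rule bij_betwI[where g = "\<lambda>d. e - d"]) auto
  show "(f \<circledast> h) e = (h \<circledast> f) e"
    unfolding fmul_apply
    by (rule Sum_any.reindex_cong[OF b]) (auto simp: fun_eq_iff mult.commute)
qed

lemma conv_commute: "conv S P Q = conv S Q P"
proof
  fix e
  have b: "bij (\<lambda>(i, d). (i, e - d :: fexp))"
    by (rule bij_betwI[where g = "\<lambda>(i, d). (i, e - d)"]) auto
  show "conv S P Q e = conv S Q P e"
    unfolding conv_def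
    by (rule Sum_any.reindex_cong[OF b]) (auto simp: fun_eq_iff mult.commute)
qed

text \<open>
  Both sides are iterated sums of the same family; the hypothesis says that this family has finite
  support, which is what an interchange of the summations requires.
\<close>

lemma conv_assoc:
  assumes fin: "\<And>e. finite {((i, d), (j, d')). i \<in> S \<and> j \<in> T \<and> P i d \<noteq> 0 \<and> M i j d' \<noteq> 0 \<and> Q j (e - d - d') \<noteq> 0}"
  shows "conv T (\<lambda>j. conv S P (\<lambda>i. M i j)) Q = conv S P (\<lambda>i. conv T (M i) Q)"
proof
  fix e
  \<comment> \<open>The same family, in the variables \<open>d, d'\<close> and in \<open>d, d2 = d + d'\<close>.\<close>
  let ?F = "\<lambda>(i, d) (j, d'). if i \<in> S \<and> j \<in> T then P i d * (M i j d' * Q j (e - d - d')) else 0"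
  let ?F2 = "\<lambda>(i, d) (j, d2). if i \<in> S \<and> j \<in> T then P i d * (M i j (d2 - d) * Q j (e - d2)) else 0"
  let ?A = "{((i, d), (j, d')). i \<in> S \<and> j \<in> T \<and> P i d \<noteq> 0 \<and> M i j d' \<noteq> 0 \<and> Q j (e - d - d') \<noteq> 0}"
  have finF: "finite {(x, y). ?F x y \<noteq> 0}"
    by (rule finite_subset[OF _ fin[of e]]) (auto split: if_splits)
  have "{(x, y). ?F2 x y \<noteq> 0} \<subseteq> (\<lambda>((i, d), (j, d')). ((i, d), (j, d + d'))) ` ?A"
  proof
    fix z assume z: "z \<in> {(x, y). ?F2 x y \<noteq> 0}"
    obtain i d j d2 where zz: "z = ((i, d), (j, d2))" by (metis surj_pair)
    from z have "i \<in> S" "j \<in> T" "P i d \<noteq> 0" "M i j (d2 - d) \<noteq> 0" "Q j (e - d2) \<noteq> 0"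
      unfolding zz by (auto split: if_splits)
    moreover have "e - d - (d2 - d) = e - d2" by (simp add: algebra_simps)
    ultimately have "((i, d), (j, d2 - d)) \<in> ?A" by auto
    then show "z \<in> (\<lambda>((i, d), (j, d')). ((i, d), (j, d + d'))) ` ?A"
      unfolding zz by (rule rev_image_eqI) simp
  qed
  then have finF2: "finite {(x, y). ?F2 x y \<noteq> 0}"
    by (rule finite_subset[OF _ finite_imageI[OF fin[of e]]])
  have finR: "finite {x. ?F2 x y \<noteq> 0}" for y by (rule finite_slices(1)[OF finF2])
  have finL: "finite {y. ?F x y \<noteq> 0}" for x by (rule finite_slices(2)[OF finF])
  have "conv T (\<lambda>j. conv S P (\<lambda>i. M i j)) Q e = Sum_any (\<lambda>y. Sum_any (\<lambda>x. ?F2 x y))"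
    unfolding conv_def
  proof (rule Sum_any.cong, goal_cases)
    case (1 y)
    obtain j d2 where y: "y = (j, d2)" by (cases y)
    show ?case
    proof (cases "j \<in> T \<and> Q j (e - d2) \<noteq> 0")
      case True
      then have "finite {x. (case x of (i, d) \<Rightarrow> if i \<in> S then P i d * M i j (d2 - d) else 0) \<noteq> 0}"
        by (intro finite_subset[OF _ finR[of y]]) (auto simp: y split: if_splits)
      from Sum_any_left_distrib[OF this] True show ?thesis
        by (auto simp: y mult.assoc intro!: Sum_any.cong)
    next
      case False
      then have "?F2 x y = 0" for x by (auto simp: y split: prod.splits)
      then show ?thesis using False by (auto simp: y)
    qed
  qed
  also have "\<dots> = Sum_any (\<lambda>x. Sum_any (\<lambda>y. ?F2 x y))"
    using Sum_any_swap_pair[OF finF2] by simp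
  also have "\<dots> = Sum_any (\<lambda>x. Sum_any (\<lambda>y. ?F x y))"
  proof (rule Sum_any.cong)
    fix x :: "'a \<times> fexp"
    obtain i d where x: "x = (i, d)" by (cases x)
    have b: "bij (\<lambda>(j::'b, d'). (j, d + d' :: fexp))"
      by (rule bij_betwI[where g = "\<lambda>(j, d2). (j, d2 - d)"]) auto
    show "(\<Sum>y. ?F2 x y) = (\<Sum>y. ?F x y)"
      by (rule Sum_any.reindex_cong[OF b]) (auto simp: fun_eq_iff x diff_diff_eq)
  qed
  also have "\<dots> = conv S P (\<lambda>i. conv T (M i) Q) e"
    unfolding conv_def
  proof (rule Sum_any.cong, goal_cases)
    case (1 x)
    obtain i d where x: "x = (i, d)" by (cases x)
    show ?case
    proof (cases "i \<in> S \<and> P i d \<noteq> 0")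
      case True
      then have "finite {y. (case y of (j, d') \<Rightarrow> if j \<in> T then M i j d' * Q j (e - d - d') else 0) \<noteq> 0}"
        by (intro finite_subset[OF _ finL[of x]]) (auto simp: x split: if_splits)
      from Sum_any_right_distrib[OF this] True show ?thesis
        by (auto simp: x mult.assoc intro!: Sum_any.cong)
    next
      case False
      then have "?F x y = 0" for y by (auto simp: x split: prod.splits)
      then show ?thesis using False by (auto simp: x)
    qed
  qed
  finally show "conv T (\<lambda>j. conv S P (\<lambda>i. M i j)) Q e = conv S P (\<lambda>i. conv T (M i) Q) e" .
qed

lemma conv_cong:
  assumes "\<And>i. i \<in> S \<Longrightarrow> P i = P' i" "\<And>i. i \<in> S \<Longrightarrow> Q i = Q' i"
  shows "conv S P Q = conv S P' Q'"
  unfolding conv_def by (rule ext, rule Sum_any.cong) (auto simp: assms)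

lemma fsum_fun_apply: "(\<Sum>s\<in>A. F s) x = (\<Sum>s\<in>A. F s x)" for F :: "'b \<Rightarrow> fser"
  by (induction A rule: infinite_finite_induct) auto

lemma conv_sum_right:
  assumes "finite A"
    and "\<And>s e. s \<in> A \<Longrightarrow> finite {(i, d). i \<in> S \<and> P i d \<noteq> 0 \<and> Q s i (e - d) \<noteq> 0}"
  shows "conv S P (\<lambda>i. \<Sum>s\<in>A. Q s i) = (\<Sum>s\<in>A. conv S P (Q s))"
proof
  fix e
  note ap = fsum_fun_apply
  have "conv S P (\<lambda>i. \<Sum>s\<in>A. Q s i) e
      = Sum_any (\<lambda>x. \<Sum>s\<in>A. (\<lambda>(i, d). if i \<in> S then P i d * Q s i (e - d) else 0) x)"
    unfolding conv_def by (rule Sum_any.cong) (auto simp: ap sum_distrib_left)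
  also have "\<dots> = (\<Sum>s\<in>A. conv S P (Q s) e)"
    unfolding conv_def
  proof (rule Sum_any_sum[OF assms(1)])
    fix s assume "s \<in> A"
    then show "finite {a. (case a of (i, d) \<Rightarrow> if i \<in> S then P i d * Q s i (e - d) else 0) \<noteq> 0}"
      by (intro finite_subset[OF _ assms(2)[of s e]]) (auto split: if_splits)
  qed
  finally show "conv S P (\<lambda>i. \<Sum>s\<in>A. Q s i) e = (\<Sum>s\<in>A. conv S P (Q s)) e" by (simp add: ap)
qed

section \<open>Exponents of the formal series that occur\<close>

text \<open>
  The points at which operators are inserted, numbered from left to right.
\<close>

definition posv :: "nat \<Rightarrow> nat \<Rightarrow> fvar" where
  "posv n i = (if i < n then Vy (Suc i)
     else Vw (if even (i - n) then int ((i - n) div 2 + 1) else - int ((i - n) div 2 + 1)))"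

definition all_vars :: "nat \<Rightarrow> nat \<Rightarrow> fvar set" where
  "all_vars g n = {Vx, Vdx} \<union> corr_vars g n"

definition tau :: "nat \<Rightarrow> fexp \<Rightarrow> real" where
  "tau g e = (\<Sum>a=1..g. Re (e (Vrho a)))"

text \<open>
  Expansions in non-negative powers of the variables on the right can only lower the sum of the
  exponents of an initial segment of \<open>x, y\<^sub>1, \<dots>, w\<^sub>-\<^sub>g\<close>. The terms \<open>f\<^sub>l\<close> of \<open>\<pi>\<^sub>N\<close> may raise such a
  partial sum by up to \<open>2N\<close>, but in the matrix \<open>A \<Delta>\<close> they come with a power of the \<open>\<rho>\<^sub>a\<close> of degree at
  least \<open>N\<close>; this is the reason for the weight 2 of \<open>tau\<close>.
\<close>

definition sig :: "nat \<Rightarrow> nat \<Rightarrow> nat \<Rightarrow> fexp \<Rightarrow> real" where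
  "sig g n s e = 2 * tau g e - (Re (e Vx) + (\<Sum>i<s. Re (e (posv n i))))"

definition functionals :: "nat \<Rightarrow> nat \<Rightarrow> (fexp \<Rightarrow> real) set" where
  "functionals g n = {tau g, (\<lambda>e. Re (e Vdx)), (\<lambda>e. - Re (e Vdx))}
     \<union> (\<lambda>a e. Re (e (Vrho a))) ` {1..g} \<union> sig g n ` {..n + 2 * g}
     \<union> (\<lambda>k e. Re (e (Vdy k))) ` {1..n} \<union> (\<lambda>k e. - Re (e (Vdy k))) ` {1..n}"

text \<open>
  All series that occur are supported in such a set of exponents. The parameter \<open>C\<close> only moves the
  apex of the cone, so that products of a fixed number of series remain under control; the powers
  of the matrix \<open>A \<Delta>\<close> even lie in the cone with \<open>C = 0\<close>.
\<close>

definition in_cone :: "nat \<Rightarrow> nat \<Rightarrow> real \<Rightarrow> fexp \<Rightarrow> bool" where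
  "in_cone g n C e \<longleftrightarrow> supported (all_vars g n) e \<and> (\<forall>\<phi>\<in>functionals g n. - C \<le> \<phi> e)"

definition halfint :: "fexp \<Rightarrow> bool" where
  "halfint e \<longleftrightarrow> (\<forall>p. 2 * e p \<in> \<int>)"

lemma functionals_additive:
  assumes "\<phi> \<in> functionals g n" shows "\<phi> (e + d) = \<phi> e + \<phi> d"
  using assms by (auto simp: functionals_def tau_def sig_def sum.distrib algebra_simps)

lemma tau_in_functionals: "tau g \<in> functionals g n"
  by (simp add: functionals_def)

lemma tau_add: "tau g (e + d) = tau g e + tau g d"
  by (simp add: tau_def sum.distrib)

lemma cone_add:
  assumes "in_cone g n C e" "in_cone g n C' d" shows "in_cone g n (C + C') (e + d)"
  using assms functionals_additive[of _ g n e d]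
  by (fastforce simp: in_cone_def supported_def)

lemma cone_mono: "in_cone g n C e \<Longrightarrow> C \<le> C' \<Longrightarrow> in_cone g n C' e"
  by (force simp: in_cone_def)

lemma cone_zero: "0 \<le> C \<Longrightarrow> in_cone g n C 0"
  by (auto simp: in_cone_def supported_def functionals_def tau_def sig_def)

lemma halfint_add: "halfint e \<Longrightarrow> halfint d \<Longrightarrow> halfint (e + d)"
  by (auto simp: halfint_def distrib_left)

lemma halfint_zero: "halfint 0"
  by (auto simp: halfint_def)

lemma finite_functionals: "finite (functionals g n)"
  by (simp add: functionals_def)

lemma finite_corr_vars: "finite (corr_vars g n)"
proof -
  have "Iset g \<subseteq> {- int g..int g}" by (auto simp: Iset_def)
  then have "finite (Iset g)" by (rule finite_subset) simp
  then show ?thesis by (simp add: corr_vars_def)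
qed

lemma finite_all_vars: "finite (all_vars g n)"
  by (simp add: all_vars_def finite_corr_vars)

lemma Vw_posv:
  assumes "a \<in> Iset g"
  obtains i where "i < n + 2 * g" "posv n i = Vw a"
proof -
  define t where "t = nat \<bar>a\<bar> - 1"
  have t: "t < g" "\<bar>a\<bar> = int t + 1" using assms by (auto simp: t_def Iset_def)
  show thesis
  proof (cases "a > 0")
    case True
    then show thesis using t by (intro that[of "n + 2 * t"]) (auto simp: posv_def)
  next
    case False
    then show thesis using t by (intro that[of "n + (2 * t + 1)"]) (auto simp: posv_def)
  qed
qed

lemma all_vars_cases:
  assumes "p \<in> all_vars g n"
  shows "p = Vx \<or> p = Vdx \<or> (\<exists>i<n + 2 * g. p = posv n i) \<or> (\<exists>k\<in>{1..n}. p = Vdy k) \<or> (\<exists>a\<in>{1..g}. p = Vrho a)"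
proof -
  have "\<exists>i<n + 2 * g. p = posv n i" if "p = Vy k" "k \<in> {1..n}" for k
    using that by (intro exI[of _ "k - 1"]) (auto simp: posv_def)
  moreover have "\<exists>i<n + 2 * g. p = posv n i" if "p = Vw a" "a \<in> Iset g" for a
    using Vw_posv[of a g n] that by metis
  ultimately show ?thesis using assms by (auto simp: all_vars_def corr_vars_def)
qed

text \<open>
  Every functional is bounded below on both parts of a decomposition of \<open>e\<close>, hence bounded on
  each part, and the functionals together determine all exponents. Half-integrality
  then leaves finitely many possibilities. One half-integral part suffices; this matters because
  the exponents in a correlation form are weights of modules, which are arbitrary complex numbers.
\<close>

lemma finite_cone_split:
  "finite {d. halfint d \<and> in_cone g n C d \<and> in_cone g n C' (e - d)}"
proof -
  define K where "K = \<bar>C\<bar> + \<bar>C'\<bar> + (\<Sum>\<phi>\<in>functionals g n. \<bar>\<phi> e\<bar>)"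
  define Z where "Z = (\<lambda>z::int. of_int z / 2 :: complex) ` {- \<lceil>12 * K\<rceil>..\<lceil>12 * K\<rceil>}"
  have bd: "\<bar>\<phi> d\<bar> \<le> K" if d: "in_cone g n C d" "in_cone g n C' (e - d)" and \<phi>: "\<phi> \<in> functionals g n" for \<phi> d
  proof -
    have "\<phi> e = \<phi> (e - d) + \<phi> d" using functionals_additive[OF \<phi>, of "e - d" d] by simp
    moreover have "- C \<le> \<phi> d" "- C' \<le> \<phi> (e - d)" using d \<phi> by (auto simp: in_cone_def)
    moreover have "\<bar>\<phi> e\<bar> \<le> (\<Sum>\<phi>\<in>functionals g n. \<bar>\<phi> e\<bar>)"
      by (rule member_le_sum[OF \<phi>]) (auto simp: finite_functionals)
    ultimately show ?thesis by (auto simp: K_def)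
  qed
  have val: "d p \<in> Z" if d: "halfint d" "in_cone g n C d" "in_cone g n C' (e - d)" and p: "p \<in> all_vars g n" for d p
  proof -
    note b = bd[OF d(2,3)]
    have K0: "K \<ge> 0" by (auto simp: K_def sum_nonneg)
    have t: "\<bar>tau g d\<bar> \<le> K" by (rule b[OF tau_in_functionals])
    \<comment> \<open>Bounds on consecutive partial sums bound the single exponents: \<open>2 (3 K) = 6 K\<close>.\<close>
    have s: "\<bar>Re (d Vx) + (\<Sum>i<s. Re (d (posv n i)))\<bar> \<le> 3 * K" if "s \<le> n + 2 * g" for s
    proof -
      have "\<bar>sig g n s d\<bar> \<le> K" using that by (intro b) (auto simp: functionals_def)
      then show ?thesis using t by (auto simp: sig_def)
    qed
    have "\<bar>Re (d p)\<bar> \<le> 6 * K"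
      using all_vars_cases[OF p]
    proof (elim disjE bexE exE conjE)
      assume "p = Vx" then show ?thesis using s[of 0] K0 by simp
    next
      assume "p = Vdx" then show ?thesis using b[of "\<lambda>e. Re (e Vdx)"] K0 by (auto simp: functionals_def)
    next
      fix i assume "i < n + 2 * g" "p = posv n i"
      then show ?thesis using s[of i] s[of "Suc i"] by simp
    next
      fix k assume "k \<in> {1..n}" "p = Vdy k"
      then show ?thesis using b[of "\<lambda>e. Re (e (Vdy k))"] K0 by (auto simp: functionals_def)
    next
      fix a assume "a \<in> {1..g}" "p = Vrho a"
      then show ?thesis using b[of "\<lambda>e. Re (e (Vrho a))"] K0 by (auto simp: functionals_def)
    qed
    moreover obtain z where z: "2 * d p = of_int z"
      using d(1) by (auto simp: halfint_def elim!: Ints_cases)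
    moreover have "d p = of_int z / 2" using z by (simp add: field_simps)
    moreover have "2 * Re (d p) = of_int z" using arg_cong[OF z, of Re] by simp
    ultimately have "\<bar>z\<bar> \<le> \<lceil>12 * K\<rceil>" by linarith
    then have "z \<in> {- \<lceil>12 * K\<rceil>..\<lceil>12 * K\<rceil>}" by auto
    then show ?thesis unfolding Z_def \<open>d p = of_int z / 2\<close> by (rule imageI)
  qed
  have "finite {f. \<forall>p. (p \<in> all_vars g n \<longrightarrow> f p \<in> Z) \<and> (p \<notin> all_vars g n \<longrightarrow> f p = 0)}"
    by (rule finite_set_of_finite_funs) (auto simp: finite_all_vars Z_def)
  then show ?thesis
    by (rule finite_subset[rotated]) (use val in \<open>auto simp: in_cone_def supported_def\<close>)
qed

text \<open>
  Besides the support, the degree \<open>tau\<close> in the \<open>\<rho>\<^sub>a\<close> is bounded below. Correlation forms satisfy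
  \<open>gen\<close>; the coefficients of the linear system satisfy the stronger \<open>good\<close>, with half-integral
  exponents. Products of any number of good series with at most one that is merely \<open>gen\<close> make sense.
\<close>

definition gen :: "nat \<Rightarrow> nat \<Rightarrow> real \<Rightarrow> real \<Rightarrow> fser \<Rightarrow> bool" where
  "gen g n C t f \<longleftrightarrow> (\<forall>e. f e \<noteq> 0 \<longrightarrow> in_cone g n C e \<and> t \<le> tau g e)"

definition good :: "nat \<Rightarrow> nat \<Rightarrow> real \<Rightarrow> real \<Rightarrow> fser \<Rightarrow> bool" where
  "good g n C t f \<longleftrightarrow> (\<forall>e. f e \<noteq> 0 \<longrightarrow> halfint e \<and> in_cone g n C e \<and> t \<le> tau g e)"

lemma good_gen: "good g n C t f \<Longrightarrow> gen g n C t f"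
  by (auto simp: good_def gen_def)

lemma good_mono: "good g n C t f \<Longrightarrow> C \<le> C' \<Longrightarrow> t' \<le> t \<Longrightarrow> good g n C' t' f"
  by (fastforce simp: good_def intro: cone_mono)

lemma gen_mono: "gen g n C t f \<Longrightarrow> C \<le> C' \<Longrightarrow> t' \<le> t \<Longrightarrow> gen g n C' t' f"
  by (fastforce simp: gen_def intro: cone_mono)

lemma gen_conv:
  assumes "\<And>i. i \<in> S \<Longrightarrow> gen g n C (s i) (P i)" "\<And>i. i \<in> S \<Longrightarrow> gen g n C' (t i) (Q i)"
    and "\<And>i. i \<in> S \<Longrightarrow> r \<le> s i + t i"
  shows "gen g n (C + C') r (conv S P Q)"
  unfolding gen_def
proof (intro allI impI)
  fix e assume "conv S P Q e \<noteq> 0"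
  then obtain i d where i: "i \<in> S" "P i d \<noteq> 0" "Q i (e - d) \<noteq> 0" by (rule conv_nonzeroE)
  have e: "e = d + (e - d)" by simp
  show "in_cone g n (C + C') e \<and> r \<le> tau g e"
    using assms(1)[OF i(1)] assms(2)[OF i(1)] assms(3)[OF i(1)] i(2,3)
      cone_add[of g n C d C' "e - d"] tau_add[of g d "e - d"]
    by (fastforce simp: gen_def)
qed

lemma good_conv:
  assumes "\<And>i. i \<in> S \<Longrightarrow> good g n C (s i) (P i)" "\<And>i. i \<in> S \<Longrightarrow> good g n C' (t i) (Q i)"
    and "\<And>i. i \<in> S \<Longrightarrow> r \<le> s i + t i"
  shows "good g n (C + C') r (conv S P Q)"
proof -
  have "gen g n (C + C') r (conv S P Q)" by (rule gen_conv[where s = s and t = t]) (use assms good_gen in auto)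
  moreover have "halfint e" if "conv S P Q e \<noteq> 0" for e
  proof -
    obtain i d where i: "i \<in> S" "P i d \<noteq> 0" "Q i (e - d) \<noteq> 0" using \<open>conv S P Q e \<noteq> 0\<close> by (rule conv_nonzeroE)
    then have "halfint (d + (e - d))" using assms(1,2)[OF i(1)] by (intro halfint_add) (auto simp: good_def)
    then show ?thesis by simp
  qed
  ultimately show ?thesis by (auto simp: good_def gen_def)
qed

lemma gen_fmul: "gen g n C s f \<Longrightarrow> gen g n C' t h \<Longrightarrow> gen g n (C + C') (s + t) (f \<circledast> h)"
  unfolding conv_unit[symmetric] by (rule gen_conv[where s = "\<lambda>_. s" and t = "\<lambda>_. t"]) auto

lemma good_fmul: "good g n C s f \<Longrightarrow> good g n C' t h \<Longrightarrow> good g n (C + C') (s + t) (f \<circledast> h)"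
  unfolding conv_unit[symmetric] by (rule good_conv[where s = "\<lambda>_. s" and t = "\<lambda>_. t"]) auto

lemma good_fone: "good g n 0 0 fone"
proof -
  have "tau g 0 = 0" by (simp add: tau_def)
  moreover have "in_cone g n 0 0" "halfint 0" by (simp_all add: cone_zero halfint_zero)
  ultimately show ?thesis
    by (auto simp: good_def fone_apply)
qed

lemma gen_add: "gen g n C t f \<Longrightarrow> gen g n C t h \<Longrightarrow> gen g n C t (f + h)"
  by (auto simp: gen_def) (metis add_0)+

lemma good_add: "good g n C t f \<Longrightarrow> good g n C t h \<Longrightarrow> good g n C t (f + h)"
  by (auto simp: good_def) (metis add_0)+

lemma good_zero: "good g n C t 0" by (simp add: good_def)
lemma gen_zero: "gen g n C t 0" by (simp add: gen_def)

lemma gen_sum: "(\<And>s. s \<in> A \<Longrightarrow> gen g n C t (F s)) \<Longrightarrow> gen g n C t (\<Sum>s\<in>A. F s)"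
  by (induction A rule: infinite_finite_induct) (auto intro: gen_add gen_zero)

lemma good_cmul: "good g n C t f \<Longrightarrow> good g n C t (cmul c f)"
  by (auto simp: good_def cmul_def)

lemma good_fsum: "(\<And>k. good g n C t (F k)) \<Longrightarrow> good g n C t (fsum F)"
  unfolding good_def fsum_def by (metis Sum_any_nonzeroE)

text \<open>
  Only the finitely many indices whose degrees add up to at most that of \<open>e\<close> contribute, and for
  each of them \<open>finite_cone_split\<close> applies.
\<close>

lemma finite_conv_support:
  assumes P: "\<And>i. i \<in> S \<Longrightarrow> good g n C (s i) (P i)" and Q: "\<And>i. i \<in> S \<Longrightarrow> gen g n C' (t i) (Q i)"
    and fin: "\<And>K. finite {i \<in> S. s i + t i \<le> K}"
  shows "finite {(i, d). i \<in> S \<and> P i d \<noteq> 0 \<and> Q i (e - d) \<noteq> 0}"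
proof (rule finite_subset)
  show "finite ({i \<in> S. s i + t i \<le> tau g e} \<times> {d. halfint d \<and> in_cone g n C d \<and> in_cone g n C' (e - d)})"
    using fin finite_cone_split by simp
  have "s i + t i \<le> tau g e \<and> halfint d \<and> in_cone g n C d \<and> in_cone g n C' (e - d)"
    if i: "i \<in> S" "P i d \<noteq> 0" "Q i (e - d) \<noteq> 0" for i d
    using P[OF i(1)] Q[OF i(1)] i tau_add[of g d "e - d"] by (fastforce simp: good_def gen_def)
  then show "{(i, d). i \<in> S \<and> P i d \<noteq> 0 \<and> Q i (e - d) \<noteq> 0} \<subseteq>
    {i \<in> S. s i + t i \<le> tau g e} \<times> {d. halfint d \<and> in_cone g n C d \<and> in_cone g n C' (e - d)}"
    by auto
qed

lemma conv_assoc_good: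
  assumes P: "\<And>i. i \<in> S \<Longrightarrow> good g n C1 (s i) (P i)"
    and M: "\<And>i j. i \<in> S \<Longrightarrow> j \<in> T \<Longrightarrow> good g n C2 (m i j) (M i j)"
    and Q: "\<And>j. j \<in> T \<Longrightarrow> gen g n C3 (t j) (Q j)"
    and fin: "\<And>K. finite {(i, j). i \<in> S \<and> j \<in> T \<and> s i + m i j + t j \<le> K}"
  shows "conv T (\<lambda>j. conv S P (\<lambda>i. M i j)) Q = conv S P (\<lambda>i. conv T (M i) Q)"
proof (rule conv_assoc)
  fix e
  let ?IJ = "{(i, j). i \<in> S \<and> j \<in> T \<and> s i + m i j + t j \<le> tau g e}"
  let ?D1 = "{d. halfint d \<and> in_cone g n C1 d \<and> in_cone g n (C2 + C3) (e - d)}"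
  let ?D2 = "{d. halfint d \<and> in_cone g n C2 d \<and> in_cone g n (C1 + C3) (e - d)}"
  have "finite ((\<lambda>((i, j), d, d'). ((i, d), (j, d'))) ` (?IJ \<times> ?D1 \<times> ?D2))"
    by (intro finite_imageI finite_cartesian_product finite_cone_split fin)
  then show "finite {((i, d), (j, d')). i \<in> S \<and> j \<in> T \<and> P i d \<noteq> 0 \<and> M i j d' \<noteq> 0 \<and> Q j (e - d - d') \<noteq> 0}"
  proof (rule finite_subset[rotated], clarify)
    fix i d j d'
    assume a: "i \<in> S" "j \<in> T" "P i d \<noteq> 0" "M i j d' \<noteq> 0" "Q j (e - d - d') \<noteq> 0"
    have p: "halfint d" "in_cone g n C1 d" "s i \<le> tau g d" using P[OF a(1)] a(3) by (auto simp: good_def)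
    have mm: "halfint d'" "in_cone g n C2 d'" "m i j \<le> tau g d'" using M[OF a(1,2)] a(4) by (auto simp: good_def)
    have q: "in_cone g n C3 (e - d - d')" "t j \<le> tau g (e - d - d')" using Q[OF a(2)] a(5) by (auto simp: gen_def)
    have e1: "e - d = d' + (e - d - d')" and e2: "e - d' = d + (e - d - d')" by (simp_all add: algebra_simps)
    have "in_cone g n (C2 + C3) (e - d)" by (subst e1, rule cone_add[OF mm(2) q(1)])
    moreover have "in_cone g n (C1 + C3) (e - d')" by (subst e2, rule cone_add[OF p(2) q(1)])
    moreover have "tau g e = tau g d + (tau g d' + tau g (e - d - d'))"
      unfolding tau_add[symmetric] by (simp add: algebra_simps)
    ultimately show "((i, d), j, d') \<in> (\<lambda>((i, j), d, d'). ((i, d), (j, d'))) ` (?IJ \<times> ?D1 \<times> ?D2)"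
      using p mm q a(1,2) by (intro image_eqI[of _ _ "((i, j), d, d')"]) auto
  qed
qed

section \<open>Formal matrices and the Neumann series\<close>

lemma conv_add_right:
  assumes "\<And>e. finite {(i, d). i \<in> S \<and> P i d \<noteq> 0 \<and> Q i (e - d) \<noteq> 0}"
    and "\<And>e. finite {(i, d). i \<in> S \<and> P i d \<noteq> 0 \<and> Q' i (e - d) \<noteq> 0}"
  shows "conv S P (\<lambda>i. Q i + Q' i) = conv S P Q + conv S P Q'"
proof -
  have "conv S P (\<lambda>i. \<Sum>s\<in>UNIV. (if s then Q i else Q' i)) = (\<Sum>s\<in>UNIV. conv S P (\<lambda>i. if s then Q i else Q' i))"
  proof (rule conv_sum_right)
    fix s :: bool and e
    show "finite {(i, d). i \<in> S \<and> P i d \<noteq> 0 \<and> (if s then Q i else Q' i) (e - d) \<noteq> 0}"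
      by (cases s) (use assms in auto)
  qed simp
  then show ?thesis by (simp add: UNIV_bool add.commute)
qed

lemma fmul_finite_support:
  assumes "good g n C s f" "gen g n C' t h"
  shows "finite {d. f d \<noteq> 0 \<and> h (e - d) \<noteq> 0}"
proof -
  have "finite {(i, d). i \<in> (UNIV :: unit set) \<and> f d \<noteq> 0 \<and> h (e - d) \<noteq> 0}"
    by (rule finite_conv_support[where s = "\<lambda>_. s" and t = "\<lambda>_. t"]) (use assms in auto)
  from finite_imageI[OF this, of snd] show ?thesis
    by (rule finite_subset[rotated]) (force simp: image_iff)
qed

lemma fmul_sum_left:
  assumes "finite A" "\<And>s. s \<in> A \<Longrightarrow> good g n (C' s) (t' s) (f s)" "gen g n C t h"
  shows "(\<Sum>s\<in>A. f s) \<circledast> h = (\<Sum>s\<in>A. f s \<circledast> h)"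
proof
  fix e
  have "((\<Sum>s\<in>A. f s) \<circledast> h) e = Sum_any (\<lambda>d. \<Sum>s\<in>A. f s d * h (e - d))"
    by (simp add: fmul_apply fsum_fun_apply sum_distrib_right)
  also have "\<dots> = (\<Sum>s\<in>A. (f s \<circledast> h) e)"
    unfolding fmul_apply
    by (rule Sum_any_sum[OF assms(1)]) (use fmul_finite_support[OF assms(2) assms(3)] in auto)
  finally show "((\<Sum>s\<in>A. f s) \<circledast> h) e = (\<Sum>s\<in>A. f s \<circledast> h) e" by (simp add: fsum_fun_apply)
qed

lemma fmul_add_left:
  assumes "good g n C s f" "good g n C' t f'" "gen g n C'' r h"
  shows "(f + f') \<circledast> h = f \<circledast> h + f' \<circledast> h"
proof -
  have "(\<Sum>s\<in>UNIV. if s then f else f') \<circledast> h = (\<Sum>s\<in>UNIV. (if s then f else f') \<circledast> h)"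
    by (rule fmul_sum_left[where C' = "\<lambda>x. if x then C else C'" and t' = "\<lambda>x. if x then s else t"])
      (use assms in auto)
  then show ?thesis by (simp add: UNIV_bool add.commute)
qed

lemma fmul_zero_right [simp]: "f \<circledast> 0 = 0"
  by (auto simp: fmul_apply)

lemma fmul_zero_left [simp]: "0 \<circledast> f = 0"
  by (auto simp: fmul_apply)

lemma fmul_fone_left [simp]: "fone \<circledast> f = f"
proof
  fix e
  have "(fone \<circledast> f) e = Sum_any (\<lambda>d. if d = 0 then f (e - d) else 0)"
    unfolding fmul_apply by (rule Sum_any.cong) (auto simp: fone_apply)
  then show "(fone \<circledast> f) e = f e" by simp
qed

lemma fsum_fmul:
  assumes F: "\<And>k::nat. good g n C (t k) (F k)" and H: "gen g n C' t' H"
    and fin: "\<And>K. finite {k. t k \<le> K}"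
  shows "fsum F \<circledast> H = fsum (\<lambda>k. F k \<circledast> H)"
proof -
  have "conv (UNIV :: unit set) (\<lambda>j. conv UNIV (\<lambda>_. fone) (\<lambda>k. F k)) (\<lambda>_. H)
      = conv UNIV (\<lambda>_. fone) (\<lambda>k. conv (UNIV :: unit set) (\<lambda>_. F k) (\<lambda>_. H))"
  proof (rule conv_assoc_good[where s = "\<lambda>_. 0" and m = "\<lambda>k _. t k" and t = "\<lambda>_. t'"])
    fix K
    have "{(i, j). i \<in> UNIV \<and> j \<in> (UNIV :: unit set) \<and> 0 + t i + t' \<le> K} = {i. t i \<le> K - t'} \<times> UNIV"
      by (auto simp: algebra_simps)
    then show "finite {(i, j). i \<in> UNIV \<and> j \<in> (UNIV :: unit set) \<and> 0 + t i + t' \<le> K}"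
      using fin by (simp add: finite_cartesian_product)
  qed (use good_fone F H in auto)
  then show ?thesis by (simp add: conv_fone_left conv_unit)
qed

definition idxs :: "nat \<Rightarrow> idx set" where
  "idxs g = {i. fst i \<in> Iset g}"

text \<open>
  The entries with second index \<open>m\<close> carry \<open>\<rho>\<^sub>a^(m/2)\<close>, which makes the infinite contractions finite
  in each degree.
\<close>

definition ht :: "idx \<Rightarrow> real" where
  "ht i = real (snd i) / 2"

lemma ht_nonneg [simp]: "0 \<le> ht i"
  by (simp add: ht_def)

lemma finite_Iset: "finite (Iset g)"
  by (rule finite_subset[of _ "{- int g..int g}"]) (auto simp: Iset_def)

lemma finite_idxs: "finite {i \<in> idxs g. ht i \<le> K}"
proof (rule finite_subset)
  show "{i \<in> idxs g. ht i \<le> K} \<subseteq> Iset g \<times> {..nat \<lceil>2 * K\<rceil>}"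
    by (auto simp: idxs_def ht_def) linarith
qed (simp add: finite_Iset)

lemma finite_idxs_le:
  assumes "\<And>i. i \<in> idxs g \<Longrightarrow> ht i - c \<le> f i" shows "finite {i \<in> idxs g. f i \<le> K}"
  by (rule finite_subset[OF _ finite_idxs[of g "K + c"]]) (use assms in force)

lemma finite_idxs_le2:
  assumes "\<And>i j. i \<in> idxs g \<Longrightarrow> j \<in> idxs g \<Longrightarrow> ht i + ht j - c \<le> f i j"
  shows "finite {(i, j). i \<in> idxs g \<and> j \<in> idxs g \<and> f i j \<le> K}"
proof (rule finite_subset)
  show "finite ({i \<in> idxs g. ht i \<le> K + c} \<times> {i \<in> idxs g. ht i \<le> K + c})"
    using finite_idxs by simp
  show "{(i, j). i \<in> idxs g \<and> j \<in> idxs g \<and> f i j \<le> K} \<subseteq> {i \<in> idxs g. ht i \<le> K + c} \<times> {i \<in> idxs g. ht i \<le> K + c}"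
  proof clarify
    fix a m b k assume "(a, m) \<in> idxs g" "(b, k) \<in> idxs g" "f (a, m) (b, k) \<le> K"
    with assms[of "(a, m)" "(b, k)"] ht_nonneg[of "(a, m)"] ht_nonneg[of "(b, k)"]
    show "(a, m) \<in> {i \<in> idxs g. ht i \<le> K + c} \<and> (b, k) \<in> {i \<in> idxs g. ht i \<le> K + c}"
      by (auto simp del: ht_nonneg)
  qed
qed

text \<open>
  \<open>contr\<close> sums first over the exponents, then over \<open>m\<close> and then over \<open>a\<close>, while \<open>conv\<close> sums over
  everything at once.
\<close>

lemma contr_eq_conv_aux:
  assumes "\<And>e. finite {(i, d). i \<in> idxs g \<and> P i d \<noteq> 0 \<and> Q i (e - d) \<noteq> 0}"
  shows "contr g P Q = conv (idxs g) P Q"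
proof
  fix e
  let ?f = "\<lambda>i. if i \<in> idxs g then (P i \<circledast> Q i) e else 0"
  have fin1: "finite {(i, d). (if i \<in> idxs g then P i d * Q i (e - d) else 0) \<noteq> 0}"
    by (rule finite_subset[OF _ assms[of e]]) (auto split: if_splits)
  have "{i. ?f i \<noteq> 0} \<subseteq> fst ` {(i, d). i \<in> idxs g \<and> P i d \<noteq> 0 \<and> Q i (e - d) \<noteq> 0}"
    by (force elim: fmul_nonzeroE split: if_splits)
  then have "finite {i. ?f i \<noteq> 0}"
    using finite_subset finite_imageI[OF assms[of e]] by blast
  moreover have "{i. ?f i \<noteq> 0} = {(c, k). ?f (c, k) \<noteq> 0}" by auto
  ultimately have fin2: "finite {(c, k). ?f (c, k) \<noteq> 0}" by simp
  have "conv (idxs g) P Q e = Sum_any (\<lambda>i. Sum_any (\<lambda>d. if i \<in> idxs g then P i d * Q i (e - d) else 0))"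
    unfolding conv_def by (rule Sum_any_pair[OF fin1, symmetric])
  also have "\<dots> = Sum_any ?f"
    by (rule Sum_any.cong) (auto simp: fmul_apply)
  also have "\<dots> = Sum_any (\<lambda>(c, k). ?f (c, k))"
    by (rule Sum_any.cong) auto
  also have "\<dots> = Sum_any (\<lambda>c. Sum_any (\<lambda>k. ?f (c, k)))"
    by (rule Sum_any_pair[OF fin2, symmetric])
  also have "\<dots> = (\<Sum>c\<in>Iset g. Sum_any (\<lambda>k. ?f (c, k)))"
    by (rule Sum_any.expand_superset[OF finite_Iset]) (auto simp: idxs_def elim!: Sum_any_nonzeroE split: if_splits)
  also have "\<dots> = contr g P Q e"
    unfolding contr_def fsum_fun_apply fsum_def by (rule sum.cong) (auto simp: idxs_def)
  finally show "contr g P Q e = conv (idxs g) P Q e" by simp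
qed

lemma contr_eq_conv:
  assumes "\<And>i. i \<in> idxs g \<Longrightarrow> good g n C (s i) (P i)" "\<And>i. i \<in> idxs g \<Longrightarrow> gen g n C' (t i) (Q i)"
    and "\<And>i. i \<in> idxs g \<Longrightarrow> ht i - c \<le> s i + t i"
  shows "contr g P Q = conv (idxs g) P Q"
  by (rule contr_eq_conv_aux, rule finite_conv_support[where s = s and t = t], rule assms, assumption,
      rule assms, assumption, rule finite_idxs_le, rule assms)

lemma contr_cong:
  assumes "\<And>i. i \<in> idxs g \<Longrightarrow> P i = P' i" "\<And>i. i \<in> idxs g \<Longrightarrow> Q i = Q' i"
  shows "contr g P Q = contr g P' Q'"
  unfolding contr_def using assms by (auto simp: idxs_def intro!: sum.cong)

lemma contr_fmul:
  assumes P: "\<And>i. i \<in> idxs g \<Longrightarrow> good g n C (s i) (P i)" and Q: "\<And>i. i \<in> idxs g \<Longrightarrow> good g n C' (t i) (Q i)"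
    and H: "gen g n C'' r H"
    and c: "\<And>i. i \<in> idxs g \<Longrightarrow> ht i - c \<le> s i + t i"
  shows "contr g P Q \<circledast> H = contr g P (\<lambda>i. Q i \<circledast> H)"
proof -
  have "conv (UNIV :: unit set) (\<lambda>j. conv (idxs g) P Q) (\<lambda>_. H)
      = conv (idxs g) P (\<lambda>i. conv (UNIV :: unit set) (\<lambda>_. Q i) (\<lambda>_. H))"
  proof (rule conv_assoc_good[where s = s and m = "\<lambda>i _. t i" and t = "\<lambda>_. r"])
    fix K
    have "{(i, j). i \<in> idxs g \<and> j \<in> (UNIV :: unit set) \<and> s i + t i + r \<le> K} = {i \<in> idxs g. s i + t i \<le> K - r} \<times> UNIV"
      by (auto simp: algebra_simps)
    then show "finite {(i, j). i \<in> idxs g \<and> j \<in> (UNIV :: unit set) \<and> s i + t i + r \<le> K}"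
      using finite_idxs_le[of g c "\<lambda>i. s i + t i"] c by (simp add: finite_cartesian_product)
  qed (use P Q H in auto)
  moreover have "contr g P Q = conv (idxs g) P Q"
    by (rule contr_eq_conv[OF P good_gen[OF Q] c])
  moreover have "contr g P (\<lambda>i. Q i \<circledast> H) = conv (idxs g) P (\<lambda>i. Q i \<circledast> H)"
  proof (rule contr_eq_conv[OF P])
    show "gen g n (C' + C'') (t i + r) (Q i \<circledast> H)" if "i \<in> idxs g" for i
      by (rule gen_fmul[OF good_gen[OF Q[OF that]] H])
    show "ht i - (c - r) \<le> s i + (t i + r)" if "i \<in> idxs g" for i using c[OF that] by simp
  qed
  ultimately show ?thesis by (simp add: conv_unit)
qed

text \<open>
  Every factor \<open>A\<close> contributes degree at least 1 in addition to the degrees tied to its indices, so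
  the powers of \<open>A\<close> tend to 0 in the \<open>\<rho>\<close>-adic sense; the maximum accounts for the final index.
\<close>

lemma good_mat_pow:
  assumes A: "\<And>i j. i \<in> idxs g \<Longrightarrow> j \<in> idxs g \<Longrightarrow> good g n 0 (1 + ht i + ht j) (A i j)"
    and "i \<in> idxs g" "j \<in> idxs g"
  shows "good g n 0 (real k + max 0 (ht j - ht i)) (mat_pow g A k i j)"
  using assms(2,3)
proof (induction k arbitrary: j)
  case 0
  then show ?case using good_fone good_zero by (auto simp: max_def)
next
  case (Suc k)
  have "contr g (mat_pow g A k i) (\<lambda>l. A l j) = conv (idxs g) (mat_pow g A k i) (\<lambda>l. A l j)"
    by (rule contr_eq_conv[OF Suc.IH good_gen[OF A], where c = 0]) (use Suc.prems in \<open>(auto simp: max_def; smt (verit) ht_nonneg of_nat_0_le_iff)+\<close>)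
  moreover have "good g n (0 + 0) (real (Suc k) + max 0 (ht j - ht i)) (conv (idxs g) (mat_pow g A k i) (\<lambda>l. A l j))"
    by (rule good_conv[OF Suc.IH A]) (use Suc.prems in \<open>(auto simp: max_def; smt (verit) ht_nonneg of_nat_0_le_iff)+\<close>)
  ultimately show ?case by (simp add: mat_mult_def)
qed

text \<open>
  A vector with \<open>Y = Z + A Y\<close> satisfies \<open>L Y = \<Sum>\<^sub>k\<^sub><\<^sub>K L A^k Z + L A^K Y\<close>, and for large \<open>K\<close> the remainder has
  too high a degree to contribute to a given monomial. Here \<open>Z\<close> is a combination of
  sources \<open>H s\<close> with known coefficient vectors \<open>R s\<close>. The sources are not half-integral, so the
  Neumann series is applied to the \<open>R s\<close> and multiplied by \<open>H s\<close> afterwards.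
\<close>

lemma neumann_solution:
  fixes A :: "idx \<Rightarrow> idx \<Rightarrow> fser" and Y L :: "idx \<Rightarrow> fser"
  assumes fin: "finite \<Sigma>" and C0: "0 \<le> C"
    and L: "\<And>i. i \<in> idxs g \<Longrightarrow> good g n C (ht i - C) (L i)"
    and A: "\<And>i j. i \<in> idxs g \<Longrightarrow> j \<in> idxs g \<Longrightarrow> good g n 0 (1 + ht i + ht j) (A i j)"
    and Y: "\<And>i. i \<in> idxs g \<Longrightarrow> gen g n C (ht i - C) (Y i)"
    and R: "\<And>s i. s \<in> \<Sigma> \<Longrightarrow> i \<in> idxs g \<Longrightarrow> good g n C (ht i - C) (R s i)"
    and H: "\<And>s. s \<in> \<Sigma> \<Longrightarrow> gen g n C (- C) (H s)"
    and eq: "\<And>i. i \<in> idxs g \<Longrightarrow> Y i = (\<Sum>s\<in>\<Sigma>. R s i \<circledast> H s) + contr g (A i) Y"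
  shows "contr g L Y = (\<Sum>s\<in>\<Sigma>. contr g L (\<lambda>i. contr g (neumann g A i) (R s)) \<circledast> H s)"
proof -
  define Z where "Z = (\<lambda>i. \<Sum>s\<in>\<Sigma>. R s i \<circledast> H s)"
  \<comment> \<open>The row vector \<open>L A^k\<close>.\<close>
  define \<Lambda> where "\<Lambda> = (\<lambda>k j. contr g L (\<lambda>i. mat_pow g A k i j))"
  note pow = good_mat_pow[OF A]
  have \<Lambda>_conv: "\<Lambda> k j = conv (idxs g) L (\<lambda>i. mat_pow g A k i j)" if "j \<in> idxs g" for k j
    unfolding \<Lambda>_def by (rule contr_eq_conv[OF L good_gen[OF pow], where c = C]) (use that C0 in \<open>(auto simp: max_def; smt (verit) ht_nonneg of_nat_0_le_iff)+\<close>)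
  have \<Lambda>: "good g n C (real k + ht j - C) (\<Lambda> k j)" if "j \<in> idxs g" for k j
  proof -
    have "good g n (C + 0) (real k + ht j - C) (conv (idxs g) L (\<lambda>i. mat_pow g A k i j))"
      by (rule good_conv[OF L pow]) (use that C0 in \<open>(auto simp: max_def; smt (verit) ht_nonneg of_nat_0_le_iff)+\<close>)
    then show ?thesis by (simp add: \<Lambda>_conv[OF that])
  qed
  have RH: "gen g n (C + C) (ht i - C - C) (R s i \<circledast> H s)" if "s \<in> \<Sigma>" "i \<in> idxs g" for s i
    using gen_fmul[OF good_gen[OF R[OF that]] H[OF that(1)]] by simp
  have Z: "gen g n (C + C) (ht i - C - C) (Z i)" if "i \<in> idxs g" for i
    unfolding Z_def by (rule gen_sum) (rule RH[OF _ that])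
  have AY_conv: "contr g (A i) Y = conv (idxs g) (A i) Y" if "i \<in> idxs g" for i
    by (rule contr_eq_conv[OF A[OF that] Y, where c = C]) (use C0 in \<open>(auto simp: max_def; smt (verit) ht_nonneg of_nat_0_le_iff)+\<close>)
  have AY: "gen g n (0 + C) (1 + ht i - C) (conv (idxs g) (A i) Y)" if "i \<in> idxs g" for i
    by (rule gen_conv[OF good_gen[OF A[OF that]] Y]) (use C0 in \<open>(auto simp: max_def; smt (verit) ht_nonneg of_nat_0_le_iff)+\<close>)
  have \<Lambda>_Suc: "\<Lambda> (Suc k) j = conv (idxs g) (\<Lambda> k) (\<lambda>l. A l j)" if j: "j \<in> idxs g" for k j
  proof -
    have "mat_pow g A (Suc k) i j = conv (idxs g) (mat_pow g A k i) (\<lambda>l. A l j)" if "i \<in> idxs g" for i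
      unfolding mat_pow.simps mat_mult_def
      by (rule contr_eq_conv[OF pow good_gen[OF A], where c = 0]) (use that j C0 in \<open>(auto simp: max_def; smt (verit) ht_nonneg of_nat_0_le_iff)+\<close>)
    then have "\<Lambda> (Suc k) j = conv (idxs g) L (\<lambda>i. conv (idxs g) (mat_pow g A k i) (\<lambda>l. A l j))"
      unfolding \<Lambda>_conv[OF j] by (intro conv_cong) auto
    also have "\<dots> = conv (idxs g) (\<lambda>l. conv (idxs g) L (\<lambda>i. mat_pow g A k i l)) (\<lambda>l. A l j)"
      by (rule conv_assoc_good[OF L pow good_gen[OF A], symmetric], use j in auto)
        (rule finite_idxs_le2[where c = C], use j C0 in \<open>(auto simp: max_def; smt (verit) ht_nonneg of_nat_0_le_iff)+\<close>)
    also have "\<dots> = conv (idxs g) (\<Lambda> k) (\<lambda>l. A l j)" by (intro conv_cong) (auto simp: \<Lambda>_conv)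
    finally show ?thesis .
  qed
  have step: "conv (idxs g) (\<Lambda> k) Y = conv (idxs g) (\<Lambda> k) Z + conv (idxs g) (\<Lambda> (Suc k)) Y" for k
  proof -
    have "conv (idxs g) (\<Lambda> k) Y = conv (idxs g) (\<Lambda> k) (\<lambda>i. Z i + conv (idxs g) (A i) Y)"
      by (intro conv_cong refl) (simp only: eq Z_def AY_conv)
    also have "\<dots> = conv (idxs g) (\<Lambda> k) Z + conv (idxs g) (\<Lambda> k) (\<lambda>i. conv (idxs g) (A i) Y)"
    proof (rule conv_add_right)
      show "finite {(i, d). i \<in> idxs g \<and> \<Lambda> k i d \<noteq> 0 \<and> Z i (e - d) \<noteq> 0}" for e
        by (rule finite_conv_support[OF \<Lambda> Z], assumption, assumption,
            rule finite_idxs_le[where c = "3 * C"]) (use C0 in \<open>(auto simp: max_def; smt (verit) ht_nonneg of_nat_0_le_iff)+\<close>)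
      show "finite {(i, d). i \<in> idxs g \<and> \<Lambda> k i d \<noteq> 0 \<and> conv (idxs g) (A i) Y (e - d) \<noteq> 0}" for e
        by (rule finite_conv_support[OF \<Lambda> AY], assumption, assumption,
            rule finite_idxs_le[where c = "3 * C"]) (use C0 in \<open>(auto simp: max_def; smt (verit) ht_nonneg of_nat_0_le_iff)+\<close>)
    qed
    also have "conv (idxs g) (\<Lambda> k) (\<lambda>i. conv (idxs g) (A i) Y)
        = conv (idxs g) (\<lambda>j. conv (idxs g) (\<Lambda> k) (\<lambda>i. A i j)) Y"
      by (rule conv_assoc_good[OF \<Lambda> A Y, symmetric], auto)
        (rule finite_idxs_le2[where c = "2 * C"], use C0 in \<open>(auto simp: max_def; smt (verit) ht_nonneg of_nat_0_le_iff)+\<close>)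
    also have "\<dots> = conv (idxs g) (\<Lambda> (Suc k)) Y" by (intro conv_cong) (auto simp: \<Lambda>_Suc)
    finally show ?thesis .
  qed
  have tele: "conv (idxs g) (\<Lambda> 0) Y = (\<Sum>k<K. conv (idxs g) (\<Lambda> k) Z) + conv (idxs g) (\<Lambda> K) Y" for K
  proof (induction K)
    case (Suc K)
    show ?case unfolding Suc.IH by (subst step[of K]) (simp add: add.assoc)
  qed simp
  have \<Lambda>0: "\<Lambda> 0 j = L j" if "j \<in> idxs g" for j
  proof
    fix e
    show "\<Lambda> 0 j e = L j e"
      unfolding \<Lambda>_conv[OF that] conv_def
      by (subst Sum_any.expand_superset[of "{(j, e)}"]) (use that in \<open>auto simp: fone_apply split: if_splits\<close>)
  qed
  have \<Lambda>Y: "gen g n (C + C) (real k - C - C) (conv (idxs g) (\<Lambda> k) Y)" for k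
    by (rule gen_conv[OF good_gen[OF \<Lambda>] Y]) (use C0 in \<open>(auto simp: max_def; smt (verit) ht_nonneg of_nat_0_le_iff)+\<close>)
  have \<Lambda>Z: "gen g n (C + (C + C)) (real k - C - C - C) (conv (idxs g) (\<Lambda> k) Z)" for k
    by (rule gen_conv[OF good_gen[OF \<Lambda>] Z]) (use C0 in \<open>(auto simp: max_def; smt (verit) ht_nonneg of_nat_0_le_iff)+\<close>)
  have fsumZ: "conv (idxs g) L Y = fsum (\<lambda>k. conv (idxs g) (\<Lambda> k) Z)"
  proof
    fix e
    \<comment> \<open>From this power on the degree of \<open>L A^K Y\<close> exceeds that of \<open>e\<close>.\<close>
    define K where "K = nat \<lceil>\<bar>tau g e\<bar> + 3 * \<bar>C\<bar> + 1\<rceil>"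
    have K: "real k > tau g e + 3 * \<bar>C\<bar>" if "k \<ge> K" for k using that unfolding K_def by linarith
    have "conv (idxs g) (\<Lambda> K) Y e = 0"
      using \<Lambda>Y[of K] K[of K] C0 by (auto simp: gen_def dest!: spec[of _ e])
    moreover have "conv (idxs g) (\<Lambda> k) Z e = 0" if "k \<ge> K" for k
      using \<Lambda>Z[of k] K[OF that] C0 by (auto simp: gen_def dest!: spec[of _ e])
    then have "fsum (\<lambda>k. conv (idxs g) (\<Lambda> k) Z) e = (\<Sum>k<K. conv (idxs g) (\<Lambda> k) Z e)"
      unfolding fsum_def by (intro Sum_any.expand_superset) (auto simp: not_le[symmetric])
    moreover have "conv (idxs g) L Y = conv (idxs g) (\<Lambda> 0) Y"
      by (rule conv_cong) (auto simp: \<Lambda>0)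
    ultimately show "conv (idxs g) L Y e = fsum (\<lambda>k. conv (idxs g) (\<Lambda> k) Z) e"
      by (simp add: tele[of K] fsum_fun_apply)
  qed
  have \<Lambda>R: "good g n (C + C) (real k - C - C) (conv (idxs g) (\<Lambda> k) (R s))" if "s \<in> \<Sigma>" for k s
    by (rule good_conv[OF \<Lambda> R[OF that]]) (use C0 in \<open>(auto simp: max_def; smt (verit) ht_nonneg of_nat_0_le_iff)+\<close>)
  have \<Lambda>Z_eq: "conv (idxs g) (\<Lambda> k) Z = (\<Sum>s\<in>\<Sigma>. conv (idxs g) (\<Lambda> k) (R s) \<circledast> H s)" for k
  proof -
    have "conv (idxs g) (\<Lambda> k) Z = (\<Sum>s\<in>\<Sigma>. conv (idxs g) (\<Lambda> k) (\<lambda>i. R s i \<circledast> H s))"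
      unfolding Z_def
    proof (rule conv_sum_right[OF fin])
      fix s e assume s: "s \<in> \<Sigma>"
      show "finite {(i, d). i \<in> idxs g \<and> \<Lambda> k i d \<noteq> 0 \<and> (R s i \<circledast> H s) (e - d) \<noteq> 0}"
        by (rule finite_conv_support[OF \<Lambda> RH[OF s]], assumption, assumption,
            rule finite_idxs_le[where c = "3 * C"]) (use C0 in \<open>(auto simp: max_def; smt (verit) ht_nonneg of_nat_0_le_iff)+\<close>)
    qed
    also have "\<dots> = (\<Sum>s\<in>\<Sigma>. conv (idxs g) (\<Lambda> k) (R s) \<circledast> H s)"
    proof (rule sum.cong[OF refl])
      fix s assume s: "s \<in> \<Sigma>"
      have "contr g (\<Lambda> k) (R s) \<circledast> H s = contr g (\<Lambda> k) (\<lambda>i. R s i \<circledast> H s)"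
        by (rule contr_fmul[OF \<Lambda> R[OF s] H[OF s], where c = "2 * C"]) (use C0 in \<open>(auto simp: max_def; smt (verit) ht_nonneg of_nat_0_le_iff)+\<close>)
      moreover have "contr g (\<Lambda> k) (R s) = conv (idxs g) (\<Lambda> k) (R s)"
        by (rule contr_eq_conv[OF \<Lambda> good_gen[OF R[OF s]], where c = "2 * C"]) (use C0 in \<open>(auto simp: max_def; smt (verit) ht_nonneg of_nat_0_le_iff)+\<close>)
      moreover have "contr g (\<Lambda> k) (\<lambda>i. R s i \<circledast> H s) = conv (idxs g) (\<Lambda> k) (\<lambda>i. R s i \<circledast> H s)"
        by (rule contr_eq_conv[OF \<Lambda> RH[OF s], where c = "3 * C"]) (use C0 in \<open>(auto simp: max_def; smt (verit) ht_nonneg of_nat_0_le_iff)+\<close>)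
      ultimately show "conv (idxs g) (\<Lambda> k) (\<lambda>i. R s i \<circledast> H s) = conv (idxs g) (\<Lambda> k) (R s) \<circledast> H s" by simp
    qed
    finally show ?thesis .
  qed
  \<comment> \<open>The Neumann sum is interchanged with both contractions.\<close>
  have NR: "contr g L (\<lambda>i. contr g (neumann g A i) (R s)) = fsum (\<lambda>k. conv (idxs g) (\<Lambda> k) (R s))"
    if s: "s \<in> \<Sigma>" for s
  proof -
    have neu: "good g n 0 0 (neumann g A i j)" if "i \<in> idxs g" "j \<in> idxs g" for i j
      unfolding neumann_def by (rule good_fsum, rule good_mono[OF pow]) (use that C0 in \<open>(auto simp: max_def; smt (verit) ht_nonneg of_nat_0_le_iff)+\<close>)
    have powR: "good g n (0 + C) (real k - C) (conv (idxs g) (mat_pow g A k i) (R s))" if "i \<in> idxs g" for i k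
      by (rule good_conv[OF pow R[OF s]]) (use that C0 in \<open>(auto simp: max_def; smt (verit) ht_nonneg of_nat_0_le_iff)+\<close>)
    have nR: "good g n (0 + C) (- C) (conv (idxs g) (neumann g A i) (R s))" if "i \<in> idxs g" for i
      by (rule good_conv[OF neu R[OF s]]) (use that C0 in \<open>(auto simp: max_def; smt (verit) ht_nonneg of_nat_0_le_iff)+\<close>)
    have 1: "contr g (neumann g A i) (R s) = conv (idxs g) (neumann g A i) (R s)" if "i \<in> idxs g" for i
      by (rule contr_eq_conv[OF neu good_gen[OF R[OF s]], where c = C]) (use that C0 in \<open>(auto simp: max_def; smt (verit) ht_nonneg of_nat_0_le_iff)+\<close>)
    have 2: "conv (idxs g) (neumann g A i) (R s) = conv UNIV (\<lambda>k. conv (idxs g) (mat_pow g A k i) (R s)) (\<lambda>_. fone)"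
      if i: "i \<in> idxs g" for i
    proof -
      have "conv (idxs g) (neumann g A i) (R s)
          = conv (idxs g) (\<lambda>j. conv UNIV (\<lambda>_. fone) (\<lambda>k. mat_pow g A k i j)) (R s)"
        by (simp add: neumann_def conv_fone_left)
      also have "\<dots> = conv UNIV (\<lambda>_. fone) (\<lambda>k. conv (idxs g) (mat_pow g A k i) (R s))"
      proof (rule conv_assoc_good[OF good_fone pow good_gen[OF R[OF s]]])
        fix K
        show "finite {(k, j). k \<in> (UNIV :: nat set) \<and> j \<in> idxs g \<and> 0 + (real k + max 0 (ht j - ht i)) + (ht j - C) \<le> K}"
        proof (rule finite_subset)
          show "finite ({..nat \<lceil>\<bar>K + C\<bar>\<rceil>} \<times> {j \<in> idxs g. ht j \<le> K + C})" using finite_idxs by simp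
          show "{(k, j). k \<in> (UNIV :: nat set) \<and> j \<in> idxs g \<and> 0 + (real k + max 0 (ht j - ht i)) + (ht j - C) \<le> K}
            \<subseteq> {..nat \<lceil>\<bar>K + C\<bar>\<rceil>} \<times> {j \<in> idxs g. ht j \<le> K + C}"
          proof (rule subsetI, elim CollectE case_prodE conjE)
            fix x k j assume x: "x = (k, j)" "j \<in> idxs g" "0 + (real k + max 0 (ht j - ht i)) + (ht j - C) \<le> K"
            have "0 \<le> max 0 (ht j - ht i)" "0 \<le> ht j" by auto
            then have "real k \<le> K + C" "ht j \<le> K + C" using x(3) by linarith+
            then show "x \<in> {..nat \<lceil>\<bar>K + C\<bar>\<rceil>} \<times> {j \<in> idxs g. ht j \<le> K + C}"
              using x(1,2) by (simp add: le_nat_iff) linarith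
          qed
        qed
      qed (use i in auto)
      also have "\<dots> = conv UNIV (\<lambda>k. conv (idxs g) (mat_pow g A k i) (R s)) (\<lambda>_. fone)"
        by (rule conv_commute)
      finally show ?thesis .
    qed
    have "contr g L (\<lambda>i. contr g (neumann g A i) (R s)) = contr g L (\<lambda>i. conv (idxs g) (neumann g A i) (R s))"
      by (rule contr_cong) (auto simp: 1)
    also have "\<dots> = conv (idxs g) L (\<lambda>i. conv (idxs g) (neumann g A i) (R s))"
      by (rule contr_eq_conv[OF L good_gen[OF nR], where c = "2 * C"]) (use C0 in \<open>(auto simp: max_def; smt (verit) ht_nonneg of_nat_0_le_iff)+\<close>)
    also have "\<dots> = conv (idxs g) L (\<lambda>i. conv UNIV (\<lambda>k. conv (idxs g) (mat_pow g A k i) (R s)) (\<lambda>_. fone))"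
      by (rule conv_cong) (auto simp: 2)
    also have "\<dots> = conv UNIV (\<lambda>k. conv (idxs g) L (\<lambda>i. conv (idxs g) (mat_pow g A k i) (R s))) (\<lambda>_. fone)"
    proof (rule conv_assoc_good[OF L powR good_gen[OF good_fone], symmetric])
      fix K
      show "finite {(i, k). i \<in> idxs g \<and> k \<in> (UNIV :: nat set) \<and> ht i - C + (real k - C) + 0 \<le> K}"
      proof (rule finite_subset)
        show "finite ({j \<in> idxs g. ht j \<le> K + 2 * C} \<times> {..nat \<lceil>\<bar>K + 2 * C\<bar>\<rceil>})" using finite_idxs by simp
        show "{(i, k). i \<in> idxs g \<and> k \<in> (UNIV :: nat set) \<and> ht i - C + (real k - C) + 0 \<le> K}
          \<subseteq> {j \<in> idxs g. ht j \<le> K + 2 * C} \<times> {..nat \<lceil>\<bar>K + 2 * C\<bar>\<rceil>}"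
        proof (rule subsetI, elim CollectE case_prodE conjE)
          fix x k j assume x: "x = (j, k)" "j \<in> idxs g" "ht j - C + (real k - C) + 0 \<le> K"
          have "0 \<le> ht j" by simp
          then have "real k \<le> K + 2 * C" "ht j \<le> K + 2 * C" using x(3) by linarith+
          then show "x \<in> {j \<in> idxs g. ht j \<le> K + 2 * C} \<times> {..nat \<lceil>\<bar>K + 2 * C\<bar>\<rceil>}"
            using x(1,2) by (simp add: le_nat_iff) linarith
        qed
      qed
    qed auto
    also have "\<dots> = conv UNIV (\<lambda>k. conv (idxs g) (\<Lambda> k) (R s)) (\<lambda>_. fone)"
    proof (rule conv_cong[OF _ refl])
      fix k
      have "conv (idxs g) L (\<lambda>i. conv (idxs g) (mat_pow g A k i) (R s))
         = conv (idxs g) (\<lambda>j. conv (idxs g) L (\<lambda>i. mat_pow g A k i j)) (R s)"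
      proof (rule conv_assoc_good[OF L pow good_gen[OF R[OF s]], symmetric])
        show "finite {(i, j). i \<in> idxs g \<and> j \<in> idxs g \<and> ht i - C + (real k + max 0 (ht j - ht i)) + (ht j - C) \<le> K}" for K
          by (rule finite_idxs_le2[where c = "2 * C"]) (use C0 in \<open>(auto simp: max_def; smt (verit) ht_nonneg of_nat_0_le_iff)+\<close>)
      qed auto
      also have "\<dots> = conv (idxs g) (\<Lambda> k) (R s)" by (rule conv_cong) (auto simp: \<Lambda>_conv)
      finally show "conv (idxs g) L (\<lambda>i. conv (idxs g) (mat_pow g A k i) (R s)) = conv (idxs g) (\<Lambda> k) (R s)" .
    qed
    also have "\<dots> = fsum (\<lambda>k. conv (idxs g) (\<Lambda> k) (R s))"
      by (subst conv_commute) (rule conv_fone_left)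
    finally show ?thesis .
  qed
  have fink: "finite {k::nat. real k - c \<le> K}" for c K
    by (rule finite_subset[of _ "{..nat \<lceil>K + c\<rceil>}"]) (auto, linarith)
  have "contr g L Y = conv (idxs g) L Y"
    by (rule contr_eq_conv[OF L Y, where c = "2 * C"]) (use C0 in \<open>(auto simp: max_def; smt (verit) ht_nonneg of_nat_0_le_iff)+\<close>)
  also have "\<dots> = fsum (\<lambda>k. \<Sum>s\<in>\<Sigma>. conv (idxs g) (\<Lambda> k) (R s) \<circledast> H s)"
    by (simp only: fsumZ \<Lambda>Z_eq)
  also have "\<dots> = (\<Sum>s\<in>\<Sigma>. fsum (\<lambda>k. conv (idxs g) (\<Lambda> k) (R s) \<circledast> H s))"
  proof
    fix e
    have g: "gen g n (C + C + C) (real k - C - C - C) (conv (idxs g) (\<Lambda> k) (R s) \<circledast> H s)" if "s \<in> \<Sigma>" for k s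
      using gen_fmul[OF good_gen[OF \<Lambda>R[OF that]] H[OF that]] by simp
    have f: "finite {k. (conv (idxs g) (\<Lambda> k) (R s) \<circledast> H s) e \<noteq> 0}" if "s \<in> \<Sigma>" for s
      by (rule finite_subset[OF _ fink[of "3 * C" "tau g e"]]) (use g[OF that] in \<open>auto simp: gen_def dest!: spec[of _ e]\<close>)
    show "fsum (\<lambda>k. \<Sum>s\<in>\<Sigma>. conv (idxs g) (\<Lambda> k) (R s) \<circledast> H s) e
      = (\<Sum>s\<in>\<Sigma>. fsum (\<lambda>k. conv (idxs g) (\<Lambda> k) (R s) \<circledast> H s)) e"
      unfolding fsum_def fsum_fun_apply by (rule Sum_any_sum[OF fin f])
  qed
  also have "\<dots> = (\<Sum>s\<in>\<Sigma>. contr g L (\<lambda>i. contr g (neumann g A i) (R s)) \<circledast> H s)"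
  proof (rule sum.cong[OF refl])
    fix s assume s: "s \<in> \<Sigma>"
    have "fsum (\<lambda>k. conv (idxs g) (\<Lambda> k) (R s)) \<circledast> H s = fsum (\<lambda>k. conv (idxs g) (\<Lambda> k) (R s) \<circledast> H s)"
    proof (rule fsum_fmul[OF \<Lambda>R[OF s] H[OF s]])
      show "finite {k. real k - C - C \<le> K}" for K using fink[of "2 * C" K] by (simp add: algebra_simps)
    qed
    then show "fsum (\<lambda>k. conv (idxs g) (\<Lambda> k) (R s) \<circledast> H s)
      = contr g L (\<lambda>i. contr g (neumann g A i) (R s)) \<circledast> H s"
      by (simp add: NR[OF s])
  qed
  finally show ?thesis .
qed

section \<open>The expansions of the rational functions\<close>

definition ex2 :: "fvar \<Rightarrow> complex \<Rightarrow> fvar \<Rightarrow> complex \<Rightarrow> fexp" where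
  "ex2 p a q b = (\<lambda>_. 0)(p := a, q := b)"

lemma mon_fmul: "(mon p c \<circledast> h) e = h (e(p := e p - c))"
proof -
  have "(mon p c \<circledast> h) e = Sum_any (\<lambda>d. if d = (\<lambda>_. 0)(p := c) then h (e - d) else 0)"
    unfolding fmul_apply by (rule Sum_any.cong) (auto simp: mon_def)
  also have "\<dots> = h (e - (\<lambda>_. 0)(p := c))" by simp
  also have "e - (\<lambda>_. 0)(p := c) = e(p := e p - c)" by (auto simp: fun_eq_iff)
  finally show ?thesis .
qed

lemma fmul_mon: "(h \<circledast> mon p c) e = h (e(p := e p - c))"
  by (subst fmul_commute) (rule mon_fmul)

lemma mon_mon:
  assumes "p \<noteq> q"
  shows "(mon p a \<circledast> mon q b) e = (if e = ex2 p a q b then 1 else 0)"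
proof -
  have "e(p := e p - a) = (\<lambda>_. 0)(q := b) \<longleftrightarrow> e = ex2 p a q b"
    using assms by (auto simp: ex2_def fun_eq_iff split: if_splits)
  then show ?thesis unfolding mon_fmul by (simp add: mon_def)
qed

lemma dd_0 [simp]: "dd p 0 f = f"
  by (simp add: dd_def)

lemma dd_add: "dd p m (f + h) = dd p m f + dd p m h"
  by (auto simp: dd_def fun_eq_iff algebra_simps)

lemma dd_sum: "dd p m (\<Sum>s\<in>A. f s) = (\<Sum>s\<in>A. dd p m (f s))"
  by (auto simp: dd_def fun_eq_iff fsum_fun_apply sum_distrib_left)

lemma dd_cmul: "dd p m (cmul c f) = cmul c (dd p m f)"
  by (auto simp: dd_def cmul_def fun_eq_iff)

lemma Sum_any_cmult: "Sum_any (\<lambda>a. c * f a) = c * Sum_any f" for c :: complex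
proof (cases "c = 0 \<or> finite {a. f a \<noteq> 0}")
  case True
  then show ?thesis by (auto simp: Sum_any_right_distrib)
next
  case False
  then have "infinite {a. c * f a \<noteq> 0}" by simp
  then show ?thesis using False by (simp del: mult_eq_0_iff)
qed

lemma cmul_fmul: "cmul c f \<circledast> h = cmul c (f \<circledast> h)"
  by (rule ext) (simp add: cmul_def fmul_apply mult.assoc Sum_any_cmult)

lemma fmul_cmul: "f \<circledast> cmul c h = cmul c (f \<circledast> h)"
  by (subst (1 2) fmul_commute) (rule cmul_fmul)

text \<open>
  The expansion of \<open>(p - q)^(-1)\<close> has the terms \<open>p^a q^b\<close> with \<open>a + b = - 1\<close>, where \<open>exa\<close> and \<open>exb\<close> are
  the exponents of the \<open>i\<close>-th term. Which of the two is negative depends on which variable is on the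
  left; \<open>kcoef\<close> is the coefficient after differentiation.
\<close>

definition exa :: "fvar \<Rightarrow> fvar \<Rightarrow> nat \<Rightarrow> complex" where
  "exa p q i = (if left_of p q then - of_nat i - 1 else of_nat i)"

definition exb :: "fvar \<Rightarrow> fvar \<Rightarrow> nat \<Rightarrow> complex" where
  "exb p q i = (if left_of p q then of_nat i else - of_nat i - 1)"

definition kern :: "fvar \<Rightarrow> fvar \<Rightarrow> nat \<Rightarrow> nat \<Rightarrow> fser" where
  "kern p q m j = dd p m (dd q j (inv_diff p q))"

definition kcoef :: "fvar \<Rightarrow> fvar \<Rightarrow> nat \<Rightarrow> nat \<Rightarrow> nat \<Rightarrow> complex" where
  "kcoef p q m j i = (if left_of p q then 1 else - 1) * (exa p q i gchoose m) * (exb p q i gchoose j)"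

lemma exa_eq_iff [simp]: "exa p q i = exa p q i' \<longleftrightarrow> i = i'"
  by (auto simp: exa_def)

lemma inv_diff_apply:
  assumes "p \<noteq> q"
  shows "inv_diff p q e = (if \<exists>i. e = ex2 p (exa p q i) q (exb p q i) then (if left_of p q then 1 else - 1) else 0)"
proof -
  have *: "inv_diff p q e = Sum_any (\<lambda>i. if e = ex2 p (exa p q i) q (exb p q i) then (if left_of p q then 1 else - 1) else 0)"
    using assms by (auto simp: inv_diff_def fsum_def cmul_def mon_mon exa_def exb_def if_distrib intro!: Sum_any.cong cong: if_cong)
  show ?thesis
  proof (cases "\<exists>i. e = ex2 p (exa p q i) q (exb p q i)")
    case True
    then obtain i0 where i0: "e = ex2 p (exa p q i0) q (exb p q i0)" by blast
    have "e = ex2 p (exa p q i) q (exb p q i) \<longleftrightarrow> i = i0" for i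
    proof
      assume "e = ex2 p (exa p q i) q (exb p q i)"
      then have "ex2 p (exa p q i) q (exb p q i) p = ex2 p (exa p q i0) q (exb p q i0) p" using i0 by simp
      then show "i = i0" using assms by (simp add: ex2_def)
    qed (use i0 in simp)
    then have "inv_diff p q e = Sum_any (\<lambda>i. if i = i0 then (if left_of p q then 1 else - 1) else 0)"
      unfolding * by (intro Sum_any.cong) simp
    then show ?thesis using True by simp
  next
    case False
    then show ?thesis by (simp add: *)
  qed
qed

lemma kern_apply:
  assumes "p \<noteq> q"
  shows "kern p q m j (ex2 p (exa p q i - of_nat m) q (exb p q i - of_nat j)) = kcoef p q m j i"
    and "kern p q m j e \<noteq> 0 \<Longrightarrow> \<exists>i. e = ex2 p (exa p q i - of_nat m) q (exb p q i - of_nat j) \<and> kcoef p q m j i \<noteq> 0"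
proof -
  have k: "kern p q m j e = ((e p + of_nat m) gchoose m) * ((e q + of_nat j) gchoose j)
      * inv_diff p q (e(p := e p + of_nat m, q := e q + of_nat j))" for e
    using assms by (simp add: kern_def dd_def mult.assoc fun_upd_twist)
  have eq: "e(p := e p + of_nat m, q := e q + of_nat j) = ex2 p (exa p q i) q (exb p q i)
      \<longleftrightarrow> e = ex2 p (exa p q i - of_nat m) q (exb p q i - of_nat j)" for i e
  proof
    assume L: "e(p := e p + of_nat m, q := e q + of_nat j) = ex2 p (exa p q i) q (exb p q i)"
    show "e = ex2 p (exa p q i - of_nat m) q (exb p q i - of_nat j)"
    proof
      fix x show "e x = ex2 p (exa p q i - of_nat m) q (exb p q i - of_nat j) x"
        using fun_cong[OF L, of x] assms by (auto simp: ex2_def eq_diff_eq split: if_splits)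
    qed
  qed (use assms in \<open>auto simp: ex2_def fun_eq_iff\<close>)
  show 1: "kern p q m j (ex2 p (exa p q i - of_nat m) q (exb p q i - of_nat j)) = kcoef p q m j i" for i
  proof -
    let ?e = "ex2 p (exa p q i - of_nat m) q (exb p q i - of_nat j)"
    have "inv_diff p q (?e(p := ?e p + of_nat m, q := ?e q + of_nat j)) = (if left_of p q then 1 else - 1)"
      unfolding inv_diff_apply[OF assms] eq by auto
    moreover have "?e p + of_nat m = exa p q i" "?e q + of_nat j = exb p q i"
      using assms by (auto simp: ex2_def)
    ultimately show ?thesis by (simp add: k kcoef_def)
  qed
  assume ne: "kern p q m j e \<noteq> 0"
  then obtain i where "e = ex2 p (exa p q i - of_nat m) q (exb p q i - of_nat j)"
    unfolding k inv_diff_apply[OF assms] eq by (auto split: if_splits)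
  then show "\<exists>i. e = ex2 p (exa p q i - of_nat m) q (exb p q i - of_nat j) \<and> kcoef p q m j i \<noteq> 0"
    using ne 1 by auto
qed

text \<open>
  An exponent of the product determines the exponent in the factor \<open>h\<close> once the number \<open>i\<close> of the
  term of the kernel is chosen, so the convolution is a sum over natural numbers.
\<close>

lemma kern_fmul:
  assumes "p \<noteq> q"
  shows "(kern p q m j \<circledast> h) e = Sum_any (\<lambda>i. kcoef p q m j i
     * h (e(p := e p - exa p q i + of_nat m, q := e q - exb p q i + of_nat j)))"
proof -
  let ?d = "\<lambda>i. ex2 p (exa p q i - of_nat m) q (exb p q i - of_nat j)"
  have "inj ?d"
  proof (rule injI)
    fix i i' assume "?d i = ?d i'"
    from fun_cong[OF this, of p] show "i = i'" using assms by (simp add: ex2_def)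
  qed
  then have "(kern p q m j \<circledast> h) e = Sum_any (\<lambda>i. kern p q m j (?d i) * h (e - ?d i))"
    unfolding fmul_apply
    by (intro Sum_any_reindex_inj[where l = ?d]) (use kern_apply(2)[OF assms, of m j] in auto)
  moreover have "e - ?d i = e(p := e p - exa p q i + of_nat m, q := e q - exb p q i + of_nat j)" for i
    using assms by (auto simp: ex2_def fun_eq_iff)
  ultimately show ?thesis by (simp add: kern_apply(1)[OF assms])
qed

lemma fl_nonzero:
  assumes "fl A N l p e \<noteq> 0" shows "\<exists>i. e = (\<lambda>_. 0)(p := - of_nat i - 1)"
proof -
  obtain i where "inv_diff_const p (A i) e \<noteq> 0"
    using assms by (auto simp: fl_def fsum_fun_apply cmul_def elim!: sum.not_neutral_contains_not_neutral)
  then show ?thesis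
    unfolding inv_diff_const_def fsum_def
    by (auto simp: cmul_def mon_def elim!: Sum_any_nonzeroE split: if_splits)
qed

lemma dd_fl_nonzero:
  assumes "dd p m (fl A N l p) e \<noteq> 0" shows "\<exists>i. e = (\<lambda>_. 0)(p := - of_nat i - 1 - of_nat m)"
proof -
  obtain i where "e(p := e p + of_nat m) = (\<lambda>_. 0)(p := - of_nat i - 1)"
    using assms fl_nonzero[of A N l p] by (auto simp: dd_def)
  then have "e = (\<lambda>_. 0)(p := - of_nat i - 1 - of_nat m)"
    by (auto simp: fun_eq_iff algebra_simps split: if_splits)
  then show ?thesis by blast
qed

text \<open>
  Only the Cauchy kernel \<open>1 / (p - q)\<close> couples the two variables; the correction is a polynomial of
  degree at most \<open>2N - 2\<close> in \<open>q\<close>.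
\<close>

lemma dd_pi_ser:
  assumes pq: "p \<noteq> q"
  shows "dd p m (dd q j (pi_ser A N p q)) = kern p q m j
     + (\<Sum>l\<in>Lset N. cmul (of_nat (l choose j)) (dd p m (fl A N l p) \<circledast> mon q (of_nat l - of_nat j)))"
proof -
  have "dd p m (dd q j (fl A N l p \<circledast> mon q (of_nat l)))
      = cmul (of_nat (l choose j)) (dd p m (fl A N l p) \<circledast> mon q (of_nat l - of_nat j))" for l
  proof
    fix e :: fexp
    let ?e = "e(p := e p + of_nat m, q := e q + of_nat j - of_nat l)"
    have 1: "dd p m (dd q j (fl A N l p \<circledast> mon q (of_nat l))) e
        = ((e p + of_nat m) gchoose m) * (((e q + of_nat j) gchoose j) * fl A N l p ?e)"
      using pq by (simp add: dd_def fmul_mon)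
    have 2: "cmul (of_nat (l choose j)) (dd p m (fl A N l p) \<circledast> mon q (of_nat l - of_nat j)) e
        = of_nat (l choose j) * (((e p + of_nat m) gchoose m) * fl A N l p ?e)"
      using pq by (simp add: dd_def fmul_mon cmul_def fun_upd_twist algebra_simps)
    show "dd p m (dd q j (fl A N l p \<circledast> mon q (of_nat l))) e
      = cmul (of_nat (l choose j)) (dd p m (fl A N l p) \<circledast> mon q (of_nat l - of_nat j)) e"
    proof (cases "fl A N l p ?e = 0")
      case False
      from fl_nonzero[OF this] obtain i where "?e = (\<lambda>_. 0)(p := - of_nat i - 1)" by blast
      from fun_cong[OF this, of q] have "e q + of_nat j = of_nat l" using pq by simp
      then show ?thesis unfolding 1 2 by (simp add: binomial_gbinomial)
    qed (simp add: 1 2)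
  qed
  then show ?thesis by (simp add: pi_ser_def dd_add dd_sum kern_def)
qed

lemma dd_fmul_const:
  assumes "\<And>e. f e \<noteq> 0 \<Longrightarrow> e p = 0"
  shows "dd p m (f \<circledast> h) = f \<circledast> dd p m h"
proof
  fix e :: fexp
  let ?e = "e(p := e p + of_nat m)"
  have "dd p m (f \<circledast> h) e = ((e p + of_nat m) gchoose m) * Sum_any (\<lambda>d. f d * h (?e - d))"
    by (simp add: dd_def fmul_apply)
  also have "\<dots> = Sum_any (\<lambda>d. f d * dd p m h (e - d))"
  proof -
    have t: "f d * dd p m h (e - d) = ((e p + of_nat m) gchoose m) * (f d * h (?e - d))" for d
    proof (cases "f d = 0")
      case False
      then have "d p = 0" by (rule assms)
      then have "(e - d)(p := (e - d) p + of_nat m) = ?e - d" by (auto simp: fun_eq_iff)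
      then show ?thesis using \<open>d p = 0\<close> by (simp add: dd_def)
    qed simp
    show ?thesis unfolding t by (simp add: Sum_any_cmult)
  qed
  finally show "dd p m (f \<circledast> h) e = (f \<circledast> dd p m h) e" by (simp add: fmul_apply)
qed

section \<open>Supports of the expansions\<close>

definition pv :: "nat \<Rightarrow> nat \<Rightarrow> fvar" where
  "pv n i = (case i of 0 \<Rightarrow> Vx | Suc i \<Rightarrow> posv n i)"

lemma pv_simps [simp]: "pv n 0 = Vx" "pv n (Suc i) = posv n i"
  by (simp_all add: pv_def)

lemma fpos_posv: "fpos (posv n i) = (if i < n then (1, Suc i) else (2, Suc (i - n)))"
proof (cases "i < n")
  case False
  show ?thesis
  proof (cases "even (i - n)")
    case True
    then obtain k where k: "i - n = 2 * k" by blast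
    have *: "nat (1 + int k) = Suc k" by simp
    show ?thesis using False True unfolding posv_def k by (simp add: *)
  next
    case odd: False
    then obtain k where k: "i - n = 2 * k + 1" by (blast elim: oddE)
    have *: "nat (1 + int k) = Suc k" by simp
    show ?thesis using False odd unfolding posv_def k by (simp add: *)
  qed
qed (simp add: posv_def)

lemma left_of_pv: "left_of (pv n i) (pv n j) \<longleftrightarrow> i < j"
  by (cases i; cases j) (auto simp: left_of_def fpos_posv)

lemma left_of_posv: "left_of (posv n i) (posv n j) \<longleftrightarrow> i < j"
  using left_of_pv[of n "Suc i" "Suc j"] by simp

lemma pv_inj [simp]: "pv n i = pv n j \<longleftrightarrow> i = j"
proof
  assume eq: "pv n i = pv n j"
  have "left_of (pv n i) (pv n j) = left_of (pv n j) (pv n j)"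
       "left_of (pv n j) (pv n i) = left_of (pv n j) (pv n j)" by (simp_all only: eq)
  then show "i = j" unfolding left_of_pv by simp
qed simp

lemma posv_inj [simp]: "posv n i = posv n j \<longleftrightarrow> i = j"
  using pv_inj[of n "Suc i" "Suc j"] by (simp del: pv_inj)

lemma posv_neq [simp]:
  "posv n i \<noteq> Vx" "posv n i \<noteq> Vdx" "posv n i \<noteq> Vdy k" "posv n i \<noteq> Vrho a"
  "Vx \<noteq> posv n i" "Vdx \<noteq> posv n i" "Vdy k \<noteq> posv n i" "Vrho a \<noteq> posv n i"
  by (auto simp: posv_def)

lemma pv_neq [simp]:
  "pv n i \<noteq> Vdx" "pv n i \<noteq> Vdy k" "pv n i \<noteq> Vrho a"
  "Vdx \<noteq> pv n i" "Vdy k \<noteq> pv n i" "Vrho a \<noteq> pv n i"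
  by (cases i; simp)+

lemma posv_in_vars:
  assumes "i < n + 2 * g" shows "posv n i \<in> corr_vars g n"
proof (cases "i < n")
  case False
  then have "(i - n) div 2 < g" using assms by linarith
  then have *: "int ((i - n) div 2) < int g" by simp
  have "int ((i - n) div 2 + 1) \<in> Iset g" "- int ((i - n) div 2 + 1) \<in> Iset g"
    unfolding Iset_def using * by (simp_all only: mem_Collect_eq) (simp_all only: of_nat_add of_nat_1, linarith+)
  then show ?thesis using False unfolding posv_def corr_vars_def by (cases "even (i - n)") auto
qed (auto simp: posv_def corr_vars_def)

lemma pv_in_vars: "i \<le> n + 2 * g \<Longrightarrow> pv n i \<in> all_vars g n"
  by (cases i) (auto simp: all_vars_def intro: posv_in_vars)

text \<open>
  Series in \<open>x\<close> and the insertion points alone. The bound on partial sums of exponents is 0 for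
  the Cauchy kernel and its derivatives, and \<open>2N\<close> when terms \<open>f\<^sub>l\<close> occur.
\<close>

definition flat :: "nat \<Rightarrow> nat \<Rightarrow> real \<Rightarrow> fser \<Rightarrow> bool" where
  "flat g n B f \<longleftrightarrow> (\<forall>e. f e \<noteq> 0 \<longrightarrow> halfint e \<and> (\<forall>p. e p \<noteq> 0 \<longrightarrow> p \<in> pv n ` {..n + 2 * g})
     \<and> (\<forall>s\<le>n + 2 * g. (\<Sum>i\<le>s. Re (e (pv n i))) \<le> B))"

definition rho_mono :: "nat \<Rightarrow> real \<Rightarrow> fser \<Rightarrow> bool" where
  "rho_mono g t f \<longleftrightarrow> (\<forall>e. f e \<noteq> 0 \<longrightarrow> halfint e \<and> (\<forall>p. e p \<noteq> 0 \<longrightarrow> p \<in> Vrho ` {1..g})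
     \<and> (\<forall>a. 0 \<le> Re (e (Vrho a))) \<and> tau g e = t)"

lemma sig_pv: "sig g n s e = 2 * tau g e - (\<Sum>i\<le>s. Re (e (pv n i)))"
  unfolding sig_def lessThan_Suc_atMost[symmetric] sum.lessThan_Suc_shift by simp

lemma sig_eq_all_pv: "\<phi> \<in> functionals g n \<longleftrightarrow>
   \<phi> = tau g \<or> \<phi> = (\<lambda>e. Re (e Vdx)) \<or> \<phi> = (\<lambda>e. - Re (e Vdx)) \<or>
   (\<exists>a\<in>{1..g}. \<phi> = (\<lambda>e. Re (e (Vrho a)))) \<or> (\<exists>s\<le>n + 2 * g. \<phi> = sig g n s) \<or>
   (\<exists>k\<in>{1..n}. \<phi> = (\<lambda>e. Re (e (Vdy k)))) \<or> (\<exists>k\<in>{1..n}. \<phi> = (\<lambda>e. - Re (e (Vdy k))))"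
  unfolding functionals_def by auto

text \<open>
  A monomial in the \<open>\<rho>\<^sub>a\<close> of degree \<open>t\<close> absorbs partial sums of size \<open>2 t\<close>; this is where the weight 2
  in \<open>sig\<close> is used.
\<close>

lemma good_rho_flat:
  assumes f: "rho_mono g t f" and h: "flat g n B h" and B: "B \<le> C + 2 * t" and C: "0 \<le> C" and t: "0 \<le> t"
  shows "good g n C t (f \<circledast> h)"
  unfolding good_def
proof (intro allI impI)
  fix e assume "(f \<circledast> h) e \<noteq> 0"
  then obtain d where d: "f d \<noteq> 0" "h (e - d) \<noteq> 0" by (rule fmul_nonzeroE)
  define d' where "d' = e - d"
  have e: "e = d + d'" by (simp add: d'_def)
  have fd: "halfint d" "\<And>p. d p \<noteq> 0 \<Longrightarrow> p \<in> Vrho ` {1..g}" "\<And>a. 0 \<le> Re (d (Vrho a))" "tau g d = t"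
    using f d(1) by (auto simp: rho_mono_def)
  have hd: "halfint d'" "\<And>p. d' p \<noteq> 0 \<Longrightarrow> p \<in> pv n ` {..n + 2 * g}"
    "\<And>s. s \<le> n + 2 * g \<Longrightarrow> (\<Sum>i\<le>s. Re (d' (pv n i))) \<le> B"
    using h d(2) by (auto simp: flat_def d'_def)
  have z: "d' (Vrho a) = 0" "d' Vdx = 0" "d' (Vdy k) = 0" for a k using hd(2) by (force simp: image_iff)+
  have z': "d (pv n i) = 0" "d Vdx = 0" "d (Vdy k) = 0" for i k using fd(2) by (force simp: image_iff)+
  have ta: "tau g e = t" using fd(4) z by (simp add: e tau_def)
  have "supported (all_vars g n) e"
    unfolding supported_def
  proof (intro allI impI)
    fix p assume p: "p \<notin> all_vars g n"
    have "d p = 0" using fd(2)[of p] p by (auto simp: all_vars_def corr_vars_def)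
    moreover have "d' p = 0" using hd(2)[of p] p pv_in_vars[of _ n g] by auto
    ultimately show "e p = 0" by (simp add: e)
  qed
  moreover have "- C \<le> \<phi> e" if \<phi>: "\<phi> \<in> functionals g n" for \<phi>
    using \<phi>[unfolded sig_eq_all_pv]
  proof (elim disjE bexE exE conjE)
    assume "\<phi> = tau g" then show ?thesis using ta C t by simp
  next
    fix a assume "\<phi> = (\<lambda>e. Re (e (Vrho a)))"
    then show ?thesis using z fd(3)[of a] C by (simp add: e)
  next
    fix s assume s: "s \<le> n + 2 * g" "\<phi> = sig g n s"
    have "(\<Sum>i\<le>s. Re (e (pv n i))) = (\<Sum>i\<le>s. Re (d' (pv n i)))" using z' by (simp add: e)
    then show ?thesis using hd(3)[OF s(1)] B ta by (simp add: s(2) sig_pv)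
  qed (use z z' C in \<open>auto simp: e\<close>)
  ultimately show "halfint e \<and> in_cone g n C e \<and> t \<le> tau g e"
    using ta halfint_add[OF fd(1) hd(1)] by (auto simp: in_cone_def e)
qed

lemma rho_mono_mon:
  assumes "a \<in> {1..g}" "0 \<le> Re c" "2 * c \<in> \<int>"
  shows "rho_mono g (Re c) (mon (Vrho a) c)"
  unfolding rho_mono_def
proof (intro allI impI)
  fix e assume "mon (Vrho a) c e \<noteq> 0"
  then have e: "e = (\<lambda>_. 0)(Vrho a := c)" by (auto simp: mon_def split: if_splits)
  have "tau g e = (\<Sum>b=1..g. if b = a then Re c else 0)" by (simp add: tau_def e if_distrib[of Re] cong: if_cong)
  then have "tau g e = Re c" using assms(1) by simp
  then show "halfint e \<and> (\<forall>p. e p \<noteq> 0 \<longrightarrow> p \<in> Vrho ` {1..g}) \<and> (\<forall>a. 0 \<le> Re (e (Vrho a))) \<and> tau g e = Re c"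
    using assms by (auto simp: e halfint_def)
qed

lemma rho_mono_fmul:
  assumes f: "rho_mono g t f" and h: "rho_mono g t' h" shows "rho_mono g (t + t') (f \<circledast> h)"
  unfolding rho_mono_def
proof (intro allI impI)
  fix e assume "(f \<circledast> h) e \<noteq> 0"
  then obtain d where d: "f d \<noteq> 0" "h (e - d) \<noteq> 0" by (rule fmul_nonzeroE)
  define d' where "d' = e - d"
  have e: "e = d + d'" by (simp add: d'_def)
  have fd: "halfint d" "\<And>p. d p \<noteq> 0 \<Longrightarrow> p \<in> Vrho ` {1..g}" "\<And>a. 0 \<le> Re (d (Vrho a))" "tau g d = t"
    using f d(1) by (auto simp: rho_mono_def)
  have hd: "halfint d'" "\<And>p. d' p \<noteq> 0 \<Longrightarrow> p \<in> Vrho ` {1..g}" "\<And>a. 0 \<le> Re (d' (Vrho a))" "tau g d' = t'"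
    using h d(2) by (auto simp: rho_mono_def d'_def)
  have "p \<in> Vrho ` {1..g}" if "e p \<noteq> 0" for p
    by (cases "d p = 0") (use fd(2)[of p] hd(2)[of p] that in \<open>auto simp: e\<close>)
  then show "halfint e \<and> (\<forall>p. e p \<noteq> 0 \<longrightarrow> p \<in> Vrho ` {1..g}) \<and> (\<forall>a. 0 \<le> Re (e (Vrho a))) \<and> tau g e = t + t'"
    using fd hd halfint_add[OF fd(1) hd(1)] by (auto simp: e tau_add)
qed

lemma flat_add: "flat g n B f \<Longrightarrow> flat g n B h \<Longrightarrow> flat g n B (f + h)"
  unfolding flat_def by (metis plus_fun_apply add_0)

lemma flat_zero: "flat g n B 0" by (simp add: flat_def)

lemma flat_sum: "(\<And>s. s \<in> A \<Longrightarrow> flat g n B (F s)) \<Longrightarrow> flat g n B (\<Sum>s\<in>A. F s)"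
  by (induction A rule: infinite_finite_induct) (auto intro: flat_add flat_zero)

lemma flat_mono: "flat g n B f \<Longrightarrow> B \<le> B' \<Longrightarrow> flat g n B' f"
  unfolding flat_def by (meson order_trans)

text \<open>
  A partial sum of the exponents of a monomial in two of the points picks up the first exponent,
  the second one, both, or none.
\<close>

lemma flat_ex2:
  assumes ij: "i \<le> n + 2 * g" "j \<le> n + 2 * g" "i \<noteq> j"
    and f: "\<And>e. f e \<noteq> 0 \<Longrightarrow> \<exists>a b. e = ex2 (pv n i) (of_int a) (pv n j) (of_int b)
       \<and> (\<forall>s. (if i \<le> s then a else 0) + (if j \<le> s then b else 0) \<le> B)"
  shows "flat g n (of_int B) f"
  unfolding flat_def
proof (intro allI impI)
  fix e assume "f e \<noteq> 0"
  with f obtain a b where e: "e = ex2 (pv n i) (of_int a) (pv n j) (of_int b)"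
    and B: "\<And>s. (if i \<le> s then a else 0) + (if j \<le> s then b else 0) \<le> B" by blast
  have h: "halfint e" by (auto simp: halfint_def e ex2_def)
  have "(\<Sum>k\<le>s. Re (e (pv n k))) \<le> of_int B" for s
  proof -
    have "(\<Sum>k\<le>s. Re (e (pv n k))) = (\<Sum>k\<le>s. (if k = i then of_int a else 0) + (if k = j then of_int b else 0))"
      using ij(3) by (intro sum.cong) (auto simp: e ex2_def)
    also have "\<dots> = of_int ((if i \<le> s then a else 0) + (if j \<le> s then b else 0))"
      by (simp add: sum.distrib)
    also have "\<dots> \<le> of_int B" using B[of s] by (simp only: of_int_le_iff)
    finally show ?thesis .
  qed
  moreover have "p \<in> pv n ` {..n + 2 * g}" if "e p \<noteq> 0" for p
    using that ij by (auto simp: e ex2_def split: if_splits)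
  ultimately show "halfint e \<and> (\<forall>p. e p \<noteq> 0 \<longrightarrow> p \<in> pv n ` {..n + 2 * g})
     \<and> (\<forall>s\<le>n + 2 * g. (\<Sum>i\<le>s. Re (e (pv n i))) \<le> of_int B)" using h by blast
qed

text \<open>
  A partial sum contains neither exponent, or the negative exponent of the left variable, or both,
  whose sum is negative.
\<close>

lemma flat_kern:
  assumes "i \<le> n + 2 * g" "j \<le> n + 2 * g" "i \<noteq> j"
  shows "flat g n 0 (kern (pv n i) (pv n j) m k)"
proof -
  have "flat g n (of_int 0) (kern (pv n i) (pv n j) m k)"
  proof (rule flat_ex2[OF assms])
    fix e assume "kern (pv n i) (pv n j) m k e \<noteq> 0"
    then obtain t where e: "e = ex2 (pv n i) (exa (pv n i) (pv n j) t - of_nat m) (pv n j) (exb (pv n i) (pv n j) t - of_nat k)"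
      using kern_apply(2)[of "pv n i" "pv n j" m k e] assms by auto
    show "\<exists>a b. e = ex2 (pv n i) (of_int a) (pv n j) (of_int b)
       \<and> (\<forall>s. (if i \<le> s then a else 0) + (if j \<le> s then b else 0) \<le> (0::int))"
    proof (cases "i < j")
      case True
      then show ?thesis
        by (intro exI[of _ "- int t - 1 - int m"] exI[of _ "int t - int k"])
          (auto simp: e exa_def exb_def left_of_pv)
    next
      case False
      then show ?thesis using assms(3)
        by (intro exI[of _ "int t - int m"] exI[of _ "- int t - 1 - int k"])
          (auto simp: e exa_def exb_def left_of_pv)
    qed
  qed
  then show ?thesis by simp
qed

lemma flat_fl:
  assumes "i \<le> n + 2 * g" "j \<le> n + 2 * g" "i \<noteq> j" "l \<in> Lset N"
  shows "flat g n (2 * real N) (cmul (of_nat (l choose k)) (dd (pv n i) m (fl A N l (pv n i)) \<circledast> mon (pv n j) (of_nat l - of_nat k)))"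
    (is "flat _ _ _ ?f")
proof -
  have "flat g n (of_int (2 * int N)) ?f"
  proof (rule flat_ex2[OF assms(1-3)])
    fix e assume ne: "?f e \<noteq> 0"
    then have k: "k \<le> l" by (auto simp: cmul_def intro: ccontr)
    from ne have "dd (pv n i) m (fl A N l (pv n i)) (e(pv n j := e (pv n j) - (of_nat l - of_nat k))) \<noteq> 0"
      by (auto simp: cmul_def fmul_mon)
    then obtain t where t: "e(pv n j := e (pv n j) - (of_nat l - of_nat k)) = (\<lambda>_. 0)(pv n i := - of_nat t - 1 - of_nat m)"
      using dd_fl_nonzero by blast
    have "e = ex2 (pv n i) (- of_nat t - 1 - of_nat m) (pv n j) (of_nat l - of_nat k)"
    proof
      fix p show "e p = ex2 (pv n i) (- of_nat t - 1 - of_nat m) (pv n j) (of_nat l - of_nat k) p"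
        using fun_cong[OF t, of p] assms(3) by (auto simp: ex2_def split: if_splits)
    qed
    then show "\<exists>a b. e = ex2 (pv n i) (of_int a) (pv n j) (of_int b)
       \<and> (\<forall>s. (if i \<le> s then a else 0) + (if j \<le> s then b else 0) \<le> 2 * int N)"
      using k assms(4) by (intro exI[of _ "- int t - 1 - int m"] exI[of _ "int l - int k"]) auto
  qed
  then show ?thesis by simp
qed

lemma flat_fl_diag:
  assumes "i \<le> n + 2 * g" "l \<in> Lset N"
  shows "flat g n (2 * real N) (cmul (of_nat (l choose k)) (dd (pv n i) m (fl A N l (pv n i)) \<circledast> mon (pv n i) (of_nat l - of_nat k)))"
    (is "flat _ _ _ ?f")
  unfolding flat_def
proof (intro allI impI)
  fix e assume ne: "?f e \<noteq> 0"
  then have k: "k \<le> l" by (auto simp: cmul_def intro: ccontr)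
  from ne have "dd (pv n i) m (fl A N l (pv n i)) (e(pv n i := e (pv n i) - (of_nat l - of_nat k))) \<noteq> 0"
    by (auto simp: cmul_def fmul_mon)
  then obtain t where t: "e(pv n i := e (pv n i) - (of_nat l - of_nat k)) = (\<lambda>_. 0)(pv n i := - of_nat t - 1 - of_nat m)"
    using dd_fl_nonzero by blast
  define c where "c = int l - int k - int t - 1 - int m"
  have e: "e = (\<lambda>_. 0)(pv n i := of_int c)"
  proof
    fix p show "e p = ((\<lambda>_. 0)(pv n i := of_int c)) p"
      using fun_cong[OF t, of p] by (auto simp: c_def algebra_simps split: if_splits)
  qed
  have c: "of_int c \<le> 2 * real N" using k assms(2) by (auto simp: c_def)
  have "(\<Sum>k\<le>s. Re (e (pv n k))) = (\<Sum>k\<le>s. if k = i then of_int c else 0)" for s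
    by (intro sum.cong) (auto simp: e)
  then have "(\<Sum>k\<le>s. Re (e (pv n k))) \<le> 2 * real N" for s using c by simp
  moreover have "p \<in> pv n ` {..n + 2 * g}" if "e p \<noteq> 0" for p
    using that assms by (auto simp: e split: if_splits)
  ultimately show "halfint e \<and> (\<forall>p. e p \<noteq> 0 \<longrightarrow> p \<in> pv n ` {..n + 2 * g})
     \<and> (\<forall>s\<le>n + 2 * g. (\<Sum>i\<le>s. Re (e (pv n i))) \<le> 2 * real N)"
    by (auto simp: halfint_def e)
qed

lemma flat_pi:
  assumes "i \<le> n + 2 * g" "j \<le> n + 2 * g" "i \<noteq> j"
  shows "flat g n (2 * real N) (dd (pv n i) m (dd (pv n j) k (pi_ser A N (pv n i) (pv n j))))"
proof -
  have "pv n i \<noteq> pv n j" using assms by simp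
  from dd_pi_ser[OF this] show ?thesis
    using flat_mono[OF flat_kern[OF assms], of "2 * real N"] flat_fl[OF assms]
    by (auto intro!: flat_add flat_sum)
qed

lemma good_flat: "flat g n B f \<Longrightarrow> 0 \<le> B \<Longrightarrow> good g n B 0 f"
proof -
  assume f: "flat g n B f" and B: "0 \<le> B"
  have "rho_mono g 0 fone" by (auto simp: rho_mono_def fone_apply halfint_zero tau_def)
  from good_rho_flat[OF this f, of B] B show ?thesis by simp
qed

lemma good_mon_dx: "good g n \<bar>Re c\<bar> 0 (mon Vdx c)" if "c \<in> \<int>"
proof -
  have "halfint ((\<lambda>_. 0)(Vdx := c))" using that by (auto simp: halfint_def)
  moreover have "in_cone g n \<bar>Re c\<bar> ((\<lambda>_. 0)(Vdx := c))"
    by (auto simp: in_cone_def supported_def all_vars_def sig_eq_all_pv tau_def sig_pv)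
  ultimately show ?thesis by (auto simp: good_def mon_def tau_def)
qed

lemma good_mon_dy: "good g n \<bar>Re c\<bar> 0 (mon (Vdy k) c)" if "c \<in> \<int>" "k \<in> {1..n}"
proof -
  have "halfint ((\<lambda>_. 0)(Vdy k := c))" using that by (auto simp: halfint_def)
  moreover have "in_cone g n \<bar>Re c\<bar> ((\<lambda>_. 0)(Vdy k := c))"
    using that(2) by (auto simp: in_cone_def supported_def all_vars_def corr_vars_def sig_eq_all_pv tau_def sig_pv; linarith)
  ultimately show ?thesis by (auto simp: good_def mon_def tau_def)
qed

section \<open>Intertwining operators: commutators, iterates and weights\<close>

lemma bilinear_onD:
  assumes "bilinear_on s t A B C f"
  shows "a \<in> A \<Longrightarrow> b \<in> B \<Longrightarrow> f a b \<in> C"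
    and "a \<in> A \<Longrightarrow> a' \<in> A \<Longrightarrow> b \<in> B \<Longrightarrow> f (a + a') b = f a b + f a' b"
    and "a \<in> A \<Longrightarrow> b \<in> B \<Longrightarrow> b' \<in> B \<Longrightarrow> f a (b + b') = f a b + f a b'"
    and "a \<in> A \<Longrightarrow> b \<in> B \<Longrightarrow> f (s c a) b = t c (f a b)"
    and "a \<in> A \<Longrightarrow> b \<in> B \<Longrightarrow> f a (s c b) = t c (f a b)"
  using assms by (simp_all add: bilinear_on_def)

locale module_family =
  fixes U :: "('v::ab_group_add) voa" and M :: "('l, 'v) voa_modules"
  assumes voa: "is_voa U" and irr: "irreducible_modules U M" and nrm: "normalized_intertwiners U M"
begin

sublocale V: vector_space "scl U"
  using voa by (simp add: is_voa_def)

abbreviation W :: "'l \<Rightarrow> 'v set" where "W \<alpha> \<equiv> mcar M \<alpha>"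
abbreviation act :: "'l \<Rightarrow> 'v modes" where "act \<alpha> \<equiv> mmode M \<alpha>"
abbreviation Wt :: "'l \<Rightarrow> complex \<Rightarrow> 'v set" where "Wt \<alpha> c \<equiv> wtsp U (mcar M \<alpha>) (mmode M \<alpha>) c"

lemma ordinary: "ordinary_module U (md M \<alpha>)"
  using irr[unfolded irreducible_modules_def, THEN conjunct1] by simp

lemma W_lab0: "W (lab0 M) = car U"
  using irr[unfolded irreducible_modules_def, THEN conjunct2, THEN conjunct2, THEN conjunct2, THEN conjunct2, THEN conjunct1] by simp

lemma act_lab0: "v \<in> car U \<Longrightarrow> w \<in> car U \<Longrightarrow> act (lab0 M) v n w = mode U v n w"
  using irr[unfolded irreducible_modules_def, THEN conjunct2, THEN conjunct2, THEN conjunct2, THEN conjunct2, THEN conjunct2, THEN conjunct1] by simp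

lemma W_subspace: "V.subspace (W \<alpha>)"
  using ordinary[of \<alpha>, unfolded ordinary_module_def fst_conv, THEN conjunct1] .

lemma W_zero [simp]: "0 \<in> W \<alpha>"
  using W_subspace by (rule V.subspace_0)

lemma W_add [intro]: "x \<in> W \<alpha> \<Longrightarrow> y \<in> W \<alpha> \<Longrightarrow> x + y \<in> W \<alpha>"
  using W_subspace by (rule V.subspace_add)

lemma W_scale [intro]: "x \<in> W \<alpha> \<Longrightarrow> scl U c x \<in> W \<alpha>"
  using W_subspace by (rule V.subspace_scale)

lemma W_sum [intro]: "(\<And>s. s \<in> A \<Longrightarrow> f s \<in> W \<alpha>) \<Longrightarrow> sum f A \<in> W \<alpha>"
  using W_subspace by (rule V.subspace_sum)

lemma intertw: "intertwiner U (md M \<alpha>) (md M \<beta>) (md M \<gamma>) (iop M \<alpha> \<beta> \<gamma>)"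
  using nrm[unfolded normalized_intertwiners_def, THEN conjunct1] by simp

lemma I_bilinear: "bilinear_on (scl U) (scl U) (W \<alpha>) (W \<beta>) (W \<gamma>) (\<lambda>v w. iop M \<alpha> \<beta> \<gamma> v n w)"
  using intertw[of \<alpha> \<beta> \<gamma>, unfolded intertwiner_def fst_conv, THEN conjunct1] by simp

lemma I_mem: "v \<in> W \<alpha> \<Longrightarrow> w \<in> W \<beta> \<Longrightarrow> iop M \<alpha> \<beta> \<gamma> v n w \<in> W \<gamma>"
  by (rule bilinear_onD(1)[OF I_bilinear])

lemma I_add_left: "v \<in> W \<alpha> \<Longrightarrow> v' \<in> W \<alpha> \<Longrightarrow> w \<in> W \<beta> \<Longrightarrow>
    iop M \<alpha> \<beta> \<gamma> (v + v') n w = iop M \<alpha> \<beta> \<gamma> v n w + iop M \<alpha> \<beta> \<gamma> v' n w"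
  by (rule bilinear_onD(2)[OF I_bilinear])

lemma I_add_right: "v \<in> W \<alpha> \<Longrightarrow> w \<in> W \<beta> \<Longrightarrow> w' \<in> W \<beta> \<Longrightarrow>
    iop M \<alpha> \<beta> \<gamma> v n (w + w') = iop M \<alpha> \<beta> \<gamma> v n w + iop M \<alpha> \<beta> \<gamma> v n w'"
  by (rule bilinear_onD(3)[OF I_bilinear])

lemma I_scale_left: "v \<in> W \<alpha> \<Longrightarrow> w \<in> W \<beta> \<Longrightarrow>
    iop M \<alpha> \<beta> \<gamma> (scl U c v) n w = scl U c (iop M \<alpha> \<beta> \<gamma> v n w)"
  by (rule bilinear_onD(4)[OF I_bilinear])

lemma I_scale_right: "v \<in> W \<alpha> \<Longrightarrow> w \<in> W \<beta> \<Longrightarrow>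
    iop M \<alpha> \<beta> \<gamma> v n (scl U c w) = scl U c (iop M \<alpha> \<beta> \<gamma> v n w)"
  by (rule bilinear_onD(5)[OF I_bilinear])

lemma I_zero_left [simp]: "w \<in> W \<beta> \<Longrightarrow> iop M \<alpha> \<beta> \<gamma> 0 n w = 0"
  using I_scale_left[of 0 \<alpha> w \<beta> \<gamma> 0 n] by simp

lemma I_zero_right [simp]: "v \<in> W \<alpha> \<Longrightarrow> iop M \<alpha> \<beta> \<gamma> v n 0 = 0"
  using I_scale_right[of v \<alpha> 0 \<beta> \<gamma> n 0] by simp

lemma I_sum_right: "v \<in> W \<alpha> \<Longrightarrow> (\<And>s. s \<in> A \<Longrightarrow> f s \<in> W \<beta>) \<Longrightarrow>
    iop M \<alpha> \<beta> \<gamma> v n (sum f A) = (\<Sum>s\<in>A. iop M \<alpha> \<beta> \<gamma> v n (f s))"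
  by (induction A rule: infinite_finite_induct) (auto simp: I_add_right W_sum)

lemma I_trunc:
  assumes "v \<in> W \<alpha>" "w \<in> W \<beta>"
  shows "\<exists>J::nat. \<forall>j\<ge>J. iop M \<alpha> \<beta> \<gamma> v (n + of_nat j) w = 0"
proof -
  obtain K where K: "\<And>n. Re n \<ge> K \<Longrightarrow> iop M \<alpha> \<beta> \<gamma> v n w = 0"
    using intertw[of \<alpha> \<beta> \<gamma>, unfolded intertwiner_def fst_conv, THEN conjunct2, THEN conjunct1,
      rule_format, OF assms] by blast
  have "iop M \<alpha> \<beta> \<gamma> v (n + of_nat j) w = 0" if "j \<ge> nat \<lceil>K - Re n\<rceil>" for j
    by (rule K) (use that in \<open>simp; linarith\<close>)
  then show ?thesis by blast
qed

lemma act_eq: "v \<in> car U \<Longrightarrow> w \<in> W \<beta> \<Longrightarrow> act \<beta> v n w = iop M (lab0 M) \<beta> \<beta> v (of_int n) w"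
  using nrm[unfolded normalized_intertwiners_def, THEN conjunct2, THEN conjunct1] by (simp add: cmodes_def)

lemma act_mem: "v \<in> car U \<Longrightarrow> w \<in> W \<beta> \<Longrightarrow> act \<beta> v n w \<in> W \<beta>"
  by (simp add: act_eq I_mem W_lab0)

lemma act_add: "v \<in> car U \<Longrightarrow> w \<in> W \<beta> \<Longrightarrow> w' \<in> W \<beta> \<Longrightarrow> act \<beta> v n (w + w') = act \<beta> v n w + act \<beta> v n w'"
  by (simp add: act_eq I_add_right W_lab0 W_add)

lemma act_scale: "v \<in> car U \<Longrightarrow> w \<in> W \<beta> \<Longrightarrow> act \<beta> v n (scl U c w) = scl U c (act \<beta> v n w)"
  by (simp add: act_eq I_scale_right W_lab0 W_scale)

lemma act_sum: "v \<in> car U \<Longrightarrow> (\<And>s. s \<in> A \<Longrightarrow> f s \<in> W \<beta>) \<Longrightarrow> act \<beta> v n (sum f A) = (\<Sum>s\<in>A. act \<beta> v n (f s))"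
  by (simp add: act_eq I_sum_right W_lab0 W_sum)

lemma act_zero [simp]: "v \<in> car U \<Longrightarrow> act \<beta> v n 0 = 0"
  by (simp add: act_eq W_lab0)

lemma act_zero_left [simp]: "w \<in> W \<beta> \<Longrightarrow> act \<beta> 0 n w = 0"
  using act_eq[of 0 w \<beta> n] W_zero[of "lab0 M"] by (simp add: W_lab0)

lemma act_trunc:
  assumes "v \<in> car U" "w \<in> W \<beta>"
  shows "\<exists>J::nat. \<forall>j\<ge>J. act \<beta> v (int j) w = 0"
  using I_trunc[of v "lab0 M" w \<beta> \<beta> 0] assms by (simp add: act_eq W_lab0)

lemma jacobi_I:
  assumes "x \<in> car U" "v \<in> W \<alpha>" "w \<in> W \<beta>"
  shows "Sum_any (\<lambda>i::nat. scl U (of_int m gchoose i)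
           (iop M \<alpha> \<beta> \<gamma> (act \<alpha> x (l + int i) v) (of_int m + n - of_nat i) w))
      = Sum_any (\<lambda>i::nat. scl U ((- 1) ^ i * (of_int l gchoose i))
           (act \<gamma> x (m + l - int i) (iop M \<alpha> \<beta> \<gamma> v (n + of_nat i) w)
            - scl U ((- 1) powi l) (iop M \<alpha> \<beta> \<gamma> v (n + of_int l - of_nat i) (act \<beta> x (m + int i) w))))"
  using intertw[of \<alpha> \<beta> \<gamma>, unfolded intertwiner_def jacobi_def fst_conv snd_conv, THEN conjunct2,
    THEN conjunct2, THEN conjunct1] assms by simp

lemma gchoose_0_nat: "(0 :: complex) gchoose i = (if i = 0 then 1 else 0)"
  by (cases i) auto

text \<open>The Borcherds identity for \<open>l = 0\<close>.\<close>

lemma I_commutator: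
  assumes x: "x \<in> car U" and v: "v \<in> W \<alpha>" and w: "w \<in> W \<beta>" and J: "\<And>j. j \<ge> J \<Longrightarrow> act \<alpha> x (int j) v = 0"
  shows "act \<gamma> x m (iop M \<alpha> \<beta> \<gamma> v n w) = iop M \<alpha> \<beta> \<gamma> v n (act \<beta> x m w)
     + (\<Sum>j<J. scl U (of_int m gchoose j) (iop M \<alpha> \<beta> \<gamma> (act \<alpha> x (int j) v) (of_int m + n - of_nat j) w))"
proof -
  have "Sum_any (\<lambda>i::nat. scl U (of_int m gchoose i)
           (iop M \<alpha> \<beta> \<gamma> (act \<alpha> x (0 + int i) v) (of_int m + n - of_nat i) w))
    = Sum_any (\<lambda>i::nat. if i = 0 then act \<gamma> x (m - int i) (iop M \<alpha> \<beta> \<gamma> v n w) - iop M \<alpha> \<beta> \<gamma> v n (act \<beta> x (m + int i) w) else 0)"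
    by (rule trans[OF jacobi_I[OF x v w, where l = 0]], rule Sum_any.cong) (simp add: gchoose_0_nat)
  also have "\<dots> = act \<gamma> x m (iop M \<alpha> \<beta> \<gamma> v n w) - iop M \<alpha> \<beta> \<gamma> v n (act \<beta> x m w)" by simp
  also have "Sum_any (\<lambda>i::nat. scl U (of_int m gchoose i)
           (iop M \<alpha> \<beta> \<gamma> (act \<alpha> x (0 + int i) v) (of_int m + n - of_nat i) w))
    = (\<Sum>j<J. scl U (of_int m gchoose j) (iop M \<alpha> \<beta> \<gamma> (act \<alpha> x (0 + int j) v) (of_int m + n - of_nat j) w))"
    by (rule Sum_any.expand_superset, simp, rule subsetI, rule ccontr) (use J w in auto)
  finally show ?thesis by (simp add: algebra_simps)
qed

text \<open>The Borcherds identity for \<open>m = 0\<close>.\<close>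

lemma I_iterate:
  assumes x: "x \<in> car U" and v: "v \<in> W \<alpha>" and w: "w \<in> W \<beta>"
  shows "iop M \<alpha> \<beta> \<gamma> (act \<alpha> x l v) n w = Sum_any (\<lambda>i::nat. scl U ((- 1) ^ i * (of_int l gchoose i))
           (act \<gamma> x (l - int i) (iop M \<alpha> \<beta> \<gamma> v (n + of_nat i) w)
            - scl U ((- 1) powi l) (iop M \<alpha> \<beta> \<gamma> v (n + of_int l - of_nat i) (act \<beta> x (int i) w))))"
proof -
  have "Sum_any (\<lambda>i::nat. scl U (of_int 0 gchoose i)
           (iop M \<alpha> \<beta> \<gamma> (act \<alpha> x (l + int i) v) (of_int 0 + n - of_nat i) w))
     = Sum_any (\<lambda>i::nat. if i = 0 then iop M \<alpha> \<beta> \<gamma> (act \<alpha> x (l + int i) v) n w else 0)"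
    by (rule Sum_any.cong) (simp add: gchoose_0_nat)
  then show ?thesis using jacobi_I[OF x v w, of 0 \<gamma> l n] by simp
qed

lemma conf_car: "conf U \<in> car U" and vac_car: "vac U \<in> car U"
  using voa by (simp_all add: is_voa_def)

lemma Wt_iff: "w \<in> Wt \<alpha> c \<longleftrightarrow> w \<in> W \<alpha> \<and> act \<alpha> (conf U) 1 w = scl U c w"
  by (simp add: wtsp_def Lop_def)

lemma Wt_mem: "w \<in> Wt \<alpha> c \<Longrightarrow> w \<in> W \<alpha>"
  by (simp add: Wt_iff)

lemma Wt_lab0: "Wt (lab0 M) c = wtsp U (car U) (mode U) c"
  using conf_car by (auto simp: wtsp_def Lop_def W_lab0 act_lab0)

lemma Wt_zero [simp]: "0 \<in> Wt \<alpha> c"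
  using conf_car by (simp add: Wt_iff)

lemma Wt_scale: "w \<in> Wt \<alpha> c \<Longrightarrow> scl U a w \<in> Wt \<alpha> c"
  using conf_car by (auto simp: Wt_iff act_scale mult.commute)

lemma Wt_add: "w \<in> Wt \<alpha> c \<Longrightarrow> w' \<in> Wt \<alpha> c \<Longrightarrow> w + w' \<in> Wt \<alpha> c"
  using conf_car by (auto simp: Wt_iff act_add V.scale_right_distrib)

lemma Wt_unique: "w \<in> Wt \<alpha> c \<Longrightarrow> w \<in> Wt \<alpha> d \<Longrightarrow> w \<noteq> 0 \<Longrightarrow> c = d"
  by (auto simp: Wt_iff)

text \<open>
  The commutator with \<open>L(0) = \<omega>(1)\<close> is governed by \<open>\<omega>(0) v = L(-1) v\<close> and \<open>\<omega>(1) v = L(0) v\<close>, and the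
  \<open>L(-1)\<close>-derivative property turns the former into a multiple of the same mode.
\<close>

lemma I_weight:
  assumes v: "v \<in> Wt \<alpha> c" and w: "w \<in> Wt \<beta> d"
  shows "iop M \<alpha> \<beta> \<gamma> v n w \<in> Wt \<gamma> (c + d - n - 1)"
proof -
  note vw = Wt_mem[OF v] Wt_mem[OF w]
  obtain J0 where J0: "\<And>j. j \<ge> J0 \<Longrightarrow> act \<alpha> (conf U) (int j) v = 0"
    using act_trunc[OF conf_car vw(1)] by blast
  define J where "J = J0 + 2"
  have J: "\<And>j. j \<ge> J \<Longrightarrow> act \<alpha> (conf U) (int j) v = 0" using J0 by (simp add: J_def)
  let ?t = "\<lambda>j. scl U (of_int 1 gchoose j) (iop M \<alpha> \<beta> \<gamma> (act \<alpha> (conf U) (int j) v) (of_int 1 + n - of_nat j) w)"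
  have g: "(1 :: complex) gchoose j = of_nat (1 choose j)" for j
    by (metis binomial_gbinomial of_nat_1)
  have "(\<Sum>j<J. ?t j) = (\<Sum>j<2. ?t j)"
    by (rule sum.mono_neutral_right) (auto simp: J_def g)
  also have "\<dots> = iop M \<alpha> \<beta> \<gamma> (act \<alpha> (conf U) 0 v) (1 + n) w + iop M \<alpha> \<beta> \<gamma> (scl U c v) n w"
    using v by (simp add: numeral_2_eq_2 Wt_iff)
  also have "iop M \<alpha> \<beta> \<gamma> (act \<alpha> (conf U) 0 v) (1 + n) w = scl U (- (1 + n)) (iop M \<alpha> \<beta> \<gamma> v n w)"
    using intertw[of \<alpha> \<beta> \<gamma>, unfolded intertwiner_def fst_conv snd_conv, THEN conjunct2,
      THEN conjunct2, THEN conjunct2] vw by (simp add: Lop_def del: V.scale_minus_left)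
  finally have "act \<gamma> (conf U) 1 (iop M \<alpha> \<beta> \<gamma> v n w) = iop M \<alpha> \<beta> \<gamma> v n (scl U d w)
      + (scl U (- (1 + n)) (iop M \<alpha> \<beta> \<gamma> v n w) + iop M \<alpha> \<beta> \<gamma> (scl U c v) n w)"
    using I_commutator[OF conf_car vw J, where \<gamma> = \<gamma> and m = 1 and n = n] w by (simp add: Wt_iff)
  also have "\<dots> = scl U (c + d - n - 1) (iop M \<alpha> \<beta> \<gamma> v n w)"
    using vw by (simp add: I_scale_left I_scale_right flip: V.scale_left_distrib)
  finally show ?thesis using I_mem[OF vw] by (simp add: Wt_iff)
qed

lemma act_weight:
  assumes "x \<in> wtsp U (car U) (mode U) c" "w \<in> Wt \<beta> d"
  shows "act \<beta> x n w \<in> Wt \<beta> (c + d - of_int n - 1)"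
proof -
  have xw: "x \<in> car U" "w \<in> W \<beta>" using assms(1) Wt_mem[OF assms(2)] by (auto simp: wtsp_def)
  have "x \<in> Wt (lab0 M) c" using assms(1) by (simp only: Wt_lab0)
  from I_weight[OF this assms(2)] show ?thesis by (simp only: act_eq[OF xw])
qed

end

section \<open>Weight decompositions and dual bases\<close>

context module_family
begin

lemma virasoro:
  "\<exists>c. \<forall>m n. \<forall>v\<in>car U.
        Lop U (mode U) m (Lop U (mode U) n v) - Lop U (mode U) n (Lop U (mode U) m v)
        = scl U (of_int (m - n)) (Lop U (mode U) (m + n) v)
          + (if m + n = 0 then scl U (of_int (m ^ 3 - m) / 12 * c) v else 0)"
  using voa by (simp only: is_voa_def)

lemma vac_modes: "v \<in> car U \<Longrightarrow> 0 \<le> n \<Longrightarrow> mode U v n (vac U) = 0"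
  using voa by (simp add: is_voa_def)

lemma creation: "v \<in> car U \<Longrightarrow> mode U v (- 1) (vac U) = v"
  using voa by (simp add: is_voa_def)

lemma mode_zero: "x \<in> car U \<Longrightarrow> mode U x n 0 = 0"
  using act_lab0[of x 0 n, symmetric] W_zero[of "lab0 M"] by (simp add: W_lab0)

text \<open>
  By the Virasoro relations applied to \<open>\<omega> = L(-2) 1\<close>. Hence \<open>L(0)\<close> is its own adjoint, which
  makes the pairing compatible with weights.
\<close>

lemma conf_weight: "conf U \<in> wtsp U (car U) (mode U) 2"
  and conf_quasiprimary: "Lop U (mode U) 1 (conf U) = 0"
proof -
  obtain c where vir: "\<And>m n. Lop U (mode U) m (Lop U (mode U) n (vac U)) - Lop U (mode U) n (Lop U (mode U) m (vac U))
        = scl U (of_int (m - n)) (Lop U (mode U) (m + n) (vac U))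
          + (if m + n = 0 then scl U (of_int (m ^ 3 - m) / 12 * c) (vac U) else 0)"
    using virasoro vac_car by blast
  have z: "Lop U (mode U) n (vac U) = 0" if "n \<ge> -1" for n
    using vac_modes[OF conf_car, of "n + 1"] that by (simp add: Lop_def)
  have c: "Lop U (mode U) (- 2) (vac U) = conf U"
    using creation[OF conf_car] by (simp add: Lop_def)
  have L0: "Lop U (mode U) n 0 = 0" for n using mode_zero[OF conf_car] by (simp add: Lop_def)
  show "conf U \<in> wtsp U (car U) (mode U) 2"
    using vir[of 0 "- 2"] by (simp add: wtsp_def c z L0 conf_car)
  show "Lop U (mode U) 1 (conf U) = 0"
    using vir[of 1 "- 2"] by (simp add: c z L0)
qed

text \<open>
  For a quasiprimary vector only the first term of \<open>e^(z L(1))\<close> survives.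
\<close>

lemma adjoint_mode_quasiprimary:
  assumes x: "Lop U (mode U) 1 x = 0" and Y0: "\<And>n. Yw 0 n w = 0"
  shows "adjoint_mode U Yw m x n w = scl U ((- 1) powi m) (Yw x (2 * m - n - 2) w)"
proof -
  have L0: "Lop U (mode U) 1 0 = 0" using mode_zero[OF conf_car] by (simp add: Lop_def)
  have "(Lop U (mode U) 1 ^^ i) 0 = 0" for i by (induction i) (simp_all add: L0)
  then have p: "(Lop U (mode U) 1 ^^ Suc i) x = 0" for i
    by (simp add: funpow_swap1 x)
  have "adjoint_mode U Yw m x n w = Sum_any (\<lambda>i::nat. if i = 0 then scl U ((- 1) powi m) (Yw x (2 * m - n - 2 - int i) w) else 0)"
    unfolding adjoint_mode_def
  proof (rule Sum_any.cong)
    fix i :: nat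
    show "scl U ((- 1) powi m / fact i) (Yw ((Lop U (mode U) 1 ^^ i) x) (2 * m - n - 2 - int i) w)
      = (if i = 0 then scl U ((- 1) powi m) (Yw x (2 * m - n - 2 - int i) w) else 0)"
    proof (cases i)
      case (Suc k)
      then show ?thesis using p[of k] Y0 by (simp del: funpow.simps)
    qed simp
  qed
  then show ?thesis by simp
qed

abbreviation P :: "'l \<Rightarrow> 'v \<Rightarrow> 'v \<Rightarrow> complex" where "P \<alpha> \<equiv> pairing M \<alpha>"

lemma contra: "contragredient U (md M \<alpha>) (md M (dual M \<alpha>)) (P \<alpha>)"
  and dual_lab0: "dual M (lab0 M) = lab0 M"
  using irr unfolding irreducible_modules_def by simp_all

lemma P_bilinear: "bilinear_on (scl U) (*) (W \<alpha>) (W (dual M \<alpha>)) UNIV (P \<alpha>)"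
  using contra[of \<alpha>] unfolding contragredient_def by simp

lemmas P_add_left = bilinear_onD(2)[OF P_bilinear]
lemmas P_add_right = bilinear_onD(3)[OF P_bilinear]
lemmas P_scale_left = bilinear_onD(4)[OF P_bilinear]
lemmas P_scale_right = bilinear_onD(5)[OF P_bilinear]

lemma P_zero_left [simp]: "b \<in> W (dual M \<alpha>) \<Longrightarrow> P \<alpha> 0 b = 0"
  using P_scale_left[of 0 \<alpha> b 0] by simp

lemma P_zero_right [simp]: "a \<in> W \<alpha> \<Longrightarrow> P \<alpha> a 0 = 0"
  using P_scale_right[of a \<alpha> 0 0] by simp

lemma P_sum_left: "b \<in> W (dual M \<alpha>) \<Longrightarrow> (\<And>s. s \<in> A \<Longrightarrow> f s \<in> W \<alpha>) \<Longrightarrow> P \<alpha> (sum f A) b = (\<Sum>s\<in>A. P \<alpha> (f s) b)"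
  by (induction A rule: infinite_finite_induct) (auto simp: P_add_left W_sum)

lemma P_sum_right: "a \<in> W \<alpha> \<Longrightarrow> (\<And>s. s \<in> A \<Longrightarrow> f s \<in> W (dual M \<alpha>)) \<Longrightarrow> P \<alpha> a (sum f A) = (\<Sum>s\<in>A. P \<alpha> a (f s))"
  by (induction A rule: infinite_finite_induct) (auto simp: P_add_right W_sum)

text \<open>
  A quasiprimary vector of weight \<open>N\<close> is, up to sign, reflected: \<open>n\<close> becomes \<open>2N - 2 - n\<close>.
\<close>

lemma P_adjoint:
  assumes x: "x \<in> wtsp U (car U) (mode U) (of_nat N)" "Lop U (mode U) 1 x = 0"
    and ab: "a \<in> W \<alpha>" "b \<in> W (dual M \<alpha>)"
  shows "P \<alpha> a (act (dual M \<alpha>) x n b) = (- 1) ^ N * P \<alpha> (act \<alpha> x (2 * int N - 2 - n) a) b"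
proof -
  have xc: "x \<in> car U" using x(1) by (simp add: wtsp_def)
  have x': "x \<in> wtsp U (car U) (mode U) (of_int (int N))" using x(1) by simp
  have "P \<alpha> a (act (dual M \<alpha>) x n b) = P \<alpha> (adjoint_mode U (act \<alpha>) (int N) x n a) b"
    using contra[of \<alpha>, unfolded contragredient_def fst_conv snd_conv, THEN conjunct2, THEN conjunct2,
      THEN spec, THEN bspec, OF x', THEN spec, THEN bspec, OF ab(1), THEN bspec, OF ab(2)] .
  also have "adjoint_mode U (act \<alpha>) (int N) x n a = scl U ((- 1) ^ N) (act \<alpha> x (2 * int N - n - 2) a)"
    by (subst adjoint_mode_quasiprimary[OF x(2)]) (use ab in simp_all)
  also have "2 * int N - n - 2 = 2 * int N - 2 - n" by simp
  finally show ?thesis using ab by (simp add: P_scale_left act_mem xc)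
qed

text \<open>
  The adjoint mode has index at least 0 and annihilates the vacuum. Together with \<open>vac_modes\<close>, the
  modes \<open>0, \<dots>, 2N - 2\<close> annihilate the vacuum on both sides; this range is the reason for the
  \<open>2N - 1\<close> forms \<open>\<Theta>\<^sub>a\<^sup>l\<close>.
\<close>

lemma P_vac_mode:
  assumes x: "x \<in> wtsp U (car U) (mode U) (of_nat N)" "Lop U (mode U) 1 x = 0"
    and w: "w \<in> W (lab0 M)" and n: "n \<le> 2 * int N - 2"
  shows "P (lab0 M) (vac U) (act (lab0 M) x n w) = 0"
proof -
  have xc: "x \<in> car U" using x(1) by (simp add: wtsp_def)
  have "act (lab0 M) x (2 * int N - 2 - n) (vac U) = 0"
    using vac_modes[OF xc, of "2 * int N - 2 - n"] n by (simp add: act_lab0 xc vac_car)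
  then show ?thesis
    using P_adjoint[OF x, of "vac U" "lab0 M" w n] w vac_car by (simp add: dual_lab0 W_lab0)
qed

lemma P_weight:
  assumes a: "a \<in> Wt \<alpha> c" and b: "b \<in> Wt (dual M \<alpha>) d" and ne: "P \<alpha> a b \<noteq> 0"
  shows "c = d"
proof -
  have "P \<alpha> a (act (dual M \<alpha>) (conf U) 1 b) = P \<alpha> (act \<alpha> (conf U) 1 a) b"
    using P_adjoint[of "conf U" 2 a \<alpha> b 1] conf_weight conf_quasiprimary a b by (simp add: Wt_iff)
  then have "d * P \<alpha> a b = c * P \<alpha> a b"
    using a b by (simp add: Wt_iff P_scale_left P_scale_right)
  then show ?thesis using ne by simp
qed

text \<open>
  Eigenvectors of \<open>L(0)\<close> for distinct eigenvalues: applying \<open>L(0) - c\<close> removes one of them.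
\<close>

lemma weights_independent:
  assumes "finite D" "\<And>d. d \<in> D \<Longrightarrow> h d \<in> Wt \<alpha> d" "(\<Sum>d\<in>D. h d) = 0" "d \<in> D"
  shows "h d = 0"
  using assms
proof (induction D arbitrary: h d rule: finite_induct)
  case (insert d0 D)
  let ?h = "\<lambda>d. scl U (d - d0) (h d)"
  have mem: "h d \<in> W \<alpha>" if "d \<in> insert d0 D" for d using insert.prems(1)[OF that] by (rule Wt_mem)
  have L: "act \<alpha> (conf U) 1 (h d) = scl U d (h d)" if "d \<in> insert d0 D" for d
    using insert.prems(1)[OF that] by (simp add: Wt_iff)
  have "(\<Sum>d\<in>insert d0 D. scl U d (h d)) = (\<Sum>d\<in>insert d0 D. act \<alpha> (conf U) 1 (h d))"
    using L by (intro sum.cong) simp_all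
  also have "\<dots> = act \<alpha> (conf U) 1 (\<Sum>d\<in>insert d0 D. h d)"
    by (rule act_sum[OF conf_car, symmetric]) (rule mem)
  also have "\<dots> = 0" using insert.prems(2) conf_car by simp
  finally have "(\<Sum>d\<in>insert d0 D. scl U d (h d)) = 0" .
  moreover have "(\<Sum>d\<in>insert d0 D. scl U d0 (h d)) = 0"
    using insert.prems(2) by (simp flip: V.scale_sum_right)
  ultimately have "(\<Sum>d\<in>insert d0 D. ?h d) = 0"
    by (simp only: V.scale_left_diff_distrib sum_subtractf) simp
  then have "(\<Sum>d\<in>D. ?h d) = 0" using insert.hyps by simp
  then have "?h d = 0" if "d \<in> D" for d
    using insert.IH[of ?h d] that insert.prems(1) by (blast intro: Wt_scale)
  then have D: "h d = 0" if "d \<in> D" for d using that insert.hyps by (metis V.scale_eq_0_iff eq_iff_diff_eq_0)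
  then have "h d0 = 0" using insert.prems(2) insert.hyps by simp
  then show ?case using D insert.prems(3) by auto
qed simp

lemma span_weights:
  assumes "v \<in> V.span (\<Union>c\<in>X. Wt \<alpha> c)"
  shows "\<exists>D h. finite D \<and> D \<subseteq> X \<and> (\<forall>d\<in>D. h d \<in> Wt \<alpha> d) \<and> v = (\<Sum>d\<in>D. h d)"
  using assms
proof (induction rule: V.span_induct_alt)
  case base
  then show ?case by (intro exI[of _ "{}"]) auto
next
  case (step c x y)
  then obtain D h where D: "finite D" "D \<subseteq> X" "\<forall>d\<in>D. h d \<in> Wt \<alpha> d" "y = (\<Sum>d\<in>D. h d)" by blast
  obtain d0 where d0: "d0 \<in> X" "x \<in> Wt \<alpha> d0" using step by blast
  let ?h = "\<lambda>d. (if d = d0 then scl U c x else 0) + (if d \<in> D then h d else 0)"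
  have "(\<Sum>d\<in>insert d0 D. ?h d) = scl U c x + (\<Sum>d\<in>insert d0 D. if d \<in> D then h d else 0)"
    using D(1) by (simp add: sum.distrib)
  also have "(\<Sum>d\<in>insert d0 D. if d \<in> D then h d else 0) = (\<Sum>d\<in>D. h d)"
    using D(1) by (intro sum.mono_neutral_cong_right) auto
  finally have "scl U c x + y = (\<Sum>d\<in>insert d0 D. ?h d)" using D(4) by simp
  moreover have "\<forall>d\<in>insert d0 D. ?h d \<in> Wt \<alpha> d"
    using D(3) d0 by (auto intro: Wt_add Wt_scale)
  ultimately show ?case using D(1,2) d0(1) by (intro exI[of _ "insert d0 D"] exI[of _ ?h]) auto
qed

lemma W_span: "W \<alpha> = V.span (\<Union>c. Wt \<alpha> c)"
  using ordinary[of \<alpha>] unfolding ordinary_module_def by simp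

definition decomp :: "'l \<Rightarrow> 'v \<Rightarrow> (complex \<Rightarrow> 'v) \<Rightarrow> bool" where
  "decomp \<alpha> v h \<longleftrightarrow> (\<forall>d. h d \<in> Wt \<alpha> d) \<and> finite {d. h d \<noteq> 0} \<and> Sum_any h = v"

lemma decomp_exists:
  assumes "v \<in> W \<alpha>" shows "\<exists>h. decomp \<alpha> v h"
proof -
  obtain D h where D: "finite D" "\<forall>d\<in>D. h d \<in> Wt \<alpha> d" "v = (\<Sum>d\<in>D. h d)"
    using span_weights[of v \<alpha> UNIV] assms W_span by auto
  let ?h = "\<lambda>d. if d \<in> D then h d else 0"
  have "Sum_any ?h = (\<Sum>d\<in>D. ?h d)" by (rule Sum_any.expand_superset) (auto simp: D(1))
  moreover have "finite {d. ?h d \<noteq> 0}" using D(1) by (auto intro: finite_subset[of _ D])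
  ultimately show ?thesis using D by (intro exI[of _ ?h]) (simp add: decomp_def)
qed

lemma decomp_unique:
  assumes "decomp \<alpha> v h" "decomp \<alpha> v h'" shows "h = h'"
proof
  fix d
  let ?D = "insert d ({d. h d \<noteq> 0} \<union> {d. h' d \<noteq> 0})"
  have fin: "finite ?D" using assms by (simp add: decomp_def)
  have "Sum_any h = (\<Sum>d\<in>?D. h d)" "Sum_any h' = (\<Sum>d\<in>?D. h' d)"
    by (rule Sum_any.expand_superset[OF fin]; blast)+
  then have "(\<Sum>d\<in>?D. h d + scl U (- 1) (h' d)) = 0"
    using assms by (simp add: decomp_def sum_subtractf)
  moreover have "h d + scl U (- 1) (h' d) \<in> Wt \<alpha> d" for d
    using assms by (intro Wt_add Wt_scale) (auto simp: decomp_def)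
  ultimately have "h d + scl U (- 1) (h' d) = 0"
    using weights_independent[OF fin, of "\<lambda>d. h d + scl U (- 1) (h' d)" \<alpha> d] by blast
  then show "h d = h' d" by simp
qed

lemma wcomp_eq: "decomp \<alpha> v h \<Longrightarrow> wcomp U (md M \<alpha>) c v = h c"
  unfolding wcomp_def fst_conv snd_conv
  by (subst the_equality[of _ h]) (use decomp_unique in \<open>auto simp: decomp_def\<close>)

lemma wcomp_mem: "v \<in> W \<alpha> \<Longrightarrow> wcomp U (md M \<alpha>) c v \<in> Wt \<alpha> c"
  using decomp_exists[of v \<alpha>] wcomp_eq[of \<alpha> v] by (metis decomp_def)

lemma wcomp_finite:
  assumes "v \<in> W \<alpha>" shows "finite {c. wcomp U (md M \<alpha>) c v \<noteq> 0}"
proof -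
  obtain h where h: "decomp \<alpha> v h" using decomp_exists[OF assms] by blast
  then show ?thesis by (simp add: wcomp_eq[OF h]) (simp add: decomp_def)
qed

text \<open>
  The mode shifts all weights by the same amount, so it carries the decomposition of \<open>v\<close> to that
  of its image.
\<close>

lemma wcomp_act:
  assumes x: "x \<in> wtsp U (car U) (mode U) k" and v: "v \<in> W \<alpha>"
  shows "wcomp U (md M \<alpha>) (c + k - of_int n - 1) (act \<alpha> x n v) = act \<alpha> x n (wcomp U (md M \<alpha>) c v)"
proof -
  have xc: "x \<in> car U" using x by (simp add: wtsp_def)
  obtain h where h: "decomp \<alpha> v h" using decomp_exists[OF v] by blast
  let ?s = "\<lambda>d. d - k + of_int n + 1"
  let ?h = "\<lambda>d. act \<alpha> x n (h (?s d))"
  have b: "bij ?s" by (rule bij_betwI[where g = "\<lambda>d. d + k - of_int n - 1"]) auto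
  have hm: "h d \<in> Wt \<alpha> d" for d using h by (simp add: decomp_def)
  have fin: "finite {d. h d \<noteq> 0}" using h by (simp add: decomp_def)
  have "{d. ?h d \<noteq> 0} \<subseteq> (\<lambda>d. d + k - of_int n - 1) ` {d. h d \<noteq> 0}"
  proof
    fix d assume "d \<in> {d. ?h d \<noteq> 0}"
    then have "h (?s d) \<noteq> 0" using act_zero[OF xc] by auto
    then show "d \<in> (\<lambda>d. d + k - of_int n - 1) ` {d. h d \<noteq> 0}" by (intro image_eqI[of _ _ "?s d"]) auto
  qed
  then have f: "finite {d. ?h d \<noteq> 0}" using fin finite_subset by blast
  have "Sum_any ?h = Sum_any (\<lambda>d. act \<alpha> x n (h d))"
    by (rule Sum_any.reindex_cong[OF b, symmetric]) (auto simp: fun_eq_iff)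
  also have "\<dots> = (\<Sum>d | h d \<noteq> 0. act \<alpha> x n (h d))"
    using xc by (intro Sum_any.expand_superset[OF fin]) auto
  also have "\<dots> = act \<alpha> x n (\<Sum>d | h d \<noteq> 0. h d)"
    by (rule act_sum[OF xc, symmetric]) (rule Wt_mem[OF hm])
  also have "\<dots> = act \<alpha> x n v"
    using h by (simp add: decomp_def Sum_any.expand_set)
  finally have sum: "Sum_any ?h = act \<alpha> x n v" .
  have mem: "?h d \<in> Wt \<alpha> d" for d
    using act_weight[OF x hm[of "?s d"], of n] by (simp add: algebra_simps)
  have "decomp \<alpha> (act \<alpha> x n v) ?h"
    unfolding decomp_def using sum f mem by blast
  from wcomp_eq[OF this, of "c + k - of_int n - 1"] show ?thesis
    by (simp add: wcomp_eq[OF h] algebra_simps)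
qed

lemma wcomp_zero: "wcomp U (md M \<alpha>) c 0 = 0"
proof -
  have "decomp \<alpha> 0 (\<lambda>_. 0)" by (simp add: decomp_def)
  from wcomp_eq[OF this] show ?thesis .
qed

lemma weights_bounded_below: "\<exists>B. \<forall>c. \<forall>w\<in>Wt \<alpha> c. w \<noteq> 0 \<longrightarrow> B \<le> Re c"
proof -
  obtain h0 where h0: "W \<alpha> = V.span (\<Union>n::nat. Wt \<alpha> (of_nat n + h0))"
    using irr[unfolded irreducible_modules_def, THEN conjunct2, THEN conjunct1] by auto
  have "Re h0 \<le> Re c" if w: "w \<in> Wt \<alpha> c" "w \<noteq> 0" for w c
  proof -
    let ?X = "range (\<lambda>n::nat. of_nat n + h0)"
    have "w \<in> V.span (\<Union>c\<in>?X. Wt \<alpha> c)" using Wt_mem[OF w(1)] h0 by simp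
    from span_weights[OF this]
    obtain D h where D: "finite D" "D \<subseteq> ?X" "\<forall>d\<in>D. h d \<in> Wt \<alpha> d" "w = (\<Sum>d\<in>D. h d)"
      by (elim exE conjE)
    have "c \<in> D"
    proof (rule ccontr)
      assume c: "c \<notin> D"
      let ?h = "\<lambda>d. if d = c then scl U (- 1) w else h d"
      have "(\<Sum>d\<in>D. ?h d) = (\<Sum>d\<in>D. h d)" using c by (intro sum.cong) auto
      then have "(\<Sum>d\<in>insert c D. ?h d) = 0" using c D by simp
      moreover have "?h d \<in> Wt \<alpha> d" if "d \<in> insert c D" for d
        using that D(3) Wt_scale[OF w(1), of "- 1"] by (cases "d = c") auto
      ultimately have "?h c = 0"
        using weights_independent[of "insert c D" ?h \<alpha> c] D(1) by blast
      then show False using w(2) by simp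
    qed
    then obtain n :: nat where "c = of_nat n + h0" using D(2) by auto
    then show ?thesis by simp
  qed
  then show ?thesis by blast
qed

definition dual_bases :: "'l \<Rightarrow> 'v set \<Rightarrow> ('v \<Rightarrow> 'v) \<Rightarrow> bool" where
  "dual_bases \<alpha> S db \<longleftrightarrow> S \<subseteq> (\<Union>c. Wt \<alpha> c) \<and> \<not> V.dependent S \<and> V.span S = W \<alpha> \<and>
     (\<forall>b\<in>S. db b \<in> W (dual M \<alpha>) \<and> (\<forall>b'\<in>S. P \<alpha> b' (db b) = (if b' = b then 1 else 0)))"

lemma basis_finite:
  assumes "dual_bases \<alpha> S db" shows "finite (S \<inter> Wt \<alpha> c)"
proof -
  have "findim U (Wt \<alpha> c)" using ordinary[of \<alpha>] unfolding ordinary_module_def by simp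
  then obtain B where B: "finite B" "V.span B = Wt \<alpha> c" by (auto simp: findim_def)
  have "V.independent (S \<inter> Wt \<alpha> c)"
    using assms V.independent_mono[of S "S \<inter> Wt \<alpha> c"] by (auto simp: dual_bases_def)
  with V.independent_span_bound[OF B(1)] B(2) show ?thesis by auto
qed

lemma basis_expand:
  assumes S: "dual_bases \<alpha> S db" and x: "x \<in> Wt \<alpha> c"
  shows "x = (\<Sum>b\<in>S \<inter> Wt \<alpha> c. scl U (P \<alpha> x (db b)) b)"
proof -
  note fin = basis_finite[OF S, of c]
  have "x \<in> V.span S" using S Wt_mem[OF x] by (simp add: dual_bases_def)
  then obtain t r where t: "finite t" "t \<subseteq> S" "x = (\<Sum>b\<in>t. scl U (r b) b)"
    unfolding V.span_explicit by blast
  have tW: "b \<in> W \<alpha>" if "b \<in> t" for b using that t(2) S Wt_mem by (auto simp: dual_bases_def)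
  have ne: "b \<noteq> 0" if "b \<in> t" for b using that t(2) S V.dependent_zero by (auto simp: dual_bases_def)
  obtain wt where wt: "b \<in> Wt \<alpha> (wt b)" if "b \<in> t" for b
    using t(2) S unfolding dual_bases_def by (metis (no_types, lifting) UN_E subsetD)
  let ?D = "insert c (wt ` t)"
  let ?h = "\<lambda>d. (\<Sum>b | b \<in> t \<and> wt b = d. scl U (r b) b) + (if d = c then scl U (- 1) x else 0)"
  have "(\<Sum>d\<in>?D. \<Sum>b | b \<in> t \<and> wt b = d. scl U (r b) b) = x"
    unfolding t(3) by (rule sum.group) (use t(1) in auto)
  then have "(\<Sum>d\<in>?D. ?h d) = 0" using t(1) by (simp add: sum.distrib)
  moreover have "?h d \<in> Wt \<alpha> d" for d
  proof -
    have sumW: "(\<Sum>b\<in>T. scl U (r b) b) \<in> Wt \<alpha> d" if "\<And>b. b \<in> T \<Longrightarrow> b \<in> Wt \<alpha> d" for T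
      using that by (induction T rule: infinite_finite_induct) (auto intro: Wt_add Wt_scale)
    have "(\<Sum>b | b \<in> t \<and> wt b = d. scl U (r b) b) \<in> Wt \<alpha> d" by (rule sumW) (use wt in auto)
    moreover have "(if d = c then scl U (- 1) x else 0) \<in> Wt \<alpha> d"
      using Wt_scale[OF x, of "- 1"] by (cases "d = c") auto
    ultimately show ?thesis by (rule Wt_add)
  qed
  ultimately have "?h c = 0" using weights_independent[of ?D ?h \<alpha> c] t(1) by blast
  then have "x = (\<Sum>b | b \<in> t \<and> wt b = c. scl U (r b) b)" by simp
  also have "{b. b \<in> t \<and> wt b = c} = t \<inter> Wt \<alpha> c" using wt ne Wt_unique by blast
  finally have x': "x = (\<Sum>b\<in>t \<inter> Wt \<alpha> c. scl U (r b) b)" .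
  also have "\<dots> = (\<Sum>b\<in>S \<inter> Wt \<alpha> c. scl U (if b \<in> t then r b else 0) b)"
    using fin t(2) by (intro sum.mono_neutral_cong_left) auto
  also have "\<dots> = (\<Sum>b\<in>S \<inter> Wt \<alpha> c. scl U (P \<alpha> x (db b)) b)"
  proof (rule sum.cong[OF refl])
    fix b assume b: "b \<in> S \<inter> Wt \<alpha> c"
    then have db: "db b \<in> W (dual M \<alpha>)" using S by (simp add: dual_bases_def)
    have "P \<alpha> x (db b) = (\<Sum>b'\<in>t \<inter> Wt \<alpha> c. P \<alpha> (scl U (r b') b') (db b))"
      unfolding x' by (rule P_sum_left[OF db]) (use tW in auto)
    also have "\<dots> = (\<Sum>b'\<in>t \<inter> Wt \<alpha> c. if b' = b then r b' else 0)"
    proof (rule sum.cong[OF refl])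
      fix b' assume b': "b' \<in> t \<inter> Wt \<alpha> c"
      then have "P \<alpha> b' (db b) = (if b' = b then 1 else 0)" using S b t(2) by (auto simp: dual_bases_def)
      then show "P \<alpha> (scl U (r b') b') (db b) = (if b' = b then r b' else 0)"
        using b' tW db by (simp add: P_scale_left)
    qed
    also have "\<dots> = (if b \<in> t then r b else 0)" using b t(1) by simp
    finally show "scl U (if b \<in> t then r b else 0) b = scl U (P \<alpha> x (db b)) b" by simp
  qed
  finally show ?thesis .
qed

text \<open>The pairing is non-degenerate, and \<open>S\<close> spans the module.\<close>

lemma dual_ext:
  assumes S: "dual_bases \<alpha> S db" and \<phi>: "\<phi> \<in> W (dual M \<alpha>)" "\<psi> \<in> W (dual M \<alpha>)"
    and eq: "\<And>b. b \<in> S \<Longrightarrow> P \<alpha> b \<phi> = P \<alpha> b \<psi>"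
  shows "\<phi> = \<psi>"
proof -
  have SW: "S \<subseteq> W \<alpha>" using S V.span_superset by (auto simp: dual_bases_def)
  have "P \<alpha> a \<phi> = P \<alpha> a \<psi> \<and> a \<in> W \<alpha>" if "a \<in> V.span S" for a
    using that
  proof (induction rule: V.span_induct_alt)
    case base
    then show ?case using \<phi> by simp
  next
    case (step c x y)
    then show ?case using \<phi> SW eq by (auto simp: P_add_left P_scale_left W_scale intro!: W_add)
  qed
  then have "(\<lambda>a. if a \<in> W \<alpha> then P \<alpha> a \<phi> else 0) = (\<lambda>a. if a \<in> W \<alpha> then P \<alpha> a \<psi> else 0)"
    using S by (auto simp: dual_bases_def)
  moreover have "inj_on (\<lambda>b a. if a \<in> W \<alpha> then P \<alpha> a b else 0) (W (dual M \<alpha>))"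
    using contra[of \<alpha>, unfolded contragredient_def fst_conv, THEN conjunct2, THEN conjunct1]
    by (rule bij_betw_imp_inj_on)
  ultimately show ?thesis using \<phi> by (auto dest: inj_onD)
qed

text \<open>
  \<open>L(0)\<close> is self-adjoint, so \<open>L(0) db b\<close> pairs with the basis like \<open>c db b\<close>.
\<close>

lemma dual_weight:
  assumes S: "dual_bases \<alpha> S db" and b: "b \<in> S \<inter> Wt \<alpha> c"
  shows "db b \<in> Wt (dual M \<alpha>) c"
proof -
  have db: "db b \<in> W (dual M \<alpha>)" using S b by (simp add: dual_bases_def)
  have "act (dual M \<alpha>) (conf U) 1 (db b) = scl U c (db b)"
  proof (rule dual_ext[OF S])
    fix b' assume b': "b' \<in> S"
    then obtain d where d: "b' \<in> Wt \<alpha> d" using S by (auto simp: dual_bases_def)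
    have "P \<alpha> b' (act (dual M \<alpha>) (conf U) 1 (db b)) = P \<alpha> (act \<alpha> (conf U) 1 b') (db b)"
      using P_adjoint[of "conf U" 2 b' \<alpha> "db b" 1] conf_weight conf_quasiprimary db Wt_mem[OF d] by simp
    also have "\<dots> = d * P \<alpha> b' (db b)" using d db by (simp add: Wt_iff P_scale_left)
    also have "\<dots> = c * P \<alpha> b' (db b)"
    proof (cases "b' = b")
      case True
      moreover have "b \<noteq> 0" using b S V.dependent_zero by (auto simp: dual_bases_def)
      ultimately show ?thesis using Wt_unique[of b \<alpha> c d] b d by simp
    next
      case False
      then show ?thesis using S b b' by (simp add: dual_bases_def)
    qed
    finally show "P \<alpha> b' (act (dual M \<alpha>) (conf U) 1 (db b)) = P \<alpha> b' (scl U c (db b))"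
      using Wt_mem[OF d] db by (simp add: P_scale_right)
  qed (use db conf_car act_mem in auto)
  then show ?thesis using db by (simp add: Wt_iff)
qed

lemma dual_expand:
  assumes S: "dual_bases \<alpha> S db" and \<phi>: "\<phi> \<in> Wt (dual M \<alpha>) c"
  shows "\<phi> = (\<Sum>b\<in>S \<inter> Wt \<alpha> c. scl U (P \<alpha> b \<phi>) (db b))"
proof (rule dual_ext[OF S])
  have db: "db b \<in> W (dual M \<alpha>)" if "b \<in> S" for b using S that by (simp add: dual_bases_def)
  show "(\<Sum>b\<in>S \<inter> Wt \<alpha> c. scl U (P \<alpha> b \<phi>) (db b)) \<in> W (dual M \<alpha>)"
    using db by (intro W_sum W_scale) auto
  fix b assume b: "b \<in> S"
  then obtain d where d: "b \<in> Wt \<alpha> d" using S by (auto simp: dual_bases_def)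
  have "P \<alpha> b (\<Sum>b\<in>S \<inter> Wt \<alpha> c. scl U (P \<alpha> b \<phi>) (db b)) = (\<Sum>b'\<in>S \<inter> Wt \<alpha> c. P \<alpha> b (scl U (P \<alpha> b' \<phi>) (db b')))"
    by (rule P_sum_right[OF Wt_mem[OF d]]) (use db in auto)
  also have "\<dots> = (\<Sum>b'\<in>S \<inter> Wt \<alpha> c. if b' = b then P \<alpha> b \<phi> else 0)"
    using S b d db by (intro sum.cong refl) (auto simp: P_scale_right Wt_mem dual_bases_def)
  also have "\<dots> = P \<alpha> b \<phi>"
    using b d \<phi> P_weight[OF d \<phi>] basis_finite[OF S, of c] by auto
  finally show "P \<alpha> b \<phi> = P \<alpha> b (\<Sum>b\<in>S \<inter> Wt \<alpha> c. scl U (P \<alpha> b \<phi>) (db b))" by simp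
qed (rule Wt_mem[OF \<phi>])

text \<open>
  The tensor \<open>\<Sum> b \<otimes> b'\<close> over a weight space represents the identity, and so an operator on the first
  factor equals its adjoint on the second. Expanding \<open>x(j) b\<close> in the basis changes the weight, which
  shifts the weight space over which the sum extends.
\<close>

lemma sewing:
  assumes x: "x \<in> wtsp U (car U) (mode U) (of_nat N)" "Lop U (mode U) 1 x = 0"
    and S: "dual_bases \<alpha> S db"
    and \<Phi>: "bilinear_on (scl U) (*) (W \<alpha>) (W (dual M \<alpha>)) UNIV \<Phi>"
  shows "(\<Sum>b\<in>S \<inter> Wt \<alpha> c. \<Phi> (act \<alpha> x j b) (db b))
    = (- 1) ^ N * (\<Sum>b\<in>S \<inter> Wt \<alpha> (c + of_nat N - 1 - of_int j). \<Phi> b (act (dual M \<alpha>) x (2 * int N - 2 - j) (db b)))"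
proof -
  let ?c = "c + of_nat N - 1 - of_int j"
  have xc: "x \<in> car U" using x(1) by (simp add: wtsp_def)
  have SW: "b \<in> W \<alpha>" if "b \<in> S" for b using S that Wt_mem by (auto simp: dual_bases_def)
  have db: "db b \<in> W (dual M \<alpha>)" if "b \<in> S" for b using S that by (simp add: dual_bases_def)
  have suml: "\<Phi> (\<Sum>s\<in>A. scl U (r s) (f s)) y = (\<Sum>s\<in>A. r s * \<Phi> (f s) y)"
    if "\<And>s. s \<in> A \<Longrightarrow> f s \<in> W \<alpha>" "y \<in> W (dual M \<alpha>)" for A :: "'v set" and r f y
  proof -
    have "\<Phi> 0 y = 0" using bilinear_onD(4)[OF \<Phi>, of 0 y 0] that(2) by simp
    then show ?thesis using that
      by (induction A rule: infinite_finite_induct)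
        (auto simp: bilinear_onD(2)[OF \<Phi>] bilinear_onD(4)[OF \<Phi>] W_sum W_scale)
  qed
  have sumr: "\<Phi> y (\<Sum>s\<in>A. scl U (r s) (f s)) = (\<Sum>s\<in>A. r s * \<Phi> y (f s))"
    if "\<And>s. s \<in> A \<Longrightarrow> f s \<in> W (dual M \<alpha>)" "y \<in> W \<alpha>" for A :: "'v set" and r f y
  proof -
    have "\<Phi> y 0 = 0" using bilinear_onD(5)[OF \<Phi>, of y 0 0] that(2) by simp
    then show ?thesis using that
      by (induction A rule: infinite_finite_induct)
        (auto simp: bilinear_onD(3)[OF \<Phi>] bilinear_onD(5)[OF \<Phi>] W_sum W_scale)
  qed
  have "(\<Sum>b\<in>S \<inter> Wt \<alpha> c. \<Phi> (act \<alpha> x j b) (db b))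
    = (\<Sum>b\<in>S \<inter> Wt \<alpha> c. \<Sum>b2\<in>S \<inter> Wt \<alpha> ?c. P \<alpha> (act \<alpha> x j b) (db b2) * \<Phi> b2 (db b))"
  proof (rule sum.cong[OF refl])
    fix b assume b: "b \<in> S \<inter> Wt \<alpha> c"
    have "act \<alpha> x j b \<in> Wt \<alpha> ?c"
      using act_weight[OF x(1), of b \<alpha> c j] b by (simp add: algebra_simps)
    from basis_expand[OF S this] suml[of "S \<inter> Wt \<alpha> ?c" "\<lambda>b. b" "db b" "\<lambda>b2. P \<alpha> (act \<alpha> x j b) (db b2)"] SW db b
    show "\<Phi> (act \<alpha> x j b) (db b) = (\<Sum>b2\<in>S \<inter> Wt \<alpha> ?c. P \<alpha> (act \<alpha> x j b) (db b2) * \<Phi> b2 (db b))"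
      by simp
  qed
  also have "\<dots> = (\<Sum>b2\<in>S \<inter> Wt \<alpha> ?c. \<Sum>b\<in>S \<inter> Wt \<alpha> c. P \<alpha> (act \<alpha> x j b) (db b2) * \<Phi> b2 (db b))"
    by (rule sum.swap)
  also have "\<dots> = (\<Sum>b2\<in>S \<inter> Wt \<alpha> ?c. (- 1) ^ N * \<Phi> b2 (act (dual M \<alpha>) x (2 * int N - 2 - j) (db b2)))"
  proof (rule sum.cong[OF refl])
    fix b2 assume b2: "b2 \<in> S \<inter> Wt \<alpha> ?c"
    let ?y = "act (dual M \<alpha>) x (2 * int N - 2 - j) (db b2)"
    have y: "?y \<in> Wt (dual M \<alpha>) c"
      using act_weight[OF x(1) dual_weight[OF S b2], of "2 * int N - 2 - j"] by (simp add: algebra_simps)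
    have Py: "P \<alpha> b ?y = (- 1) ^ N * P \<alpha> (act \<alpha> x j b) (db b2)" if "b \<in> S" for b
      using P_adjoint[OF x SW[OF that] db, of b2 "2 * int N - 2 - j"] b2 by simp
    have "\<Phi> b2 ?y = (\<Sum>b\<in>S \<inter> Wt \<alpha> c. P \<alpha> b ?y * \<Phi> b2 (db b))"
      using dual_expand[OF S y] sumr[of "S \<inter> Wt \<alpha> c" db b2 "\<lambda>b. P \<alpha> b ?y"] SW db b2 by simp
    also have "\<dots> = (- 1) ^ N * (\<Sum>b\<in>S \<inter> Wt \<alpha> c. P \<alpha> (act \<alpha> x j b) (db b2) * \<Phi> b2 (db b))"
      using Py by (auto simp: sum_distrib_left mult.assoc intro!: sum.cong)
    finally show "(\<Sum>b\<in>S \<inter> Wt \<alpha> c. P \<alpha> (act \<alpha> x j b) (db b2) * \<Phi> b2 (db b)) = (- 1) ^ N * \<Phi> b2 ?y"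
      by (simp flip: power_add mult.assoc)
  qed
  finally show ?thesis by (simp add: sum_distrib_left)
qed

end

section \<open>Chains of intertwining operators\<close>

lemma chain_append: "chain M (xs @ ys) s = chain M xs (chain M ys s)"
  by (induction xs) (auto split: prod.splits)

locale insertions = module_family U M
  for U :: "('v::ab_group_add) voa" and M :: "('l, 'v) voa_modules" +
  fixes la mu :: "nat \<Rightarrow> 'l" and r N :: nat and x :: 'v
  assumes mu_0: "mu 0 = lab0 M" and mu_r: "mu r = lab0 M" and N: "1 \<le> N"
    and xw: "x \<in> wtsp U (car U) (mode U) (of_nat N)" and xq: "Lop U (mode U) 1 x = 0"
begin

lemma xc: "x \<in> car U"
  using xw by (simp add: wtsp_def)

definition ent :: "(nat \<Rightarrow> 'v) \<Rightarrow> (nat \<Rightarrow> complex) \<Rightarrow> nat \<Rightarrow> 'l \<times> 'l \<times> 'l \<times> 'v \<times> complex" where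
  "ent vs \<epsilon> i = (la i, mu (Suc i), mu i, vs i, \<epsilon> i)"

text \<open>
  The operators at the positions \<open>a, \<dots>, b - 1\<close> applied to \<open>s\<close>; \<open>\<epsilon> i\<close> is the exponent of the variable
  at position \<open>i\<close>, and the intermediate modules are \<open>mu\<close>.
\<close>

definition seg :: "(nat \<Rightarrow> 'v) \<Rightarrow> (nat \<Rightarrow> complex) \<Rightarrow> nat \<Rightarrow> nat \<Rightarrow> 'v \<Rightarrow> 'v" where
  "seg vs \<epsilon> a b s = chain M (map (ent vs \<epsilon>) [a..<b]) s"

abbreviation op :: "nat \<Rightarrow> 'v \<Rightarrow> complex \<Rightarrow> 'v \<Rightarrow> 'v" where
  "op i \<equiv> iop M (la i) (mu (Suc i)) (mu i)"

lemma seg_same [simp]: "seg vs \<epsilon> a a s = s"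
  by (simp add: seg_def)

lemma seg_Cons: "a < b \<Longrightarrow> seg vs \<epsilon> a b s = op a (vs a) (- \<epsilon> a - 1) (seg vs \<epsilon> (Suc a) b s)"
  by (simp add: seg_def upt_conv_Cons ent_def)

lemma seg_split: "a \<le> c \<Longrightarrow> c \<le> b \<Longrightarrow> seg vs \<epsilon> a b s = seg vs \<epsilon> a c (seg vs \<epsilon> c b s)"
  using upt_add_eq_append[of a c "b - c"] by (simp add: seg_def chain_append)

lemma seg_cong: "(\<And>i. a \<le> i \<Longrightarrow> i < b \<Longrightarrow> vs i = vs' i \<and> \<epsilon> i = \<epsilon>' i) \<Longrightarrow> seg vs \<epsilon> a b s = seg vs' \<epsilon>' a b s"
  unfolding seg_def by (intro arg_cong[where f = "\<lambda>l. chain M l s"] map_cong) (auto simp: ent_def)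

lemma seg_mem:
  assumes "a \<le> b" "s \<in> W (mu b)" "\<And>i. a \<le> i \<Longrightarrow> i < b \<Longrightarrow> vs i \<in> W (la i)"
  shows "seg vs \<epsilon> a b s \<in> W (mu a)"
  using assms(1)
proof (induction rule: inc_induct)
  case (step n)
  then show ?case by (simp add: seg_Cons I_mem assms(3))
qed (simp add: assms(2))

lemma seg_sum:
  assumes "a \<le> b" "\<And>t. t \<in> A \<Longrightarrow> f t \<in> W (mu b)" "\<And>i. a \<le> i \<Longrightarrow> i < b \<Longrightarrow> vs i \<in> W (la i)"
  shows "seg vs \<epsilon> a b (sum f A) = (\<Sum>t\<in>A. seg vs \<epsilon> a b (f t))"
  using assms(1)
proof (induction rule: inc_induct)
  case (step n)
  have "seg vs \<epsilon> (Suc n) b (f t) \<in> W (mu (Suc n))" if "t \<in> A" for t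
    by (rule seg_mem) (use step assms(2,3) that in auto)
  then show ?case using step by (simp add: seg_Cons assms(3) I_sum_right)
qed simp

lemma seg_add:
  assumes "a \<le> b" "s \<in> W (mu b)" "s' \<in> W (mu b)" "\<And>i. a \<le> i \<Longrightarrow> i < b \<Longrightarrow> vs i \<in> W (la i)"
  shows "seg vs \<epsilon> a b (s + s') = seg vs \<epsilon> a b s + seg vs \<epsilon> a b s'"
  using seg_sum[of a b UNIV "\<lambda>t. if t then s else s'" vs \<epsilon>] assms by (auto simp: UNIV_bool add.commute)

lemma seg_scale:
  assumes "a \<le> b" "s \<in> W (mu b)" "\<And>i. a \<le> i \<Longrightarrow> i < b \<Longrightarrow> vs i \<in> W (la i)"
  shows "seg vs \<epsilon> a b (scl U c s) = scl U c (seg vs \<epsilon> a b s)"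
  using assms(1)
proof (induction rule: inc_induct)
  case (step n)
  have "seg vs \<epsilon> (Suc n) b s \<in> W (mu (Suc n))"
    by (rule seg_mem) (use step assms(2,3) in auto)
  then show ?case using step by (simp add: seg_Cons assms(3) I_scale_right)
qed simp

lemma seg_zero:
  assumes "a \<le> b" "\<And>i. a \<le> i \<Longrightarrow> i < b \<Longrightarrow> vs i \<in> W (la i)"
  shows "seg vs \<epsilon> a b 0 = 0"
  using seg_sum[of a b "{}" "\<lambda>_. 0" vs \<epsilon>] assms by simp

lemma seg_weight:
  assumes "a \<le> b" "s \<in> Wt (mu b) d" "\<And>i. a \<le> i \<Longrightarrow> i < b \<Longrightarrow> vs i \<in> Wt (la i) (c i)"
  shows "seg vs \<epsilon> a b s \<in> Wt (mu a) (d + (\<Sum>i=a..<b. c i + \<epsilon> i))"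
  using assms(1)
proof (induction rule: inc_induct)
  case (step n)
  from I_weight[OF assms(3)[OF step(1,2)] step(3), of "mu n" "- \<epsilon> n - 1"] step(2)
  show ?case by (simp add: seg_Cons sum.atLeast_Suc_lessThan algebra_simps)
qed (simp add: assms(2))

lemma seg_slot:
  assumes i: "a \<le> i" "i < b" and s: "s \<in> W (mu b)" and vs: "\<And>k. a \<le> k \<Longrightarrow> k < b \<Longrightarrow> k \<noteq> i \<Longrightarrow> vs k \<in> W (la k)"
  shows "v \<in> W (la i) \<Longrightarrow> v' \<in> W (la i) \<Longrightarrow>
      seg (vs(i := v + v')) \<epsilon> a b s = seg (vs(i := v)) \<epsilon> a b s + seg (vs(i := v')) \<epsilon> a b s"
    and "v \<in> W (la i) \<Longrightarrow> seg (vs(i := scl U c v)) \<epsilon> a b s = scl U c (seg (vs(i := v)) \<epsilon> a b s)"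
proof -
  let ?w = "seg vs \<epsilon> (Suc i) b s"
  have w: "?w \<in> W (mu (Suc i))" by (rule seg_mem) (use i s vs in auto)
  have sp: "seg (vs(i := v)) \<epsilon> a b s = seg vs \<epsilon> a i (op i v (- \<epsilon> i - 1) ?w)" for v
  proof -
    have "seg (vs(i := v)) \<epsilon> a b s = seg (vs(i := v)) \<epsilon> a i (op i v (- \<epsilon> i - 1) (seg (vs(i := v)) \<epsilon> (Suc i) b s))"
      using i by (subst seg_split[of a i b]) (simp_all add: seg_Cons)
    also have "seg (vs(i := v)) \<epsilon> (Suc i) b s = ?w" by (rule seg_cong) auto
    also have "seg (vs(i := v)) \<epsilon> a i t = seg vs \<epsilon> a i t" for t by (rule seg_cong) auto
    finally show ?thesis .
  qed
  show "seg (vs(i := v + v')) \<epsilon> a b s = seg (vs(i := v)) \<epsilon> a b s + seg (vs(i := v')) \<epsilon> a b s"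
    if "v \<in> W (la i)" "v' \<in> W (la i)"
    using that w i vs by (simp add: sp I_add_left seg_add I_mem)
  show "seg (vs(i := scl U c v)) \<epsilon> a b s = scl U c (seg (vs(i := v)) \<epsilon> a b s)" if "v \<in> W (la i)"
    using that w i vs by (simp add: sp I_scale_left seg_scale I_mem)
qed

abbreviation ins :: "(nat \<Rightarrow> 'v) \<Rightarrow> nat \<Rightarrow> int \<Rightarrow> nat \<Rightarrow> 'v" where
  "ins vs i j \<equiv> vs(i := act (la i) x j (vs i))"

lemma ins_mem: "(\<And>k. vs k \<in> W (la k)) \<Longrightarrow> ins vs i j k \<in> W (la k)"
  by (simp add: act_mem xc)

text \<open>
  The mode is commuted through one operator after another. The bound \<open>J\<close> beyond which all \<open>x(j) v\<^sub>i\<close>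
  vanish makes all sums finite.
\<close>

lemma seg_commutator:
  assumes "a \<le> b" and s: "s \<in> W (mu b)" and vs: "\<And>i. vs i \<in> W (la i)"
    and J: "\<And>i j. a \<le> i \<Longrightarrow> i < b \<Longrightarrow> J \<le> j \<Longrightarrow> act (la i) x (int j) (vs i) = 0"
  shows "act (mu a) x m (seg vs \<epsilon> a b s) = seg vs \<epsilon> a b (act (mu b) x m s)
    + (\<Sum>i=a..<b. \<Sum>j<J. scl U (of_int m gchoose j)
         (seg (ins vs i (int j)) (\<epsilon>(i := \<epsilon> i - of_int m + of_nat j)) a b s))"
  using assms(1)
proof (induction rule: inc_induct)
  case base
  then show ?case by simp
next
  case (step k)
  let ?\<psi> = "seg vs \<epsilon> (Suc k) b s" and ?n = "- \<epsilon> k - 1"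
  let ?S = "\<lambda>a i j. seg (ins vs i (int j)) (\<epsilon>(i := \<epsilon> i - of_int m + of_nat j)) a b s"
  have \<psi>: "?\<psi> \<in> W (mu (Suc k))" by (rule seg_mem) (use step s vs in auto)
  have am: "act (mu b) x m s \<in> W (mu b)" using s xc by (simp add: act_mem)
  have S: "?S (Suc k) i j \<in> W (mu (Suc k))" for i j
    by (rule seg_mem[OF _ s]) (use step vs act_mem[OF xc vs] in auto)
  have "act (mu k) x m (seg vs \<epsilon> k b s) = act (mu k) x m (op k (vs k) ?n ?\<psi>)"
    using step by (simp add: seg_Cons)
  also have "\<dots> = op k (vs k) ?n (act (mu (Suc k)) x m ?\<psi>)
     + (\<Sum>j<J. scl U (of_int m gchoose j) (op k (act (la k) x (int j) (vs k)) (of_int m + ?n - of_nat j) ?\<psi>))"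
    by (rule I_commutator[OF xc vs \<psi>]) (use J step in auto)
  also have "(\<Sum>j<J. scl U (of_int m gchoose j) (op k (act (la k) x (int j) (vs k)) (of_int m + ?n - of_nat j) ?\<psi>))
     = (\<Sum>j<J. scl U (of_int m gchoose j) (?S k k j))"
  proof (rule sum.cong[OF refl])
    fix j
    have "?S k k j = op k (act (la k) x (int j) (vs k)) (- (\<epsilon> k - of_int m + of_nat j) - 1) (?S (Suc k) k j)"
      using step by (simp add: seg_Cons)
    also have "?S (Suc k) k j = ?\<psi>" by (rule seg_cong) auto
    also have "- (\<epsilon> k - of_int m + of_nat j) - 1 = of_int m + ?n - of_nat j" by simp
    finally show "scl U (of_int m gchoose j) (op k (act (la k) x (int j) (vs k)) (of_int m + ?n - of_nat j) ?\<psi>)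
      = scl U (of_int m gchoose j) (?S k k j)" by (simp only:)
  qed
  also have "act (mu (Suc k)) x m ?\<psi> = seg vs \<epsilon> (Suc k) b (act (mu b) x m s)
    + (\<Sum>i=Suc k..<b. \<Sum>j<J. scl U (of_int m gchoose j) (?S (Suc k) i j))"
    by (rule step.IH)
  also have "op k (vs k) ?n \<dots> = op k (vs k) ?n (seg vs \<epsilon> (Suc k) b (act (mu b) x m s))
    + (\<Sum>i=Suc k..<b. \<Sum>j<J. scl U (of_int m gchoose j) (op k (vs k) ?n (?S (Suc k) i j)))"
  proof -
    have "seg vs \<epsilon> (Suc k) b (act (mu b) x m s) \<in> W (mu (Suc k))"
      by (rule seg_mem[OF _ am]) (use step vs in auto)
    then show ?thesis using vs S by (simp add: I_add_right I_sum_right I_scale_right W_sum W_scale)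
  qed
  also have "op k (vs k) ?n (seg vs \<epsilon> (Suc k) b (act (mu b) x m s)) = seg vs \<epsilon> k b (act (mu b) x m s)"
    using step by (simp add: seg_Cons)
  also have "(\<Sum>i=Suc k..<b. \<Sum>j<J. scl U (of_int m gchoose j) (op k (vs k) ?n (?S (Suc k) i j)))
    = (\<Sum>i=Suc k..<b. \<Sum>j<J. scl U (of_int m gchoose j) (?S k i j))"
    using step by (intro sum.cong refl) (simp add: seg_Cons)
  finally show ?case unfolding sum.atLeast_Suc_lessThan[OF step(2)] by (simp only: ac_simps)
qed

definition val :: "(nat \<Rightarrow> 'v) \<Rightarrow> (nat \<Rightarrow> complex) \<Rightarrow> complex" where
  "val vs \<epsilon> = P (lab0 M) (vac U) (seg vs \<epsilon> 0 r (vac U))"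

lemma vac_W: "vac U \<in> W (mu r)" and vac_W0: "vac U \<in> W (lab0 M)"
  using vac_car by (simp_all add: mu_r W_lab0)

lemma act_vac: "0 \<le> m \<Longrightarrow> act (mu r) x m (vac U) = 0"
  using vac_modes[OF xc] vac_car xc by (simp add: mu_r act_lab0)

lemma P_vac_add: "s \<in> W (lab0 M) \<Longrightarrow> s' \<in> W (lab0 M) \<Longrightarrow>
    P (lab0 M) (vac U) (s + s') = P (lab0 M) (vac U) s + P (lab0 M) (vac U) s'"
  using P_add_right[of "vac U" "lab0 M" s s'] vac_W0 by (simp add: dual_lab0)

lemma P_vac_scale: "s \<in> W (lab0 M) \<Longrightarrow> P (lab0 M) (vac U) (scl U c s) = c * P (lab0 M) (vac U) s"
  using P_scale_right[of "vac U" "lab0 M" s c] vac_W0 by (simp add: dual_lab0)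

lemma P_vac_sum: "(\<And>t. t \<in> A \<Longrightarrow> f t \<in> W (lab0 M)) \<Longrightarrow>
    P (lab0 M) (vac U) (sum f A) = (\<Sum>t\<in>A. P (lab0 M) (vac U) (f t))"
  using P_sum_right[of "vac U" "lab0 M" A f] vac_W0 by (simp add: dual_lab0)

lemma val_mode:
  assumes vs: "\<And>i. vs i \<in> W (la i)" and m: "0 \<le> m"
    and J: "\<And>i j. i < r \<Longrightarrow> J \<le> j \<Longrightarrow> act (la i) x (int j) (vs i) = 0"
  shows "P (lab0 M) (vac U) (act (lab0 M) x m (seg vs \<epsilon> 0 r (vac U)))
    = (\<Sum>i<r. \<Sum>j<J. (of_int m gchoose j) * val (ins vs i (int j)) (\<epsilon>(i := \<epsilon> i - of_int m + of_nat j)))"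
proof -
  let ?S = "\<lambda>i j. seg (ins vs i (int j)) (\<epsilon>(i := \<epsilon> i - of_int m + of_nat j)) 0 r (vac U)"
  have S: "?S i j \<in> W (lab0 M)" for i j
    using seg_mem[OF _ vac_W, of 0 "ins vs i (int j)"] ins_mem[OF vs] by (simp add: mu_0)
  have A: "act (lab0 M) x m (seg vs \<epsilon> 0 r (vac U)) = (\<Sum>i=0..<r. \<Sum>j<J. scl U (of_int m gchoose j) (?S i j))"
    using seg_commutator[OF _ vac_W vs, of 0 J m \<epsilon>] J m by (simp add: act_vac mu_0 seg_zero vs)
  have "P (lab0 M) (vac U) (act (lab0 M) x m (seg vs \<epsilon> 0 r (vac U))) = (\<Sum>i=0..<r. \<Sum>j<J. (of_int m gchoose j) * P (lab0 M) (vac U) (?S i j))"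
    unfolding A using S by (simp add: P_vac_sum P_vac_scale W_sum W_scale)
  then show ?thesis unfolding val_def lessThan_atLeast0 .
qed

text \<open>
  A mode with \<open>0 \<le> m \<le> 2N - 2\<close> annihilates the vacuum on both sides, so only the commutators remain.
\<close>

lemma val_moment_zero:
  assumes vs: "\<And>i. vs i \<in> W (la i)" and m: "0 \<le> m" "m \<le> 2 * int N - 2"
    and J: "\<And>i j. i < r \<Longrightarrow> J \<le> j \<Longrightarrow> act (la i) x (int j) (vs i) = 0"
  shows "(\<Sum>i<r. \<Sum>j<J. (of_int m gchoose j) * val (ins vs i (int j)) (\<epsilon>(i := \<epsilon> i - of_int m + of_nat j))) = 0"
proof -
  have "seg vs \<epsilon> 0 r (vac U) \<in> W (lab0 M)"
    using seg_mem[OF _ vac_W, of 0 vs \<epsilon>] vs by (simp add: mu_0)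
  from P_vac_mode[OF xw xq this m(2)] show ?thesis
    by (simp only: val_mode[OF vs m(1) J])
qed

text \<open>
  If the exponents to the right of \<open>i\<close> are fixed, then lowering the exponent at \<open>i\<close> eventually gives 0,
  by lower truncation of the intertwining operator.
\<close>

lemma val_finite:
  assumes vs: "\<And>i. vs i \<in> W (la i)" and i: "i < r"
  shows "finite {t::nat. val vs (\<epsilon>' t) \<noteq> 0 \<and> \<epsilon>' t i = c - of_nat t \<and> (\<forall>k>i. \<epsilon>' t k = \<epsilon> k)}"
proof -
  let ?w = "seg vs \<epsilon> (Suc i) r (vac U)"
  have w: "?w \<in> W (mu (Suc i))" by (rule seg_mem[OF _ vac_W]) (use i vs in auto)
  obtain T where T: "\<And>t. t \<ge> T \<Longrightarrow> op i (vs i) (- c - 1 + of_nat t) ?w = 0"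
    using I_trunc[OF vs w, where \<gamma> = "mu i" and n = "- c - 1"] by auto
  have z: "val vs (\<epsilon>' t) = 0" if t: "t \<ge> T" "\<epsilon>' t i = c - of_nat t" "\<forall>k>i. \<epsilon>' t k = \<epsilon> k" for t
  proof -
    have "seg vs (\<epsilon>' t) i r (vac U) = op i (vs i) (- (c - of_nat t) - 1) (seg vs (\<epsilon>' t) (Suc i) r (vac U))"
      using i t(2) by (simp add: seg_Cons)
    also have "seg vs (\<epsilon>' t) (Suc i) r (vac U) = ?w" by (rule seg_cong) (use t(3) in auto)
    also have "- (c - of_nat t) - 1 = - c - 1 + of_nat t" by simp
    finally have "seg vs (\<epsilon>' t) i r (vac U) = 0" using T[OF t(1)] by simp
    then show ?thesis using i vs vac_W0
      by (simp add: val_def seg_split[of 0 i r] seg_zero dual_lab0)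
  qed
  have "{t. val vs (\<epsilon>' t) \<noteq> 0 \<and> \<epsilon>' t i = c - of_nat t \<and> (\<forall>k>i. \<epsilon>' t k = \<epsilon> k)} \<subseteq> {..<T}"
  proof
    fix t assume "t \<in> {t. val vs (\<epsilon>' t) \<noteq> 0 \<and> \<epsilon>' t i = c - of_nat t \<and> (\<forall>k>i. \<epsilon>' t k = \<epsilon> k)}"
    then show "t \<in> {..<T}" using z[of t] by (cases "T \<le> t") auto
  qed
  then show ?thesis by (rule finite_subset) simp
qed

lemma gbinomial_neg_Suc:
  "((- of_nat m - 1 :: complex) gchoose t) = (- 1) ^ t * of_nat ((m + t) choose t)"
  by (subst gbinomial_negated_upper) (simp add: binomial_gbinomial add.commute)

end

context insertions
begin

text \<open>
  These three are the exponents and the coefficient of \<open>exa\<close>, \<open>exb\<close> and \<open>kcoef\<close>, with positions in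
  place of variables: the \<open>t\<close>-th term of \<open>\<partial>\<^sup>m \<partial>\<^sup>j (q\<^sub>i\<^sub>0 - q\<^sub>i)^(-1) / (m! j!)\<close>.
\<close>

definition ka :: "nat \<Rightarrow> nat \<Rightarrow> nat \<Rightarrow> complex" where
  "ka i0 i t = (if i0 < i then - of_nat t - 1 else of_nat t)"

definition kb :: "nat \<Rightarrow> nat \<Rightarrow> nat \<Rightarrow> complex" where
  "kb i0 i t = (if i0 < i then of_nat t else - of_nat t - 1)"

definition kco :: "nat \<Rightarrow> nat \<Rightarrow> nat \<Rightarrow> nat \<Rightarrow> nat \<Rightarrow> complex" where
  "kco i0 i m j t = (if i0 < i then 1 else - 1) * (ka i0 i t gchoose m) * (kb i0 i t gchoose j)"

definition ksh :: "nat \<Rightarrow> nat \<Rightarrow> nat \<Rightarrow> nat \<Rightarrow> nat \<Rightarrow> (nat \<Rightarrow> complex) \<Rightarrow> nat \<Rightarrow> complex" where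
  "ksh i0 i m j t \<epsilon> = \<epsilon>(i0 := \<epsilon> i0 - ka i0 i t + of_nat m, i := \<epsilon> i - kb i0 i t + of_nat j)"

lemma val_kernel_finite:
  assumes vs: "\<And>i. vs i \<in> W (la i)" and i: "i0 < r" "i < r" "i \<noteq> i0"
  shows "finite {t. val (ins vs i (int j)) (ksh i0 i m j t \<epsilon>) \<noteq> 0}"
proof (cases "i0 < i")
  case True
  show ?thesis
    by (rule finite_subset[OF _ val_finite[where vs = "ins vs i (int j)", OF ins_mem[OF vs] i(2), where \<epsilon>' = "\<lambda>t. ksh i0 i m j t \<epsilon>"
        and c = "\<epsilon> i + of_nat j" and \<epsilon> = \<epsilon>]]) (use True in \<open>auto simp: ksh_def kb_def\<close>)
next
  case False
  show ?thesis
    by (rule finite_subset[OF _ val_finite[where vs = "ins vs i (int j)", OF ins_mem[OF vs] i(1), where \<epsilon>' = "\<lambda>t. ksh i0 i m j t \<epsilon>"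
        and c = "\<epsilon> i0 + of_nat m" and \<epsilon> = \<epsilon>]]) (use False i(3) in \<open>auto simp: ksh_def ka_def\<close>)
qed

lemma minus_one_powi_neg: "(- 1 :: complex) powi (- int m - 1) = - ((- 1) ^ m)"
proof -
  have "(- 1 :: complex) powi (- int (Suc m)) = inverse ((- 1) ^ Suc m)"
    by (simp only: power_int_minus power_int_of_nat)
  also have "\<dots> = - ((- 1) ^ m)" by (cases "even m") simp_all
  also have "- int (Suc m) = - int m - 1" by simp
  finally show ?thesis .
qed

lemma Sum_any_shift:
  fixes f :: "nat \<Rightarrow> complex"
  assumes "\<And>t. t < m \<Longrightarrow> f t = 0" "\<And>t. T + m \<le> t \<Longrightarrow> f t = 0"
  shows "Sum_any f = (\<Sum>t<T. f (t + m))"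
proof -
  have "Sum_any f = (\<Sum>t\<in>{m..<T + m}. f t)"
    by (rule Sum_any.expand_superset, simp, rule subsetI, rule ccontr) (use assms in \<open>auto simp: not_less\<close>)
  also have "\<dots> = (\<Sum>t<T. f (t + m))"
    using sum.shift_bounds_nat_ivl[of f 0 m T] by (simp add: lessThan_atLeast0)
  finally show ?thesis .
qed

text \<open>
  A mode of index \<open>- m - 1\<close> at the insertion \<open>i0\<close> is an \<open>m\<close>-th Taylor coefficient of \<open>Y(x, z)\<close> there. By
  the iterate formula it is a sum of terms with a mode of \<open>x\<close> immediately to the left of this
  operator and terms with one immediately to its right. The former have negative index and are moved to
  the left vacuum, the latter have non-negative index and are moved to the right vacuum; both are
  annihilated there. The commutators collected on the way are the singular parts at the other
  insertions, weighted by the expansion of \<open>(q\<^sub>i\<^sub>0 - q\<^sub>i)^(-1)\<close> that suits the relative position.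
\<close>

lemma val_negative_mode:
  assumes vs: "\<And>i. vs i \<in> W (la i)" and i0: "i0 < r"
    and J: "\<And>i j. i < r \<Longrightarrow> J \<le> j \<Longrightarrow> act (la i) x (int j) (vs i) = 0"
  shows "val (ins vs i0 (- int m - 1)) \<epsilon> = (\<Sum>i\<in>{..<r} - {i0}. \<Sum>j<J.
     Sum_any (\<lambda>t. kco i0 i m j t * val (ins vs i (int j)) (ksh i0 i m j t \<epsilon>)))"
proof -
  define l where "l = - int m - 1"
  define n where "n = - \<epsilon> i0 - 1"
  define \<psi> where "\<psi> = seg vs \<epsilon> (Suc i0) r (vac U)"
  define pre where "pre = (\<lambda>\<phi>. P (lab0 M) (vac U) (seg vs \<epsilon> 0 i0 \<phi>))"
  let ?i1 = "Suc i0"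
  let ?V = "\<lambda>i j t. val (ins vs i (int j)) (ksh i0 i m j t \<epsilon>)"
  have \<psi>: "\<psi> \<in> W (mu ?i1)" unfolding \<psi>_def by (rule seg_mem[OF _ vac_W]) (use i0 vs in auto)
  have segW: "seg vs \<epsilon> 0 i0 \<phi> \<in> W (lab0 M)" if "\<phi> \<in> W (mu i0)" for \<phi>
    using seg_mem[OF _ that, of 0 vs \<epsilon>] vs by (simp add: mu_0)
  have pre_add: "pre (\<phi> + \<phi>') = pre \<phi> + pre \<phi>'" if "\<phi> \<in> W (mu i0)" "\<phi>' \<in> W (mu i0)" for \<phi> \<phi>'
    using that vs segW by (simp add: pre_def seg_add P_vac_add)
  have pre_scale: "pre (scl U c \<phi>) = c * pre \<phi>" if "\<phi> \<in> W (mu i0)" for \<phi> c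
    using that vs segW by (simp add: pre_def seg_scale P_vac_scale)
  have pre_zero: "pre 0 = 0" using pre_scale[of 0 0] by simp
  have pre_sum: "pre (sum f A) = (\<Sum>t\<in>A. pre (f t))" if "\<And>t. t \<in> A \<Longrightarrow> f t \<in> W (mu i0)" for f and A :: "nat set"
    using that vs segW by (simp add: pre_def seg_sum P_vac_sum)
  have val_pre: "val vs' \<epsilon>' = P (lab0 M) (vac U) (seg vs' \<epsilon>' 0 i0 (op i0 (vs' i0) (- \<epsilon>' i0 - 1) (seg vs' \<epsilon>' ?i1 r (vac U))))"
    for vs' \<epsilon>'
    by (simp only: val_def seg_split[of 0 i0 r, OF le0 less_imp_le[OF i0]] seg_Cons[OF i0])
  have opW: "op i0 (vs i0) k \<phi> \<in> W (mu i0)" if "\<phi> \<in> W (mu ?i1)" for k \<phi> using that vs by (simp add: I_mem)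

  have "finite (\<Union>i\<in>{..<r} - {i0}. \<Union>j<J. {t. ?V i j t \<noteq> 0})"
    using val_kernel_finite[OF vs i0] by auto
  then obtain T1 where "(\<Union>i\<in>{..<r} - {i0}. \<Union>j<J. {t. ?V i j t \<noteq> 0}) \<subseteq> {..<T1}"
    using finite_nat_iff_bounded by blast
  then have T1: "?V i j t = 0" if "i < r" "i \<noteq> i0" "j < J" "T1 \<le> t" for i j t
    using that by (fastforce simp: not_less[symmetric])
  obtain T2 where T2: "\<And>t. T2 \<le> t \<Longrightarrow> op i0 (vs i0) (n + of_nat t) \<psi> = 0"
    using I_trunc[OF vs \<psi>, where \<gamma> = "mu i0" and n = n] by blast
  obtain T3 where T3: "\<And>t. T3 \<le> t \<Longrightarrow> act (mu ?i1) x (int t) \<psi> = 0"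
    using act_trunc[OF xc \<psi>] by blast
  \<comment> \<open>All three kinds of terms vanish from \<open>T\<close> on: by truncation at the other insertions, at \<open>i0\<close>, and of \<open>x\<close>.\<close>
  define T where "T = max T1 (max T2 T3)"
  let ?X = "\<lambda>t. act (mu i0) x (l - int t) (op i0 (vs i0) (n + of_nat t) \<psi>)"
  let ?Y = "\<lambda>t. op i0 (vs i0) (n + of_int l - of_nat t) (act (mu ?i1) x (int t) \<psi>)"
  have XW: "?X t \<in> W (mu i0)" and YW: "?Y t \<in> W (mu i0)" for t
    using \<psi> by (simp_all add: act_mem xc opW)

  have "seg (ins vs i0 l) \<epsilon> ?i1 r (vac U) = \<psi>" unfolding \<psi>_def by (rule seg_cong) auto
  moreover have "seg (ins vs i0 l) \<epsilon> 0 i0 s = seg vs \<epsilon> 0 i0 s" for s by (rule seg_cong) auto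
  ultimately have "val (ins vs i0 l) \<epsilon> = pre (op i0 (act (la i0) x l (vs i0)) n \<psi>)"
    by (simp add: val_pre pre_def n_def)
  also have "op i0 (act (la i0) x l (vs i0)) n \<psi>
      = Sum_any (\<lambda>t::nat. scl U ((- 1) ^ t * (of_int l gchoose t)) (?X t - scl U ((- 1) powi l) (?Y t)))"
    by (rule I_iterate[OF xc vs \<psi>])
  also have "\<dots> = (\<Sum>t<T. scl U ((- 1) ^ t * (of_int l gchoose t)) (?X t - scl U ((- 1) powi l) (?Y t)))"
  proof (rule Sum_any.expand_superset, simp, rule subsetI, rule ccontr)
    fix t assume t: "t \<in> {t. scl U ((- 1) ^ t * (of_int l gchoose t)) (?X t - scl U ((- 1) powi l) (?Y t)) \<noteq> 0}" "t \<notin> {..<T}"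
    then have "?X t = 0" "?Y t = 0" using T2[of t] T3[of t] xc vs by (auto simp: T_def)
    then show False using t(1) by simp
  qed
  also have "pre \<dots> = (\<Sum>t<T. (- 1) ^ t * (of_int l gchoose t) * (pre (?X t) + (- 1) ^ m * pre (?Y t)))"
  proof -
    have e: "scl U a (?X t - scl U ((- 1) powi l) (?Y t)) = scl U a (?X t + scl U ((- 1) ^ m) (?Y t))" for a t
      by (simp add: l_def minus_one_powi_neg)
    show ?thesis unfolding e using XW YW by (simp add: pre_sum pre_scale pre_add W_add W_scale)
  qed
  also have "\<dots> = (\<Sum>t<T. (- 1) ^ t * (of_int l gchoose t) * pre (?X t)) + (\<Sum>t<T. (- 1) ^ t * (of_int l gchoose t) * ((- 1) ^ m * pre (?Y t)))"
    by (simp add: distrib_left sum.distrib)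
  also have "(\<Sum>t<T. (- 1) ^ t * (of_int l gchoose t) * pre (?X t))
     = (\<Sum>i<i0. \<Sum>j<J. Sum_any (\<lambda>t. kco i0 i m j t * ?V i j t))"
  proof -
    \<comment> \<open>The mode has index \<open>l - t < 0 \<le> 2N - 2\<close>, so it vanishes next to the left vacuum.\<close>
    have preX: "pre (?X t) = (\<Sum>i<i0. \<Sum>j<J. - (of_int (l - int t) gchoose j) * ?V i j (t + m))" for t
    proof -
      let ?\<chi> = "op i0 (vs i0) (n + of_nat t) \<psi>" and ?k = "l - int t"
      let ?S = "\<lambda>i j. seg (ins vs i (int j)) (\<epsilon>(i := \<epsilon> i - of_int ?k + of_nat j)) 0 i0 ?\<chi>"
      have \<chi>: "?\<chi> \<in> W (mu i0)" by (rule opW[OF \<psi>])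
      have SW: "?S i j \<in> W (lab0 M)" for i j
        using seg_mem[OF _ \<chi>, of 0 "ins vs i (int j)"] ins_mem[OF vs] by (simp add: mu_0)
      have PS: "P (lab0 M) (vac U) (?S i j) = ?V i j (t + m)" if i: "i < i0" for i j
      proof -
        have "seg (ins vs i (int j)) (ksh i0 i m j (t + m) \<epsilon>) ?i1 r (vac U) = \<psi>"
          unfolding \<psi>_def by (rule seg_cong) (use i in \<open>auto simp: ksh_def\<close>)
        moreover have "seg (ins vs i (int j)) (ksh i0 i m j (t + m) \<epsilon>) 0 i0 s
          = seg (ins vs i (int j)) (\<epsilon>(i := \<epsilon> i - of_int ?k + of_nat j)) 0 i0 s" for s
          by (rule seg_cong) (use i in \<open>auto simp: ksh_def kb_def l_def\<close>)
        moreover have "- ksh i0 i m j (t + m) \<epsilon> i0 - 1 = n + of_nat t"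
          using i by (simp add: ksh_def ka_def n_def)
        ultimately show ?thesis using i by (simp add: val_pre)
      qed
      have "act (mu 0) x ?k (seg vs \<epsilon> 0 i0 ?\<chi>) = seg vs \<epsilon> 0 i0 (act (mu i0) x ?k ?\<chi>)
         + (\<Sum>i=0..<i0. \<Sum>j<J. scl U (of_int ?k gchoose j) (?S i j))"
        by (rule seg_commutator[OF _ \<chi> vs]) (use J i0 in auto)
      then have "P (lab0 M) (vac U) (act (lab0 M) x ?k (seg vs \<epsilon> 0 i0 ?\<chi>))
         = P (lab0 M) (vac U) (seg vs \<epsilon> 0 i0 (act (mu i0) x ?k ?\<chi>)
         + (\<Sum>i=0..<i0. \<Sum>j<J. scl U (of_int ?k gchoose j) (?S i j)))"
        by (simp only: mu_0)
      also have "\<dots> = pre (?X t) + (\<Sum>i=0..<i0. \<Sum>j<J. (of_int ?k gchoose j) * P (lab0 M) (vac U) (?S i j))"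
        using SW segW XW by (simp add: P_vac_add P_vac_sum P_vac_scale W_sum W_scale pre_def)
      finally have "pre (?X t) + (\<Sum>i=0..<i0. \<Sum>j<J. (of_int ?k gchoose j) * P (lab0 M) (vac U) (?S i j)) = 0"
        using P_vac_mode[OF xw xq segW[OF \<chi>], of ?k] N by (simp add: l_def)
      then have "pre (?X t) = (\<Sum>i=0..<i0. \<Sum>j<J. - (of_int ?k gchoose j) * P (lab0 M) (vac U) (?S i j))"
        by (simp add: sum_negf eq_neg_iff_add_eq_0)
      also have "\<dots> = (\<Sum>i<i0. \<Sum>j<J. - (of_int ?k gchoose j) * ?V i j (t + m))"
        unfolding lessThan_atLeast0[of i0] by (intro sum.cong refl) (auto simp only: PS atLeastLessThan_iff)
      finally show ?thesis .
    qed
    \<comment> \<open>A negated upper index: \<open>(- 1)^t (- m - 1 choose t) = (m + t choose m)\<close>.\<close>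
    have c: "(- 1) ^ t * (of_int l gchoose t) * - (of_int (l - int t) gchoose j) = kco i0 i m j (t + m)"
      if "i < i0" for i j t
    proof -
      have e: "complex_of_int l = - of_nat m - 1" "complex_of_int (l - int t) = - of_nat (t + m) - 1"
        by (simp_all add: l_def)
      have "((of_nat (t + m) :: complex) gchoose m) = of_nat ((m + t) choose t)"
        using binomial_symmetric[of m "t + m"] by (simp add: add.commute flip: binomial_gbinomial of_nat_add)
      then have "(- 1) ^ t * (of_int l gchoose t) = ((of_nat (t + m) :: complex) gchoose m)"
        unfolding e gbinomial_neg_Suc by (simp flip: mult.assoc power_add)
      then show ?thesis using that unfolding kco_def ka_def kb_def e by simp
    qed
    have "(\<Sum>t<T. (- 1) ^ t * (of_int l gchoose t) * pre (?X t))
      = (\<Sum>t<T. \<Sum>i<i0. \<Sum>j<J. kco i0 i m j (t + m) * ?V i j (t + m))"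
      unfolding preX sum_distrib_left
    proof (intro sum.cong refl)
      fix t i j assume "i \<in> {..<i0}"
      then have "i < i0" by simp
      from c[OF this, of t j] show "(- 1) ^ t * (of_int l gchoose t) * (- (of_int (l - int t) gchoose j) * ?V i j (t + m))
        = kco i0 i m j (t + m) * ?V i j (t + m)" by (simp only: mult.assoc[symmetric])
    qed
    also have "\<dots> = (\<Sum>i<i0. \<Sum>j<J. \<Sum>t<T. kco i0 i m j (t + m) * ?V i j (t + m))"
      by (subst sum.swap, intro sum.cong refl sum.swap)
    also have "\<dots> = (\<Sum>i<i0. \<Sum>j<J. Sum_any (\<lambda>t. kco i0 i m j t * ?V i j t))"
    proof (intro sum.cong refl Sum_any_shift[symmetric])
      fix i j t assume i: "i \<in> {..<i0}" "j \<in> {..<J}"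
      show "kco i0 i m j t * ?V i j t = 0" if "t < m"
        using i that by (simp add: kco_def ka_def flip: binomial_gbinomial)
      show "kco i0 i m j t * ?V i j t = 0" if "T + m \<le> t"
        using T1[of i j t] i i0 that by (simp add: T_def)
    qed
    finally show ?thesis .
  qed
  also have "(\<Sum>t<T. (- 1) ^ t * (of_int l gchoose t) * ((- 1) ^ m * pre (?Y t)))
     = (\<Sum>i=Suc i0..<r. \<Sum>j<J. Sum_any (\<lambda>t. kco i0 i m j t * ?V i j t))"
  proof -
    \<comment> \<open>The mode has index \<open>t \<ge> 0\<close>, so it annihilates the right vacuum.\<close>
    have preY: "pre (?Y t) = (\<Sum>i=Suc i0..<r. \<Sum>j<J. (of_nat t gchoose j) * ?V i j t)" for t
    proof -
      let ?S = "\<lambda>i j. seg (ins vs i (int j)) (\<epsilon>(i := \<epsilon> i - of_int (int t) + of_nat j)) ?i1 r (vac U)"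
      let ?k = "n + of_int l - of_nat t"
      have SW: "?S i j \<in> W (mu ?i1)" for i j
        by (rule seg_mem[OF _ vac_W]) (use i0 ins_mem[OF vs] in auto)
      have PS: "pre (op i0 (vs i0) ?k (?S i j)) = ?V i j t" if i: "i0 < i" for i j
      proof -
        have "seg (ins vs i (int j)) (ksh i0 i m j t \<epsilon>) ?i1 r (vac U) = ?S i j"
          by (rule seg_cong) (use i in \<open>auto simp: ksh_def kb_def\<close>)
        moreover have "seg (ins vs i (int j)) (ksh i0 i m j t \<epsilon>) 0 i0 s = seg vs \<epsilon> 0 i0 s" for s
          by (rule seg_cong) (use i in \<open>auto simp: ksh_def\<close>)
        moreover have "- ksh i0 i m j t \<epsilon> i0 - 1 = ?k"
          using i by (simp add: ksh_def ka_def n_def l_def)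
        ultimately show ?thesis using i by (simp add: val_pre pre_def)
      qed
      have "act (mu ?i1) x (int t) \<psi> = (\<Sum>i=?i1..<r. \<Sum>j<J. scl U (of_int (int t) gchoose j) (?S i j))"
        using seg_commutator[OF _ vac_W vs, of ?i1 J "int t" \<epsilon>] J i0 vs by (simp add: act_vac seg_zero \<psi>_def)
      then have "pre (?Y t) = pre (op i0 (vs i0) ?k (\<Sum>i=?i1..<r. \<Sum>j<J. scl U (of_int (int t) gchoose j) (?S i j)))"
        by (simp only:)
      also have "op i0 (vs i0) ?k (\<Sum>i=?i1..<r. \<Sum>j<J. scl U (of_int (int t) gchoose j) (?S i j))
        = (\<Sum>i=?i1..<r. \<Sum>j<J. scl U (of_int (int t) gchoose j) (op i0 (vs i0) ?k (?S i j)))"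
        using SW vs by (simp add: I_sum_right I_scale_right W_sum W_scale)
      also have "pre \<dots> = (\<Sum>i=?i1..<r. \<Sum>j<J. (of_int (int t) gchoose j) * pre (op i0 (vs i0) ?k (?S i j)))"
        using opW[OF SW] by (simp add: pre_sum pre_scale W_sum W_scale)
      also have "\<dots> = (\<Sum>i=?i1..<r. \<Sum>j<J. (of_nat t gchoose j) * ?V i j t)"
      proof (intro sum.cong refl)
        fix i j assume "i \<in> {?i1..<r}"
        then have "i0 < i" by simp
        then show "(of_int (int t) gchoose j) * pre (op i0 (vs i0) ?k (?S i j)) = (of_nat t gchoose j) * ?V i j t"
          by (simp only: PS) (simp only: of_int_of_nat_eq)
      qed
      finally show ?thesis .
    qed
    have c: "(- 1) ^ t * (of_int l gchoose t) * ((- 1) ^ m * (of_nat t gchoose j)) = kco i0 i m j t"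
      if "i0 < i" for i j t
    proof -
      have e: "complex_of_int l = - of_nat m - 1" by (simp add: l_def)
      have "((m + t) choose t) = ((t + m) choose m)"
        using binomial_symmetric[of m "t + m"] by (simp add: add.commute)
      then have "(- 1) ^ t * (of_int l gchoose t) * (- 1) ^ m = ((- of_nat t - 1 :: complex) gchoose m)"
        unfolding e gbinomial_neg_Suc by (simp add: mult.commute flip: mult.assoc power_add)
      then show ?thesis using that unfolding kco_def ka_def kb_def by (simp add: mult.assoc)
    qed
    have "(\<Sum>t<T. (- 1) ^ t * (of_int l gchoose t) * ((- 1) ^ m * pre (?Y t)))
      = (\<Sum>t<T. \<Sum>i=?i1..<r. \<Sum>j<J. kco i0 i m j t * ?V i j t)"
      unfolding preY sum_distrib_left
    proof (intro sum.cong refl)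
      fix t i j assume "i \<in> {?i1..<r}"
      then have "i0 < i" by simp
      from c[OF this, of t j] show "(- 1) ^ t * (of_int l gchoose t) * ((- 1) ^ m * ((of_nat t gchoose j) * ?V i j t))
        = kco i0 i m j t * ?V i j t" by (simp only: mult.assoc[symmetric])
    qed
    also have "\<dots> = (\<Sum>i=?i1..<r. \<Sum>j<J. \<Sum>t<T. kco i0 i m j t * ?V i j t)"
      by (subst sum.swap, intro sum.cong refl sum.swap)
    also have "\<dots> = (\<Sum>i=?i1..<r. \<Sum>j<J. Sum_any (\<lambda>t. kco i0 i m j t * ?V i j t))"
    proof (intro sum.cong refl)
      fix i j assume i: "i \<in> {?i1..<r}" "j \<in> {..<J}"
      have "Sum_any (\<lambda>t. kco i0 i m j t * ?V i j t) = (\<Sum>t<T. kco i0 i m j (t + 0) * ?V i j (t + 0))"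
        by (rule Sum_any_shift) (use T1[of i j] i in \<open>auto simp: T_def\<close>)
      then show "(\<Sum>t<T. kco i0 i m j t * ?V i j t) = Sum_any (\<lambda>t. kco i0 i m j t * ?V i j t)" by simp
    qed
    finally show ?thesis .
  qed
  also have "(\<Sum>i<i0. \<Sum>j<J. Sum_any (\<lambda>t. kco i0 i m j t * ?V i j t))
      + (\<Sum>i=Suc i0..<r. \<Sum>j<J. Sum_any (\<lambda>t. kco i0 i m j t * ?V i j t))
    = (\<Sum>i\<in>{..<r} - {i0}. \<Sum>j<J. Sum_any (\<lambda>t. kco i0 i m j t * ?V i j t))"
  proof -
    have e: "{..<r} - {i0} = {..<i0} \<union> {Suc i0..<r}" using i0 by auto
    show ?thesis unfolding e by (rule sum.union_disjoint[symmetric]) auto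
  qed
  finally show ?thesis by (simp only: l_def)
qed

lemma weight_lower_bound: "\<exists>B\<ge>0. \<forall>i\<le>r. (\<forall>c. \<forall>w\<in>Wt (la i) c. w \<noteq> 0 \<longrightarrow> - B \<le> Re c) \<and> (\<forall>c. \<forall>w\<in>Wt (mu i) c. w \<noteq> 0 \<longrightarrow> - B \<le> Re c)"
proof -
  have "\<exists>B. \<forall>c. \<forall>w\<in>Wt \<alpha> c. w \<noteq> 0 \<longrightarrow> B \<le> Re c" for \<alpha> by (rule weights_bounded_below)
  then obtain B where B: "\<And>\<alpha> c w. w \<in> Wt \<alpha> c \<Longrightarrow> w \<noteq> 0 \<Longrightarrow> B \<alpha> \<le> Re c" by metis
  define B0 where "B0 = (\<Sum>i\<le>r. \<bar>B (la i)\<bar> + \<bar>B (mu i)\<bar>)"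
  have b: "\<bar>B (la i)\<bar> \<le> B0" "\<bar>B (mu i)\<bar> \<le> B0" if "i \<le> r" for i
  proof -
    have "\<bar>B (la i)\<bar> + \<bar>B (mu i)\<bar> \<le> B0"
      unfolding B0_def by (rule member_le_sum) (use that in auto)
    then show "\<bar>B (la i)\<bar> \<le> B0" "\<bar>B (mu i)\<bar> \<le> B0" by auto
  qed
  have "- B0 \<le> Re c" if "i \<le> r" "w \<in> Wt (la i) c" "w \<noteq> 0" for i w c
    using b(1)[OF that(1)] B[OF that(2,3)] by linarith
  moreover have "- B0 \<le> Re c" if "i \<le> r" "w \<in> Wt (mu i) c" "w \<noteq> 0" for i w c
    using b(2)[OF that(1)] B[OF that(2,3)] by linarith
  moreover have "B0 \<ge> 0" by (auto simp: B0_def intro: sum_nonneg)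
  ultimately show ?thesis by blast
qed

text \<open>
  The vector obtained after the operators at positions \<open>\<ge> s\<close> is non-zero, so its weight is bounded
  below. The total weight being 0, this bounds the weight gained at the first \<open>s\<close> positions from
  above, and the weights of the inserted vectors are bounded below as well.
\<close>

lemma val_nonzero_bounds:
  assumes B: "\<And>i c w. i \<le> r \<Longrightarrow> w \<in> Wt (la i) c \<Longrightarrow> w \<noteq> 0 \<Longrightarrow> - B \<le> Re c"
      "\<And>i c w. i \<le> r \<Longrightarrow> w \<in> Wt (mu i) c \<Longrightarrow> w \<noteq> 0 \<Longrightarrow> - B \<le> Re c"
    and vs: "\<And>i. vs i \<in> W (la i)" "\<And>i. i < r \<Longrightarrow> vs i \<in> Wt (la i) (c i)"
    and ne: "val vs \<epsilon> \<noteq> 0" and s: "s \<le> r" and B0: "0 \<le> B"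
  shows "(\<Sum>i<s. Re (\<epsilon> i)) \<le> real (Suc r) * B" and "\<And>i. i < r \<Longrightarrow> vs i \<noteq> 0"
proof -
  show nz: "vs i \<noteq> 0" if i: "i < r" for i
  proof
    assume "vs i = 0"
    then have "seg vs \<epsilon> i r (vac U) = 0"
      using i seg_mem[OF _ vac_W, of "Suc i" vs \<epsilon>] vs by (simp add: seg_Cons)
    then have "val vs \<epsilon> = 0" using i vs vac_W0 by (simp add: val_def seg_split[of 0 i r] seg_zero dual_lab0)
    then show False using ne by simp
  qed
  have v0: "vac U \<in> Wt (mu r) 0"
    using vac_modes[OF conf_car, of 1] vac_W conf_car vac_car by (simp add: Wt_iff mu_r act_lab0)
  have w: "seg vs \<epsilon> a r (vac U) \<in> Wt (mu a) (\<Sum>i=a..<r. c i + \<epsilon> i)" if "a \<le> r" for a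
    using seg_weight[OF that v0, of vs c \<epsilon>] vs(2) by simp
  \<comment> \<open>A non-zero pairing with the vacuum forces the total weight to be 0.\<close>
  have tot: "(\<Sum>i=0..<r. c i + \<epsilon> i) = 0"
  proof -
    have "seg vs \<epsilon> 0 r (vac U) \<in> Wt (dual M (lab0 M)) (\<Sum>i=0..<r. c i + \<epsilon> i)"
      using w[of 0] by (simp add: mu_0 dual_lab0)
    moreover have "vac U \<in> Wt (lab0 M) 0" using v0 by (simp add: mu_r)
    ultimately show ?thesis using P_weight[of "vac U" "lab0 M" 0] ne unfolding val_def by metis
  qed
  have "seg vs \<epsilon> s r (vac U) \<noteq> 0"
    using ne s vs vac_W0 by (auto simp: val_def seg_split[of 0 s r] seg_zero dual_lab0)
  then have "- B \<le> Re (\<Sum>i=s..<r. c i + \<epsilon> i)" using B(2)[OF s w[OF s]] by simp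
  moreover have "(\<Sum>i=0..<r. c i + \<epsilon> i) = (\<Sum>i=0..<s. c i + \<epsilon> i) + (\<Sum>i=s..<r. c i + \<epsilon> i)"
    using s by (simp add: sum.atLeastLessThan_concat)
  then have "(\<Sum>i=0..<s. c i + \<epsilon> i) = - (\<Sum>i=s..<r. c i + \<epsilon> i)"
    unfolding tot by (simp only: eq_neg_iff_add_eq_0)
  ultimately have "Re (\<Sum>i=0..<s. c i + \<epsilon> i) \<le> B" by simp
  then have "(\<Sum>i<s. Re (c i)) + (\<Sum>i<s. Re (\<epsilon> i)) \<le> B"
    by (simp add: sum.distrib lessThan_atLeast0)
  moreover have "(\<Sum>i<s. - B) \<le> (\<Sum>i<s. Re (c i))"
  proof (rule sum_mono)
    fix i assume "i \<in> {..<s}"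
    then have i: "i < r" using s by simp
    show "- B \<le> Re (c i)" by (rule B(1)[OF less_imp_le[OF i] vs(2)[OF i] nz[OF i]])
  qed
  moreover have "real s * B \<le> real r * B" using s B0 by (intro mult_right_mono) auto
  ultimately show "(\<Sum>i<s. Re (\<epsilon> i)) \<le> real (Suc r) * B" by (simp add: algebra_simps)
qed

end

section \<open>Correlation forms with a mode at one insertion\<close>

text \<open>
  The order \<open>1, -1, 2, -2, \<dots>, g, -g\<close> of the points \<open>w\<^sub>a\<close>, and the position of \<open>w\<^sub>a\<close> in the whole chain.
\<close>

definition ws :: "nat \<Rightarrow> int" where
  "ws t = (if even t then int (t div 2 + 1) else - int (t div 2 + 1))"

definition wpos :: "nat \<Rightarrow> int \<Rightarrow> nat" where
  "wpos n a = n + (2 * (nat \<bar>a\<bar> - 1) + (if a < 0 then 1 else 0))"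

lemma posv_y: "i < n \<Longrightarrow> posv n i = Vy (Suc i)"
  by (simp add: posv_def)

lemma posv_w: "posv n (n + t) = Vw (ws t)"
  by (simp add: posv_def ws_def)

lemma ws_simps: "ws (2 * k) = int (Suc k)" "ws (Suc (2 * k)) = - int (Suc k)"
  by (simp_all add: ws_def)

lemma ws_wpos: "a \<noteq> 0 \<Longrightarrow> ws (wpos n a - n) = a"
  by (cases "a < 0") (auto simp: wpos_def ws_def)

lemma wpos_ge: "n \<le> wpos n a"
  by (simp add: wpos_def)

lemma posv_wpos: "a \<noteq> 0 \<Longrightarrow> posv n (wpos n a) = Vw a"
  using posv_w[of n "wpos n a - n"] wpos_ge[of n a] by (simp add: ws_wpos)

lemma wpos_less: "a \<in> Iset g \<Longrightarrow> wpos n a < n + 2 * g"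
  by (auto simp: wpos_def Iset_def)

lemma wpos_ws: "wpos n (ws t) = n + t"
proof (cases "even t")
  case True
  then obtain k where "t = 2 * k" by blast
  then show ?thesis by (simp add: ws_simps wpos_def nat_add_distrib)
next
  case False
  then obtain k where "t = Suc (2 * k)" by (auto elim: oddE)
  then show ?thesis by (simp add: ws_simps wpos_def nat_add_distrib)
qed

lemma ws_Iset: "t < 2 * g \<Longrightarrow> ws t \<in> Iset g"
  by (auto simp: ws_def Iset_def)

lemma sum_wpos: "(\<Sum>i=n..<n + 2 * g. f i) = (\<Sum>a\<in>Iset g. f (wpos n a))"
proof -
  have "bij_betw (wpos n) (Iset g) {n..<n + 2 * g}"
  proof (rule bij_betwI[where g = "\<lambda>i. ws (i - n)"])
    show "wpos n \<in> Iset g \<rightarrow> {n..<n + 2 * g}" using wpos_less wpos_ge by auto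
    show "(\<lambda>i. ws (i - n)) \<in> {n..<n + 2 * g} \<rightarrow> Iset g" using ws_Iset by auto
    show "ws (wpos n a - n) = a" if "a \<in> Iset g" for a using that by (auto simp: ws_wpos Iset_def)
    show "wpos n (ws (i - n)) = i" if "i \<in> {n..<n + 2 * g}" for i using that by (simp add: wpos_ws)
  qed
  then show ?thesis by (rule sum.reindex_bij_betw[symmetric])
qed

lemma concat_pairs: "concat (map (\<lambda>a. [f (2 * a), f (Suc (2 * a))]) [0..<g]) = map f [0..<2 * g]"
  by (induction g) simp_all

locale genus_forms = module_family U M
  for U :: "('v::ab_group_add) voa" and M :: "('l, 'v) voa_modules" +
  fixes G :: "('l, 'v) genus_data" and n :: nat and \<gamma> \<delta> :: "nat \<Rightarrow> 'l" and v :: "nat \<Rightarrow> 'v"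
    and N :: nat and x :: 'v
  assumes N: "1 \<le> N" and xw: "x \<in> wtsp U (car U) (mode U) (of_nat N)" and xq: "Lop U (mode U) 1 x = 0"
    and g1: "1 \<le> genus G" and vm: "\<And>k. k \<in> {1..n} \<Longrightarrow> v k \<in> mcar M (\<gamma> k)"
    and \<delta>0: "\<delta> 0 = lab0 M" and \<delta>n: "\<delta> n = lab0 M"
    and be0: "be G 0 = lab0 M" and be2g: "be G (2 * genus G) = lab0 M"
    and bases: "homogeneous_dual_bases U M G"
begin

abbreviation g :: nat where "g \<equiv> genus G"
abbreviation r :: nat where "r \<equiv> n + 2 * genus G"

definition la :: "nat \<Rightarrow> 'l" where
  "la i = (if i < n then \<gamma> (Suc i) else wlab M G (ws (i - n)))"

definition mu :: "nat \<Rightarrow> 'l" where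
  "mu i = (if i \<le> n then \<delta> i else be G (i - n))"

lemma mu_w: "mu (n + t) = be G t"
  by (simp add: mu_def \<delta>n be0)

sublocale insertions U M la mu r N x
  by unfold_locales (use N xw xq g1 \<delta>0 be2g mu_w[of "2 * genus G"] in \<open>simp_all add: mu_def\<close>)

definition vecs :: "(nat \<Rightarrow> 'v) \<Rightarrow> (int \<Rightarrow> 'v) \<Rightarrow> fexp \<Rightarrow> nat \<Rightarrow> 'v" where
  "vecs v' bv e i = (if i < n then wcomp U (md M (\<gamma> (Suc i))) (e (Vdy (Suc i))) (v' (Suc i))
     else if i < r then bv (ws (i - n)) else 0)"

definition pexp :: "fexp \<Rightarrow> nat \<Rightarrow> complex" where
  "pexp e i = e (posv n i)"

definition bset :: "fexp \<Rightarrow> (nat \<Rightarrow> 'v) set" where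
  "bset e = (\<Pi>\<^sub>E a\<in>{1..g}. bas G a \<inter> Wt (al G a) (e (Vrho a)))"

lemma y_w_part: "chain M (y_part U M n \<gamma> \<delta> v' e @ w_part M G bv e) s = seg (vecs v' bv e) (pexp e) 0 r s"
proof -
  let ?f = "ent (vecs v' bv e) (pexp e)"
  have "y_part U M n \<gamma> \<delta> v' e = map ?f [0..<n]"
  proof -
    have "[1..<n + 1] = map Suc [0..<n]" by (simp add: map_Suc_upt)
    then show ?thesis
      by (simp add: y_part_def ent_def vecs_def la_def mu_def pexp_def posv_y)
  qed
  moreover have "w_part M G bv e = map (\<lambda>t. ?f (n + t)) [0..<2 * g]"
  proof -
    have "[1..<g + 1] = map Suc [0..<g]" by (simp add: map_Suc_upt)
    then have "w_part M G bv e = concat (map (\<lambda>k. [?f (n + 2 * k), ?f (n + Suc (2 * k))]) [0..<g])"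
      unfolding w_part_def by (auto simp: ent_def vecs_def la_def mu_w pexp_def posv_w ws_simps
          simp flip: add_Suc_right intro!: arg_cong[where f = concat])
    also have "\<dots> = map (\<lambda>t. ?f (n + t)) [0..<2 * g]"
      by (rule concat_pairs[of "\<lambda>t. ?f (n + t)"])
    finally show ?thesis .
  qed
  moreover have "[0..<r] = [0..<n] @ map (\<lambda>t. n + t) [0..<2 * g]"
    using map_add_upt[of n "2 * g"] upt_add_eq_append[of 0 n "2 * g"] by (simp add: add.commute)
  ultimately show ?thesis by (simp add: seg_def o_def)
qed

lemma corr_val:
  "corr U M G n \<gamma> \<delta> v' F T e = (\<Sum>b\<in>bset e. P (lab0 M) (vac U) (F (seg (vecs v' (T (wvec G b)) e) (pexp e) 0 r (vac U))))"
  unfolding corr_def y_w_part bset_def ..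

text \<open>
  The correlation form with \<open>x(j) v\<^sub>i\<close> in place of the vector at position \<open>i\<close>, for any integer \<open>j\<close>. The
  exponents of the \<open>dy\<^sub>k\<close> and \<open>\<rho>\<^sub>a\<close> remain the weights of the vectors before \<open>x(j)\<close> is applied.
\<close>

definition Ins :: "nat \<Rightarrow> int \<Rightarrow> fser" where
  "Ins i j = (\<lambda>e. if supported (corr_vars g n) e
     then \<Sum>b\<in>bset e. val (ins (vecs v (wvec G b) e) i j) (pexp e) else 0)"

lemma dual_bases_G: "a \<in> {1..g} \<Longrightarrow> dual_bases (al G a) (bas G a) (dbas G a)"
  using bases unfolding homogeneous_dual_bases_def dual_bases_def by blast

lemma finite_bset: "finite (bset e)"
  unfolding bset_def by (rule finite_PiE[OF finite_atLeastAtMost basis_finite[OF dual_bases_G]])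

lemma wvec_weight:
  assumes b: "b \<in> bset e" and a: "a \<in> Iset g"
  shows "wvec G b a \<in> Wt (wlab M G a) (e (Vrho (nat \<bar>a\<bar>)))"
proof -
  have a': "nat \<bar>a\<bar> \<in> {1..g}" using a by (auto simp: Iset_def)
  then have m: "b (nat \<bar>a\<bar>) \<in> bas G (nat \<bar>a\<bar>) \<inter> Wt (al G (nat \<bar>a\<bar>)) (e (Vrho (nat \<bar>a\<bar>)))"
    using b unfolding bset_def by (rule PiE_mem[rotated])
  show ?thesis
  proof (cases "a > 0")
    case True
    then show ?thesis using m by (simp add: wvec_def wlab_def)
  next
    case False
    then have "nat \<bar>a\<bar> = nat (- a)" by simp
    with False dual_weight[OF dual_bases_G[OF a'] m] show ?thesis
      by (simp add: wvec_def wlab_def)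
  qed
qed

lemma vecs_weight:
  assumes b: "b \<in> bset e" and i: "i < r"
  shows "vecs v (wvec G b) e i \<in> Wt (la i) (if i < n then e (Vdy (Suc i)) else e (Vrho (nat \<bar>ws (i - n)\<bar>)))"
proof (cases "i < n")
  case True
  then show ?thesis using wcomp_mem[OF vm[of "Suc i"]] by (simp add: vecs_def la_def)
next
  case False
  then have "ws (i - n) \<in> Iset g" using i by (intro ws_Iset) auto
  from wvec_weight[OF b this] False i show ?thesis by (simp add: vecs_def la_def)
qed

lemma vecs_mem:
  assumes b: "b \<in> bset e" shows "vecs v (wvec G b) e i \<in> W (la i)"
proof (cases "i < r")
  case True
  then show ?thesis using vecs_weight[OF b True] Wt_mem by blast
next
  case False
  then show ?thesis by (simp add: vecs_def)
qed

lemma ins_weight: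
  assumes b: "b \<in> bset e" and i: "i < r"
  shows "act (la i) x j (vecs v (wvec G b) e i)
    \<in> Wt (la i) (of_nat N + (if i < n then e (Vdy (Suc i)) else e (Vrho (nat \<bar>ws (i - n)\<bar>))) - of_int j - 1)"
  by (rule act_weight[OF xw vecs_weight[OF b i]])

text \<open>
  For a given monomial only finitely many basis vectors are involved, whence a common bound.
\<close>

lemma modes_vanish: "\<exists>J. \<forall>b\<in>bset e. \<forall>i<r. \<forall>j\<ge>J. act (la i) x (int j) (vecs v (wvec G b) e i) = 0"
proof -
  have "\<exists>J. \<forall>j\<ge>J. act (la i) x (int j) (vecs v (wvec G b) e i) = 0" if "b \<in> bset e" for b i
    by (rule act_trunc[OF xc vecs_mem[OF that]])
  then obtain J where J: "\<And>b i j. b \<in> bset e \<Longrightarrow> J b i \<le> j \<Longrightarrow> act (la i) x (int j) (vecs v (wvec G b) e i) = 0"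
    by metis
  define J0 where "J0 = (\<Sum>p\<in>bset e \<times> {..<r}. J (fst p) (snd p))"
  have "J b i \<le> J0" if "b \<in> bset e" "i < r" for b i
    using member_le_sum[of "(b, i)" "bset e \<times> {..<r}" "\<lambda>p. J (fst p) (snd p)"] that finite_bset
    by (simp add: J0_def)
  then show ?thesis using J by (meson order_trans)
qed

lemma val_zero_vec:
  assumes b: "\<And>i. vs i \<in> W (la i)" and i: "i < r" "vs i = 0"
  shows "val vs \<epsilon> = 0"
proof -
  have "seg vs \<epsilon> i r (vac U) = 0"
    using i seg_mem[OF _ vac_W, of "Suc i" vs \<epsilon>] b by (simp add: seg_Cons)
  then show ?thesis using i b vac_W0
    by (simp add: val_def seg_split[of 0 i r] seg_zero dual_lab0)
qed

text \<open>
  The basis vectors involved depend only on the exponents of the \<open>\<rho>\<^sub>a\<close> and \<open>dy\<^sub>k\<close>, so the bound is uniform in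
  the exponents of the insertion points, along which the kernels spread.
\<close>

lemma Ins_large:
  "\<exists>J. \<forall>j\<ge>J. \<forall>i<r. \<forall>e'. (\<forall>a. e' (Vrho a) = e (Vrho a)) \<and> (\<forall>k. e' (Vdy k) = e (Vdy k)) \<longrightarrow> Ins i (int j) e' = 0"
proof -
  obtain J where J: "\<And>b i j. b \<in> bset e \<Longrightarrow> i < r \<Longrightarrow> J \<le> j \<Longrightarrow> act (la i) x (int j) (vecs v (wvec G b) e i) = 0"
    using modes_vanish[of e] by blast
  have "Ins i (int j) e' = 0" if "J \<le> j" "i < r" "\<forall>a. e' (Vrho a) = e (Vrho a)" "\<forall>k. e' (Vdy k) = e (Vdy k)" for i j e'
  proof -
    have [simp]: "bset e' = bset e" "vecs v bv e' = vecs v bv e" for bv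
      using that(3,4) by (auto simp: bset_def vecs_def fun_eq_iff)
    have "val (ins (vecs v (wvec G b) e) i (int j)) \<epsilon> = 0" if b: "b \<in> bset e" for b \<epsilon>
      by (rule val_zero_vec[OF ins_mem[OF vecs_mem[OF b]] \<open>i < r\<close>]) (use J[OF b \<open>i < r\<close> \<open>J \<le> j\<close>] in simp)
    then show ?thesis by (simp add: Ins_def)
  qed
  then show ?thesis by blast
qed

lemma pexp_upd: "pexp (e(posv n i := c)) = (pexp e)(i := c)"
  by (auto simp: pexp_def fun_eq_iff)

lemma posv_corr: "i < r \<Longrightarrow> posv n i \<in> corr_vars g n"
  by (rule posv_in_vars)

lemma supported_upd: "p \<in> S \<Longrightarrow> supported S (e(p := c)) = supported S e"
  by (auto simp: supported_def)

lemma bset_upd [simp]: "bset (e(posv n i := c)) = bset e" "bset (e(Vx := c)) = bset e"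
    "bset (e(Vdx := c)) = bset e" "bset (e(Vdy k := c)) = bset e"
  by (auto simp: bset_def)

lemma vecs_upd [simp]: "vecs v' bv (e(posv n i := c)) = vecs v' bv e" "vecs v' bv (e(Vx := c)) = vecs v' bv e"
    "vecs v' bv (e(Vdx := c)) = vecs v' bv e" "vecs v' bv (e(Vrho a := c)) = vecs v' bv e"
  by (auto simp: vecs_def fun_eq_iff)

lemma pexp_upd' [simp]: "pexp (e(Vx := c)) = pexp e" "pexp (e(Vdx := c)) = pexp e"
    "pexp (e(Vdy k := c)) = pexp e" "pexp (e(Vrho a := c)) = pexp e"
  by (auto simp: pexp_def fun_eq_iff)

text \<open>
  The residue theorem for \<open>z^l\<close>, which at infinity decays fast enough because the form behaves like
  \<open>z^(-2N)\<close>. This freedom allows \<open>1 / (x - y)\<close> to be replaced by \<open>\<pi>\<^sub>N(x, y)\<close>.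
\<close>

lemma moments_zero:
  assumes l: "l \<in> Lset N"
  shows "(\<Sum>i<r. \<Sum>j\<le>l. cmul (of_nat (l choose j)) (mon (posv n i) (of_nat l - of_nat j) \<circledast> Ins i (int j))) = 0"
proof
  fix e :: fexp
  have l2: "int l \<le> 2 * int N - 2" using l N by auto
  show "(\<Sum>i<r. \<Sum>j\<le>l. cmul (of_nat (l choose j)) (mon (posv n i) (of_nat l - of_nat j) \<circledast> Ins i (int j))) e = 0 e"
  proof (cases "supported (corr_vars g n) e")
    case True
    obtain J0 where J0: "\<And>b i j. b \<in> bset e \<Longrightarrow> i < r \<Longrightarrow> J0 \<le> j \<Longrightarrow> act (la i) x (int j) (vecs v (wvec G b) e i) = 0"
      using modes_vanish[of e] by blast
    \<comment> \<open>Beyond \<open>l\<close> the binomial coefficients vanish, so the range may be extended to a common bound.\<close>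
    define J where "J = J0 + Suc l"
    have "(\<Sum>i<r. \<Sum>j\<le>l. cmul (of_nat (l choose j)) (mon (posv n i) (of_nat l - of_nat j) \<circledast> Ins i (int j))) e
      = (\<Sum>i<r. \<Sum>j\<le>l. of_nat (l choose j) * Ins i (int j) (e(posv n i := e (posv n i) - (of_nat l - of_nat j))))"
      by (simp add: fsum_fun_apply cmul_def mon_fmul)
    also have "\<dots> = (\<Sum>i<r. \<Sum>j\<le>l. \<Sum>b\<in>bset e. (of_int (int l) gchoose j) * val (ins (vecs v (wvec G b) e) i (int j))
        ((pexp e)(i := pexp e i - of_int (int l) + of_nat j)))"
      by (intro sum.cong refl)
        (simp add: Ins_def supported_upd posv_corr True pexp_upd sum_distrib_left binomial_gbinomial,
         simp add: pexp_def algebra_simps)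
    also have "\<dots> = (\<Sum>i<r. \<Sum>j<J. \<Sum>b\<in>bset e. (of_int (int l) gchoose j) * val (ins (vecs v (wvec G b) e) i (int j))
        ((pexp e)(i := pexp e i - of_int (int l) + of_nat j)))"
    proof (rule sum.cong[OF refl], rule sum.mono_neutral_left)
      show "{..l} \<subseteq> {..<J}" by (auto simp: J_def)
      show "\<forall>j\<in>{..<J} - {..l}. (\<Sum>b\<in>bset e. (of_int (int l) gchoose j) * val (ins (vecs v (wvec G b) e) i (int j))
        ((pexp e)(i := pexp e i - of_int (int l) + of_nat j))) = 0" for i
      proof
        fix j assume "j \<in> {..<J} - {..l}"
        then have "(of_int (int l) :: complex) gchoose j = 0" by (simp flip: binomial_gbinomial)
        then show "(\<Sum>b\<in>bset e. (of_int (int l) gchoose j) * val (ins (vecs v (wvec G b) e) i (int j))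
          ((pexp e)(i := pexp e i - of_int (int l) + of_nat j))) = 0" by (simp only: mult_zero_left sum.neutral_const)
      qed
    qed simp
    also have "\<dots> = (\<Sum>b\<in>bset e. \<Sum>i<r. \<Sum>j<J. (of_int (int l) gchoose j) * val (ins (vecs v (wvec G b) e) i (int j))
        ((pexp e)(i := pexp e i - of_int (int l) + of_nat j)))"
      by (subst (2) sum.swap, subst sum.swap) (rule refl)
    also have "\<dots> = 0"
      by (intro sum.neutral ballI val_moment_zero[OF vecs_mem]) (use l2 J0 in \<open>auto simp: J_def\<close>)
    finally show ?thesis by simp
  next
    case False
    then show ?thesis
      by (auto simp: fsum_fun_apply cmul_def mon_fmul Ins_def supported_upd posv_corr intro!: sum.neutral)
  qed
qed

lemma kcoef_posv: "kcoef (posv n i0) (posv n i) m j t = kco i0 i m j t"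
  and exa_posv: "exa (posv n i0) (posv n i) t = ka i0 i t" and exb_posv: "exb (posv n i0) (posv n i) t = kb i0 i t"
  by (simp_all add: kcoef_def kco_def exa_def exb_def ka_def kb_def left_of_posv)

lemma kern_Ins:
  assumes i: "i0 < r" "i < r" "i \<noteq> i0"
  shows "(kern (posv n i0) (posv n i) m j \<circledast> Ins i (int j)) e = (if supported (corr_vars g n) e then
     \<Sum>b\<in>bset e. Sum_any (\<lambda>t. kco i0 i m j t * val (ins (vecs v (wvec G b) e) i (int j)) (ksh i0 i m j t (pexp e))) else 0)"
proof -
  have ne: "posv n i0 \<noteq> posv n i" using i by simp
  have p: "pexp (e(posv n i0 := e (posv n i0) - ka i0 i t + of_nat m, posv n i := e (posv n i) - kb i0 i t + of_nat j))
      = ksh i0 i m j t (pexp e)" for t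
    using i by (auto simp: pexp_def ksh_def fun_eq_iff)
  have *: "(kern (posv n i0) (posv n i) m j \<circledast> Ins i (int j)) e = (if supported (corr_vars g n) e then
     Sum_any (\<lambda>t. \<Sum>b\<in>bset e. kco i0 i m j t * val (ins (vecs v (wvec G b) e) i (int j)) (ksh i0 i m j t (pexp e))) else 0)"
    unfolding kern_fmul[OF ne] kcoef_posv exa_posv exb_posv
    by (auto simp: Ins_def supported_upd posv_corr i p sum_distrib_left)
  show ?thesis
    unfolding *
  proof (rule if_cong[OF refl _ refl], rule Sum_any_sum[OF finite_bset])
    fix b assume b: "b \<in> bset e"
    show "finite {t. kco i0 i m j t * val (ins (vecs v (wvec G b) e) i (int j)) (ksh i0 i m j t (pexp e)) \<noteq> 0}"
      by (rule finite_subset[OF _ val_kernel_finite[OF vecs_mem[OF b] i]]) auto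
  qed
qed

lemma fsum_eq_sum:
  fixes F :: "nat \<Rightarrow> fser"
  assumes "\<And>j. J \<le> j \<Longrightarrow> F j e = 0" shows "fsum F e = (\<Sum>j<J. F j e)"
  unfolding fsum_def
  by (rule Sum_any.expand_superset, simp, rule subsetI, rule ccontr) (use assms in auto)

lemma kern_Ins_large:
  "\<exists>J. \<forall>j\<ge>J. \<forall>i0<r. \<forall>i<r. \<forall>m. i \<noteq> i0 \<longrightarrow> (kern (posv n i0) (posv n i) m j \<circledast> Ins i (int j)) e = 0"
proof -
  obtain J where J: "\<And>i j e'. J \<le> j \<Longrightarrow> i < r \<Longrightarrow> (\<forall>a. e' (Vrho a) = e (Vrho a)) \<and> (\<forall>k. e' (Vdy k) = e (Vdy k)) \<Longrightarrow> Ins i (int j) e' = 0"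
    using Ins_large[of e] by blast
  have "(kern (posv n i0) (posv n i) m j \<circledast> Ins i (int j)) e = 0"
    if "J \<le> j" "i0 < r" "i < r" "i \<noteq> i0" for i0 i j m
  proof -
    have ne: "posv n i0 \<noteq> posv n i" using that by simp
    show ?thesis unfolding kern_fmul[OF ne] using J[OF that(1,3)] by simp
  qed
  then show ?thesis by blast
qed

text \<open>The termwise form of \<open>val_negative_mode\<close>, summed over the bases.\<close>

lemma Ins_negative:
  assumes i0: "i0 < r"
  shows "Ins i0 (- int m - 1) = (\<Sum>i\<in>{..<r} - {i0}. fsum (\<lambda>j. kern (posv n i0) (posv n i) m j \<circledast> Ins i (int j)))"
proof
  fix e
  obtain J1 where J1: "\<And>b i j. b \<in> bset e \<Longrightarrow> i < r \<Longrightarrow> J1 \<le> j \<Longrightarrow> act (la i) x (int j) (vecs v (wvec G b) e i) = 0"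
    using modes_vanish[of e] by blast
  obtain J2 where J2: "\<And>i0 i j m. J2 \<le> j \<Longrightarrow> i0 < r \<Longrightarrow> i < r \<Longrightarrow> i \<noteq> i0 \<Longrightarrow> (kern (posv n i0) (posv n i) m j \<circledast> Ins i (int j)) e = 0"
    using kern_Ins_large[of e] by blast
  define J where "J = J1 + J2"
  have "(\<Sum>i\<in>{..<r} - {i0}. fsum (\<lambda>j. kern (posv n i0) (posv n i) m j \<circledast> Ins i (int j))) e
    = (\<Sum>i\<in>{..<r} - {i0}. \<Sum>j<J. (kern (posv n i0) (posv n i) m j \<circledast> Ins i (int j)) e)"
    unfolding fsum_fun_apply by (intro sum.cong refl fsum_eq_sum J2) (use i0 in \<open>auto simp: J_def\<close>)
  also have "\<dots> = (if supported (corr_vars g n) e then \<Sum>i\<in>{..<r} - {i0}. \<Sum>j<J.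
     \<Sum>b\<in>bset e. Sum_any (\<lambda>t. kco i0 i m j t * val (ins (vecs v (wvec G b) e) i (int j)) (ksh i0 i m j t (pexp e))) else 0)"
  proof -
    have "(\<Sum>i\<in>{..<r} - {i0}. \<Sum>j<J. (kern (posv n i0) (posv n i) m j \<circledast> Ins i (int j)) e)
      = (\<Sum>i\<in>{..<r} - {i0}. \<Sum>j<J. if supported (corr_vars g n) e then
       \<Sum>b\<in>bset e. Sum_any (\<lambda>t. kco i0 i m j t * val (ins (vecs v (wvec G b) e) i (int j)) (ksh i0 i m j t (pexp e))) else 0)"
      by (intro sum.cong refl kern_Ins) (use i0 in auto)
    then show ?thesis by (cases "supported (corr_vars g n) e") simp_all
  qed
  also have "\<dots> = (if supported (corr_vars g n) e then \<Sum>b\<in>bset e. \<Sum>i\<in>{..<r} - {i0}. \<Sum>j<J.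
     Sum_any (\<lambda>t. kco i0 i m j t * val (ins (vecs v (wvec G b) e) i (int j)) (ksh i0 i m j t (pexp e))) else 0)"
    by (subst (2) sum.swap, subst sum.swap) (rule refl)
  also have "\<dots> = Ins i0 (- int m - 1) e"
  proof -
    have "val (ins (vecs v (wvec G b) e) i0 (- int m - 1)) (pexp e) = (\<Sum>i\<in>{..<r} - {i0}. \<Sum>j<J.
     Sum_any (\<lambda>t. kco i0 i m j t * val (ins (vecs v (wvec G b) e) i (int j)) (ksh i0 i m j t (pexp e))))"
      if "b \<in> bset e" for b
      by (rule val_negative_mode[OF vecs_mem[OF that] i0]) (use J1[OF that] in \<open>auto simp: J_def\<close>)
    then show ?thesis by (simp add: Ins_def)
  qed
  finally show "Ins i0 (- int m - 1) e = (\<Sum>i\<in>{..<r} - {i0}. fsum (\<lambda>j. kern (posv n i0) (posv n i) m j \<circledast> Ins i (int j))) e"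
    by simp
qed

end

context genus_forms
begin

lemma seg_in_lab0:
  assumes "b \<in> bset e"
  shows "seg (vecs v (wvec G b) e) \<epsilon> 0 r (vac U) \<in> W (lab0 M)"
  using seg_mem[OF _ vac_W, of 0 "vecs v (wvec G b) e" \<epsilon>] vecs_mem[OF assms] by (simp add: mu_0)

text \<open>
  The reduction formula of genus 0: the coefficient of \<open>x^(-m-1)\<close> is the mode \<open>m\<close> next to the left vacuum,
  which for \<open>m \<ge> 0\<close> is commuted to the right, and which vanishes for \<open>m < 0\<close>.
\<close>

lemma Fcorr_u_kern:
  "Fcorr_u U M G n \<gamma> \<delta> N x v
    = mon Vdx (of_nat N) \<circledast> (\<Sum>i<r. fsum (\<lambda>j. kern Vx (posv n i) 0 j \<circledast> Ins i (int j)))"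
proof
  fix e :: fexp
  define e1 where "e1 = e(Vdx := e Vdx - of_nat N)"
  define e0 where "e0 = e(Vx := 0, Vdx := 0)"
  define S where "S \<longleftrightarrow> supported ({Vx, Vdx} \<union> corr_vars g n) e \<and> e Vdx = of_nat N"
  have nv: "Vx \<notin> corr_vars g n" "Vdx \<notin> corr_vars g n" by (auto simp: corr_vars_def)
  \<comment> \<open>A term of the kernel contributes to \<open>e\<close> only if it accounts for the full power of \<open>x\<close>.\<close>
  have trm: "kcoef Vx (posv n i) 0 j t * Ins i (int j) (e1(Vx := e1 Vx - exa Vx (posv n i) t + of_nat 0,
        posv n i := e1 (posv n i) - exb Vx (posv n i) t + of_nat j))
    = (if S \<and> e Vx = - of_nat t - 1 then (of_nat t gchoose j) * Ins i (int j) (e0(posv n i := e0 (posv n i) - of_nat t + of_nat j)) else 0)"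
    if i: "i < r" for i j t
  proof -
    let ?e = "e1(Vx := e1 Vx - exa Vx (posv n i) t + of_nat 0, posv n i := e1 (posv n i) - exb Vx (posv n i) t + of_nat j)"
    have lo: "left_of Vx (posv n i)" using left_of_pv[of n 0 "Suc i"] by simp
    have k: "kcoef Vx (posv n i) 0 j t = (of_nat t gchoose j)" "exa Vx (posv n i) t = - of_nat t - 1"
      "exb Vx (posv n i) t = of_nat t" using lo by (simp_all add: kcoef_def exa_def exb_def)
    show ?thesis
    proof (cases "S \<and> e Vx = - of_nat t - 1")
      case True
      then have "?e = e0(posv n i := e0 (posv n i) - of_nat t + of_nat j)"
        by (auto simp: fun_eq_iff k e1_def e0_def S_def)
      then show ?thesis using True by (simp add: k)
    next
      case False
      have "\<not> supported (corr_vars g n) ?e"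
      proof
        assume s: "supported (corr_vars g n) ?e"
        then have "?e Vx = 0" "?e Vdx = 0" using nv by (auto simp: supported_def)
        then have "e Vx = - of_nat t - 1" "e Vdx = of_nat N" by (auto simp: e1_def k eq_neg_iff_add_eq_0 algebra_simps)
        moreover have "e p = 0" if "p \<notin> {Vx, Vdx} \<union> corr_vars g n" for p
        proof -
          have "?e p = 0" using s that unfolding supported_def by blast
          moreover have "p \<noteq> posv n i" using posv_corr[OF i] that by auto
          ultimately show ?thesis using that by (simp add: e1_def)
        qed
        ultimately show False using False by (auto simp: S_def supported_def)
      qed
      then have "Ins i (int j) ?e = 0" by (simp add: Ins_def)
      then show ?thesis by (simp only: if_not_P[OF False] mult_zero_right)
    qed
  qed
  have K: "(kern Vx (posv n i) 0 j \<circledast> Ins i (int j)) e1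
    = Sum_any (\<lambda>t. if S \<and> e Vx = - of_nat t - 1 then (of_nat t gchoose j) * Ins i (int j) (e0(posv n i := e0 (posv n i) - of_nat t + of_nat j)) else 0)"
    if "i < r" for i j
    unfolding kern_fmul[OF posv_neq(5)] by (intro Sum_any.cong trm[OF that])
  have R: "(mon Vdx (of_nat N) \<circledast> (\<Sum>i<r. fsum (\<lambda>j. kern Vx (posv n i) 0 j \<circledast> Ins i (int j)))) e
     = (\<Sum>i<r. fsum (\<lambda>j. kern Vx (posv n i) 0 j \<circledast> Ins i (int j)) e1)"
    by (simp add: mon_fmul fsum_fun_apply e1_def)
  have L: "Fcorr_u U M G n \<gamma> \<delta> N x v e = (if S then \<Sum>b\<in>bset e. P (lab0 M) (vac U)
      (cmodes (mode U) x (- e Vx - 1) (seg (vecs v (wvec G b) e) (pexp e) 0 r (vac U))) else 0)"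
    by (simp add: Fcorr_u_def corr_val S_def)
  show "Fcorr_u U M G n \<gamma> \<delta> N x v e
    = (mon Vdx (of_nat N) \<circledast> (\<Sum>i<r. fsum (\<lambda>j. kern Vx (posv n i) 0 j \<circledast> Ins i (int j)))) e"
  proof (cases "S \<and> (\<exists>m::nat. e Vx = - of_nat m - 1)")
    case True
    then obtain m :: nat where m: "e Vx = - of_nat m - 1" and S by blast
    have b0: "bset e0 = bset e" "vecs v bv e0 = vecs v bv e" "pexp e0 = pexp e" for bv
      by (simp_all add: e0_def)
    have "supported (corr_vars g n) e0" using \<open>S\<close> by (auto simp: e0_def S_def supported_def)
    obtain J1 where J1: "\<And>b i j. b \<in> bset e \<Longrightarrow> i < r \<Longrightarrow> J1 \<le> j \<Longrightarrow> act (la i) x (int j) (vecs v (wvec G b) e i) = 0"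
      using modes_vanish[of e] by blast
    have K': "(kern Vx (posv n i) 0 j \<circledast> Ins i (int j)) e1
        = (of_nat m gchoose j) * Ins i (int j) (e0(posv n i := e0 (posv n i) - of_nat m + of_nat j))" if "i < r" for i j
    proof -
      have "(kern Vx (posv n i) 0 j \<circledast> Ins i (int j)) e1 = Sum_any (\<lambda>t. if t = m then
          (of_nat t gchoose j) * Ins i (int j) (e0(posv n i := e0 (posv n i) - of_nat t + of_nat j)) else 0)"
        unfolding K[OF that] by (rule Sum_any.cong) (use m \<open>S\<close> in auto)
      then show ?thesis by simp
    qed
    have z: "(kern Vx (posv n i) 0 j \<circledast> Ins i (int j)) e1 = 0" if "Suc m \<le> j" "i < r" for i j
      unfolding K'[OF that(2)] using that(1) by (simp flip: binomial_gbinomial)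
    define J where "J = J1 + Suc m"
    have "(\<Sum>i<r. fsum (\<lambda>j. kern Vx (posv n i) 0 j \<circledast> Ins i (int j)) e1)
      = (\<Sum>i<r. \<Sum>j<J. (kern Vx (posv n i) 0 j \<circledast> Ins i (int j)) e1)"
      by (intro sum.cong refl fsum_eq_sum z) (auto simp: J_def)
    also have "\<dots> = (\<Sum>i<r. \<Sum>j<J. \<Sum>b\<in>bset e. (of_int (int m) gchoose j) * val (ins (vecs v (wvec G b) e) i (int j))
        ((pexp e)(i := pexp e i - of_int (int m) + of_nat j)))"
    proof (intro sum.cong refl)
      fix i j assume "i \<in> {..<r}"
      then have i: "i < r" by simp
      show "(kern Vx (posv n i) 0 j \<circledast> Ins i (int j)) e1 = (\<Sum>b\<in>bset e. (of_int (int m) gchoose j)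
        * val (ins (vecs v (wvec G b) e) i (int j)) ((pexp e)(i := pexp e i - of_int (int m) + of_nat j)))"
        unfolding K'[OF i]
        by (simp add: Ins_def supported_upd posv_corr i \<open>supported (corr_vars g n) e0\<close> b0 pexp_upd sum_distrib_left,
            simp add: pexp_def e0_def)
    qed
    also have "\<dots> = (\<Sum>b\<in>bset e. \<Sum>i<r. \<Sum>j<J. (of_int (int m) gchoose j) * val (ins (vecs v (wvec G b) e) i (int j))
        ((pexp e)(i := pexp e i - of_int (int m) + of_nat j)))"
      by (subst (2) sum.swap, subst sum.swap) (rule refl)
    also have "\<dots> = (\<Sum>b\<in>bset e. P (lab0 M) (vac U) (act (lab0 M) x (int m) (seg (vecs v (wvec G b) e) (pexp e) 0 r (vac U))))"
      by (intro sum.cong refl val_mode[symmetric] vecs_mem) (use J1 in \<open>auto simp: J_def\<close>)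
    also have "\<dots> = (\<Sum>b\<in>bset e. P (lab0 M) (vac U)
      (cmodes (mode U) x (- e Vx - 1) (seg (vecs v (wvec G b) e) (pexp e) 0 r (vac U))))"
      by (intro sum.cong refl) (use seg_in_lab0 in \<open>simp add: m cmodes_def act_lab0 xc W_lab0\<close>)
    finally show ?thesis using L R \<open>S\<close> by simp
  next
    case False
    have "(kern Vx (posv n i) 0 j \<circledast> Ins i (int j)) e1 = 0" if "i < r" for i j
      unfolding K[OF that] using False by (auto intro!: Sum_any.expand_superset[of "{}", simplified])
    then have "(\<Sum>i<r. fsum (\<lambda>j. kern Vx (posv n i) 0 j \<circledast> Ins i (int j)) e1) = 0"
      by (simp add: fsum_def)
    moreover have "P (lab0 M) (vac U) (cmodes (mode U) x (- e Vx - 1) (seg (vecs v (wvec G b) e) (pexp e) 0 r (vac U))) = 0"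
      if S and b: "b \<in> bset e" for b
    proof (cases "- e Vx - 1 \<in> \<int>")
      case True
      then obtain k where k: "- e Vx - 1 = of_int k" by (rule Ints_cases)
      \<comment> \<open>The remaining powers of \<open>x\<close> belong to negative modes, which the left vacuum annihilates.\<close>
      have "k < 0"
      proof (rule ccontr)
        assume "\<not> k < 0"
        then have kn: "(of_int k :: complex) = of_nat (nat k)" by simp
        have "e Vx = - (- e Vx - 1) - 1" by simp
        then have "e Vx = - of_nat (nat k) - 1" unfolding k kn .
        then show False using False \<open>S\<close> by blast
      qed
      then show ?thesis
        using P_vac_mode[OF xw xq seg_in_lab0[OF b], of k "pexp e"] N seg_in_lab0[OF b, of "pexp e"]
        by (simp add: k cmodes_def act_lab0 xc W_lab0)
    next
      case False
      then show ?thesis using vac_W0 by (simp add: cmodes_def dual_lab0)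
    qed
    ultimately show ?thesis using L R by simp
  qed
qed

lemma val_slot:
  assumes i: "i < r" and vs: "\<And>k. k \<noteq> i \<Longrightarrow> vs k \<in> W (la k)"
  shows "y \<in> W (la i) \<Longrightarrow> y' \<in> W (la i) \<Longrightarrow> val (vs(i := y + y')) \<epsilon> = val (vs(i := y)) \<epsilon> + val (vs(i := y')) \<epsilon>"
    and "y \<in> W (la i) \<Longrightarrow> val (vs(i := scl U c y)) \<epsilon> = c * val (vs(i := y)) \<epsilon>"
proof -
  have m: "seg (vs(i := y)) \<epsilon> 0 r (vac U) \<in> W (lab0 M)" if "y \<in> W (la i)" for y
    using seg_mem[OF _ vac_W, of 0 "vs(i := y)" \<epsilon>] that vs by (simp add: mu_0)
  show "val (vs(i := y + y')) \<epsilon> = val (vs(i := y)) \<epsilon> + val (vs(i := y')) \<epsilon>" if "y \<in> W (la i)" "y' \<in> W (la i)"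
    using seg_slot(1)[OF le0 i vac_W vs that, where \<epsilon> = \<epsilon>] m that by (simp add: val_def P_vac_add)
  show "val (vs(i := scl U c y)) \<epsilon> = c * val (vs(i := y)) \<epsilon>" if "y \<in> W (la i)"
    using seg_slot(2)[OF le0 i vac_W vs that, where \<epsilon> = \<epsilon>] m that by (simp add: val_def P_vac_scale)
qed

lemma la_wpos: "a \<in> Iset g \<Longrightarrow> la (wpos n a) = wlab M G a"
  using wpos_ge[of n a] by (auto simp: la_def ws_wpos Iset_def)

text \<open>
The choice of \<open>b\<^sub>k\<close> is separated from that of the other basis vectors.
\<close>

lemma sum_bset:
  fixes f :: "_ \<Rightarrow> complex"
  assumes k: "k \<in> {1..g}"
  shows "(\<Sum>b\<in>bset e. f b) = (\<Sum>h\<in>(\<Pi>\<^sub>E a\<in>{1..g} - {k}. bas G a \<inter> Wt (al G a) (e (Vrho a))).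
     \<Sum>y\<in>bas G k \<inter> Wt (al G k) (e (Vrho k)). f (h(k := y)))"
proof -
  let ?X = "\<lambda>a. bas G a \<inter> Wt (al G a) (e (Vrho a))"
  have "bset e = (\<lambda>(y, h). h(k := y)) ` (?X k \<times> (\<Pi>\<^sub>E a\<in>{1..g} - {k}. ?X a))"
    unfolding bset_def using PiE_insert_eq[of k "{1..g} - {k}" ?X] k by (simp add: insert_absorb)
  moreover have "inj_on (\<lambda>(y, h). h(k := y)) (?X k \<times> (\<Pi>\<^sub>E a\<in>{1..g} - {k}. ?X a))"
    by (rule inj_combinator[where T = ?X]) auto
  ultimately have "(\<Sum>b\<in>bset e. f b) = (\<Sum>(y, h)\<in>?X k \<times> (\<Pi>\<^sub>E a\<in>{1..g} - {k}. ?X a). f (h(k := y)))"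
    by (simp add: sum.reindex case_prod_unfold)
  also have "\<dots> = (\<Sum>y\<in>?X k. \<Sum>h\<in>(\<Pi>\<^sub>E a\<in>{1..g} - {k}. ?X a). f (h(k := y)))"
    by (simp add: sum.cartesian_product)
  finally show ?thesis by (simp add: sum.swap[of _ "?X k"])
qed

lemma Ins_sewing_pos:
  assumes a: "a \<in> Iset g" "0 < a"
  shows "Ins (wpos n a) j = cmul ((- 1) ^ N) (rho a (of_int j + 1 - of_nat N) \<circledast> Ins (wpos n (- a)) (2 * int N - 2 - j))"
proof
  fix e :: fexp
  define k where "k = nat a"
  define p where "p = wpos n a"
  define p' where "p' = wpos n (- a)"
  define e' where "e' = e(Vrho k := e (Vrho k) - (of_int j + 1 - of_nat N))"
  let ?al = "al G k" and ?S = "bas G k" and ?db = "dbas G k"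
  let ?H = "\<Pi>\<^sub>E a\<in>{1..g} - {k}. bas G a \<inter> Wt (al G a) (e (Vrho a))"
  have k: "k \<in> {1..g}" "int k = a" using a by (auto simp: k_def Iset_def)
  have a': "- a \<in> Iset g" using a by (auto simp: Iset_def)
  have "p \<noteq> p'" using a by (simp add: p_def p'_def wpos_def)
  then have pr: "p < r" "p' < r" "p \<noteq> p'" "n \<le> p" "n \<le> p'"
    using wpos_less[OF a(1), of n] wpos_less[OF a', of n] wpos_ge by (simp_all add: p_def p'_def)
  have wsp: "ws (p - n) = a" "ws (p' - n) = - a" using a by (simp_all add: p_def p'_def ws_wpos)
  have lap: "la p = ?al" "la p' = dual M ?al"
    using a by (simp_all add: p_def p'_def la_wpos a' wlab_def k_def)
  have supp: "supported (corr_vars g n) e' = supported (corr_vars g n) e"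
    unfolding e'_def by (rule supported_upd) (use k in \<open>auto simp: corr_vars_def\<close>)
  have H': "(\<Pi>\<^sub>E a\<in>{1..g} - {k}. bas G a \<inter> Wt (al G a) (e' (Vrho a))) = ?H"
    by (rule PiE_cong) (simp add: e'_def)
  have ek: "e' (Vrho k) = e (Vrho k) + of_nat N - 1 - of_int j" by (simp add: e'_def)
  have vv: "vecs v bv e' = vecs v bv e" "pexp e' = pexp e" for bv by (simp_all add: e'_def)
  \<comment> \<open>The basis vector \<open>b\<^sub>k\<close> enters at the two positions \<open>p\<close> and \<open>p\'\<close> only.\<close>
  have V: "vecs v (wvec G (h(k := y))) e = (vecs v (wvec G h) e)(p := y, p' := ?db y)" for h y
  proof
    fix i
    have ip: "i = p" if "n \<le> i" "ws (i - n) = a" using wpos_ws[of n "i - n"] that by (simp add: p_def)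
    have ip': "i = p'" if "n \<le> i" "ws (i - n) = - a" using wpos_ws[of n "i - n"] that by (simp add: p'_def)
    have w0: "wvec G (h(k := y)) c = wvec G h c" if "c \<noteq> a" "c \<noteq> - a" for c
      using that a(2) by (auto simp: wvec_def k_def)
    have w1: "wvec G (h(k := y)) a = y" "wvec G (h(k := y)) (- a) = ?db y"
      using a(2) by (simp_all add: wvec_def k_def)
    consider "i = p" | "i = p'" "i \<noteq> p" | "i \<noteq> p" "i \<noteq> p'" by blast
    then show "vecs v (wvec G (h(k := y))) e i = ((vecs v (wvec G h) e)(p := y, p' := ?db y)) i"
    proof cases
      case 1
      then show ?thesis using pr wsp w1 by (simp add: vecs_def)
    next
      case 2
      then show ?thesis using pr wsp w1 by (simp add: vecs_def)
    next
      case 3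
      have "wvec G (h(k := y)) (ws (i - n)) = wvec G h (ws (i - n))" if "n \<le> i"
        by (rule w0) (use ip ip' that 3 in auto)
      then show ?thesis using 3 by (simp add: vecs_def)
    qed
  qed
  have sew: "(\<Sum>y\<in>?S \<inter> Wt ?al (e (Vrho k)). val (ins (vecs v (wvec G (h(k := y))) e) p j) (pexp e))
    = (- 1) ^ N * (\<Sum>y\<in>?S \<inter> Wt ?al (e' (Vrho k)). val (ins (vecs v (wvec G (h(k := y))) e) p' (2 * int N - 2 - j)) (pexp e))"
    if h: "h \<in> ?H" for h
  proof -
    \<comment> \<open>Zeros at the two positions make this a vector family in the right modules, whatever \<open>h k\<close> is.\<close>
    define v0 where "v0 = (vecs v (wvec G h) e)(p := 0, p' := 0)"
    define \<Phi> where "\<Phi> = (\<lambda>y y'. val (v0(p := y, p' := y')) (pexp e))"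
    have v0: "v0 i \<in> W (la i)" for i
    proof -
      consider "i = p \<or> i = p' \<or> r \<le> i" | "i < n" | "n \<le> i" "i < r" "i \<noteq> p" "i \<noteq> p'" by linarith
      then show ?thesis
      proof cases
        case 1
        then show ?thesis using pr by (auto simp: v0_def vecs_def)
      next
        case 2
        then have "i \<noteq> p" "i \<noteq> p'" using pr by auto
        moreover have "vecs v (wvec G h) e i \<in> W (la i)"
          using 2 Wt_mem[OF wcomp_mem[OF vm[of "Suc i"]]] by (simp add: vecs_def la_def)
        ultimately show ?thesis by (simp add: v0_def)
      next
        case 3
        define c where "c = ws (i - n)"
        have c: "c \<in> Iset g" unfolding c_def by (rule ws_Iset) (use 3 in auto)
        have "c \<noteq> a" "c \<noteq> - a" using 3 wpos_ws[of n "i - n"] by (auto simp: c_def p_def p'_def)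
        then have ck: "nat \<bar>c\<bar> \<in> {1..g} - {k}" using c a(2) by (auto simp: Iset_def k_def)
        have m: "h (nat \<bar>c\<bar>) \<in> bas G (nat \<bar>c\<bar>) \<inter> Wt (al G (nat \<bar>c\<bar>)) (e (Vrho (nat \<bar>c\<bar>)))"
          by (rule PiE_mem[OF h ck])
        have "wvec G h c \<in> W (wlab M G c)"
        proof (cases "c > 0")
          case True
          then show ?thesis using Wt_mem[OF IntD2[OF m]] by (simp add: wvec_def wlab_def)
        next
          case False
          then have "nat \<bar>c\<bar> = nat (- c)" by simp
          moreover have "nat \<bar>c\<bar> \<in> {1..g}" using ck by blast
          ultimately show ?thesis using False Wt_mem[OF dual_weight[OF dual_bases_G m]]
            by (simp add: wvec_def wlab_def)
        qed
        then show ?thesis using 3 by (simp add: v0_def vecs_def la_def c_def)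
      qed
    qed
    have "bilinear_on (scl U) (*) (W ?al) (W (dual M ?al)) UNIV \<Phi>"
      unfolding bilinear_on_def
    proof (intro conjI ballI allI UNIV_I)
      fix y y' z assume y: "y \<in> W ?al" "y' \<in> W ?al" "z \<in> W (dual M ?al)"
      have tw: "v0(p := y, p' := z) = (v0(p' := z))(p := y)" for y using pr(3) by (simp add: fun_upd_twist)
      show "\<Phi> (y + y') z = \<Phi> y z + \<Phi> y' z"
        unfolding \<Phi>_def tw by (rule val_slot(1)[OF pr(1)]) (use v0 y lap in auto)
    next
      fix y z z' assume y: "y \<in> W ?al" "z \<in> W (dual M ?al)" "z' \<in> W (dual M ?al)"
      show "\<Phi> y (z + z') = \<Phi> y z + \<Phi> y z'"
        unfolding \<Phi>_def by (rule val_slot(1)[OF pr(2)]) (use v0 y lap in auto)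
    next
      fix c y z assume y: "y \<in> W ?al" "z \<in> W (dual M ?al)"
      have tw: "v0(p := y, p' := z) = (v0(p' := z))(p := y)" for y using pr(3) by (simp add: fun_upd_twist)
      show "\<Phi> (scl U c y) z = c * \<Phi> y z"
        unfolding \<Phi>_def tw by (rule val_slot(2)[OF pr(1)]) (use v0 y lap in auto)
      show "\<Phi> y (scl U c z) = c * \<Phi> y z"
        unfolding \<Phi>_def by (rule val_slot(2)[OF pr(2)]) (use v0 y lap in auto)
    qed
    from sewing[OF xw xq dual_bases_G[OF k(1)] this, where c = "e (Vrho k)" and j = j]
    have "(\<Sum>y\<in>?S \<inter> Wt ?al (e (Vrho k)). \<Phi> (act ?al x j y) (?db y))
      = (- 1) ^ N * (\<Sum>y\<in>?S \<inter> Wt ?al (e' (Vrho k)). \<Phi> y (act (dual M ?al) x (2 * int N - 2 - j) (?db y)))"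
      unfolding ek .
    moreover have "ins (vecs v (wvec G (h(k := y))) e) p j = v0(p := act ?al x j y, p' := ?db y)" for y
      using pr(3) by (auto simp: V v0_def lap fun_eq_iff)
    moreover have "ins (vecs v (wvec G (h(k := y))) e) p' i = v0(p := y, p' := act (dual M ?al) x i (?db y))" for y i
      using pr(3) by (auto simp: V v0_def lap fun_eq_iff)
    ultimately show ?thesis by (simp only: \<Phi>_def)
  qed
  have "nat \<bar>a\<bar> = k" using a by (simp add: k_def)
  then have "cmul ((- 1) ^ N) (rho a (of_int j + 1 - of_nat N) \<circledast> Ins p' (2 * int N - 2 - j)) e
    = (- 1) ^ N * Ins p' (2 * int N - 2 - j) e'"
    by (simp add: cmul_def mon_fmul e'_def)
  also have "\<dots> = Ins p j e"
    unfolding Ins_def supp vv sum_bset[OF k(1)] H'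
    by (cases "supported (corr_vars g n) e") (simp_all only: if_True if_False mult_zero_right sum_distrib_left[of "(- 1) ^ N"] sew cong: sum.cong)
  finally show "Ins (wpos n a) j e
    = cmul ((- 1) ^ N) (rho a (of_int j + 1 - of_nat N) \<circledast> Ins (wpos n (- a)) (2 * int N - 2 - j)) e"
    by (simp only: p_def p'_def)
qed

text \<open>
  The two points \<open>w\<^sub>a\<close> and \<open>w\<^sub>-\<^sub>a\<close> carry dual bases, so \<open>sewing\<close> applies. The power of \<open>\<rho>\<^sub>a\<close> compensates
  for the change of weight of the basis vectors.
\<close>

lemma Ins_sewing:
  assumes a: "a \<in> Iset g"
  shows "Ins (wpos n a) j = cmul ((- 1) ^ N) (rho a (of_int j + 1 - of_nat N) \<circledast> Ins (wpos n (- a)) (2 * int N - 2 - j))"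
proof (cases "0 < a")
  case True
  then show ?thesis using Ins_sewing_pos a by blast
next
  case False
  then have a': "- a \<in> Iset g" "0 < - a" using a by (auto simp: Iset_def)
  have *: "Ins (wpos n (- a)) (2 * int N - 2 - j)
      = cmul ((- 1) ^ N) (rho (- a) (of_int (2 * int N - 2 - j) + 1 - of_nat N) \<circledast> Ins (wpos n (- (- a))) (2 * int N - 2 - (2 * int N - 2 - j)))"
    by (rule Ins_sewing_pos[OF a'])
  show ?thesis
  proof
    fix e
    have s: "(- 1 :: complex) ^ N * (- 1) ^ N = 1" by (simp flip: power_add)
    show "Ins (wpos n a) j e = cmul ((- 1) ^ N) (rho a (of_int j + 1 - of_nat N) \<circledast> Ins (wpos n (- a)) (2 * int N - 2 - j)) e"
      unfolding * by (simp add: cmul_def mon_fmul s flip: mult.assoc)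
  qed
qed

lemma Fcorr_res_Ins:
  assumes a: "a \<in> Iset g"
  shows "Fcorr_res U M G n \<gamma> \<delta> a l x v = Ins (wpos n a) (int l)"
proof -
  have "vecs v ((wvec G b)(a := act (wlab M G a) x (int l) (wvec G b a))) e = ins (vecs v (wvec G b) e) (wpos n a) (int l)" for b e
  proof
    fix i
    have ia: "i = wpos n a" if "n \<le> i" "ws (i - n) = a" using wpos_ws[of n "i - n"] that by simp
    have a0: "a \<noteq> 0" using a by (simp add: Iset_def)
    show "vecs v ((wvec G b)(a := act (wlab M G a) x (int l) (wvec G b a))) e i = ins (vecs v (wvec G b) e) (wpos n a) (int l) i"
    proof (cases "i = wpos n a")
      case True
      then show ?thesis using wpos_less[OF a, of n] wpos_ge[of n a] la_wpos[OF a] ws_wpos[OF a0, of n]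
        by (simp add: vecs_def)
    next
      case False
      then have "ws (i - n) \<noteq> a" if "n \<le> i" using ia that by blast
      then show ?thesis using False by (simp add: vecs_def)
    qed
  qed
  then show ?thesis by (intro ext) (simp add: Fcorr_res_def Ins_def corr_val val_def)
qed

text \<open>
  In \<open>Fcorr\<close> the exponent of \<open>dy\<^sub>k\<close> is the weight of \<open>x(j) v\<^sub>k\<close>, which exceeds that of \<open>v\<^sub>k\<close> by \<open>N - 1 - j\<close>.
\<close>

lemma Ins_y:
  assumes k: "k \<in> {1..n}"
  shows "Ins (k - 1) (int j) = mon (Vdy k) (1 - of_nat N + of_nat j)
    \<circledast> Fcorr U M G n \<gamma> \<delta> (v(k := mmode M (\<gamma> k) x (int j) (v k)))"
proof
  fix e :: fexp
  let ?c = "1 - of_nat N + of_nat j :: complex"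
  let ?e = "e(Vdy k := e (Vdy k) - ?c)"
  have s: "supported (corr_vars g n) ?e = supported (corr_vars g n) e"
    by (rule supported_upd) (use k in \<open>auto simp: corr_vars_def\<close>)
  have w: "wcomp U (md M (\<gamma> k)) (e (Vdy k) - ?c) (act (\<gamma> k) x (int j) (v k)) = act (\<gamma> k) x (int j) (wcomp U (md M (\<gamma> k)) (e (Vdy k)) (v k))"
    using wcomp_act[OF xw vm[OF k], of "e (Vdy k)" "int j"] by (simp add: algebra_simps)
  have "vecs (v(k := act (\<gamma> k) x (int j) (v k))) bv ?e = ins (vecs v bv e) (k - 1) (int j)" for bv
    using k w by (auto simp: vecs_def la_def fun_eq_iff)
  then show "Ins (k - 1) (int j) e = (mon (Vdy k) ?c \<circledast> Fcorr U M G n \<gamma> \<delta> (v(k := mmode M (\<gamma> k) x (int j) (v k)))) e"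
    by (simp add: mon_fmul Fcorr_def s Ins_def corr_val val_def)
qed

lemma Ins_y_zero:
  assumes k: "k \<in> {1..n}" and z: "act (\<gamma> k) x (int j) (v k) = 0"
  shows "Ins (k - 1) (int j) = 0"
proof
  fix e
  have "act (\<gamma> k) x (int j) (wcomp U (md M (\<gamma> k)) (e (Vdy k)) (v k)) = 0"
    using wcomp_act[OF xw vm[OF k], of "e (Vdy k)" "int j"] z by (simp add: wcomp_zero)
  then have "ins (vecs v (wvec G b) e) (k - 1) (int j) (k - 1) = 0" for b
    using k by (auto simp: vecs_def la_def)
  moreover have "k - 1 < r" using k by auto
  ultimately have "val (ins (vecs v (wvec G b) e) (k - 1) (int j)) \<epsilon> = 0" if "b \<in> bset e" for b \<epsilon>
    by (intro val_zero_vec[of _ "k - 1"] ins_mem vecs_mem that)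
  then show "Ins (k - 1) (int j) e = 0 e" by (simp add: Ins_def)
qed

end

section \<open>Multiplication by monomials\<close>

text \<open>
  A monomial only translates exponents, so it may be moved about freely, also in front of
  products for which associativity is not available.
\<close>

lemma mon_fmul_assoc: "(mon p c \<circledast> f) \<circledast> h = mon p c \<circledast> (f \<circledast> h)"
proof
  fix e
  have b: "bij (\<lambda>d::fexp. d(p := d p - c))"
    by (rule bij_betwI[where g = "\<lambda>d. d(p := d p + c)"]) auto
  have eq: "e(p := e p - c) - d(p := d p - c) = e - d" for d :: fexp
    by (auto simp: fun_eq_iff)
  show "((mon p c \<circledast> f) \<circledast> h) e = (mon p c \<circledast> (f \<circledast> h)) e"
    unfolding mon_fmul fmul_apply[of f h] fmul_apply[of "mon p c \<circledast> f" h]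
    by (rule Sum_any.reindex_cong[OF b, symmetric]) (rule ext, simp only: o_apply mon_fmul eq)
qed

lemma fmul_mon_left: "f \<circledast> (mon p c \<circledast> h) = mon p c \<circledast> (f \<circledast> h)"
  by (metis fmul_commute mon_fmul_assoc)

lemma fmul_mon_assoc: "(f \<circledast> mon p c) \<circledast> h = mon p c \<circledast> (f \<circledast> h)"
  by (metis fmul_commute mon_fmul_assoc)

lemma mon_mon_same: "mon p a \<circledast> (mon p b \<circledast> f) = mon p (a + b) \<circledast> f"
  by (rule ext) (simp add: mon_fmul diff_diff_eq)

lemma mon_0 [simp]: "mon p 0 \<circledast> f = f"
  by (rule ext) (simp add: mon_fmul)

lemma mon_commute: "mon p a \<circledast> (mon q b \<circledast> f) = mon q b \<circledast> (mon p a \<circledast> f)"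
  by (rule fmul_mon_left)

lemma mon_sum: "mon p c \<circledast> (\<Sum>s\<in>A. f s) = (\<Sum>s\<in>A. mon p c \<circledast> f s)"
  by (rule ext) (simp add: mon_fmul fsum_fun_apply)

lemma mon_add: "mon p c \<circledast> (f + h) = mon p c \<circledast> f + mon p c \<circledast> h"
  by (rule ext) (simp add: mon_fmul)

lemma mon_fsum: "mon p c \<circledast> fsum F = fsum (\<lambda>k. mon p c \<circledast> F k)"
  by (rule ext) (simp add: mon_fmul fsum_def)

lemma cmul_sum: "cmul c (\<Sum>s\<in>A. f s) = (\<Sum>s\<in>A. cmul c (f s))"
  by (rule ext) (simp add: cmul_def fsum_fun_apply sum_distrib_left)

lemma cmul_add: "cmul c (f + h) = cmul c f + cmul c h"
  by (rule ext) (simp add: cmul_def algebra_simps)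

lemma cmul_fsum: "cmul c (fsum F) = fsum (\<lambda>k. cmul c (F k))"
  by (rule ext) (simp add: cmul_def fsum_def Sum_any_cmult)

lemma cmul_1 [simp]: "cmul 1 f = f"
  by (simp add: cmul_def)

lemma cmul_0 [simp]: "cmul 0 f = 0"
  by (simp add: cmul_def fun_eq_iff)

lemma fsum_add:
  assumes "\<And>e. finite {j. F j e \<noteq> 0}" "\<And>e. finite {j. H j e \<noteq> 0}"
  shows "fsum (\<lambda>j. F j + H j) = fsum F + fsum H"
  by (rule ext) (simp add: fsum_def Sum_any.distrib[OF assms])

lemma fsum_finite:
  assumes "\<And>j. J \<le> j \<Longrightarrow> F j = 0"
  shows "fsum F = (\<Sum>j<J. F (j::nat))"
  unfolding fsum_def
  by (rule ext, simp only: fsum_fun_apply, rule Sum_any.expand_superset, simp, rule subsetI, rule ccontr)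
    (use assms in auto)

lemma fmul_sum_finite:
  assumes "finite A" "\<And>s e. s \<in> A \<Longrightarrow> finite {d. f d \<noteq> 0 \<and> h s (e - d) \<noteq> 0}"
  shows "f \<circledast> (\<Sum>s\<in>A. h s) = (\<Sum>s\<in>A. f \<circledast> h s)"
proof
  fix e
  have "(f \<circledast> (\<Sum>s\<in>A. h s)) e = Sum_any (\<lambda>d. \<Sum>s\<in>A. f d * h s (e - d))"
    by (simp add: fmul_apply fsum_fun_apply sum_distrib_left)
  also have "\<dots> = (\<Sum>s\<in>A. (f \<circledast> h s) e)"
    unfolding fmul_apply by (rule Sum_any_sum[OF assms(1)]) (use assms(2) in simp)
  finally show "(f \<circledast> (\<Sum>s\<in>A. h s)) e = (\<Sum>s\<in>A. f \<circledast> h s) e" by (simp add: fsum_fun_apply)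
qed

section \<open>Reduction formulas with the kernel \<open>\<pi>\<^sub>N\<close>\<close>

context genus_forms
begin

text \<open>
  Weights are bounded below in each of the finitely many modules involved. This bounds the
  exponents of the \<open>\<rho>\<^sub>a\<close> from below and, by \<open>val_nonzero_bounds\<close>, the partial sums of the exponents
  of the points from above. At \<open>w\<^sub>a\<close> the vector \<open>x(j) b\<^sub>a\<close>, of weight \<open>N - 1 - j + wt b\<^sub>a\<close>, is non-zero,
  so the exponent of \<open>\<rho>\<^sub>a\<close> grows with \<open>j\<close>; this growth makes the infinite vectors converge.
\<close>

lemma Ins_bounds:
  obtains C where "0 \<le> C" "\<And>i j. i < r \<Longrightarrow> gen g n C (- C) (Ins i j)"
    and "\<And>a j e. a \<in> Iset g \<Longrightarrow> Ins (wpos n a) (int j) e \<noteq> 0 \<Longrightarrow> real j - C \<le> Re (e (Vrho (nat \<bar>a\<bar>)))"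
    and "\<And>i j e s. i < r \<Longrightarrow> Ins i j e \<noteq> 0 \<Longrightarrow> s \<le> r \<Longrightarrow> (\<Sum>k<s. Re (e (posv n k))) \<le> C"
proof -
  from weight_lower_bound obtain B where B0: "0 \<le> B"
    and B: "\<forall>i\<le>r. (\<forall>c. \<forall>w\<in>Wt (la i) c. w \<noteq> 0 \<longrightarrow> - B \<le> Re c) \<and> (\<forall>c. \<forall>w\<in>Wt (mu i) c. w \<noteq> 0 \<longrightarrow> - B \<le> Re c)"
    by (elim exE conjE)
  have Bla: "- B \<le> Re c" if "i \<le> r" "w \<in> Wt (la i) c" "w \<noteq> 0" for i c w
    by (rule B[THEN spec, THEN mp, OF that(1), THEN conjunct1, THEN spec, THEN bspec, OF that(2), THEN mp, OF that(3)])
  have Bmu: "- B \<le> Re c" if "i \<le> r" "w \<in> Wt (mu i) c" "w \<noteq> 0" for i c w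
    by (rule B[THEN spec, THEN mp, OF that(1), THEN conjunct2, THEN spec, THEN bspec, OF that(2), THEN mp, OF that(3)])
  \<comment> \<open>The inhomogeneous vectors \<open>v k\<close> have finitely many components, so the exponents of the \<open>dy\<^sub>k\<close> are bounded.\<close>
  define DS where "DS = (\<Union>k\<in>{1..n}. {c. wcomp U (md M (\<gamma> k)) c (v k) \<noteq> 0})"
  define D where "D = (\<Sum>c\<in>DS. \<bar>Re c\<bar>)"
  have DS: "finite DS" unfolding DS_def by (intro finite_UN_I wcomp_finite vm) auto
  have D0: "0 \<le> D" by (simp add: D_def sum_nonneg)
  define C where "C = real (Suc r) * B + 2 * real g * B + D + real N + B"
  have C0: "0 \<le> C" using B0 D0 by (simp add: C_def)
  have Cs: "real (Suc r) * B + 2 * real g * B \<le> C" "D \<le> C" "B \<le> C" "real g * B \<le> C" "real N + B \<le> C"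
    using B0 D0 by (simp_all add: C_def add_increasing add_increasing2)
  have main: "in_cone g n C e \<and> - C \<le> tau g e \<and> (\<forall>s\<le>r. (\<Sum>k<s. Re (e (posv n k))) \<le> C) \<and> (\<forall>a\<in>Iset g. i = wpos n a \<longrightarrow> of_int j - C \<le> Re (e (Vrho (nat \<bar>a\<bar>))))"
    if i: "i < r" and ne: "Ins i j e \<noteq> 0" for i j e
  proof -
    have supp: "supported (corr_vars g n) e" using ne by (auto simp: Ins_def split: if_splits)
    obtain b where b: "b \<in> bset e" and vne: "val (ins (vecs v (wvec G b) e) i j) (pexp e) \<noteq> 0"
      using ne supp by (auto simp: Ins_def elim: sum.not_neutral_contains_not_neutral)
    let ?vs = "vecs v (wvec G b) e" and ?base = "\<lambda>k. if k < n then e (Vdy (Suc k)) else e (Vrho (nat \<bar>ws (k - n)\<bar>))"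
    let ?c = "\<lambda>k. if k = i then of_nat N + ?base k - of_int j - 1 else ?base k"
    have w: "ins ?vs i j k \<in> Wt (la k) (?c k)" if "k < r" for k
    proof (cases "k = i")
      case True
      show ?thesis using ins_weight[OF b i, of j] by (simp only: True fun_upd_same if_True simp_thms)
    next
      case False
      with vecs_weight[OF b that] show ?thesis by simp
    qed
    have nz: "ins ?vs i j k \<noteq> 0" if "k < r" for k
      by (rule val_nonzero_bounds(2)[where c = ?c and s = 0, OF _ _ _ _ vne _ B0 that])
        (erule (2) Bla | erule (2) Bmu | rule ins_mem[OF vecs_mem[OF b]] | erule w | rule le0)+
    have vnz: "?vs k \<noteq> 0" if "k < r" for k using nz[OF that] xc by (cases "k = i") auto
    have pre: "(\<Sum>k<s. Re (pexp e k)) \<le> real (Suc r) * B" if "s \<le> r" for s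
      by (rule val_nonzero_bounds(1)[where c = ?c, OF _ _ _ _ vne that B0])
        (erule (2) Bla | erule (2) Bmu | rule ins_mem[OF vecs_mem[OF b]] | erule w)+
    have rhoB: "- B \<le> Re (e (Vrho a))" if a: "a \<in> {1..g}" for a
    proof -
      have ia: "int a \<in> Iset g" using a by (auto simp: Iset_def)
      have k: "wpos n (int a) < r" by (rule wpos_less[OF ia])
      have "int a \<noteq> 0" using a by auto
      then have "?base (wpos n (int a)) = e (Vrho a)" using wpos_ge[of n "int a"] by (simp add: ws_wpos)
      then show ?thesis using Bla[OF less_imp_le[OF k] vecs_weight[OF b k] vnz[OF k]] by simp
    qed
    have tauB: "- (real g * B) \<le> tau g e"
    proof -
      have "(\<Sum>a=1..g. - B) \<le> tau g e" unfolding tau_def by (rule sum_mono) (rule rhoB)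
      then show ?thesis by simp
    qed
    have dyD: "\<bar>Re (e (Vdy k))\<bar> \<le> D" if k: "k \<in> {1..n}" for k
    proof -
      have "?vs (k - 1) \<noteq> 0" using k by (intro vnz) auto
      moreover have "k - 1 < n" "Suc (k - 1) = k" using k by auto
      ultimately have "wcomp U (md M (\<gamma> k)) (e (Vdy k)) (v k) \<noteq> 0" by (simp only: vecs_def if_True not_False_eq_True)
      then have "e (Vdy k) \<in> DS" unfolding DS_def using k by blast
      then show ?thesis unfolding D_def by (rule member_le_sum) (use DS in auto)
    qed
    have z: "e Vx = 0" "e Vdx = 0" using supp by (auto simp: supported_def corr_vars_def)
    have "supported (all_vars g n) e" using supp by (auto simp: supported_def all_vars_def)
    moreover have "- C \<le> \<phi> e" if \<phi>: "\<phi> \<in> functionals g n" for \<phi>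
      using \<phi>[unfolded sig_eq_all_pv]
    proof (elim disjE bexE exE conjE)
      assume "\<phi> = tau g" then show ?thesis using tauB Cs(4) by simp
    next
      fix a assume "a \<in> {1..g}" "\<phi> = (\<lambda>e. Re (e (Vrho a)))"
      then show ?thesis using rhoB[of a] Cs by simp
    next
      fix s assume s: "s \<le> r" "\<phi> = sig g n s"
      have "sig g n s e = 2 * tau g e - (\<Sum>k<s. Re (pexp e k))" by (simp add: sig_def z pexp_def)
      then show ?thesis using pre[OF s(1)] tauB Cs(1) s(2) by simp
    next
      fix k assume "k \<in> {1..n}" "\<phi> = (\<lambda>e. Re (e (Vdy k)))"
      then show ?thesis using dyD[of k] Cs by simp
    next
      fix k assume "k \<in> {1..n}" "\<phi> = (\<lambda>e. - Re (e (Vdy k)))"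
      then show ?thesis using dyD[of k] Cs by simp
    qed (use z C0 in auto)
    moreover have "of_int j - C \<le> Re (e (Vrho (nat \<bar>a\<bar>)))" if a: "a \<in> Iset g" "i = wpos n a" for a
    proof -
      have "a \<noteq> 0" using a by (simp add: Iset_def)
      then have "?base i = e (Vrho (nat \<bar>a\<bar>))" using a(2) wpos_ge[of n a] by (simp add: ws_wpos)
      moreover have "- B \<le> Re (?c i)" by (rule Bla[OF less_imp_le[OF i] w[OF i] nz[OF i]])
      ultimately show ?thesis using Cs(5) by simp
    qed
    moreover have "(\<Sum>k<s. Re (e (posv n k))) \<le> C" if "s \<le> r" for s
    proof -
      have "0 \<le> 2 * real g * B" using B0 by simp
      moreover have "(\<Sum>k<s. Re (e (posv n k))) \<le> real (Suc r) * B" using pre[OF that] unfolding pexp_def .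
      ultimately show ?thesis using Cs(1) by linarith
    qed
    ultimately show ?thesis using tauB Cs(4) by (auto simp: in_cone_def)
  qed
  show thesis
  proof (rule that[OF C0])
    show "gen g n C (- C) (Ins i j)" if "i < r" for i j using main[OF that] by (auto simp: gen_def)
    show "real j - C \<le> Re (e (Vrho (nat \<bar>a\<bar>)))" if "a \<in> Iset g" "Ins (wpos n a) (int j) e \<noteq> 0" for a j e
      using main[OF wpos_less[OF that(1)] that(2)] that(1) by simp
    show "(\<Sum>k<s. Re (e (posv n k))) \<le> C" if "i < r" "Ins i j e \<noteq> 0" "s \<le> r" for i j e s
      using main[OF that(1,2)] that(3) by blast
  qed
qed

lemma flat_Ins_large:
  "\<exists>J. \<forall>j\<ge>J. \<forall>i<r. \<forall>f B. flat g n B f \<longrightarrow> (f \<circledast> Ins i (int j)) e = 0"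
proof -
  obtain J where J: "\<And>i j e'. J \<le> j \<Longrightarrow> i < r \<Longrightarrow> (\<forall>a. e' (Vrho a) = e (Vrho a)) \<and> (\<forall>k. e' (Vdy k) = e (Vdy k)) \<Longrightarrow> Ins i (int j) e' = 0"
    using Ins_large[of e] by blast
  have "(f \<circledast> Ins i (int j)) e = 0" if "J \<le> j" "i < r" "flat g n B f" for i j f B
  proof (rule ccontr)
    assume "(f \<circledast> Ins i (int j)) e \<noteq> 0"
    then obtain d where d: "f d \<noteq> 0" "Ins i (int j) (e - d) \<noteq> 0" by (rule fmul_nonzeroE)
    have "d (Vrho a) = 0" "d (Vdy k) = 0" for a k
      using that(3) d(1) unfolding flat_def by (force simp: image_iff)+
    then have "Ins i (int j) (e - d) = 0" by (intro J[OF that(1,2)]) simp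
    then show False using d(2) by simp
  qed
  then show ?thesis by blast
qed

lemma flat_Ins_finite: 
  assumes "\<And>j. flat g n (B j) (f j)" "i < r"
  shows "finite {j. (f j \<circledast> Ins i (int j)) e \<noteq> 0}"
proof -
  obtain J where J: "\<And>j. J \<le> j \<Longrightarrow> (f j \<circledast> Ins i (int j)) e = 0"
    using flat_Ins_large[of e] assms by blast
  have "{j. (f j \<circledast> Ins i (int j)) e \<noteq> 0} \<subseteq> {..<J}"
  proof
    fix j assume "j \<in> {j. (f j \<circledast> Ins i (int j)) e \<noteq> 0}"
    then show "j \<in> {..<J}" using J[of j] by (cases "J \<le> j") auto
  qed
  then show ?thesis by (rule finite_subset) simp
qed

text \<open>
  The part of \<open>\<pi>\<^sub>N\<close>, after differentiation, that is polynomial in the point \<open>i\<close>.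
\<close>

definition fpart :: "(nat \<Rightarrow> complex) \<Rightarrow> fvar \<Rightarrow> nat \<Rightarrow> nat \<Rightarrow> nat \<Rightarrow> fser" where
  "fpart A p m i j = (\<Sum>l\<in>Lset N. cmul (of_nat (l choose j)) (dd p m (fl A N l p) \<circledast> mon (posv n i) (of_nat l - of_nat j)))"

lemma flat_fpart_term:
  assumes "k \<le> r" "i < r" "l \<in> Lset N"
  shows "flat g n (2 * real N) (cmul (of_nat (l choose j)) (dd (pv n k) m (fl A N l (pv n k)) \<circledast> mon (posv n i) (of_nat l - of_nat j)))"
proof (cases "k = Suc i")
  case True
  then show ?thesis using flat_fl_diag[of k n g l N j m A] assms by simp
next
  case False
  then show ?thesis using flat_fl[of k n g "Suc i" l N j m A] assms by simp
qed

lemma flat_fpart: "k \<le> r \<Longrightarrow> i < r \<Longrightarrow> flat g n (2 * real N) (fpart A (pv n k) m i j)"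
  unfolding fpart_def by (rule flat_sum) (rule flat_fpart_term)

lemma fpart_zero: "2 * N - 1 \<le> j \<Longrightarrow> fpart A p m i j = 0"
  unfolding fpart_def
proof (rule sum.neutral, rule ballI)
  fix l assume "2 * N - 1 \<le> j" "l \<in> Lset N"
  then have "l choose j = 0" using N by (intro binomial_eq_0) auto
  then show "cmul (of_nat (l choose j)) (dd p m (fl A N l p) \<circledast> mon (posv n i) (of_nat l - of_nat j)) = 0"
    by (simp only: of_nat_0 cmul_0)
qed

text \<open>
  The contributions of the \<open>f\<^sub>l\<close> sum up to multiples of the moments, which vanish.
\<close>

lemma fpart_sum:
  assumes k: "k \<le> r"
  shows "(\<Sum>i<r. fsum (\<lambda>j. fpart A (pv n k) m i j \<circledast> Ins i (int j))) = 0"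
proof -
  obtain C where C: "0 \<le> C" "\<And>i j. i < r \<Longrightarrow> gen g n C (- C) (Ins i j)" using Ins_bounds by metis
  let ?f = "\<lambda>l. dd (pv n k) m (fl A N l (pv n k))"
  have gf: "good g n (2 * real N) 0 (?f l)" if "l \<in> Lset N" for l
  proof -
    have "cmul (of_nat (l choose l)) (?f l \<circledast> mon (pv n k) (of_nat l - of_nat l)) = ?f l"
      by (simp add: fmul_commute[of _ "mon (pv n k) 0"])
    then show ?thesis using flat_fl_diag[OF k that, of l m A] by (intro good_flat) simp_all
  qed
  have "(\<Sum>i<r. fsum (\<lambda>j. fpart A (pv n k) m i j \<circledast> Ins i (int j)))
    = (\<Sum>i<r. \<Sum>j<2 * N - 1. fpart A (pv n k) m i j \<circledast> Ins i (int j))"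
    by (intro sum.cong refl fsum_finite) (simp add: fpart_zero)
  also have "\<dots> = (\<Sum>i<r. \<Sum>j<2 * N - 1. \<Sum>l\<in>Lset N. ?f l \<circledast> cmul (of_nat (l choose j)) (mon (posv n i) (of_nat l - of_nat j) \<circledast> Ins i (int j)))"
  proof (intro sum.cong refl)
    fix i j assume i: "i \<in> {..<r}"
    have "fpart A (pv n k) m i j \<circledast> Ins i (int j) = (\<Sum>l\<in>Lset N. cmul (of_nat (l choose j)) (?f l \<circledast> mon (posv n i) (of_nat l - of_nat j)) \<circledast> Ins i (int j))"
      unfolding fpart_def
      by (rule fmul_sum_left[OF _ good_flat[OF flat_fpart_term[OF k]] C(2)]) (use i in auto)
    then show "fpart A (pv n k) m i j \<circledast> Ins i (int j)
      = (\<Sum>l\<in>Lset N. ?f l \<circledast> cmul (of_nat (l choose j)) (mon (posv n i) (of_nat l - of_nat j) \<circledast> Ins i (int j)))"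
      by (simp add: cmul_fmul fmul_cmul fmul_mon_assoc fmul_mon_left)
  qed
  also have "\<dots> = (\<Sum>l\<in>Lset N. \<Sum>i<r. \<Sum>j<2 * N - 1. ?f l \<circledast> cmul (of_nat (l choose j)) (mon (posv n i) (of_nat l - of_nat j) \<circledast> Ins i (int j)))"
    by (subst (2) sum.swap, subst sum.swap) (rule refl)
  also have "\<dots> = (\<Sum>l\<in>Lset N. ?f l \<circledast> 0)"
  proof (rule sum.cong[OF refl])
    fix l assume l: "l \<in> Lset N"
    let ?h = "\<lambda>i j. cmul (of_nat (l choose j)) (mon (posv n i) (of_nat l - of_nat j) \<circledast> Ins i (int j))"
    have fin: "finite {d. ?f l d \<noteq> 0 \<and> ?h i j (e - d) \<noteq> 0}" if i: "i < r" for i j e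
    proof (rule finite_subset)
      let ?e = "e(posv n i := e (posv n i) - (of_nat l - of_nat j))"
      have "?e - d = (e - d)(posv n i := (e - d) (posv n i) - (of_nat l - of_nat j))" for d :: fexp
        by (auto simp: fun_eq_iff)
      then show "{d. ?f l d \<noteq> 0 \<and> ?h i j (e - d) \<noteq> 0} \<subseteq> {d. ?f l d \<noteq> 0 \<and> Ins i (int j) (?e - d) \<noteq> 0}"
        by (auto simp: cmul_def mon_fmul)
      show "finite {d. ?f l d \<noteq> 0 \<and> Ins i (int j) (?e - d) \<noteq> 0}"
        by (rule fmul_finite_support[OF gf[OF l] C(2)[OF i]])
    qed
    have "(\<Sum>i<r. \<Sum>j<2 * N - 1. ?f l \<circledast> ?h i j) = ?f l \<circledast> (\<Sum>i<r. \<Sum>j<2 * N - 1. ?h i j)"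
    proof -
      have "?f l \<circledast> (\<Sum>p\<in>{..<r} \<times> {..<2 * N - 1}. ?h (fst p) (snd p)) = (\<Sum>p\<in>{..<r} \<times> {..<2 * N - 1}. ?f l \<circledast> ?h (fst p) (snd p))"
        by (rule fmul_sum_finite) (use fin in auto)
      then show ?thesis by (simp add: sum.cartesian_product case_prod_unfold)
    qed
    also have "(\<Sum>i<r. \<Sum>j<2 * N - 1. ?h i j) = (\<Sum>i<r. \<Sum>j\<le>l. ?h i j)"
    proof (rule sum.cong[OF refl], rule sum.mono_neutral_right)
      show "{..l} \<subseteq> {..<2 * N - 1}" using l N by auto
      show "\<forall>j\<in>{..<2 * N - 1} - {..l}. ?h i j = 0" for i
      proof
        fix j assume "j \<in> {..<2 * N - 1} - {..l}"
        then have "l choose j = 0" by (intro binomial_eq_0) auto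
        then show "?h i j = 0" by (simp only: of_nat_0 cmul_0)
      qed
    qed simp
    also have "\<dots> = 0" by (rule moments_zero[OF l])
    finally show "(\<Sum>i<r. \<Sum>j<2 * N - 1. ?f l \<circledast> ?h i j) = ?f l \<circledast> 0" .
  qed
  also have "\<dots> = 0" by simp
  finally show ?thesis .
qed

lemma pi_split:
  assumes k: "k \<le> r" "i < r" "k \<noteq> Suc i"
  shows "fsum (\<lambda>j. dd (pv n k) m (dd (posv n i) j (pi_ser A N (pv n k) (posv n i))) \<circledast> Ins i (int j))
    = fsum (\<lambda>j. kern (pv n k) (posv n i) m j \<circledast> Ins i (int j)) + fsum (\<lambda>j. fpart A (pv n k) m i j \<circledast> Ins i (int j))"
proof -
  obtain C where C: "0 \<le> C" "\<And>i j. i < r \<Longrightarrow> gen g n C (- C) (Ins i j)" using Ins_bounds by metis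
  have ne: "pv n k \<noteq> posv n i" using pv_inj[of n k "Suc i"] k(3) by (simp del: pv_inj)
  have fk: "flat g n 0 (kern (pv n k) (posv n i) m j)" for j
    using flat_kern[of k n g "Suc i" m j] k by simp
  have "dd (pv n k) m (dd (posv n i) j (pi_ser A N (pv n k) (posv n i))) \<circledast> Ins i (int j)
    = kern (pv n k) (posv n i) m j \<circledast> Ins i (int j) + fpart A (pv n k) m i j \<circledast> Ins i (int j)" for j
    unfolding dd_pi_ser[OF ne] fpart_def[symmetric]
    by (rule fmul_add_left[OF good_flat[OF fk] good_flat[OF flat_fpart[OF k(1,2)]] C(2)[OF k(2)]]) auto
  then show ?thesis
    by (simp only:) (rule fsum_add, rule flat_Ins_finite[OF fk k(2)], rule flat_Ins_finite[OF flat_fpart[OF k(1,2)] k(2)])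
qed

lemma Fcorr_u_pi:
  "Fcorr_u U M G n \<gamma> \<delta> N x v
    = mon Vdx (of_nat N) \<circledast> (\<Sum>i<r. fsum (\<lambda>j. dd (posv n i) j (pi_ser A N Vx (posv n i)) \<circledast> Ins i (int j)))"
proof -
  have "(\<Sum>i<r. fsum (\<lambda>j. dd (posv n i) j (pi_ser A N Vx (posv n i)) \<circledast> Ins i (int j)))
    = (\<Sum>i<r. fsum (\<lambda>j. kern Vx (posv n i) 0 j \<circledast> Ins i (int j))
       + fsum (\<lambda>j. fpart A (pv n 0) 0 i j \<circledast> Ins i (int j)))"
    by (intro sum.cong refl) (use pi_split[of 0 _ 0 A] in simp)
  also have "\<dots> = (\<Sum>i<r. fsum (\<lambda>j. kern Vx (posv n i) 0 j \<circledast> Ins i (int j)))"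
    unfolding sum.distrib fpart_sum[OF le0] by simp
  finally show ?thesis unfolding Fcorr_u_kern by simp
qed

text \<open>
  The polynomial terms are added at all insertions, \<open>i0\<close> included, where there is no singular kernel;
  this produces the exceptional entries \<open>A\<^sub>a\<^sub>,\<^sub>-\<^sub>a\<close> of the matrix.
\<close>

lemma Ins_negative_pi:
  assumes i0: "i0 < r"
  shows "Ins i0 (- int m - 1)
    = (\<Sum>i<r. fsum (\<lambda>j. (if i = i0 then fpart A (posv n i0) m i0 j
         else dd (posv n i0) m (dd (posv n i) j (pi_ser A N (posv n i0) (posv n i)))) \<circledast> Ins i (int j)))"
proof -
  let ?k = "\<lambda>i. fsum (\<lambda>j. kern (posv n i0) (posv n i) m j \<circledast> Ins i (int j))"
  let ?f = "\<lambda>i. fsum (\<lambda>j. fpart A (posv n i0) m i j \<circledast> Ins i (int j))"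
  have "(\<Sum>i<r. fsum (\<lambda>j. (if i = i0 then fpart A (posv n i0) m i0 j
         else dd (posv n i0) m (dd (posv n i) j (pi_ser A N (posv n i0) (posv n i)))) \<circledast> Ins i (int j)))
    = (\<Sum>i<r. (if i = i0 then 0 else ?k i) + ?f i)"
  proof (rule sum.cong[OF refl])
    fix i assume "i \<in> {..<r}"
    then show "fsum (\<lambda>j. (if i = i0 then fpart A (posv n i0) m i0 j
         else dd (posv n i0) m (dd (posv n i) j (pi_ser A N (posv n i0) (posv n i)))) \<circledast> Ins i (int j))
      = (if i = i0 then 0 else ?k i) + ?f i"
      using pi_split[of "Suc i0" i m A] i0 by (cases "i = i0") auto
  qed
  also have "\<dots> = (\<Sum>i<r. if i = i0 then 0 else ?k i)"
    using fpart_sum[of "Suc i0" A m] i0 by (simp add: sum.distrib)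
  also have "\<dots> = (\<Sum>i\<in>{..<r} - {i0}. ?k i)"
    by (rule sum.mono_neutral_cong_right) auto
  finally show ?thesis unfolding Ins_negative[OF i0] by simp
qed

end

section \<open>The shift matrix and low indices\<close>

lemma fsum_split:
  assumes "\<And>e. finite {k. F (k::nat) e \<noteq> 0}"
  shows "fsum F = (\<Sum>l<K. F l) + fsum (\<lambda>k. F (k + K))"
proof
  fix e
  obtain J where J: "{k. F k e \<noteq> 0} \<subseteq> {..<J}" using assms[of e] finite_nat_iff_bounded by blast
  have z: "F k e = 0" if "J \<le> k" for k using J that by fastforce
  have "fsum F e = (\<Sum>k<J + K. F k e)"
    unfolding fsum_def by (rule Sum_any.expand_superset) (use J in auto)
  also have "\<dots> = (\<Sum>l<K. F l e) + (\<Sum>k<J. F (k + K) e)"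
    by (induction J) (simp_all add: add.commute)
  also have "(\<Sum>k<J. F (k + K) e) = fsum (\<lambda>k. F (k + K)) e"
    unfolding fsum_def
    by (rule Sum_any.expand_superset[symmetric], simp, rule subsetI, rule ccontr) (use z in auto)
  finally show "fsum F e = ((\<Sum>l<K. F l) + fsum (\<lambda>k. F (k + K))) e" by (simp add: fsum_fun_apply)
qed

lemma contr_split:
  assumes "\<And>c e. c \<in> Iset g \<Longrightarrow> finite {k. (P (c, k) \<circledast> Q (c, k)) e \<noteq> 0}"
  shows "contr g P Q = (\<Sum>c\<in>Iset g. \<Sum>l<K. P (c, l) \<circledast> Q (c, l))
    + contr g (\<lambda>(c, k). P (c, k + K)) (\<lambda>(c, k). Q (c, k + K))"
  unfolding contr_def sum.distrib[symmetric] by (intro sum.cong refl) (simp add: fsum_split[where K = K, OF assms])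

text \<open>The matrix \<open>\<Delta>\<close> shifts the second index by \<open>2N - 1\<close>.\<close>

lemma contr_Delta:
  assumes "b \<in> Iset g"
  shows "contr g P (\<lambda>k. Delta N k (b, m)) = P (b, m + 2 * N - 1)"
proof
  fix e
  have "fsum (\<lambda>k. P (c, k) \<circledast> Delta N (c, k) (b, m)) e = (if c = b then P (b, m + 2 * N - 1) e else 0)" for c
  proof (cases "c = b")
    case True
    have "fsum (\<lambda>k. P (c, k) \<circledast> Delta N (c, k) (b, m)) e = Sum_any (\<lambda>k. if k = m + 2 * N - 1 then P (b, k) e else 0)"
      unfolding fsum_def by (rule Sum_any.cong) (use True in \<open>auto simp: fmul_commute[of _ fone]\<close>)
    then show ?thesis using True by simp
  next
    case False
    then show ?thesis by (simp add: fsum_def)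
  qed
  then show "contr g P (\<lambda>k. Delta N k (b, m)) e = P (b, m + 2 * N - 1) e"
    using assms by (simp add: contr_def fsum_fun_apply finite_Iset)
qed

lemma sum_Iset: "(\<Sum>b\<in>Iset g. f b) = (\<Sum>a=1..g. f (int a) + f (- int a))" for f :: "int \<Rightarrow> 'a::comm_monoid_add"
proof -
  have "Iset g = int ` {1..g} \<union> (\<lambda>a. - int a) ` {1..g}"
  proof (intro set_eqI iffI)
    fix b assume b: "b \<in> Iset g"
    show "b \<in> int ` {1..g} \<union> (\<lambda>a. - int a) ` {1..g}"
    proof (cases "b > 0")
      case True
      then have "b = int (nat b)" "nat b \<in> {1..g}" using b by (auto simp: Iset_def)
      then show ?thesis by blast
    next
      case False
      then have "b = - int (nat (- b))" "nat (- b) \<in> {1..g}" using b by (auto simp: Iset_def)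
      then show ?thesis by blast
    qed
  qed (auto simp: Iset_def)
  moreover have "int ` {1..g} \<inter> (\<lambda>a. - int a) ` {1..g} = {}" by auto
  ultimately have "(\<Sum>b\<in>Iset g. f b) = (\<Sum>b\<in>int ` {1..g}. f b) + (\<Sum>b\<in>(\<lambda>a. - int a) ` {1..g}. f b)"
    by (simp add: sum.union_disjoint)
  also have "\<dots> = (\<Sum>a=1..g. f (int a)) + (\<Sum>a=1..g. f (- int a))"
    by (subst (1 2) sum.reindex) (auto simp: inj_on_def)
  finally show ?thesis by (simp add: sum.distrib)
qed

lemma good_neumann:
  assumes A: "\<And>i j. i \<in> idxs g \<Longrightarrow> j \<in> idxs g \<Longrightarrow> good g n 0 (1 + ht i + ht j) (A i j)"
    and ij: "i \<in> idxs g" "j \<in> idxs g"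
  shows "good g n 0 0 (neumann g A i j)"
  unfolding neumann_def by (rule good_fsum, rule good_mono[OF good_mat_pow[OF A ij]]) auto

lemma good_neumann_contr:
  assumes A: "\<And>i j. i \<in> idxs g \<Longrightarrow> j \<in> idxs g \<Longrightarrow> good g n 0 (1 + ht i + ht j) (A i j)"
    and L: "\<And>i. i \<in> idxs g \<Longrightarrow> good g n C (ht i - C) (L i)"
    and R: "\<And>i. i \<in> idxs g \<Longrightarrow> good g n C (ht i - C) (R i)"
  shows "good g n (C + C) (- C - C) (contr g L (\<lambda>i. contr g (neumann g A i) R))"
proof -
  have neu: "good g n 0 0 (neumann g A i j)" if "i \<in> idxs g" "j \<in> idxs g" for i j
    by (rule good_neumann[OF A that])
  have NR: "good g n C (- C) (contr g (neumann g A i) R)" if i: "i \<in> idxs g" for i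
  proof -
    have "contr g (neumann g A i) R = conv (idxs g) (neumann g A i) R"
      by (rule contr_eq_conv[OF neu[OF i] good_gen[OF R], where c = C]) auto
    moreover have "good g n (0 + C) (- C) (conv (idxs g) (neumann g A i) R)"
      by (rule good_conv[OF neu[OF i] R]) auto
    ultimately show ?thesis by simp
  qed
  have "contr g L (\<lambda>i. contr g (neumann g A i) R) = conv (idxs g) L (\<lambda>i. contr g (neumann g A i) R)"
    by (rule contr_eq_conv[OF L good_gen[OF NR], where c = "C + C"]) auto
  moreover have "good g n (C + C) (- C - C) (conv (idxs g) L (\<lambda>i. contr g (neumann g A i) R))"
    by (rule good_conv[OF L NR]) auto
  ultimately show ?thesis by simp
qed

section \<open>Derivatives of \<open>\<Psi>\<^sub>N\<close>\<close>

text \<open>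
  Differentiation with respect to \<open>y\<^sub>k\<close> passes by the coefficients in which \<open>y\<^sub>k\<close> does not occur. In \<open>\<Psi>\<close>
  only the vector \<open>R\<close> and the first term depend on it.
\<close>

definition indep :: "fvar \<Rightarrow> fser \<Rightarrow> bool" where
  "indep p f \<longleftrightarrow> (\<forall>e. f e \<noteq> 0 \<longrightarrow> e p = 0)"

lemma indep_fmul: "indep p f \<Longrightarrow> indep p h \<Longrightarrow> indep p (f \<circledast> h)"
  unfolding indep_def
proof (intro allI impI)
  fix e assume a: "\<forall>e. f e \<noteq> 0 \<longrightarrow> e p = 0" "\<forall>e. h e \<noteq> 0 \<longrightarrow> e p = 0" "(f \<circledast> h) e \<noteq> 0"
  from a(3) obtain d where "f d \<noteq> 0" "h (e - d) \<noteq> 0" by (rule fmul_nonzeroE)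
  then have "d p = 0" "(e - d) p = 0" using a(1,2) by blast+
  then show "e p = 0" by simp
qed

lemma indep_zero: "indep p 0" by (simp add: indep_def)

lemma indep_add: "indep p f \<Longrightarrow> indep p h \<Longrightarrow> indep p (f + h)"
  unfolding indep_def by (metis add_0 plus_fun_apply)

lemma indep_sum: "(\<And>s. s \<in> A \<Longrightarrow> indep p (f s)) \<Longrightarrow> indep p (\<Sum>s\<in>A. f s)"
  by (induction A rule: infinite_finite_induct) (auto intro: indep_add indep_zero)

lemma indep_fsum: "(\<And>k. indep p (F k)) \<Longrightarrow> indep p (fsum F)"
  unfolding indep_def fsum_def by (metis Sum_any_nonzeroE)

lemma indep_cmul: "indep p f \<Longrightarrow> indep p (cmul c f)"
  by (auto simp: indep_def cmul_def)

lemma indep_mon: "p \<noteq> q \<Longrightarrow> indep p (mon q c)"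
  by (auto simp: indep_def mon_def)

lemma indep_dd: "p \<noteq> q \<Longrightarrow> indep p f \<Longrightarrow> indep p (dd q m f)"
  by (auto simp: indep_def dd_def)

lemma indep_fone: "indep p fone"
  by (auto simp: indep_def fone_apply)

lemma indep_fl: "p \<noteq> q \<Longrightarrow> indep p (fl A N l q)"
  unfolding fl_def inv_diff_const_def by (intro indep_sum indep_cmul indep_fsum indep_mon)

lemma indep_pi: "p \<noteq> q \<Longrightarrow> p \<noteq> q' \<Longrightarrow> indep p (pi_ser A N q q')"
  unfolding pi_ser_def inv_diff_def
  by (auto intro!: indep_add indep_sum indep_fmul indep_fl indep_mon indep_fsum indep_cmul)

lemma indep_contr: "(\<And>i. i \<in> idxs g \<Longrightarrow> indep p (P i)) \<Longrightarrow> (\<And>i. i \<in> idxs g \<Longrightarrow> indep p (Q i)) \<Longrightarrow> indep p (contr g P Q)"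
  unfolding contr_def by (intro indep_sum indep_fsum indep_fmul) (auto simp: idxs_def)

lemma indep_L: "indep (Vy k) (Lvec A N i)"
  by (cases i) (auto intro!: indep_fmul indep_mon indep_dd indep_pi)

lemma indep_A: "indep (Vy k) (Amat A N i j)"
  by (cases i; cases j) (auto intro!: indep_fmul indep_mon indep_dd indep_pi indep_cmul indep_sum indep_fl)

lemma indep_Delta: "indep p (Delta N i j)"
  by (cases i; cases j) (auto simp: indep_fone indep_zero)

lemma indep_neumann: "indep (Vy k) (neumann g (Atil g A N) i j)"
proof -
  have A: "indep (Vy k) (Atil g A N i j)" for i j
    unfolding Atil_def mat_mult_def by (intro indep_contr indep_A indep_Delta)
  have "indep (Vy k) (mat_pow g (Atil g A N) t i j)" for t
  proof (induction t arbitrary: j)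
    case 0
    then show ?case by (simp add: indep_fone indep_zero)
  next
    case (Suc t)
    then show ?case unfolding mat_pow.simps mat_mult_def by (intro indep_contr Suc.IH A)
  qed
  then show ?thesis unfolding neumann_def by (rule indep_fsum)
qed

lemma dd_fsum: "dd p m (fsum F) = fsum (\<lambda>k. dd p m (F k))"
  by (rule ext) (simp add: dd_def fsum_def Sum_any_cmult)

lemma dd_contr:
  assumes "\<And>i. i \<in> idxs g \<Longrightarrow> indep p (P i)"
  shows "dd p m (contr g P Q) = contr g P (\<lambda>i. dd p m (Q i))"
proof -
  have "dd p m (P (c, k) \<circledast> Q (c, k)) = P (c, k) \<circledast> dd p m (Q (c, k))" if "c \<in> Iset g" for c k
    by (rule dd_fmul_const) (use assms[of "(c, k)"] that in \<open>auto simp: indep_def idxs_def\<close>)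
  then show ?thesis by (simp add: contr_def dd_sum dd_fsum)
qed

lemma dd_fmul_mon: "p \<noteq> q \<Longrightarrow> dd p m (f \<circledast> mon q c) = dd p m f \<circledast> mon q c"
  by (rule ext) (simp add: dd_def fmul_mon fun_upd_twist)

lemma dd_mon_fmul: "p \<noteq> q \<Longrightarrow> dd p m (mon q c \<circledast> f) = mon q c \<circledast> dd p m f"
  by (rule ext) (simp add: dd_def mon_fmul fun_upd_twist)

lemma dd_commute: "p \<noteq> q \<Longrightarrow> dd p m (dd q j f) = dd q j (dd p m f)"
  by (rule ext) (simp add: dd_def fun_upd_twist)

lemma dd_Psi:
  "dd (Vy k) j (Psi g A N k)
    = dd (Vy k) j (pi_ser A N Vx (Vy k)) \<circledast> mon Vdx (of_nat N) \<circledast> mon (Vdy k) (1 - of_nat N)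
     + contr g (Ltil g A N) (\<lambda>i. contr g (neumann g (Atil g A N) i) (\<lambda>i'. dd (Vy k) j (Rvec A N k i')))"
proof -
  have "dd (Vy k) j (contr g (Ltil g A N) (\<lambda>i. contr g (neumann g (Atil g A N) i) (Rvec A N k)))
    = contr g (Ltil g A N) (\<lambda>i. dd (Vy k) j (contr g (neumann g (Atil g A N) i) (Rvec A N k)))"
    by (rule dd_contr) (auto simp: Ltil_def intro!: indep_contr indep_L indep_Delta)
  also have "\<dots> = contr g (Ltil g A N) (\<lambda>i. contr g (neumann g (Atil g A N) i) (\<lambda>i'. dd (Vy k) j (Rvec A N k i')))"
    by (intro contr_cong refl dd_contr indep_neumann)
  finally show ?thesis unfolding Psi_def dd_add by (simp add: dd_fmul_mon)
qed

lemma dd_Rvec: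
  "dd (Vy k) j (Rvec A N k (a, m)) = cmul ((- 1) ^ N) (rho a ((of_nat m + 1) / 2)
     \<circledast> dd (Vw (- a)) m (dd (Vy k) j (pi_ser A N (Vw (- a)) (Vy k))) \<circledast> mon (Vdy k) (1 - of_nat N))"
  by (simp add: dd_cmul dd_fmul_mon dd_mon_fmul dd_commute[of "Vy k" "Vw (- a)"])

section \<open>Degrees of the vectors and matrices in \<open>\<rho>\<close>\<close>

lemma rho_mono_rho:
  assumes "a \<in> Iset g" "0 \<le> c"
  shows "rho_mono g (real c / 2) (rho a (of_nat c / 2))"
proof -
  have "nat \<bar>a\<bar> \<in> {1..g}" using assms(1) by (auto simp: Iset_def)
  then show ?thesis using rho_mono_mon[of "nat \<bar>a\<bar>" g "of_nat c / 2"] by simp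
qed

lemma Vw_pv:
  assumes "a \<in> Iset g" shows "Vw a = pv n (Suc (wpos n a))" "Suc (wpos n a) \<le> n + 2 * g"
  using assms wpos_less[OF assms, of n] by (simp_all add: posv_wpos Iset_def Suc_le_eq)

lemma uminus_Iset: "a \<in> Iset g \<Longrightarrow> - a \<in> Iset g"
  by (simp add: Iset_def)

lemma good_Lvec:
  assumes "i \<in> idxs g" shows "good g n (3 * real N) (ht i) (Lvec A N i)"
proof -
  obtain a m where i: "i = (a, m)" by (cases i)
  have a: "a \<in> Iset g" using assms by (simp add: i idxs_def)
  have "flat g n (2 * real N) (dd (Vw a) m (pi_ser A N Vx (Vw a)))"
    using flat_pi[of 0 n g "Suc (wpos n a)" N 0 m A] Vw_pv[OF a, of n] by simp
  then have "good g n (2 * real N) (real m / 2) (rho a (of_nat m / 2) \<circledast> dd (Vw a) m (pi_ser A N Vx (Vw a)))"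
    by (intro good_rho_flat[OF rho_mono_rho[OF a]]) auto
  from good_fmul[OF this good_mon_dx[of "of_nat N" g n]] show ?thesis by (simp add: i ht_def)
qed

lemma good_dd_Rvec:
  assumes "i \<in> idxs g" and k: "k \<in> {1..n}" and N: "1 \<le> N"
  shows "good g n (3 * real N) (ht i) (dd (Vy k) j (Rvec A N k i))"
proof -
  obtain a m where i: "i = (a, m)" by (cases i)
  have a: "- a \<in> Iset g" "a \<in> Iset g" using assms(1) by (simp_all add: i idxs_def Iset_def)
  have k': "Vy k = pv n (Suc (k - 1))" "Suc (k - 1) \<le> n + 2 * g" using k by (cases k; auto simp: posv_def)+
  have ne: "Suc (wpos n (- a)) \<noteq> Suc (k - 1)" using wpos_ge[of n "- a"] k by auto
  have "flat g n (2 * real N) (dd (Vw (- a)) m (dd (Vy k) j (pi_ser A N (Vw (- a)) (Vy k))))"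
    using flat_pi[OF Vw_pv(2)[OF a(1)] k'(2) ne, of N m j A] Vw_pv(1)[OF a(1), of n] k'(1) by (simp del: pv_simps)
  then have "good g n (2 * real N) (real (m + 1) / 2) (rho a (of_nat (m + 1) / 2)
      \<circledast> dd (Vw (- a)) m (dd (Vy k) j (pi_ser A N (Vw (- a)) (Vy k))))"
    by (intro good_rho_flat[OF rho_mono_rho[OF a(2)]]) auto
  from good_cmul[OF good_fmul[OF this good_mon_dy[of "1 - of_nat N" k n g]]] k
  have "good g n (2 * real N + \<bar>Re (1 - of_nat N)\<bar>) (real (m + 1) / 2 + 0) (dd (Vy k) j (Rvec A N k i))"
    unfolding i dd_Rvec by (simp add: add.commute)
  then show ?thesis by (rule good_mono) (use N in \<open>auto simp: i ht_def\<close>)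
qed

text \<open>
  The degree \<open>(m + k + 1) / 2\<close> in the \<open>\<rho>\<^sub>a\<close> has to make up for the terms \<open>f\<^sub>l\<close>, unless \<open>C\<close> does.
\<close>

lemma good_Amat:
  assumes ij: "(a, m) \<in> idxs g" "(b, k) \<in> idxs g" and C: "2 * real N \<le> C + real (m + k + 1)" "0 \<le> C"
  shows "good g n C (real (m + k + 1) / 2) (Amat A N (a, m) (b, k))"
proof -
  have a: "- a \<in> Iset g" "a \<in> Iset g" "b \<in> Iset g" using ij by (simp_all add: idxs_def Iset_def)
  have h: "2 * (z / 2) = z" for z :: real by simp
  have C': "2 * real N \<le> C + 2 * (real (m + k + 1) / 2)" unfolding h by (rule C(1))
  show ?thesis
  proof (cases "a = - b")
    case False
    then have ne: "Suc (wpos n (- a)) \<noteq> Suc (wpos n b)"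
      using ws_wpos[of "- a" n] ws_wpos[of b n] a by (auto simp: Iset_def)
    have f: "flat g n (2 * real N) (dd (Vw (- a)) m (dd (Vw b) k (pi_ser A N (Vw (- a)) (Vw b))))"
      using flat_pi[OF Vw_pv(2)[OF a(1)] Vw_pv(2)[OF a(3)] ne, of N m k A] Vw_pv(1)[OF a(1), of n] Vw_pv(1)[OF a(3), of n]
      by (simp del: pv_simps)
    have "rho_mono g (real (m + 1) / 2 + real k / 2) (rho a (of_nat (m + 1) / 2) \<circledast> rho b (of_nat k / 2))"
      by (intro rho_mono_fmul rho_mono_rho a) auto
    then have "rho_mono g (real (m + k + 1) / 2) (rho a ((of_nat m + 1) / 2) \<circledast> rho b (of_nat k / 2))"
      by (simp add: add_divide_distrib algebra_simps)
    from good_cmul[OF good_rho_flat[OF this f C' C(2)]] False show ?thesis by simp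
  next
    case True
    have f: "flat g n (2 * real N) (\<Sum>l\<in>Lset N. cmul (of_nat (l choose k))
             (dd (Vw (- a)) m (fl A N l (Vw (- a))) \<circledast> mon (Vw (- a)) (of_nat l - of_nat k)))"
      by (rule flat_sum) (use flat_fl_diag[where N = N and k = k and m = m and A = A, OF Vw_pv(2)[OF a(1)]] Vw_pv(1)[OF a(1), of n] in \<open>simp del: pv_simps\<close>)
    have "rho_mono g (real (m + k + 1) / 2) (rho a (of_nat (m + k + 1) / 2))"
      by (intro rho_mono_rho a) auto
    then have "rho_mono g (real (m + k + 1) / 2) (rho a ((of_nat m + of_nat k + 1) / 2))" by (simp add: ac_simps)
    from good_cmul[OF good_rho_flat[OF this f C' C(2)]] True show ?thesis by simp
  qed
qed

lemma Atil_eq: "b \<in> Iset g \<Longrightarrow> Atil g A N i (b, k) = Amat A N i (b, k + 2 * N - 1)"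
  unfolding Atil_def mat_mult_def by (rule contr_Delta)

lemma Ltil_eq: "b \<in> Iset g \<Longrightarrow> Ltil g A N (b, k) = Lvec A N (b, k + 2 * N - 1)"
  unfolding Ltil_def by (rule contr_Delta)

text \<open>
  After the shift of the second index by \<open>2N - 1\<close> the degree is at least \<open>N\<close>, and no enlargement of the
  cone is needed. As \<open>C = 0\<close>, arbitrarily high powers of the matrix stay in the same cone.
\<close>

lemma good_Atil:
  assumes "i \<in> idxs g" "j \<in> idxs g" "1 \<le> N"
  shows "good g n 0 (1 + ht i + ht j) (Atil g A N i j)"
proof -
  obtain a m b k where i: "i = (a, m)" and j: "j = (b, k)" by (metis surj_pair)
  have b: "b \<in> Iset g" and ij: "(a, m) \<in> idxs g" "(b, k + 2 * N - 1) \<in> idxs g" using assms by (simp_all add: i j idxs_def)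
  have "good g n 0 (real (m + (k + 2 * N - 1) + 1) / 2) (Amat A N (a, m) (b, k + 2 * N - 1))"
    by (rule good_Amat[OF ij]) (use assms(3) in auto)
  then show ?thesis unfolding i j Atil_eq[OF b]
    by (rule good_mono) (use assms(3) in \<open>auto simp: ht_def add_divide_distrib\<close>)
qed

lemma good_Ltil:
  assumes "i \<in> idxs g" "1 \<le> N" shows "good g n (3 * real N) (ht i) (Ltil g A N i)"
proof -
  obtain a m where i: "i = (a, m)" by (cases i)
  have a: "a \<in> Iset g" "(a, m + 2 * N - 1) \<in> idxs g" using assms(1) by (simp_all add: i idxs_def)
  show ?thesis unfolding i Ltil_eq[OF a(1)]
    by (rule good_mono[OF good_Lvec[OF a(2)]]) (use assms(2) in \<open>auto simp: ht_def\<close>)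
qed

lemma good_mon_rho:
  assumes "a \<in> Iset g" "2 * c \<in> \<int>"
  shows "good g n (2 * \<bar>Re c\<bar>) (Re c) (rho a c)"
proof -
  let ?p = "Vrho (nat \<bar>a\<bar>)" and ?e = "(\<lambda>_. 0)(Vrho (nat \<bar>a\<bar>) := c)"
  have a: "nat \<bar>a\<bar> \<in> {1..g}" using assms(1) by (auto simp: Iset_def)
  have t: "tau g ?e = Re c" using a by (simp add: tau_def if_distrib[of Re] cong: if_cong)
  have "halfint ?e" using assms(2) by (auto simp: halfint_def)
  moreover have "in_cone g n (2 * \<bar>Re c\<bar>) ?e"
    using a t by (auto simp: in_cone_def supported_def all_vars_def corr_vars_def sig_eq_all_pv sig_pv;
      use abs_ge_minus_self[of "Re c"] abs_ge_zero[of "Re c"] in linarith)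
  ultimately show ?thesis using t by (auto simp: good_def mon_def)
qed

section \<open>The genus recursion\<close>

context genus_forms
begin

text \<open>
  The unknowns: the modes \<open>x(m)\<close> at \<open>w\<^sub>a\<close>, scaled such that the coefficients of the system become the
  entries of \<open>L\<close>, \<open>R\<close> and \<open>A\<close>. The vector \<open>Y\<close> consists of those with \<open>m > 2N - 2\<close>.
\<close>

definition X :: "idx \<Rightarrow> fser" where
  "X i = rho (fst i) (- of_nat (snd i) / 2) \<circledast> Ins (wpos n (fst i)) (int (snd i))"

definition Y :: "idx \<Rightarrow> fser" where
  "Y i = X (fst i, snd i + (2 * N - 1))"

text \<open>
  The modes \<open>x(j)\<close> at \<open>y\<^sub>k\<close>; the factor \<open>dy\<^sub>k^(1 - N)\<close> of \<open>\<Pi>\<^sub>N\<close> is split off.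
\<close>

definition H :: "nat \<Rightarrow> nat \<Rightarrow> fser" where
  "H k j = mon (Vdy k) (of_nat N - 1) \<circledast> Ins (k - 1) (int j)"

text \<open>
  By \<open>Ins_bounds\<close> the exponent of \<open>\<rho>\<^sub>a\<close> in the mode \<open>m\<close> at \<open>w\<^sub>a\<close> is at least \<open>m\<close> up to a constant. The
  scaling uses up one half of this, and the other half bounds the degree.
\<close>

lemma X_H_bounds:
  obtains C where "0 \<le> C" "\<And>i. i \<in> idxs g \<Longrightarrow> gen g n C (ht i - C) (X i)"
    and "\<And>k j. k \<in> {1..n} \<Longrightarrow> gen g n C (- C) (H k j)"
    and "\<And>i j. i < r \<Longrightarrow> gen g n C (- C) (Ins i j)"
proof -
  obtain C0 where C0: "0 \<le> C0" "\<And>i j. i < r \<Longrightarrow> gen g n C0 (- C0) (Ins i j)"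
    and rh: "\<And>a j e. a \<in> Iset g \<Longrightarrow> Ins (wpos n a) (int j) e \<noteq> 0 \<Longrightarrow> real j - C0 \<le> Re (e (Vrho (nat \<bar>a\<bar>)))"
    and pre: "\<And>i j e s. i < r \<Longrightarrow> Ins i j e \<noteq> 0 \<Longrightarrow> s \<le> r \<Longrightarrow> (\<Sum>k<s. Re (e (posv n k))) \<le> C0"
    using Ins_bounds by blast
  define C where "C = (2 * real g + 2) * C0 + real N"
  have gC: "0 \<le> real g * C0" using C0(1) by simp
  have CC: "C0 + real N \<le> C" "real g * C0 \<le> C" "2 * (real g * C0) + C0 \<le> C" "0 \<le> C" "C0 \<le> C"
    using gC C0(1) by (simp_all add: C_def algebra_simps)
  show thesis
  proof (rule that)
    fix i assume i: "i \<in> idxs g"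
    obtain a m where am: "i = (a, m)" by (cases i)
    have a: "a \<in> Iset g" "nat \<bar>a\<bar> \<in> {1..g}" using i by (auto simp: am idxs_def Iset_def)
    have "in_cone g n C e \<and> ht i - C \<le> tau g e" if e: "X i e \<noteq> 0" for e
    proof -
      let ?p = "Vrho (nat \<bar>a\<bar>)"
      \<comment> \<open>The exponent before the scaling by \<open>\<rho>\<^sub>a^(-m/2)\<close>.\<close>
      define e' where "e' = e(?p := e ?p + of_nat m / 2)"
      have e': "Ins (wpos n a) (int m) e' \<noteq> 0" using e by (simp add: X_def am mon_fmul e'_def)
      have cone: "in_cone g n C0 e'" using C0(2)[OF wpos_less[OF a(1)]] e' by (auto simp: gen_def)
      have sup: "supported (corr_vars g n) e'" using e' by (auto simp: Ins_def split: if_splits)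
      have rho_ge: "- C0 \<le> Re (e' (Vrho b))" if "b \<in> {1..g}" for b
        using cone that by (auto simp: in_cone_def functionals_def)
      have "(\<Sum>b\<in>{1..g} - {nat \<bar>a\<bar>}. - C0) \<le> (\<Sum>b\<in>{1..g} - {nat \<bar>a\<bar>}. Re (e' (Vrho b)))"
        by (intro sum_mono rho_ge) auto
      moreover have "tau g e' = Re (e' ?p) + (\<Sum>b\<in>{1..g} - {nat \<bar>a\<bar>}. Re (e' (Vrho b)))"
        unfolding tau_def by (rule sum.remove) (use a in auto)
      moreover have "real (card ({1..g} - {nat \<bar>a\<bar>})) = real g - 1" using a(2) by (simp add: of_nat_diff)
      ultimately have "Re (e' ?p) - (real g - 1) * C0 \<le> tau g e'" by simp
      then have t': "real m - real g * C0 \<le> tau g e'" using rh[OF a(1) e'] by (simp add: algebra_simps)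
      have "tau g e' = tau g e + real m / 2"
      proof -
        have "tau g e' = Re (e' ?p) + (\<Sum>b\<in>{1..g} - {nat \<bar>a\<bar>}. Re (e' (Vrho b)))"
          unfolding tau_def by (rule sum.remove) (use a in auto)
        moreover have "tau g e = Re (e ?p) + (\<Sum>b\<in>{1..g} - {nat \<bar>a\<bar>}. Re (e (Vrho b)))"
          unfolding tau_def by (rule sum.remove) (use a in auto)
        ultimately show ?thesis by (simp add: e'_def)
      qed
      then have t: "real m / 2 - real g * C0 \<le> tau g e" using t' by simp
      have "- C \<le> \<phi> e" if "\<phi> \<in> functionals g n" for \<phi>
      proof -
        have dx: "e Vdx = 0" "e Vx = 0" using sup by (auto simp: supported_def corr_vars_def e'_def)
        have \<sigma>: "- C \<le> sig g n s e" if s: "s \<le> n + 2 * g" for s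
        proof -
          have "(\<Sum>i<s. Re (e (posv n i))) = (\<Sum>i<s. Re (e' (posv n i)))" by (simp add: e'_def)
          then have "(\<Sum>i<s. Re (e (posv n i))) \<le> C0" using pre[OF wpos_less[OF a(1)] e' s] by simp
          then show ?thesis unfolding sig_def dx using t CC(3) by simp
        qed
        have \<rho>: "- C \<le> Re (e (Vrho b))" if b: "b \<in> {1..g}" for b
        proof (cases "b = nat \<bar>a\<bar>")
          case True
          then show ?thesis using rh[OF a(1) e'] CC(5) C0(1) by (simp add: e'_def)
        next
          case False
          then show ?thesis using rho_ge[OF b] CC(5) by (simp add: e'_def)
        qed
        have dy: "- C \<le> Re (e (Vdy k))" "- C \<le> - Re (e (Vdy k))" if "k \<in> {1..n}" for k
        proof -
          have "- C0 \<le> \<phi> e'" if "\<phi> \<in> functionals g n" for \<phi>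
            using cone that by (simp add: in_cone_def)
          from this[of "\<lambda>e. Re (e (Vdy k))"] this[of "\<lambda>e. - Re (e (Vdy k))"]
          have "- C0 \<le> Re (e' (Vdy k))" "- C0 \<le> - Re (e' (Vdy k))"
            using that by (auto simp: functionals_def)
          then show "- C \<le> Re (e (Vdy k))" "- C \<le> - Re (e (Vdy k))" using CC(5) by (simp_all add: e'_def)
        qed
        from that show ?thesis unfolding functionals_def
          using t CC(2,4) dx \<sigma> \<rho> dy by auto
      qed
      moreover have "supported (all_vars g n) e"
        unfolding supported_def
      proof (intro allI impI)
        fix p assume "p \<notin> all_vars g n"
        then have p: "p \<notin> corr_vars g n" by (simp add: all_vars_def)
        then have "p \<noteq> ?p" using a(2) by (auto simp: corr_vars_def)
        then have "e p = e' p" by (simp add: e'_def)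
        also have "\<dots> = 0" using sup p by (simp add: supported_def)
        finally show "e p = 0" .
      qed
      ultimately show ?thesis using t CC(2) by (simp add: in_cone_def am ht_def)
    qed
    then show "gen g n C (ht i - C) (X i)" by (simp add: gen_def)
  next
    fix k j assume k: "k \<in> {1..n}"
    have "good g n \<bar>Re (of_nat N - 1)\<bar> 0 (mon (Vdy k) (of_nat N - 1))" by (rule good_mon_dy) (use k in auto)
    from gen_fmul[OF good_gen[OF this] C0(2)[of "k - 1" "int j"]]
    have "gen g n (\<bar>Re (of_nat N - 1)\<bar> + C0) (0 + - C0) (H k j)" using k by (auto simp: H_def)
    then show "gen g n C (- C) (H k j)" by (rule gen_mono) (use CC N in auto)
  next
    fix i j assume "i < r"
    then show "gen g n C (- C) (Ins i j)" by (intro gen_mono[OF C0(2)]) (use CC in auto)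
  qed (rule CC(4))
qed

lemma fpart_wpos:
  assumes "a \<in> Iset g"
  shows "fpart A (Vw a) m (wpos n a) j = (\<Sum>l\<in>Lset N. cmul (of_nat (l choose j))
           (dd (Vw a) m (fl A N l (Vw a)) \<circledast> mon (Vw a) (of_nat l - of_nat j)))"
  using assms by (simp add: fpart_def posv_wpos Iset_def)

text \<open>
The kernel of \<open>A\<^sub>a\<^sub>b\<close> without the powers of the \<open>\<rho>\<^sub>a\<close>.
\<close>

definition wker :: "(nat \<Rightarrow> complex) \<Rightarrow> int \<Rightarrow> nat \<Rightarrow> int \<Rightarrow> nat \<Rightarrow> fser" where
  "wker A a m b j = (if a = - b then fpart A (Vw (- a)) m (wpos n (- a)) j
     else dd (Vw (- a)) m (dd (Vw b) j (pi_ser A N (Vw (- a)) (Vw b))))"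

lemma Amat_X:
  assumes "a \<in> Iset g"
  shows "Amat A N (a, m) (b, j) \<circledast> X (b, j)
    = cmul ((- 1) ^ N) (rho a ((of_nat m + 1) / 2) \<circledast> (wker A a m b j \<circledast> Ins (wpos n b) (int j)))"
proof (cases "a = - b")
  case True
  let ?D = "fpart A (Vw (- a)) m (wpos n (- a)) j"
  have "Amat A N (a, m) (b, j) = cmul ((- 1) ^ N) (rho a ((of_nat m + of_nat j + 1) / 2) \<circledast> ?D)"
    using True fpart_wpos[OF uminus_Iset[OF assms], of A m j] by simp
  moreover have "X (b, j) = rho a (- of_nat j / 2) \<circledast> Ins (wpos n b) (int j)" using True by (simp add: X_def)
  moreover have "(of_nat m + of_nat j + 1) / 2 + - of_nat j / 2 = (of_nat m + 1) / (2 :: complex)"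
    by (simp add: field_simps)
  moreover have "wker A a m b j = ?D" using True by (simp add: wker_def)
  ultimately show ?thesis
    by (simp only: cmul_fmul mon_fmul_assoc fmul_mon_left[of ?D] mon_mon_same)
next
  case False
  let ?D = "dd (Vw (- a)) m (dd (Vw b) j (pi_ser A N (Vw (- a)) (Vw b)))"
  have "Amat A N (a, m) (b, j) = cmul ((- 1) ^ N) (rho a ((of_nat m + 1) / 2) \<circledast> rho b (of_nat j / 2) \<circledast> ?D)"
    using False by simp
  moreover have "X (b, j) = rho b (- of_nat j / 2) \<circledast> Ins (wpos n b) (int j)" by (simp add: X_def)
  moreover have "of_nat j / 2 + - of_nat j / 2 = (0 :: complex)" by simp
  ultimately show ?thesis
    using False by (simp only: cmul_fmul mon_fmul_assoc fmul_mon_left[of ?D] mon_mon_same wker_def if_False mon_0)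
qed

lemma flat_wker:
  assumes a: "a \<in> Iset g" and b: "b \<in> Iset g"
  shows "flat g n (2 * real N) (wker A a m b j)"
proof (cases "a = - b")
  case True
  then show ?thesis
    using flat_fpart[OF Vw_pv(2)[OF uminus_Iset[OF a]] wpos_less[OF uminus_Iset[OF a]], of A m j]
      Vw_pv(1)[OF uminus_Iset[OF a], of n] by (simp add: wker_def del: pv_simps)
next
  case False
  then have ne: "Suc (wpos n (- a)) \<noteq> Suc (wpos n b)"
    using ws_wpos[of "- a" n] ws_wpos[of b n] a b by (auto simp: Iset_def)
  show ?thesis
    using False flat_pi[OF Vw_pv(2)[OF uminus_Iset[OF a]] Vw_pv(2)[OF b] ne, of N m j A]
      Vw_pv(1)[OF uminus_Iset[OF a], of n] Vw_pv(1)[OF b, of n]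
    by (simp add: wker_def del: pv_simps)
qed

lemma Amat_X_finite:
  assumes "a \<in> Iset g" "b \<in> Iset g"
  shows "finite {j. (Amat A N (a, m) (b, j) \<circledast> X (b, j)) e \<noteq> 0}"
proof -
  let ?e = "e(Vrho (nat \<bar>a\<bar>) := e (Vrho (nat \<bar>a\<bar>)) - (of_nat m + 1) / 2)"
  have "finite {j. (wker A a m b j \<circledast> Ins (wpos n b) (int j)) ?e \<noteq> 0}"
    by (rule flat_Ins_finite[OF flat_wker[OF assms] wpos_less[OF assms(2)]])
  then show ?thesis unfolding Amat_X[OF assms(1)]
    by (rule finite_subset[rotated]) (auto simp: cmul_def mon_fmul)
qed

lemma Lvec_X:
  "Lvec A N (b, j) \<circledast> X (b, j)
    = mon Vdx (of_nat N) \<circledast> (dd (Vw b) j (pi_ser A N Vx (Vw b)) \<circledast> Ins (wpos n b) (int j))"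
proof -
  let ?D = "dd (Vw b) j (pi_ser A N Vx (Vw b))"
  have "Lvec A N (b, j) \<circledast> X (b, j) = mon Vdx (of_nat N) \<circledast> (rho b (of_nat j / 2) \<circledast>
      (rho b (- of_nat j / 2) \<circledast> (?D \<circledast> Ins (wpos n b) (int j))))"
    by (simp only: Lvec.simps X_def fst_conv snd_conv fmul_mon_assoc mon_fmul_assoc fmul_mon_left[of ?D]
        fmul_mon_left[of "rho b (of_nat j / 2)" Vdx])
  moreover have "of_nat j / 2 + - of_nat j / 2 = (0 :: complex)" by simp
  ultimately show ?thesis by (simp only: mon_mon_same mon_0)
qed

lemma Lvec_X_finite:
  assumes "b \<in> Iset g"
  shows "finite {j. (Lvec A N (b, j) \<circledast> X (b, j)) e \<noteq> 0}"
proof -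
  have f: "flat g n (2 * real N) (dd (Vw b) j (pi_ser A N Vx (Vw b)))" for j
    using flat_pi[of 0 n g "Suc (wpos n b)" N 0 j A] Vw_pv[OF assms, of n] by simp
  show ?thesis unfolding Lvec_X
    using flat_Ins_finite[OF f wpos_less[OF assms], where e = "e(Vdx := e Vdx - of_nat N)"] by (simp only: mon_fmul)
qed

lemma sum_positions: "(\<Sum>i<r. f i) = (\<Sum>k=1..n. f (k - 1)) + (\<Sum>a\<in>Iset g. f (wpos n a))"
proof -
  have "(\<Sum>i<r. f i) = (\<Sum>i=0..<n. f i) + (\<Sum>i=n..<r. f i)"
    by (simp add: lessThan_atLeast0 sum.atLeastLessThan_concat)
  also have "(\<Sum>i=0..<n. f i) = (\<Sum>k=1..n. f (k - 1))"
    by (rule sum.reindex_bij_witness[of _ "\<lambda>k. k - 1" Suc]) auto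
  finally show ?thesis by (simp add: sum_wpos)
qed

lemma u_expansion:
  assumes J: "\<And>k j. k \<in> {1..n} \<Longrightarrow> J \<le> j \<Longrightarrow> Ins (k - 1) (int j) = 0"
  shows "Fcorr_u U M G n \<gamma> \<delta> N x v
    = (\<Sum>k=1..n. \<Sum>j<J. (dd (Vy k) j (pi_ser A N Vx (Vy k)) \<circledast> mon Vdx (of_nat N) \<circledast> mon (Vdy k) (1 - of_nat N)) \<circledast> H k j)
      + contr g (Lvec A N) X"
proof -
  have y: "mon Vdx (of_nat N) \<circledast> fsum (\<lambda>j. dd (posv n (k - 1)) j (pi_ser A N Vx (posv n (k - 1))) \<circledast> Ins (k - 1) (int j))
    = (\<Sum>j<J. (dd (Vy k) j (pi_ser A N Vx (Vy k)) \<circledast> mon Vdx (of_nat N) \<circledast> mon (Vdy k) (1 - of_nat N)) \<circledast> H k j)"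
    if k: "k \<in> {1..n}" for k
  proof -
    have pk: "posv n (k - 1) = Vy k" using k by (auto simp: posv_def)
    have "fsum (\<lambda>j. dd (Vy k) j (pi_ser A N Vx (Vy k)) \<circledast> Ins (k - 1) (int j))
      = (\<Sum>j<J. dd (Vy k) j (pi_ser A N Vx (Vy k)) \<circledast> Ins (k - 1) (int j))"
      by (rule fsum_finite) (use J[OF k] in simp)
    moreover have "(D \<circledast> mon Vdx (of_nat N) \<circledast> mon (Vdy k) (1 - of_nat N)) \<circledast> H k j
        = mon Vdx (of_nat N) \<circledast> (D \<circledast> Ins (k - 1) (int j))" for D j
    proof -
      have "(D \<circledast> mon Vdx (of_nat N) \<circledast> mon (Vdy k) (1 - of_nat N)) \<circledast> H k j
          = mon (Vdy k) (1 - of_nat N) \<circledast> (mon Vdx (of_nat N) \<circledast> (D \<circledast> H k j))"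
        by (subst fmul_mon_assoc, subst fmul_mon_assoc, rule refl)
      also have "D \<circledast> H k j = mon (Vdy k) (of_nat N - 1) \<circledast> (D \<circledast> Ins (k - 1) (int j))"
        unfolding H_def by (rule fmul_mon_left)
      also have "mon Vdx (of_nat N) \<circledast> (mon (Vdy k) (of_nat N - 1) \<circledast> (D \<circledast> Ins (k - 1) (int j)))
          = mon (Vdy k) (of_nat N - 1) \<circledast> (mon Vdx (of_nat N) \<circledast> (D \<circledast> Ins (k - 1) (int j)))"
        by (rule mon_commute)
      finally show ?thesis unfolding mon_mon_same by simp
    qed
    ultimately show ?thesis unfolding pk by (simp only: mon_sum)
  qed
  have w: "(\<Sum>b\<in>Iset g. mon Vdx (of_nat N) \<circledast> fsum (\<lambda>j. dd (posv n (wpos n b)) j (pi_ser A N Vx (posv n (wpos n b))) \<circledast> Ins (wpos n b) (int j)))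
     = contr g (Lvec A N) X"
    unfolding contr_def Lvec_X mon_fsum by (rule sum.cong) (auto simp: posv_wpos Iset_def)
  show ?thesis
    unfolding Fcorr_u_pi[of A] sum_positions mon_add w[symmetric] mon_sum
    by (intro arg_cong2[where f = "(+)"] refl sum.cong y)
qed

text \<open>
  Sewing turns a mode \<open>m + 2N - 1\<close> at \<open>w\<^sub>a\<close> into the mode \<open>- m - 1\<close> at \<open>w\<^sub>-\<^sub>a\<close>, to which \<open>Ins_negative_pi\<close>
  applies. This closes the linear system.
\<close>

lemma Y_expansion:
  assumes J: "\<And>k j. k \<in> {1..n} \<Longrightarrow> J \<le> j \<Longrightarrow> Ins (k - 1) (int j) = 0" and a: "a \<in> Iset g"
  shows "Y (a, m) = (\<Sum>k=1..n. \<Sum>j<J. dd (Vy k) j (Rvec A N k (a, m)) \<circledast> H k j) + contr g (Amat A N (a, m)) X"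
proof -
  let ?S = "\<lambda>f. cmul ((- 1) ^ N) (rho a ((of_nat m + 1) / 2) \<circledast> f)"
  let ?i = "wpos n (- a)"
  let ?K = "\<lambda>i j. if i = ?i then fpart A (posv n ?i) m ?i j
         else dd (posv n ?i) m (dd (posv n i) j (pi_ser A N (posv n ?i) (posv n i)))"
  have na: "- a \<in> Iset g" "a \<noteq> 0" using a by (auto simp: Iset_def)
  have Vi: "posv n ?i = Vw (- a)" using na by (simp add: posv_wpos)
  have NN: "int (m + (2 * N - 1)) = int m + 2 * int N - 1" using N by (simp add: of_nat_diff)
  have ix: "2 * int N - 2 - (int m + 2 * int N - 1) = - int m - 1" by simp
  have "Ins (wpos n a) (int (m + (2 * N - 1)))
      = cmul ((- 1) ^ N) (rho a (of_int (int m + 2 * int N - 1) + 1 - of_nat N) \<circledast> Ins ?i (- int m - 1))"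
    using Ins_sewing[OF a, of "int m + 2 * int N - 1"] unfolding NN ix .
  moreover have "- of_nat (m + (2 * N - 1)) / 2 + (of_int (int m + 2 * int N - 1) + 1 - of_nat N)
      = (of_nat m + 1 :: complex) / 2"
    using N by (simp add: of_nat_diff field_simps)
  ultimately have "Y (a, m) = ?S (Ins ?i (- int m - 1))"
    by (simp only: Y_def X_def fst_conv snd_conv fmul_cmul mon_mon_same)
  also have "\<dots> = (\<Sum>k=1..n. ?S (fsum (\<lambda>j. ?K (k - 1) j \<circledast> Ins (k - 1) (int j))))
      + (\<Sum>b\<in>Iset g. ?S (fsum (\<lambda>j. ?K (wpos n b) j \<circledast> Ins (wpos n b) (int j))))"
    unfolding Ins_negative_pi[OF wpos_less[OF na(1)], of m A] sum_positions mon_add cmul_add mon_sum cmul_sum ..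
  also have "(\<Sum>b\<in>Iset g. ?S (fsum (\<lambda>j. ?K (wpos n b) j \<circledast> Ins (wpos n b) (int j)))) = contr g (Amat A N (a, m)) X"
    unfolding contr_def Amat_X[OF a]
  proof (rule sum.cong[OF refl])
    fix b assume b: "b \<in> Iset g"
    have "?K (wpos n b) j = wker A a m b j" for j
    proof (cases "a = - b")
      case True
      then show ?thesis using Vi by (simp add: wker_def)
    next
      case False
      then have "wpos n b \<noteq> ?i"
        using ws_wpos[of "- a" n] ws_wpos[of b n] na b by (auto simp: Iset_def)
      then show ?thesis using False b Vi by (simp add: wker_def posv_wpos Iset_def)
    qed
    then show "?S (fsum (\<lambda>j. ?K (wpos n b) j \<circledast> Ins (wpos n b) (int j)))
        = fsum (\<lambda>k. cmul ((- 1) ^ N) (rho a ((of_nat m + 1) / 2) \<circledast> (wker A a m b k \<circledast> Ins (wpos n b) (int k))))"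
      by (simp only: mon_fsum cmul_fsum)
  qed
  also have "(\<Sum>k=1..n. ?S (fsum (\<lambda>j. ?K (k - 1) j \<circledast> Ins (k - 1) (int j))))
      = (\<Sum>k=1..n. \<Sum>j<J. dd (Vy k) j (Rvec A N k (a, m)) \<circledast> H k j)"
  proof (rule sum.cong[OF refl])
    fix k assume k: "k \<in> {1..n}"
    let ?D = "\<lambda>j. dd (Vw (- a)) m (dd (Vy k) j (pi_ser A N (Vw (- a)) (Vy k)))"
    have pk: "posv n (k - 1) = Vy k" using k by (auto simp: posv_def)
    have "k - 1 \<noteq> ?i" using wpos_ge[of n "- a"] k by auto
    then have K: "?K (k - 1) j = ?D j" for j using Vi pk by simp
    have "fsum (\<lambda>j. ?D j \<circledast> Ins (k - 1) (int j)) = (\<Sum>j<J. ?D j \<circledast> Ins (k - 1) (int j))"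
      by (rule fsum_finite) (use J[OF k] in simp)
    moreover have "dd (Vy k) j (Rvec A N k (a, m)) \<circledast> H k j = ?S (?D j \<circledast> Ins (k - 1) (int j))" for j
    proof -
      have "(1 - of_nat N) + (of_nat N - 1) = (0 :: complex)" by simp
      then show ?thesis
        unfolding dd_Rvec H_def
        by (simp only: cmul_fmul mon_fmul_assoc fmul_mon_assoc fmul_mon_left[of "?D j"] mon_mon_same mon_0)
    qed
    ultimately show "?S (fsum (\<lambda>j. ?K (k - 1) j \<circledast> Ins (k - 1) (int j)))
        = (\<Sum>j<J. dd (Vy k) j (Rvec A N k (a, m)) \<circledast> H k j)"
      by (simp only: K mon_sum cmul_sum)
  qed
  finally show ?thesis .
qed

end

context genus_forms
begin

text \<open>
  The modes \<open>0, \<dots>, 2N - 2\<close> at the \<open>w\<^sub>a\<close> are not determined by the system. They are separated and play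
  the role of further sources.
\<close>

lemma contr_moments:
  assumes "\<And>c e. c \<in> Iset g \<Longrightarrow> finite {k. (B (c, k) \<circledast> X (c, k)) e \<noteq> 0}"
  shows "contr g B X = (\<Sum>c\<in>Iset g. \<Sum>l<2 * N - 1. B (c, l) \<circledast> X (c, l))
    + contr g (\<lambda>(c, k). B (c, k + (2 * N - 1))) Y"
proof -
  have "contr g B' (\<lambda>(c, k). X (c, k + (2 * N - 1))) = contr g B' Y" for B'
    by (intro contr_cong) (auto simp: Y_def)
  then show ?thesis using contr_split[where K = "2 * N - 1", OF assms] by (simp only:)
qed

lemma Tform_Ins:
  "Tform g A N b l \<circledast> Ins (wpos n b) (int l)
    = (Lvec A N (b, l) + contr g (Ltil g A N) (\<lambda>i. contr g (neumann g (Atil g A N) i) (\<lambda>i'. Amat A N i' (b, l)))) \<circledast> X (b, l)"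
  unfolding Tform_def X_def mat_mult_def fst_conv snd_conv by (simp only: mon_fmul_assoc fmul_mon_left)

lemma gen_Ins: obtains C where "0 \<le> C" "\<And>i j. i < r \<Longrightarrow> gen g n C (- C) (Ins i j)"
  using X_H_bounds by metis

lemma good_Atil': "i \<in> idxs g \<Longrightarrow> j \<in> idxs g \<Longrightarrow> good g n 0 (1 + ht i + ht j) (Atil g A N i j)"
  by (rule good_Atil[OF _ _ N])

lemma good_contr_neumann:
  assumes R: "\<And>i. i \<in> idxs g \<Longrightarrow> good g n (3 * real N) (ht i - 3 * real N) (R i)"
  shows "good g n (3 * real N + 3 * real N) (- (3 * real N) - 3 * real N)
    (contr g (Ltil g A N) (\<lambda>i. contr g (neumann g (Atil g A N) i) R))"
  by (rule good_neumann_contr[OF good_Atil' _ R]) (auto intro: good_mono[OF good_Ltil[OF _ N]])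

lemma good_Amat_column:
  assumes "i \<in> idxs g" "b \<in> Iset g"
  shows "good g n (3 * real N) (ht i - 3 * real N) (Amat A N i (b, l))"
proof -
  obtain a m where i: "i = (a, m)" by (cases i)
  have "good g n (2 * real N) (real (m + l + 1) / 2) (Amat A N (a, m) (b, l))"
    by (rule good_Amat) (use assms in \<open>auto simp: i idxs_def\<close>)
  then show ?thesis unfolding i by (rule good_mono) (auto simp: ht_def add_divide_distrib)
qed

lemma good_Tform:
  assumes "b \<in> Iset g"
  obtains C t where "good g n C t (Tform g A N b l)"
proof -
  let ?K = "contr g (Ltil g A N) (\<lambda>i. contr g (neumann g (Atil g A N) i) (\<lambda>i'. Amat A N i' (b, l)))"
  have "good g n (6 * real N) (- (6 * real N)) ?K"
    by (rule good_mono[OF good_contr_neumann[OF good_Amat_column[OF _ assms]]]) auto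
  moreover have "good g n (6 * real N) (- (6 * real N)) (Lvec A N (b, l))"
    by (rule good_mono[OF good_Lvec]) (use assms in \<open>auto simp: idxs_def ht_def\<close>)
  ultimately have 1: "good g n (6 * real N) (- (6 * real N)) (Lvec A N (b, l) + ?K)" by (intro good_add)
  have 2: "good g n (2 * \<bar>Re (- of_nat l / 2)\<bar>) (Re (- of_nat l / 2)) (rho b (- of_nat l / 2))"
    by (rule good_mon_rho[OF assms]) auto
  show thesis using that[unfolded Tform_def mat_mult_def, OF good_fmul[OF 2 1]] .
qed

text \<open>
  The modes \<open>l\<close> at \<open>w\<^sub>a\<close> and \<open>2N - 2 - l\<close> at \<open>w\<^sub>-\<^sub>a\<close> are proportional by sewing, so the coefficient of the
  former in the recursion has two contributions.
\<close>

lemma Theta_Ins: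
  assumes a: "a \<in> Iset g" and l: "l \<le> 2 * N - 2"
  shows "Theta g A N a l \<circledast> Ins (wpos n a) (int l)
    = Tform g A N a l \<circledast> Ins (wpos n a) (int l)
      + Tform g A N (- a) (2 * N - 2 - l) \<circledast> Ins (wpos n (- a)) (int (2 * N - 2 - l))"
proof -
  let ?l = "2 * N - 2 - l"
  have na: "- a \<in> Iset g" by (rule uminus_Iset[OF a])
  have il: "int ?l = 2 * int N - 2 - int l" using l N by (simp add: of_nat_diff)
  have ix: "2 * int N - 2 - (2 * int N - 2 - int l) = int l" by simp
  have ex: "of_int (2 * int N - 2 - int l) + 1 - of_nat N = (of_nat N - 1 - of_nat l :: complex)" by simp
  have sew: "Ins (wpos n (- a)) (int ?l) = cmul ((- 1) ^ N) (rho a (of_nat N - 1 - of_nat l) \<circledast> Ins (wpos n a) (int l))"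
    using Ins_sewing[OF na, of "2 * int N - 2 - int l"] unfolding ix ex il by simp
  obtain C0 where I: "gen g n C0 (- C0) (Ins (wpos n a) (int l))" using gen_Ins wpos_less[OF a] by metis
  obtain C t where T: "good g n C t (Tform g A N a l)" by (rule good_Tform[OF a])
  obtain C' t' where T': "good g n C' t' (Tform g A N (- a) ?l)" by (rule good_Tform[OF na])
  have "2 * (of_nat N - 1 - of_nat l :: complex) \<in> \<int>" by simp
  from good_cmul[OF good_fmul[OF good_mon_rho[OF a this] T']]
  have T'': "good g n (2 * \<bar>Re (of_nat N - 1 - of_nat l)\<bar> + C') (Re (of_nat N - 1 - of_nat l) + t')
      (cmul ((- 1) ^ N) (rho a (of_nat N - 1 - of_nat l) \<circledast> Tform g A N (- a) ?l))" .
  have "cmul ((- 1) ^ N) (rho a (of_nat N - 1 - of_nat l) \<circledast> Tform g A N (- a) ?l) \<circledast> Ins (wpos n a) (int l)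
      = Tform g A N (- a) ?l \<circledast> Ins (wpos n (- a)) (int ?l)"
    unfolding sew cmul_fmul fmul_cmul mon_fmul_assoc fmul_mon_left ..
  then show ?thesis unfolding Theta_def by (simp only: fmul_add_left[OF T T'' I])
qed

lemma sum_Theta:
  "(\<Sum>b\<in>Iset g. \<Sum>l<2 * N - 1. Tform g A N b l \<circledast> Ins (wpos n b) (int l))
    = (\<Sum>a=1..g. \<Sum>l=0..2 * N - 2. Theta g A N (int a) l \<circledast> Fcorr_res U M G n \<gamma> \<delta> (int a) l x v)"
proof -
  let ?t = "\<lambda>b l. Tform g A N b l \<circledast> Ins (wpos n b) (int l)"
  have L: "{..<2 * N - 1} = {0..2 * N - 2}" using N by auto
  have "(\<Sum>l=0..2 * N - 2. ?t (int a) l) + (\<Sum>l=0..2 * N - 2. ?t (- int a) l)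
      = (\<Sum>l=0..2 * N - 2. Theta g A N (int a) l \<circledast> Fcorr_res U M G n \<gamma> \<delta> (int a) l x v)"
    if a: "a \<in> {1..g}" for a
  proof -
    have ai: "int a \<in> Iset g" using a by (auto simp: Iset_def)
    have rev: "(\<Sum>l=0..2 * N - 2. ?t (- int a) l) = (\<Sum>l=0..2 * N - 2. ?t (- int a) (2 * N - 2 - l))"
      by (subst sum.atLeastAtMost_rev) simp
    have "(\<Sum>l=0..2 * N - 2. Theta g A N (int a) l \<circledast> Ins (wpos n (int a)) (int l))
        = (\<Sum>l=0..2 * N - 2. ?t (int a) l + ?t (- int a) (2 * N - 2 - l))"
      by (rule sum.cong[OF refl], rule Theta_Ins[OF ai]) simp
    then show ?thesis by (simp only: Fcorr_res_Ins[OF ai] sum.distrib rev[symmetric])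
  qed
  then show ?thesis unfolding sum_Iset L by (rule sum.cong[OF refl])
qed

text \<open>
  The form with \<open>Y(x)\<close> inserted is a linear function of the modes at the \<open>y\<^sub>k\<close>, the low modes at the
  \<open>w\<^sub>a\<close> and \<open>Y\<close>. Solving the system for \<open>Y\<close> by \<open>neumann_solution\<close>, each source acquires its direct
  coefficient plus a Neumann series, which is the expansion of \<open>\<Psi>\<close> and \<open>T\<^sub>a\<^sup>l\<close> respectively.
\<close>

theorem genus_recursion:
  "Fcorr_u U M G n \<gamma> \<delta> N x v =
      (\<Sum>a=1..g. \<Sum>l=0..2 * N - 2. Theta g A N (int a) l \<circledast> Fcorr_res U M G n \<gamma> \<delta> (int a) l x v)
    + (\<Sum>k=1..n. fsum (\<lambda>j::nat. dd (Vy k) j (Psi g A N k)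
         \<circledast> Fcorr U M G n \<gamma> \<delta> (v(k := mmode M (\<gamma> k) x (int j) (v k))) \<circledast> mon (Vdy k) (of_nat j)))"
proof -
  have xc: "x \<in> car U" using xw by (simp add: wtsp_def)
  have "\<forall>k. \<exists>J. k \<in> {1..n} \<longrightarrow> (\<forall>j\<ge>J. act (\<gamma> k) x (int j) (v k) = 0)"
    using act_trunc[OF xc vm] by blast
  then obtain J0 where J0: "\<And>k j. k \<in> {1..n} \<Longrightarrow> J0 k \<le> j \<Longrightarrow> act (\<gamma> k) x (int j) (v k) = 0" by metis
  \<comment> \<open>A crude common bound for the modes that do not annihilate some \<open>v k\<close>.\<close>
  define J where "J = (\<Sum>k=1..n. J0 k)"
  have J: "Ins (k - 1) (int j) = 0" if k: "k \<in> {1..n}" and j: "J \<le> j" for k j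
  proof (rule Ins_y_zero[OF k J0[OF k]])
    have "J0 k \<le> J" unfolding J_def by (rule member_le_sum) (use k in auto)
    then show "J0 k \<le> j" using j by simp
  qed
  obtain C0 where C0: "0 \<le> C0" "\<And>i. i \<in> idxs g \<Longrightarrow> gen g n C0 (ht i - C0) (X i)"
    "\<And>k j. k \<in> {1..n} \<Longrightarrow> gen g n C0 (- C0) (H k j)"
    using X_H_bounds by metis
  define C where "C = C0 + 3 * real N"
  have CC: "C0 \<le> C" "3 * real N \<le> C" "0 \<le> C" using C0(1) by (simp_all add: C_def)

  let ?A = "Atil g A N" and ?L = "Ltil g A N"
  let ?l = "{..<2 * N - 1}"
  \<comment> \<open>The sources: \<open>Inl (k, j)\<close> for the mode \<open>j\<close> at \<open>y\<^sub>k\<close>, \<open>Inr (b, l)\<close> for the low mode \<open>l\<close> at \<open>w\<^sub>b\<close>.\<close>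
  let ?\<Sigma> = "Inl ` ({1..n} \<times> {..<J}) \<union> Inr ` (Iset g \<times> ?l)"
  define R :: "nat \<times> nat + idx \<Rightarrow> idx \<Rightarrow> fser" where
    "R s i = (case s of Inl (k, j) \<Rightarrow> dd (Vy k) j (Rvec A N k i) | Inr c \<Rightarrow> Amat A N i c)" for s i
  define S :: "nat \<times> nat + idx \<Rightarrow> fser" where
    "S s = (case s of Inl (k, j) \<Rightarrow> H k j | Inr c \<Rightarrow> X c)" for s
  have sum_\<Sigma>: "(\<Sum>s\<in>?\<Sigma>. f s) = (\<Sum>k=1..n. \<Sum>j<J. f (Inl (k, j))) + (\<Sum>b\<in>Iset g. \<Sum>l\<in>?l. f (Inr (b, l)))"
    for f :: "nat \<times> nat + idx \<Rightarrow> fser"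
  proof -
    have "(\<Sum>s\<in>?\<Sigma>. f s) = (\<Sum>s\<in>Inl ` ({1..n} \<times> {..<J}). f s) + (\<Sum>s\<in>Inr ` (Iset g \<times> ?l). f s)"
      by (rule sum.union_disjoint) (auto simp: finite_Iset)
    then show ?thesis by (simp add: sum.reindex sum.cartesian_product)
  qed

  have Amat_fold: "contr g (\<lambda>(c, k). Amat A N (a, m) (c, k + (2 * N - 1))) Y = contr g (?A (a, m)) Y" for a m
    by (intro contr_cong refl) (use N in \<open>auto simp: idxs_def Atil_eq\<close>)
  have Lvec_fold: "contr g (\<lambda>(c, k). Lvec A N (c, k + (2 * N - 1))) Y = contr g ?L Y"
    by (intro contr_cong refl) (use N in \<open>auto simp: idxs_def Ltil_eq\<close>)

  have "contr g ?L Y = (\<Sum>s\<in>?\<Sigma>. contr g ?L (\<lambda>i. contr g (neumann g ?A i) (R s)) \<circledast> S s)"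
  proof (rule neumann_solution[where C = C, OF _ CC(3) _ good_Atil'])
    show "finite ?\<Sigma>" by (simp add: finite_Iset)
    show "good g n C (ht i - C) (?L i)" if "i \<in> idxs g" for i
      by (rule good_mono[OF good_Ltil[OF that N]]) (use CC in auto)
    show "gen g n C (ht i - C) (Y i)" if "i \<in> idxs g" for i
      unfolding Y_def by (rule gen_mono[OF C0(2)]) (use that CC in \<open>auto simp: idxs_def ht_def add_divide_distrib intro: add_mono\<close>)
    show "good g n C (ht i - C) (R s i)" if s: "s \<in> ?\<Sigma>" and i: "i \<in> idxs g" for s i
      using s
    proof (elim UnE imageE SigmaE)
      fix kj k j assume "s = Inl kj" "kj = (k, j)" "k \<in> {1..n}"
      then show ?thesis unfolding R_def
        by simp (rule good_mono[OF good_dd_Rvec[OF i _ N]], use CC in auto)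
    next
      fix c b l assume "s = Inr c" "c = (b, l)" "b \<in> Iset g"
      then show ?thesis unfolding R_def
        by (simp del: Amat.simps) (rule good_mono[OF good_Amat_column[OF i]], use CC in auto)
    qed
    show "gen g n C (- C) (S s)" if "s \<in> ?\<Sigma>" for s
      using that
    proof (elim UnE imageE SigmaE)
      fix kj k j assume "s = Inl kj" "kj = (k, j)" "k \<in> {1..n}"
      then show ?thesis unfolding S_def by simp (rule gen_mono[OF C0(3)], use CC in auto)
    next
      fix c b l assume "s = Inr c" "c = (b, l)" "b \<in> Iset g"
      then show ?thesis unfolding S_def
        by simp (rule gen_mono[OF C0(2)], use CC in \<open>auto simp: idxs_def ht_def\<close>)
    qed
    show "Y i = (\<Sum>s\<in>?\<Sigma>. R s i \<circledast> S s) + contr g (?A i) Y" if i: "i \<in> idxs g" for i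
    proof -
      obtain a m where am: "i = (a, m)" by (cases i)
      have a: "a \<in> Iset g" using i by (simp add: am idxs_def)
      have "contr g (Amat A N (a, m)) X = (\<Sum>c\<in>Iset g. \<Sum>l\<in>?l. Amat A N (a, m) (c, l) \<circledast> X (c, l)) + contr g (?A (a, m)) Y"
        unfolding Amat_fold[symmetric] by (rule contr_moments) (rule Amat_X_finite[OF a])
      moreover have "Y (a, m) = (\<Sum>k=1..n. \<Sum>j<J. dd (Vy k) j (Rvec A N k (a, m)) \<circledast> H k j) + contr g (Amat A N (a, m)) X"
        by (rule Y_expansion[OF _ a]) (rule J)
      ultimately have "Y (a, m) = (\<Sum>k=1..n. \<Sum>j<J. dd (Vy k) j (Rvec A N k (a, m)) \<circledast> H k j)
          + ((\<Sum>c\<in>Iset g. \<Sum>l\<in>?l. Amat A N (a, m) (c, l) \<circledast> X (c, l)) + contr g (?A (a, m)) Y)"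
        by (simp only:)
      then show ?thesis
        unfolding am sum_\<Sigma> R_def S_def sum.case prod.case by (simp only: add.assoc)
    qed
  qed
  then have LY: "contr g ?L Y
    = (\<Sum>k=1..n. \<Sum>j<J. contr g ?L (\<lambda>i. contr g (neumann g ?A i) (\<lambda>i'. dd (Vy k) j (Rvec A N k i'))) \<circledast> H k j)
      + (\<Sum>b\<in>Iset g. \<Sum>l\<in>?l. contr g ?L (\<lambda>i. contr g (neumann g ?A i) (\<lambda>i'. Amat A N i' (b, l))) \<circledast> X (b, l))"
    unfolding sum_\<Sigma> R_def S_def sum.case prod.case .

  have y: "dd (Vy k) j (Psi g A N k) \<circledast> H k j
    = (dd (Vy k) j (pi_ser A N Vx (Vy k)) \<circledast> mon Vdx (of_nat N) \<circledast> mon (Vdy k) (1 - of_nat N)) \<circledast> H k j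
      + contr g ?L (\<lambda>i. contr g (neumann g ?A i) (\<lambda>i'. dd (Vy k) j (Rvec A N k i'))) \<circledast> H k j"
    if k: "k \<in> {1..n}" for k j
    unfolding dd_Psi
  proof (rule fmul_add_left[OF _ good_contr_neumann C0(3)[OF k]])
    have pk: "Vy k = pv n (Suc (k - 1))" "Suc (k - 1) \<le> n + 2 * g" using k by (cases k; auto simp: posv_def)+
    have "flat g n (2 * real N) (dd (Vy k) j (pi_ser A N Vx (Vy k)))"
      using flat_pi[of 0 n g "Suc (k - 1)" N 0 j A] pk by simp
    from good_fmul[OF good_fmul[OF good_flat[OF this] good_mon_dx[of "of_nat N"]] good_mon_dy[of "1 - of_nat N" k]]
    show "good g n (2 * real N + \<bar>Re (of_nat N)\<bar> + \<bar>Re (1 - of_nat N)\<bar>) (0 + 0 + 0)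
        (dd (Vy k) j (pi_ser A N Vx (Vy k)) \<circledast> mon Vdx (of_nat N) \<circledast> mon (Vdy k) (1 - of_nat N))"
      using k by simp
    show "good g n (3 * real N) (ht i - 3 * real N) (dd (Vy k) j (Rvec A N k i))" if "i \<in> idxs g" for i
      by (rule good_mono[OF good_dd_Rvec[OF that k N]]) auto
  qed
  have w: "Tform g A N b l \<circledast> Ins (wpos n b) (int l)
    = Lvec A N (b, l) \<circledast> X (b, l)
      + contr g ?L (\<lambda>i. contr g (neumann g ?A i) (\<lambda>i'. Amat A N i' (b, l))) \<circledast> X (b, l)"
    if b: "b \<in> Iset g" for b l
    unfolding Tform_Ins
    by (rule fmul_add_left[OF good_Lvec good_contr_neumann[OF good_Amat_column[OF _ b]] C0(2)])
      (use b in \<open>auto simp: idxs_def\<close>)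

  have "Fcorr_u U M G n \<gamma> \<delta> N x v
    = (\<Sum>k=1..n. \<Sum>j<J. dd (Vy k) j (Psi g A N k) \<circledast> H k j)
      + (\<Sum>b\<in>Iset g. \<Sum>l\<in>?l. Tform g A N b l \<circledast> Ins (wpos n b) (int l))"
  proof -
    have "(\<Sum>k=1..n. \<Sum>j<J. dd (Vy k) j (Psi g A N k) \<circledast> H k j)
      = (\<Sum>k=1..n. \<Sum>j<J. (dd (Vy k) j (pi_ser A N Vx (Vy k)) \<circledast> mon Vdx (of_nat N) \<circledast> mon (Vdy k) (1 - of_nat N)) \<circledast> H k j)
      + (\<Sum>k=1..n. \<Sum>j<J. contr g ?L (\<lambda>i. contr g (neumann g ?A i) (\<lambda>i'. dd (Vy k) j (Rvec A N k i'))) \<circledast> H k j)"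
      unfolding sum.distrib[symmetric] by (intro sum.cong refl y)
    moreover have "(\<Sum>b\<in>Iset g. \<Sum>l\<in>?l. Tform g A N b l \<circledast> Ins (wpos n b) (int l))
      = (\<Sum>b\<in>Iset g. \<Sum>l\<in>?l. Lvec A N (b, l) \<circledast> X (b, l))
      + (\<Sum>b\<in>Iset g. \<Sum>l\<in>?l. contr g ?L (\<lambda>i. contr g (neumann g ?A i) (\<lambda>i'. Amat A N i' (b, l))) \<circledast> X (b, l))"
      unfolding sum.distrib[symmetric] by (intro sum.cong refl w)
    moreover have "contr g (Lvec A N) X = (\<Sum>b\<in>Iset g. \<Sum>l\<in>?l. Lvec A N (b, l) \<circledast> X (b, l)) + contr g ?L Y"
      unfolding Lvec_fold[symmetric] by (rule contr_moments) (rule Lvec_X_finite)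
    moreover have "Fcorr_u U M G n \<gamma> \<delta> N x v
      = (\<Sum>k=1..n. \<Sum>j<J. (dd (Vy k) j (pi_ser A N Vx (Vy k)) \<circledast> mon Vdx (of_nat N) \<circledast> mon (Vdy k) (1 - of_nat N)) \<circledast> H k j)
        + contr g (Lvec A N) X"
      by (rule u_expansion) (rule J)
    ultimately show ?thesis unfolding LY by (simp only: ac_simps)
  qed
  also have "(\<Sum>k=1..n. \<Sum>j<J. dd (Vy k) j (Psi g A N k) \<circledast> H k j)
    = (\<Sum>k=1..n. fsum (\<lambda>j::nat. dd (Vy k) j (Psi g A N k)
         \<circledast> Fcorr U M G n \<gamma> \<delta> (v(k := mmode M (\<gamma> k) x (int j) (v k))) \<circledast> mon (Vdy k) (of_nat j)))"
  proof (rule sum.cong[OF refl])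
    fix k assume k: "k \<in> {1..n}"
    let ?F = "\<lambda>j. Fcorr U M G n \<gamma> \<delta> (v(k := mmode M (\<gamma> k) x (int j) (v k)))"
    have "(of_nat N - 1) + (1 - of_nat N + of_nat j) = (of_nat j :: complex)" for j by simp
    then have H: "H k j = mon (Vdy k) (of_nat j) \<circledast> ?F j" for j
      unfolding H_def Ins_y[OF k] by (simp only: mon_mon_same)
    have "fsum (\<lambda>j. dd (Vy k) j (Psi g A N k) \<circledast> H k j) = (\<Sum>j<J. dd (Vy k) j (Psi g A N k) \<circledast> H k j)"
      by (rule fsum_finite) (use J[OF k] in \<open>simp add: H_def\<close>)
    then show "(\<Sum>j<J. dd (Vy k) j (Psi g A N k) \<circledast> H k j)
      = fsum (\<lambda>j::nat. dd (Vy k) j (Psi g A N k) \<circledast> ?F j \<circledast> mon (Vdy k) (of_nat j))"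
      unfolding H fmul_mon_left by (simp only: fmul_commute[of _ "mon (Vdy k) (of_nat _)"])
  qed
  finally show ?thesis unfolding sum_Theta by (simp only: add.commute)
qed

end

theorem theorem5p2:
  fixes U :: "('v::ab_group_add) voa"
    and M :: "('l, 'v) voa_modules"
    and G :: "('l, 'v) genus_data"
    and N g n :: nat
    and A :: "nat \<Rightarrow> complex"
    and sw sr :: "int \<Rightarrow> complex"
    and \<gamma> \<delta> :: "nat \<Rightarrow> 'l"
    and u :: 'v and v :: "nat \<Rightarrow> 'v"
  assumes "is_voa U" and "simple_voa U" and "strong_cft_type U"
    and "\<exists>P. contragredient U (car U, mode U) (car U, mode U) P"
    and "irreducible_modules U M" and "fusion_assumption U M" and "normalized_intertwiners U M"
    and "N \<ge> 1" and "g \<ge> 1" and "N \<ge> 2 \<longrightarrow> g \<ge> 2" and "genus G = g"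
    and "schottky_parameters g sw sr" and "admissible_points g N sw sr A"
    and "u \<in> wtsp U (car U) (mode U) (of_nat N)" and "Lop U (mode U) 1 u = 0"
    and "\<And>k. k \<in> {1..n} \<Longrightarrow> v k \<in> mcar M (\<gamma> k)"
    and "admissible_delta M n \<gamma> \<delta>" and "admissible_beta M G" and "homogeneous_dual_bases U M G"
  shows "Fcorr_u U M G n \<gamma> \<delta> N u v =
      (\<Sum>a=1..g. \<Sum>l=0..2 * N - 2. Theta g A N (int a) l \<circledast> Fcorr_res U M G n \<gamma> \<delta> (int a) l u v)
    + (\<Sum>k=1..n. fsum (\<lambda>j::nat. dd (Vy k) j (Psi g A N k)
         \<circledast> Fcorr U M G n \<gamma> \<delta> (v(k := mmode M (\<gamma> k) u (int j) (v k))) \<circledast> mon (Vdy k) (of_nat j)))"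
proof -
  interpret genus_forms U M G n \<gamma> \<delta> v N u
    by unfold_locales (use assms in \<open>auto simp: admissible_delta_def admissible_beta_def\<close>)
  show ?thesis using genus_recursion[of A] assms(11) by simp
qed

end
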